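(* Let $n\ge1$ and $\alpha\in(0,1]$. There exists a constant $c_{n,\alpha}>0$, depending only on $n$ and $\alpha$, such that $$[f]_{BV^\beta(\mathbb{R}^n)}\le c_{n,\alpha}\,\|f\|_{H^1(\mathbb{R}^n)}^{(\alpha-\beta)/\alpha}\,[f]_{BV^\alpha(\mathbb{R}^n)}^{\beta/\alpha}$$ for all $\beta\in[0,\alpha)$ and all $f\in H^1(\mathbb{R}^n)\cap BV^\alpha(\mathbb{R}^n)$.
   Context: For $\alpha\in[0,1)$ set $\mu_{n,\alpha}:=2^{\alpha}\pi^{-\frac n2}\frac{\Gamma\left(\frac{n+\alpha+1}{2}\right)}{\Gamma\left(\frac{1-\alpha}{2}\right)}$ and, for $\varphi\in C^\infty_c(\mathbb{R}^n;\mathbb{R}^n)$, $$\mathrm{div}^\alpha\varphi(x):=\mu_{n,\alpha}\lim_{\varepsilon\to0^+}\int_{\{|y|>\varepsilon\}}\frac{y\cdot\varphi(x+y)}{|y|^{n+\alpha+1}}\,dy,\quad x\in\mathbb{R}^n,$$ a bounded function. For $f\in L^1(\mathbb{R}^n)$ and $\alpha\in[0,1)$ let $$[f]_{BV^\alpha(\mathbb{R}^n)}=|D^\alpha f|(\mathbb{R}^n):=\sup\left\{\int_{\mathbb{R}^n}f\,\mathrm{div}^\alpha\varphi\,dx:\varphi\in C^\infty_c(\mathbb{R}^n;\mathbb{R}^n),\ \|\varphi\|_{L^\infty}\le1\right\}$$ and $BV^\alpha(\mathbb{R}^n):=\{f\in L^1(\mathbb{R}^n):[f]_{BV^\alpha(\mathbb{R}^n)}<+\infty\}$.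 For $\alpha=1$, $BV^1(\mathbb{R}^n)=BV(\mathbb{R}^n)$ is the usual space of functions of bounded variation and $[f]_{BV^1(\mathbb{R}^n)}=|Df|(\mathbb{R}^n)$. The real Hardy space is $H^1(\mathbb{R}^n)=\{f\in L^1(\mathbb{R}^n):Rf\in L^1(\mathbb{R}^n;\mathbb{R}^n)\}$ with norm $\|f\|_{H^1}=\|f\|_{L^1}+\|Rf\|_{L^1}$, where $R$ is the vector-valued Riesz transform, $Rf(x)=\mu_{n,0}\lim_{\varepsilon\to0^+}\int_{\{|y|>\varepsilon\}}\frac{y\,f(x+y)}{|y|^{n+1}}\,dy$ (Fourier symbol $i\xi/|\xi|$). *)

theory Defs
  imports "HOL-Analysis.Analysis"
begin

text \<open>
  The space \<open>\<real>\<^sup>n\<close> is \<^typ>\<open>real ^ 'n\<close> with \<open>n = CARD('n)\<close>.  All integrals are with respect to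
  \<^term>\<open>lebesgue\<close>, the complete Lebesgue measure, so that integrability and the values of the
  integrals depend only on almost-everywhere classes.
\<close>

section \<open>Test vector fields\<close>

primrec C_k :: "nat \<Rightarrow> ('a::euclidean_space \<Rightarrow> 'b::real_normed_vector) \<Rightarrow> bool" where
  "C_k 0 f \<longleftrightarrow> continuous_on UNIV f"
| "C_k (Suc k) f \<longleftrightarrow>
     (\<forall>x. f differentiable (at x)) \<and> (\<forall>v. C_k k (\<lambda>x. frechet_derivative f (at x) v))"

definition test_fields :: "(real ^ 'n \<Rightarrow> real ^ 'n) set" where
  "test_fields = {\<phi>. (\<forall>k. C_k k \<phi>) \<and> compact (closure {x. \<phi> x \<noteq> 0})}"

definition unit_test_fields :: "(real ^ 'n \<Rightarrow> real ^ 'n) set" where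
  "unit_test_fields = {\<phi> \<in> test_fields. AE x in lebesgue. norm (\<phi> x) \<le> 1}"

section \<open>Fractional and classical divergence\<close>

definition frac_mu :: "nat \<Rightarrow> real \<Rightarrow> real" where
  "frac_mu n \<alpha> =
     2 powr \<alpha> * pi powr (- real n / 2) * Gamma ((real n + \<alpha> + 1) / 2) / Gamma ((1 - \<alpha>) / 2)"

definition frac_div :: "real \<Rightarrow> (real ^ 'n \<Rightarrow> real ^ 'n) \<Rightarrow> real ^ 'n \<Rightarrow> real" where
  "frac_div \<alpha> \<phi> x =
     frac_mu CARD('n) \<alpha> *
     Lim (at_right 0) (\<lambda>\<epsilon>.
       set_lebesgue_integral lebesgue {y. norm y > \<epsilon>}
         (\<lambda>y. (y \<bullet> \<phi> (x + y)) / norm y powr (real CARD('n) + \<alpha> + 1)))"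

definition classical_div :: "(real ^ 'n \<Rightarrow> real ^ 'n) \<Rightarrow> real ^ 'n \<Rightarrow> real" where
  "classical_div \<phi> x = (\<Sum>i\<in>UNIV. frechet_derivative \<phi> (at x) (axis i 1) $ i)"

section \<open>Fractional variation and the spaces \<open>BV\<^sup>\<alpha>\<close>\<close>

definition frac_variation :: "real \<Rightarrow> (real ^ 'n \<Rightarrow> real) \<Rightarrow> ereal" where
  "frac_variation \<alpha> f =
     (SUP \<phi>\<in>unit_test_fields. ereal (integral\<^sup>L lebesgue (\<lambda>x. f x * frac_div \<alpha> \<phi> x)))"

definition total_variation :: "(real ^ 'n \<Rightarrow> real) \<Rightarrow> ereal" where
  "total_variation f =
     (SUP \<phi>\<in>unit_test_fields. ereal (integral\<^sup>L lebesgue (\<lambda>x. f x * classical_div \<phi> x)))"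

text \<open>Only the range \<open>0 \<le> \<alpha> \<le> 1\<close> is meaningful.\<close>

definition BV_seminorm :: "real \<Rightarrow> (real ^ 'n \<Rightarrow> real) \<Rightarrow> ereal" where
  "BV_seminorm \<alpha> f = (if \<alpha> = 1 then total_variation f else frac_variation \<alpha> f)"

definition BV_space :: "real \<Rightarrow> (real ^ 'n \<Rightarrow> real) set" where
  "BV_space \<alpha> = {f. integrable lebesgue f \<and> BV_seminorm \<alpha> f < \<infinity>}"

section \<open>Riesz transform and the real Hardy space\<close>

definition riesz_trunc :: "(real ^ 'n \<Rightarrow> real) \<Rightarrow> real ^ 'n \<Rightarrow> real \<Rightarrow> real ^ 'n" where
  "riesz_trunc f x \<epsilon> =
     set_lebesgue_integral lebesgue {y. norm y > \<epsilon>}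
       (\<lambda>y. (f (x + y) / norm y ^ (CARD('n) + 1)) *\<^sub>R y)"

definition riesz :: "(real ^ 'n \<Rightarrow> real) \<Rightarrow> real ^ 'n \<Rightarrow> real ^ 'n" where
  "riesz f x = frac_mu CARD('n) 0 *\<^sub>R Lim (at_right 0) (riesz_trunc f x)"

text \<open>
  The principal value is only an almost-everywhere limit, and \<^const>\<open>Lim\<close> is unspecified where no
  limit exists.  Hence \<open>Rf \<in> L\<^sup>1\<close> is read as: the limit exists almost everywhere and the
  resulting function is integrable.  (For \<open>f \<in> L\<^sup>1\<close> the almost-everywhere existence is automatic
  by Calderon--Zygmund theory, so that this clause does not restrict the space.)
\<close>

definition hardy_H1 :: "(real ^ 'n \<Rightarrow> real) set" where
  "hardy_H1 = {f. integrable lebesgue f \<and>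
     (AE x in lebesgue. \<exists>l. (riesz_trunc f x \<longlongrightarrow> l) (at_right 0)) \<and>
     integrable lebesgue (riesz f)}"

definition H1_norm :: "(real ^ 'n \<Rightarrow> real) \<Rightarrow> real" where
  "H1_norm f = integral\<^sup>L lebesgue (\<lambda>x. \<bar>f x\<bar>) + integral\<^sup>L lebesgue (\<lambda>x. norm (riesz f x))"

section \<open>Real powers with \<open>0\<^sup>0 = 1\<close>\<close>

text \<open>
  The exponent \<open>\<beta> / \<alpha>\<close> vanishes for \<open>\<beta> = 0\<close>, where the usual reading is \<open>t\<^sup>0 = 1\<close> for all
  \<open>t \<ge> 0\<close>, whereas \<open>0 powr 0 = 0\<close> in the library.
\<close>

definition rpow :: "real \<Rightarrow> real \<Rightarrow> real" where
  "rpow t s = (if s = 0 then 1 else t powr s)"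

end

theory Submission
  imports Defs "HOL-Probability.Probability"
begin

text \<open>
  Write \<open>g(\<sigma>) = \<integral> f div (heat \<sigma> * \<phi>)\<close>.  The kernel of \<open>div\<^sup>\<beta>\<close> is a superposition of gradients of heat
  kernels, so \<open>\<integral> f div\<^sup>\<beta> \<phi>\<close> is a bounded multiple of \<open>\<integral> \<sigma> powr (- 1/2 - \<beta>/2) g(\<sigma>) d\<sigma>\<close>, and the claim becomes
  an interpolation inequality for fractional integrals on the half-line.  Its two hypotheses are bounds on
  the fractional integrals of \<open>g\<close> of orders \<open>1/2\<close> (from the Hardy norm) and \<open>1/2 - \<alpha>/2\<close> (from the
  \<open>BV\<^sup>\<alpha>\<close> seminorm; for \<open>\<alpha> = 1\<close> a bound on \<open>g\<close> itself).  Both hold uniformly over translates of \<open>\<phi>\<close>, so by the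
  semigroup property they persist when \<open>g\<close> is shifted to \<open>g(\<cdot> + s)\<close>.  Splitting the integral at a scale \<open>T\<close>
  and optimising in \<open>T\<close> gives the inequality.

  The Hardy norm bound is \<open>\<bar>\<integral> f div\<^sup>0 \<phi>\<bar> \<le> \<parallel>R f\<parallel>\<^sub>1\<close>, where \<open>R f\<close> is only known as an almost everywhere limit of
  truncations.  Duality is passed to the limit by a Calderon--Zygmund decomposition of \<open>f\<close> at a height
  tending to infinity: the good part is controlled in \<open>L\<^sup>2\<close> on the exceptional set, and the mass of the
  bad part tends to zero.
\<close>

text \<open>The constant must not depend on \<beta>, and both ends of the range threaten it. Near
  \<beta> = 0 an absolute-value estimate of the large scales costs a factor 1 / \<beta>; it is
  avoided by keeping the cancellation in the fractional integrals of g, and this is what the Hardy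
  norm buys. As \<beta> tends to \<alpha> the small scales cost 1 / (\<alpha> - \<beta>). For
  \<alpha> < 1 this is compensated by the pole of a Beta function, for \<alpha> = 1 by the zero of
  the normalising constant \<open>frac_mu\<close> at \<beta> = 1. The Riesz kernel is truncated in
  heat time instead of in space. Pairing with a test field is then exact at every truncation, and
  the L2 bound follows from the decay of the heat energy without Fourier transform. Averaging the
  sharp truncations links the two, so almost everywhere convergence carries over without a maximal
  function. The only information on the limit is that it is integrable, so every error in the
  duality argument has to vanish, and a weak-type bound alone would not give the L1 norm of R
  f.\<close>

abbreviation nn_integral_lborel :: "('a::euclidean_space \<Rightarrow> ennreal) \<Rightarrow> ennreal" (binder "NN " 10)
  where "nn_integral_lborel f \<equiv> nn_integral lborel f"

section \<open>The heat kernel and its gradient\<close>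

lemma distr_lborel_shift:
  fixes a :: "'a::euclidean_space"
  shows "distr lborel borel (\<lambda>x. a + x) = lborel"
  using lborel_affine[of 1 a] by (simp add: density_1)

lemma distr_lborel_reflect:
  fixes a :: "'a::euclidean_space"
  shows "distr lborel borel (\<lambda>x. a - x) = lborel"
  using lborel_affine[of "-1" a] by (simp add: density_1)

lemma nn_integral_shift:
  fixes a :: "'a::euclidean_space"
  assumes [measurable]: "f \<in> borel_measurable borel"
  shows "(NN x. f (a + x)) = (NN x. f x)"
proof -
  have "(\<integral>\<^sup>+x. f x \<partial>distr lborel borel (\<lambda>x. a + x)) = (NN x. f (a + x))"
    by (rule nn_integral_distr) auto
  then show ?thesis by (simp add: distr_lborel_shift)
qed

lemma nn_integral_reflect:
  fixes a :: "'a::euclidean_space"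
  assumes [measurable]: "f \<in> borel_measurable borel"
  shows "(NN x. f (a - x)) = (NN x. f x)"
proof -
  have "(\<integral>\<^sup>+x. f x \<partial>distr lborel borel (\<lambda>x. a - x)) = (NN x. f (a - x))"
    by (rule nn_integral_distr) auto
  then show ?thesis by (simp add: distr_lborel_reflect)
qed

lemma
  fixes a :: "'a::euclidean_space" and f :: "'a \<Rightarrow> 'b::{banach,second_countable_topology}"
  assumes [measurable]: "f \<in> borel_measurable borel"
  shows integral_shift: "(LBINT x. f (a + x)) = (LBINT x. f x)"
    and integrable_shift: "integrable lborel (\<lambda>x. f (a + x)) \<longleftrightarrow> integrable lborel f"
    and integral_reflect: "(LBINT x. f (a - x)) = (LBINT x. f x)"
proof -
  have "(\<integral>x. f x \<partial>distr lborel borel (\<lambda>x. a + x)) = (LBINT x. f (a + x))"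
    by (rule integral_distr) auto
  then show "(LBINT x. f (a + x)) = (LBINT x. f x)" by (simp add: distr_lborel_shift)
  have "(\<integral>x. f x \<partial>distr lborel borel (\<lambda>x. a - x)) = (LBINT x. f (a - x))"
    by (rule integral_distr) auto
  then show "(LBINT x. f (a - x)) = (LBINT x. f x)" by (simp add: distr_lborel_reflect)
  have "integrable (distr lborel borel (\<lambda>x. a + x)) f \<longleftrightarrow> integrable lborel (\<lambda>x. f (a + x))"
    by (rule integrable_distr_eq) auto
  then show "integrable lborel (\<lambda>x. f (a + x)) \<longleftrightarrow> integrable lborel f" by (simp add: distr_lborel_shift)
qed

text \<open>Reflection preserves the integral, so it equals its own negative. A non-integrable odd
  function is covered as well, its integral being 0 by convention.\<close>

lemma integral_odd_eq_0:
  fixes f :: "'a::euclidean_space \<Rightarrow> 'b::{banach,second_countable_topology}"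
  assumes [measurable]: "f \<in> borel_measurable borel" and odd: "\<And>x. f (- x) = - f x"
  shows "(LBINT x. f x) = 0"
proof -
  have "(LBINT x. f x) = (LBINT x. f (0 - x))" by (rule integral_reflect[symmetric]) simp
  also have "... = - (LBINT x. f x)" by (simp add: odd)
  finally have eq: "(LBINT x. f x) = - (LBINT x. f x)" .
  have "2 *\<^sub>R (LBINT x. f x) = (LBINT x. f x) + - (LBINT x. f x)"
    unfolding scaleR_2 by (subst eq[symmetric]) (rule refl)
  then show ?thesis by simp
qed

text \<open>Absolute integrability is verified below by an iterated nonnegative integral in one
  convenient order, so Tonelli's test is stated in that form, together with all the consequences
  that are used.\<close>

lemma Fubini_lborel:
  fixes F :: "'a::euclidean_space \<Rightarrow> 'b::euclidean_space \<Rightarrow> 'c::{banach,second_countable_topology}"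
  assumes meas[measurable]: "(\<lambda>(x, y). F x y) \<in> borel_measurable (lborel \<Otimes>\<^sub>M lborel)"
    and fin: "(NN x. NN y. ennreal (norm (F x y))) < \<infinity>"
  shows "(LBINT x. (LBINT y. F x y)) = (LBINT y. (LBINT x. F x y))"
    and "integrable lborel (\<lambda>x. LBINT y. F x y)"
    and "integrable lborel (\<lambda>y. LBINT x. F x y)"
    and "AE x in lborel. integrable lborel (F x)"
    and "AE y in lborel. integrable lborel (\<lambda>x. F x y)"
proof -
  have int: "integrable (lborel \<Otimes>\<^sub>M lborel) (\<lambda>(x, y). F x y)"
  proof (rule integrableI_bounded)
    have "(\<integral>\<^sup>+p. ennreal (norm (case p of (x, y) \<Rightarrow> F x y)) \<partial>(lborel \<Otimes>\<^sub>M lborel))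
      = (NN x. NN y. ennreal (norm (F x y)))"
      by (subst lborel.nn_integral_fst[symmetric]) auto
    then show "(\<integral>\<^sup>+p. ennreal (norm (case p of (x, y) \<Rightarrow> F x y)) \<partial>(lborel \<Otimes>\<^sub>M lborel)) < \<infinity>"
      using fin by simp
  qed (rule meas)
  show "(LBINT x. (LBINT y. F x y)) = (LBINT y. (LBINT x. F x y))"
    using lborel_pair.Fubini_integral[OF int] by simp
  show "integrable lborel (\<lambda>x. LBINT y. F x y)"
    using lborel_pair.integrable_fst[OF int] by simp
  show "integrable lborel (\<lambda>y. LBINT x. F x y)"
    using lborel_pair.integrable_snd[OF int] by simp
  show "AE x in lborel. integrable lborel (F x)"
    using lborel_pair.AE_integrable_fst[OF int] by simp
  show "AE y in lborel. integrable lborel (\<lambda>x. F x y)"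
    using lborel_pair.AE_integrable_snd[OF int] by simp
qed

text \<open>A non-measurable \<open>f\<close> has integral 0 by convention, and then
  \<open>0 \<le> C\<close> suffices. Estimates by nonnegative integrals thus carry over without a
  separate integrability check.\<close>

lemma norm_integral_le_nn:
  fixes f :: "'a \<Rightarrow> 'b::{banach,second_countable_topology}"
  assumes "(\<integral>\<^sup>+x. ennreal (norm (f x)) \<partial>M) \<le> ennreal C" "0 \<le> C"
  shows "norm (\<integral>x. f x \<partial>M) \<le> C"
proof (cases "f \<in> borel_measurable M")
  case True
  then have "integrable M f"
    using assms by (intro integrableI_bounded) (auto simp: order_le_less_trans[OF _ ennreal_less_top])
  from integral_norm_bound_ennreal[OF this] assms show ?thesis
    by (meson ennreal_le_iff order_trans)
next
  case False
  then have "\<not> integrable M f" by auto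
  then show ?thesis using assms by (simp add: not_integrable_integral_eq)
qed

section \<open>The Gaussian kernel: moments, gradient and semigroup\<close>

definition heat :: "real \<Rightarrow> 'a::euclidean_space \<Rightarrow> real" where
  "heat t y = (4 * pi * t) powr (- real DIM('a) / 2) * exp (- (norm y)\<^sup>2 / (4 * t))"

text \<open>Minus the spatial gradient of \<open>heat t\<close>. With this sign, pairing
  \<open>kern\<close> with a field yields the divergence of the heat extension of the field and not
  its negative.\<close>

definition kern :: "real \<Rightarrow> 'a::euclidean_space \<Rightarrow> 'a" where
  "kern t y = (heat t y / (2 * t)) *\<^sub>R y"

lemma heat_measurable[measurable (raw)]:
  assumes [measurable]: "f \<in> borel_measurable M" "g \<in> borel_measurable M"
  shows "(\<lambda>x. heat (f x) (g x :: 'a::euclidean_space)) \<in> borel_measurable M"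
  unfolding heat_def by measurable

lemma kern_measurable[measurable (raw)]:
  assumes [measurable]: "f \<in> borel_measurable M" "g \<in> borel_measurable M"
  shows "(\<lambda>x. kern (f x) (g x :: 'a::euclidean_space)) \<in> borel_measurable M"
  unfolding kern_def by measurable

lemma heat_nonneg[simp]: "0 \<le> heat t y" by (simp add: heat_def)

lemma heat_minus[simp]: "heat t (- y) = heat t y" by (simp add: heat_def)

lemma kern_minus[simp]: "kern t (- y) = - kern t y" by (simp add: kern_def)

text \<open>Reduces all Gaussian moments to one dimension: each coordinate is a centred normal
  variable of variance \<open>2 * t\<close>.\<close>

lemma heat_eq_prod:
  fixes y :: "'a::euclidean_space"
  assumes t: "0 < t"
  shows "heat t y = (\<Prod>b\<in>Basis. normal_density 0 (sqrt (2 * t)) (y \<bullet> b))"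
proof -
  have "(\<Prod>b\<in>Basis. normal_density 0 (sqrt (2 * t)) (y \<bullet> b))
    = (1 / sqrt (2 * pi * (2 * t))) ^ DIM('a) * exp (\<Sum>b\<in>Basis. - (y \<bullet> b)\<^sup>2 / (2 * (2 * t)))"
    using t by (simp add: normal_density_def prod_dividef exp_sum power_divide)
  also have "(\<Sum>b\<in>Basis. - (y \<bullet> b)\<^sup>2 / (2 * (2 * t))) = - (norm y)\<^sup>2 / (4 * t)"
  proof -
    have "(norm y)\<^sup>2 = (\<Sum>b\<in>Basis. (y \<bullet> b)\<^sup>2)"
      unfolding power2_norm_eq_inner by (subst euclidean_inner) (simp add: power2_eq_square)
    then show ?thesis by (simp add: sum_divide_distrib[symmetric] sum_negf)
  qed
  also have "(1 / sqrt (2 * pi * (2 * t))) ^ DIM('a) = (4 * pi * t) powr (- real DIM('a) / 2)"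
  proof -
    have "1 / sqrt (2 * pi * (2 * t)) = (4 * pi * t) powr (- (1 / 2))"
      using t by (simp add: powr_minus_divide powr_half_sqrt mult.commute mult.left_commute)
    then show ?thesis using t by (simp add: powr_powr powr_realpow[symmetric])
  qed
  finally show ?thesis by (simp add: heat_def)
qed

lemma nn_integral_heat:
  assumes t: "0 < t"
  shows "(NN y. ennreal (heat t (y::'a::euclidean_space))) = 1"
proof -
  have "(NN y. ennreal (heat t (y::'a)))
    = (NN y. (\<Prod>b\<in>(Basis::'a set). ennreal (normal_density 0 (sqrt (2 * t)) (y \<bullet> b))))"
    by (simp add: heat_eq_prod[OF t] prod_ennreal)
  also have "... = (\<Prod>b\<in>(Basis::'a set). NN x. ennreal (normal_density 0 (sqrt (2 * t)) x))"
    by (rule nn_integral_lborel_prod) auto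
  also have "(NN x. ennreal (normal_density 0 (sqrt (2 * t)) x)) = 1"
    using t by (subst nn_integral_eq_integral) auto
  finally show ?thesis by simp
qed

lemma nn_integral_normal_square:
  assumes "0 < \<sigma>"
  shows "(NN x. ennreal (normal_density 0 \<sigma> x * x\<^sup>2)) = ennreal (\<sigma>\<^sup>2)"
proof -
  have "has_bochner_integral lborel (\<lambda>x. normal_density 0 \<sigma> x * x\<^sup>2) (\<sigma>\<^sup>2)"
    using normal_moment_even[OF assms, of 0 1] by (simp add: fact_numeral power2_eq_square)
  then show ?thesis
    by (subst nn_integral_eq_integral) (auto simp: has_bochner_integral_iff)
qed

lemma nn_integral_heat_square:
  assumes t: "0 < t"
  shows "(NN y. ennreal (heat t y * (norm (y::'a::euclidean_space))\<^sup>2)) = ennreal (2 * real DIM('a) * t)"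
proof -
  let ?nd = "normal_density 0 (sqrt (2 * t))"
  have 1: "(NN y. ennreal (heat t y * (y \<bullet> b)\<^sup>2)) = ennreal (2 * t)" if b: "b \<in> Basis" for b :: 'a
  proof -
    \<comment> \<open>Coordinate \<open>b\<close> carries the extra square, the others a plain
      density; the integral becomes one second moment times factors equal to 1.\<close>
    let ?F = "\<lambda>b' x. if b' = b then ennreal (?nd x * x\<^sup>2) else ennreal (?nd x)"
    have eq: "ennreal (heat t y * (y \<bullet> b)\<^sup>2) = (\<Prod>b'\<in>Basis. ?F b' (y \<bullet> b'))" for y
    proof -
      have "heat t y * (y \<bullet> b)\<^sup>2 = ?nd (y \<bullet> b) * (y \<bullet> b)\<^sup>2 * (\<Prod>b'\<in>Basis - {b}. ?nd (y \<bullet> b'))"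
        unfolding heat_eq_prod[OF t] using b by (subst prod.remove[OF _ b]) auto
      moreover have "(\<Prod>b'\<in>Basis. ?F b' (y \<bullet> b')) = ?F b (y \<bullet> b) * (\<Prod>b'\<in>Basis - {b}. ?F b' (y \<bullet> b'))"
        using b by (subst prod.remove[OF _ b]) auto
      moreover have "(\<Prod>b'\<in>Basis - {b}. ?F b' (y \<bullet> b')) = ennreal (\<Prod>b'\<in>Basis - {b}. ?nd (y \<bullet> b'))"
        by (subst prod_ennreal[symmetric]) (auto intro!: prod.cong)
      ultimately show ?thesis by (simp only: if_True) (simp add: ennreal_mult'' prod_nonneg del: mult_cancel_right)
    qed
    have "(NN y. ennreal (heat t y * (y \<bullet> b)\<^sup>2)) = (NN y. (\<Prod>b'\<in>(Basis::'a set). ?F b' (y \<bullet> b')))"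
      by (simp add: eq)
    also have "... = (\<Prod>b'\<in>Basis. NN x. ?F b' x)"
      by (rule nn_integral_lborel_prod) auto
    also have "... = (\<Prod>b'\<in>Basis. if b' = b then ennreal (2 * t) else 1)"
    proof (rule prod.cong)
      fix b' :: 'a
      have "(NN x. ennreal (?nd x)) = 1"
        using t by (subst nn_integral_eq_integral) auto
      then show "(NN x. ?F b' x) = (if b' = b then ennreal (2 * t) else 1)"
        using nn_integral_normal_square[of "sqrt (2 * t)"] t by simp
    qed simp
    also have "... = ennreal (2 * t)" using b by (simp add: prod.remove)
    finally show ?thesis .
  qed
  have "(NN y. ennreal (heat t y * (norm (y::'a))\<^sup>2))
    = (NN y. (\<Sum>b\<in>(Basis::'a set). ennreal (heat t y * (y \<bullet> b)\<^sup>2)))"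
  proof (rule nn_integral_cong)
    fix y :: 'a
    have "(norm y)\<^sup>2 = (\<Sum>b\<in>Basis. (y \<bullet> b)\<^sup>2)"
      unfolding power2_norm_eq_inner by (subst euclidean_inner) (simp add: power2_eq_square)
    then show "ennreal (heat t y * (norm y)\<^sup>2) = (\<Sum>b\<in>Basis. ennreal (heat t y * (y \<bullet> b)\<^sup>2))"
      by (simp add: sum_distrib_left)
  qed
  also have "... = (\<Sum>b\<in>(Basis::'a set). ennreal (2 * t))"
    by (subst nn_integral_sum) (auto simp: 1)
  also have "... = ennreal (2 * real DIM('a) * t)"
    using t by (simp add: ennreal_mult'' ennreal_of_nat_eq_real_of_nat[symmetric] mult_ac)
  finally show ?thesis .
qed

lemma integrable_heat[simp]: "0 < t \<Longrightarrow> integrable lborel (heat t :: 'a::euclidean_space \<Rightarrow> real)"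
  by (rule integrableI_bounded) (auto simp: nn_integral_heat)

lemma integral_heat[simp]: "0 < t \<Longrightarrow> (LBINT y. heat t (y::'a::euclidean_space)) = 1"
  by (rule integral_eq_nn_integral[THEN trans]) (auto simp: nn_integral_heat)

lemma integrable_heat_square[simp]:
  "0 < t \<Longrightarrow> integrable lborel (\<lambda>y. heat t y * (norm (y::'a::euclidean_space))\<^sup>2)"
  by (rule integrableI_bounded) (auto simp: nn_integral_heat_square)

lemma integral_heat_square[simp]:
  "0 < t \<Longrightarrow> (LBINT y. heat t y * (norm (y::'a::euclidean_space))\<^sup>2) = 2 * real DIM('a) * t"
  by (rule integral_eq_nn_integral[THEN trans]) (auto simp: nn_integral_heat_square)

text \<open>Scale invariance: the weight \<open>norm y\<close> offsets the growth of the mass of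
  \<open>kern t\<close> as \<open>t\<close> decreases, so the value does not depend on
  \<open>t\<close>. Both the Lipschitz bound for \<open>heat_div\<close> and the far part of
  Hoermander's condition come from this moment.\<close>

lemma nn_integral_norm_kern_times_norm:
  assumes t: "0 < t"
  shows "(NN y. ennreal (norm (kern t y) * norm (y::'a::euclidean_space))) = ennreal DIM('a)"
proof -
  have "(NN y. ennreal (norm (kern t y) * norm (y::'a)))
     = (NN y. ennreal (1 / (2 * t)) * ennreal (heat t y * (norm (y::'a))\<^sup>2))"
    using t by (intro nn_integral_cong) (simp add: kern_def ennreal_mult'[symmetric] power2_eq_square)
  also have "... = ennreal (1 / (2 * t)) * ennreal (2 * real DIM('a) * t)"
    by (simp add: nn_integral_cmult nn_integral_heat_square[OF t])
  also have "... = ennreal DIM('a)" using t by (simp add: ennreal_mult''[symmetric])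
  finally show ?thesis .
qed

text \<open>The first moment of the Gaussian is avoided:
  \<open>2 * norm y \<le> sqrt t + (norm y)\<^sup>2 / sqrt t\<close> reduces it to the zeroth and
  second moments. The resulting constant is 1/4 + n/2, at most n.\<close>

lemma nn_integral_norm_kern:
  assumes t: "0 < t"
  shows "(NN y. ennreal (norm (kern t (y::'a::euclidean_space)))) \<le> ennreal (real DIM('a) * t powr (- 1 / 2))"
proof -
  have "(NN y. ennreal (norm (kern t (y::'a))))
    \<le> (NN y. ennreal (1 / 4 * t powr (- 1 / 2)) * ennreal (heat t y) + ennreal (1 / 4 * t powr (- 3 / 2)) * ennreal (heat t y * (norm (y::'a))\<^sup>2))"
  proof (rule nn_integral_mono)
    fix y :: 'a
    have s: "sqrt t > 0" "sqrt t * sqrt t = t" using t by auto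
    have p1: "t powr (- 1 / 2) = 1 / sqrt t"
      using t by (simp add: powr_minus_divide powr_half_sqrt)
    have p2: "t powr (- 3 / 2) = 1 / (t * sqrt t)"
    proof -
      have "t powr (- 3 / 2) = t powr (- 1 + - 1 / 2)" by simp
      also have "... = t powr (- 1) * t powr (- 1 / 2)" by (rule powr_add)
      finally show ?thesis using t unfolding p1 by (simp add: powr_minus_divide)
    qed
    have "0 \<le> (norm y - sqrt t)\<^sup>2" by simp
    then have "2 * (norm y * sqrt t) \<le> (norm y)\<^sup>2 + t"
      using s t by (simp add: power2_diff)
    then have "norm y \<le> 1 / 2 * (sqrt t + (norm y)\<^sup>2 / sqrt t)"
      using s by (simp add: field_simps)
    then have "heat t y / (2 * t) * norm y \<le> heat t y / (2 * t) * (1 / 2 * (sqrt t + (norm y)\<^sup>2 / sqrt t))"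
      using t by (intro mult_left_mono) auto
    also have "... = 1 / 4 * t powr (- 1 / 2) * heat t y + 1 / 4 * t powr (- 3 / 2) * (heat t y * (norm y)\<^sup>2)"
      unfolding p1 p2 using t s by (simp add: field_simps)
    finally have "norm (kern t y) \<le> 1 / 4 * t powr (- 1 / 2) * heat t y + 1 / 4 * t powr (- 3 / 2) * (heat t y * (norm y)\<^sup>2)"
      using t by (simp add: kern_def)
    then show "ennreal (norm (kern t y)) \<le> ennreal (1 / 4 * t powr (- 1 / 2)) * ennreal (heat t y) + ennreal (1 / 4 * t powr (- 3 / 2)) * ennreal (heat t y * (norm y)\<^sup>2)"
      by (simp add: ennreal_mult'[symmetric] ennreal_plus[symmetric] del: ennreal_plus)
  qed
  also have "... = ennreal (1 / 4 * t powr (- 1 / 2)) + ennreal (1 / 4 * t powr (- 3 / 2)) * ennreal (2 * real DIM('a) * t)"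
    by (simp add: nn_integral_add nn_integral_cmult nn_integral_heat[OF t] nn_integral_heat_square[OF t])
  also have "... = ennreal (1 / 4 * t powr (- 1 / 2) + DIM('a) / 2 * (t powr (- 3 / 2) * t))"
    using t by (simp add: ennreal_mult''[symmetric] ennreal_plus[symmetric] del: ennreal_plus)
  also have "t powr (- 3 / 2) * t = t powr (- 1 / 2)"
    using t powr_add[of t "- 3 / 2" 1] by simp
  also have "ennreal (1 / 4 * t powr (- 1 / 2) + DIM('a) / 2 * t powr (- 1 / 2)) \<le> ennreal (real DIM('a) * t powr (- 1 / 2))"
  proof (rule ennreal_leI)
    have "1 / 4 * t powr (- 1 / 2) + real DIM('a) / 2 * t powr (- 1 / 2) = (1 / 4 + real DIM('a) / 2) * t powr (- 1 / 2)"
      by (simp add: algebra_simps)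
    also have "... \<le> DIM('a) * t powr (- 1 / 2)"
    proof (rule mult_right_mono)
      have "1 \<le> real DIM('a)" by (simp add: Suc_le_eq)
      then show "1 / 4 + real DIM('a) / 2 \<le> DIM('a)" by linarith
    qed simp
    finally show "1 / 4 * t powr (- 1 / 2) + real DIM('a) / 2 * t powr (- 1 / 2) \<le> DIM('a) * t powr (- 1 / 2)" .
  qed
  finally show ?thesis .
qed

lemma integrable_kern[simp]: "0 < t \<Longrightarrow> integrable lborel (kern t :: 'a::euclidean_space \<Rightarrow> 'a)"
  by (rule integrableI_bounded) (auto intro!: order_le_less_trans[OF nn_integral_norm_kern])

text \<open>In the scaled radius \<open>r = norm y / (2 * sqrt t)\<close> everything reduces to
  \<open>r * exp (- r\<^sup>2) \<le> 1\<close>. The factor \<open>4 * pi\<close> is dropped at no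
  cost because the power is negative.\<close>

lemma norm_kern_le:
  assumes t: "0 < t"
  shows "norm (kern t (y::'a::euclidean_space)) \<le> t powr (- (real DIM('a) + 1) / 2)"
proof -
  define r where "r = norm y / (2 * sqrt t)"
  have s: "sqrt t > 0" "sqrt t * sqrt t = t" using t by auto
  have r2: "(norm y)\<^sup>2 / (4 * t) = r\<^sup>2" using s by (simp add: r_def power_divide power_mult_distrib power2_eq_square)
  have ny: "norm y = 2 * sqrt t * r" using s by (simp add: r_def)
  have r0: "0 \<le> r" using t by (simp add: r_def)
  have "0 \<le> (r - 1)\<^sup>2" by simp
  then have "2 * r \<le> 1 + r\<^sup>2" by (simp add: power2_diff)
  then have "r \<le> 1 + r\<^sup>2" using r0 by linarith
  also have "... \<le> exp (r\<^sup>2)" by (rule exp_ge_add_one_self)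
  finally have re: "r * exp (- r\<^sup>2) \<le> 1" by (simp add: exp_minus field_simps)
  have p: "(4 * pi * t) powr (- real DIM('a) / 2) \<le> t powr (- real DIM('a) / 2)"
    using t pi_gt3 by (intro powr_mono2') auto
  have "norm (kern t y) = (4 * pi * t) powr (- real DIM('a) / 2) * (1 / sqrt t) * (r * exp (- r\<^sup>2))"
    using t s by (simp add: kern_def heat_def r2[symmetric] ny[symmetric]) (simp add: r_def field_simps)
  also have "... \<le> t powr (- real DIM('a) / 2) * (1 / sqrt t) * 1"
    using p re r0 s by (intro mult_mono) auto
  also have "1 / sqrt t = t powr (- (1/2))"
    using t by (simp add: powr_minus_divide powr_half_sqrt)
  also have "t powr (- real DIM('a) / 2) * t powr (- (1/2)) * 1 = t powr (- (real DIM('a) + 1) / 2)"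
    by (simp flip: powr_add add: field_simps)
  finally show ?thesis .
qed

text \<open>Completing the square: as a function of \<open>z\<close> the product is again Gaussian,
  with time \<open>t * s / (t + s)\<close> and centre \<open>(s / (t + s)) *\<^sub>R y\<close>,
  times a factor free of \<open>z\<close>. Both correlation identities for heat gradients rest on
  this.\<close>

lemma heat_mult:
  fixes y z :: "'a::euclidean_space"
  assumes t: "0 < t" and s: "0 < s"
  shows "heat t (y - z) * heat s z = heat (t + s) y * heat (t * s / (t + s)) (z - (s / (t + s)) *\<^sub>R y)"
proof -
  have ts: "t + s > 0" using t s by simp
  have e: "(norm (y - z))\<^sup>2 / (4 * t) + (norm z)\<^sup>2 / (4 * s)
     = (norm y)\<^sup>2 / (4 * (t + s)) + (norm (z - (s / (t + s)) *\<^sub>R y))\<^sup>2 / (4 * (t * s / (t + s)))"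
  proof -
    have n1: "(norm (y - z))\<^sup>2 = y \<bullet> y - 2 * (y \<bullet> z) + z \<bullet> z"
      by (simp add: power2_norm_eq_inner inner_diff_left inner_diff_right inner_commute)
    have n2: "(norm (z - m *\<^sub>R y))\<^sup>2 = z \<bullet> z - 2 * m * (y \<bullet> z) + m\<^sup>2 * (y \<bullet> y)" for m
      by (simp add: power2_norm_eq_inner inner_diff_left inner_diff_right inner_commute[of z y])
        (simp add: power2_eq_square right_diff_distrib)
    have n3: "(norm z)\<^sup>2 = z \<bullet> z" "(norm y)\<^sup>2 = y \<bullet> y" by (simp_all add: power2_norm_eq_inner)
    have k: "(A - 2 * B + C) / (4 * t) + C / (4 * s) = A / (4 * u) + (C - 2 * (s / u) * B + (s / u)\<^sup>2 * A) / (4 * (t * s / u))"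
      if u: "u = t + s" "u > 0" for A B C u :: real
    proof -
      have "(A - 2 * B + C) / (4 * t) + C / (4 * s) = (s * (A - 2 * B + C) + t * C) / (4 * t * s)"
        using t s by (simp add: field_simps)
      also have "... = (s * (A - 2 * B + C) + t * C) * u / (4 * t * s * u)" using u(2) by simp
      also have "(s * (A - 2 * B + C) + t * C) * u = t * s * A + (C * u\<^sup>2 - 2 * s * B * u + s\<^sup>2 * A)"
        unfolding u(1) by (simp add: algebra_simps power2_eq_square)
      also have "... / (4 * t * s * u) = A / (4 * u) + (C * u\<^sup>2 - 2 * s * B * u + s\<^sup>2 * A) / (4 * t * s * u)"
        using t s u(2) by (simp add: add_divide_distrib)
      also have "C * u\<^sup>2 - 2 * s * B * u + s\<^sup>2 * A = (C - 2 * (s / u) * B + (s / u)\<^sup>2 * A) * u\<^sup>2"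
        using u(2) by (simp add: algebra_simps power2_eq_square)
      also have "... / (4 * t * s * u) = (C - 2 * (s / u) * B + (s / u)\<^sup>2 * A) / (4 * (t * s / u))"
        using u(2) by (simp add: power2_eq_square)
      finally show ?thesis .
    qed
    show ?thesis unfolding n1 n2 n3 by (rule k) (use ts in auto)
  qed
  have p: "(4 * pi * t) powr c * (4 * pi * s) powr c = (4 * pi * (t + s)) powr c * (4 * pi * (t * s / (t + s))) powr c" for c
  proof -
    have "(4 * pi * t) * (4 * pi * s) = (4 * pi * (t + s)) * (4 * pi * (t * s / (t + s)))"
      using ts by (simp add: field_simps)
    then have "((4 * pi * t) * (4 * pi * s)) powr c = ((4 * pi * (t + s)) * (4 * pi * (t * s / (t + s)))) powr c"
      by (simp only:)
    moreover have "0 \<le> 4 * pi * t" "0 \<le> 4 * pi * s" "0 \<le> 4 * pi * (t + s)" "0 \<le> 4 * pi * (t * s / (t + s))"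
      using t s by auto
    ultimately show ?thesis by (simp only: powr_mult)
  qed
  have "exp (- (norm (y - z))\<^sup>2 / (4 * t)) * exp (- (norm z)\<^sup>2 / (4 * s))
    = exp (- (norm y)\<^sup>2 / (4 * (t + s))) * exp (- (norm (z - (s / (t + s)) *\<^sub>R y))\<^sup>2 / (4 * (t * s / (t + s))))"
    using e by (simp flip: exp_add)
  then show ?thesis
    unfolding heat_def using p[of "- real DIM('a) / 2"]
    by (simp only: mult.assoc mult.left_commute[of "exp _"])
      (simp only: mult.assoc[symmetric])
qed

lemma integrable_heat_scaleR: "0 < t \<Longrightarrow> integrable lborel (\<lambda>z::'a::euclidean_space. heat t z *\<^sub>R z)"
  and integral_heat_scaleR: "0 < t \<Longrightarrow> (LBINT z. heat t z *\<^sub>R (z::'a)) = 0"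
proof -
  assume t: "0 < t"
  have eq: "(\<lambda>z::'a. heat t z *\<^sub>R z) = (\<lambda>z. (2 * t) *\<^sub>R kern t z)"
    using t by (simp add: kern_def fun_eq_iff)
  show "integrable lborel (\<lambda>z::'a. heat t z *\<^sub>R z)" unfolding eq using t by simp
  show "(LBINT z. heat t z *\<^sub>R (z::'a)) = 0"
    by (rule integral_odd_eq_0) (simp_all add: heat_def)
qed

text \<open>After \<open>heat_mult\<close> the variable is recentred. The odd first moment vanishes,
  and the surviving mean \<open>t / (t + s)\<close> times \<open>y\<close> turns the prefactor
  \<open>1 / (2 * t)\<close> into that of the total time.\<close>

lemma kern_semigroup:
  fixes y :: "'a::euclidean_space"
  assumes t: "0 < t" and s: "0 < s"
  shows "(LBINT z. heat s z *\<^sub>R kern t (y - z)) = kern (t + s) y"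
proof -
  define \<rho> where "\<rho> = t * s / (t + s)"
  define m where "m = s / (t + s)"
  have \<rho>: "0 < \<rho>" using t s by (simp add: \<rho>_def)
  have m1: "1 - m = t / (t + s)" using t s by (simp add: m_def field_simps)
  have "heat s z *\<^sub>R kern t (y - z) = (heat (t + s) y / (2 * t)) *\<^sub>R (heat \<rho> (z - m *\<^sub>R y) *\<^sub>R ((1 - m) *\<^sub>R y - (z - m *\<^sub>R y)))" for z
  proof -
    have "heat s z *\<^sub>R kern t (y - z) = (heat t (y - z) * heat s z / (2 * t)) *\<^sub>R (y - z)"
      by (simp add: kern_def)
    also have "heat t (y - z) * heat s z = heat (t + s) y * heat \<rho> (z - m *\<^sub>R y)"
      unfolding \<rho>_def m_def by (rule heat_mult[OF t s])
    finally have e: "heat s z *\<^sub>R kern t (y - z) = (heat (t + s) y * heat \<rho> (z - m *\<^sub>R y) / (2 * t)) *\<^sub>R (y - z)" .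
    have e2: "y - z = (1 - m) *\<^sub>R y - (z - m *\<^sub>R y)" by (simp add: algebra_simps)
    show ?thesis unfolding e by (subst e2) simp
  qed
  then have "(LBINT z. heat s z *\<^sub>R kern t (y - z))
    = (LBINT z. (heat (t + s) y / (2 * t)) *\<^sub>R (heat \<rho> (z - m *\<^sub>R y) *\<^sub>R ((1 - m) *\<^sub>R y - (z - m *\<^sub>R y))))"
    by presburger
  also have "... = (heat (t + s) y / (2 * t)) *\<^sub>R (LBINT z. heat \<rho> (- (m *\<^sub>R y) + z) *\<^sub>R ((1 - m) *\<^sub>R y - (- (m *\<^sub>R y) + z)))"
    unfolding integral_scaleR_right[symmetric] by simp
  also have "(LBINT z. heat \<rho> (- (m *\<^sub>R y) + z) *\<^sub>R ((1 - m) *\<^sub>R y - (- (m *\<^sub>R y) + z)))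
    = (LBINT z. heat \<rho> z *\<^sub>R ((1 - m) *\<^sub>R y - z))"
    by (rule integral_shift) simp
  also have "... = (LBINT z. heat \<rho> (z::'a) *\<^sub>R ((1 - m) *\<^sub>R y)) - (LBINT z. heat \<rho> z *\<^sub>R (z::'a))"
    unfolding scaleR_diff_right
    by (rule Bochner_Integration.integral_diff) (auto intro!: integrable_heat_scaleR \<rho> integrable_heat integrable_scaleR_left)
  also have "... = (1 - m) *\<^sub>R y" using \<rho> by (simp add: integral_heat_scaleR)
  also have "(heat (t + s) y / (2 * t)) *\<^sub>R (1 - m) *\<^sub>R y = kern (t + s) y"
    unfolding m1 using t s by (simp add: kern_def)
  finally show ?thesis .
qed

section \<open>The time derivative of the heat kernel\<close>

definition heat_dt :: "real \<Rightarrow> 'a::euclidean_space \<Rightarrow> real" where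
  "heat_dt s w = heat s w * ((norm w)\<^sup>2 / (4 * s\<^sup>2) - real DIM('a) / (2 * s))"

lemma heat_dt_measurable[measurable (raw)]:
  assumes [measurable]: "f \<in> borel_measurable M" "g \<in> borel_measurable M"
  shows "(\<lambda>x. heat_dt (f x) (g x :: 'a::euclidean_space)) \<in> borel_measurable M"
  unfolding heat_dt_def by measurable

lemma has_derivative_heat_time:
  assumes s: "0 < s"
  shows "((\<lambda>s. heat s (w::'a::euclidean_space)) has_real_derivative heat_dt s w) (at s)"
proof -
  define c where "c = - real DIM('a) / 2"
  have "((\<lambda>s. 4 * pi * s) has_real_derivative 4 * pi) (at s)"
    by (auto intro!: derivative_eq_intros)
  moreover have "0 < 4 * pi * s" using s by simp
  ultimately have d1: "((\<lambda>s. (4 * pi * s) powr c) has_real_derivative c * (4 * pi * s) powr (c - 1) * (4 * pi)) (at s)"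
    using DERIV_chain'[of "\<lambda>s. 4 * pi * s" "4 * pi" s UNIV "\<lambda>z. z powr c"] has_real_derivative_powr[of "4 * pi * s" c]
    by simp
  have p: "(4 * pi * s) powr (c - 1) = (4 * pi * s) powr c / (4 * pi * s)"
    using s by (simp add: powr_diff)
  have d2: "((\<lambda>s. exp (- (norm w)\<^sup>2 / (4 * s))) has_real_derivative exp (- (norm w)\<^sup>2 / (4 * s)) * ((norm w)\<^sup>2 / (4 * s\<^sup>2))) (at s)"
    using s by (auto intro!: derivative_eq_intros simp: power2_eq_square)
  show ?thesis
    using DERIV_cong[OF DERIV_mult[OF d1 d2], of "heat_dt s w"] s
    unfolding heat_def heat_dt_def p c_def[symmetric] by (simp add: c_def field_simps)
qed

text \<open>The correlation of two heat gradients is minus the Laplacian of the kernel at the total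
  time, hence minus its time derivative. It is obtained by completing the square and the Gaussian
  moments of order 0, 1 and 2. That only \<open>\<sigma> + \<tau>\<close> enters is what makes the
  L2 bound for the Riesz kernels work.\<close>

lemma integral_kern_inner_kern:
  fixes w :: "'a::euclidean_space"
  assumes \<sigma>: "0 < \<sigma>" and \<tau>: "0 < \<tau>"
  shows "(LBINT y. kern \<sigma> y \<bullet> kern \<tau> (w + y)) = - heat_dt (\<sigma> + \<tau>) w"
proof -
  define \<rho> where "\<rho> = \<tau> * \<sigma> / (\<tau> + \<sigma>)"
  define m where "m = \<sigma> / (\<tau> + \<sigma>)"
  define c where "c = heat (\<tau> + \<sigma>) w / (4 * \<tau> * \<sigma>)"
  have \<rho>: "0 < \<rho>" using \<sigma> \<tau> by (simp add: \<rho>_def)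
  have m1: "1 - m = \<tau> / (\<tau> + \<sigma>)" using \<sigma> \<tau> by (simp add: m_def field_simps)
  let ?q = "\<lambda>u. m * (1 - m) * (norm w)\<^sup>2 * heat \<rho> u + (1 - 2 * m) * ((heat \<rho> u *\<^sub>R u) \<bullet> w) - heat \<rho> u * (norm u)\<^sup>2"
  have pt: "kern \<sigma> z \<bullet> kern \<tau> (w - z) = c * ?q (- (m *\<^sub>R w) + z)" for z
  proof -
    have "kern \<sigma> z \<bullet> kern \<tau> (w - z) = heat \<tau> (w - z) * heat \<sigma> z / (4 * \<tau> * \<sigma>) * (z \<bullet> (w - z))"
      by (simp add: kern_def)
    also have "heat \<tau> (w - z) * heat \<sigma> z = heat (\<tau> + \<sigma>) w * heat \<rho> (z - m *\<^sub>R w)"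
      unfolding \<rho>_def m_def by (rule heat_mult[OF \<tau> \<sigma>])
    finally have e: "kern \<sigma> z \<bullet> kern \<tau> (w - z) = c * (heat \<rho> (z - m *\<^sub>R w) * (z \<bullet> (w - z)))"
      by (simp add: c_def)
    define u where "u = z - m *\<^sub>R w"
    have z: "z = u + m *\<^sub>R w" by (simp add: u_def)
    have e3: "z \<bullet> (w - z) = m * (1 - m) * (norm w)\<^sup>2 + (1 - 2 * m) * (u \<bullet> w) - (norm u)\<^sup>2"
      unfolding z power2_norm_eq_inner
      by (simp add: inner_diff_left inner_diff_right inner_add_left inner_add_right inner_commute[of w u] algebra_simps)
    have "heat \<rho> u * (z \<bullet> (w - z)) = ?q u" unfolding e3 by (simp add: algebra_simps)
    moreover have "- (m *\<^sub>R w) + z = u" by (simp add: u_def)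
    ultimately show ?thesis using e by (simp add: u_def[symmetric])
  qed
  have "(LBINT y. kern \<sigma> y \<bullet> kern \<tau> (w + y)) = (LBINT y. kern \<sigma> (0 - y) \<bullet> kern \<tau> (w + (0 - y)))"
    by (rule integral_reflect[symmetric]) simp
  also have "... = - (LBINT y. kern \<sigma> y \<bullet> kern \<tau> (w - y))" by simp
  also have "(LBINT y. kern \<sigma> y \<bullet> kern \<tau> (w - y)) = c * (LBINT z. ?q (- (m *\<^sub>R w) + z))"
    unfolding pt by simp
  also have "(LBINT z. ?q (- (m *\<^sub>R w) + z)) = (LBINT z. ?q z)"
    by (rule integral_shift) simp
  also have "... = m * (1 - m) * (norm w)\<^sup>2 - 2 * real DIM('a) * \<rho>"
  proof -
    have i1: "integrable lborel (\<lambda>u::'a. m * (1 - m) * (norm w)\<^sup>2 * heat \<rho> u)" using \<rho> by simp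
    have i2: "integrable lborel (\<lambda>u::'a. (1 - 2 * m) * ((heat \<rho> u *\<^sub>R u) \<bullet> w))"
      by (intro integrable_mult_right integrable_inner_left integrable_heat_scaleR \<rho>)
    have z: "(LBINT u. (heat \<rho> u *\<^sub>R u) \<bullet> w) = 0"
      by (subst integral_inner_left) (simp_all only: integral_heat_scaleR[OF \<rho>] integrable_heat_scaleR[OF \<rho>] inner_zero_left simp_thms)
    have "(LBINT z. ?q z) = (LBINT u. m * (1 - m) * (norm w)\<^sup>2 * heat \<rho> u + (1 - 2 * m) * ((heat \<rho> u *\<^sub>R (u::'a)) \<bullet> w))
       - (LBINT u. heat \<rho> u * (norm (u::'a))\<^sup>2)"
      by (rule Bochner_Integration.integral_diff[OF Bochner_Integration.integrable_add[OF i1 i2] integrable_heat_square[OF \<rho>]])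
    also have "... = (LBINT u. m * (1 - m) * (norm w)\<^sup>2 * heat \<rho> (u::'a)) + (LBINT u. (1 - 2 * m) * ((heat \<rho> u *\<^sub>R u) \<bullet> w)) - 2 * real DIM('a) * \<rho>"
      by (simp only: Bochner_Integration.integral_add[OF i1 i2] integral_heat_square[OF \<rho>])
    also have "... = m * (1 - m) * (norm w)\<^sup>2 - 2 * real DIM('a) * \<rho>"
      unfolding integral_mult_right_zero z integral_heat[OF \<rho>] by simp
    finally show ?thesis .
  qed
  also have "- (c * (m * (1 - m) * (norm w)\<^sup>2 - 2 * real DIM('a) * \<rho>)) = - heat_dt (\<sigma> + \<tau>) w"
  proof -
    define u where "u = \<tau> + \<sigma>"
    have u: "u > 0" using \<sigma> \<tau> by (simp add: u_def)
    have "c * (m * (1 - m) * (norm w)\<^sup>2 - 2 * real DIM('a) * \<rho>) = heat u w * ((norm w)\<^sup>2 / (4 * u\<^sup>2) - real DIM('a) / (2 * u))"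
      unfolding m1 unfolding c_def m_def \<rho>_def u_def[symmetric] using u \<sigma> \<tau>
      by (simp add: field_simps power2_eq_square)
    then show ?thesis by (simp add: heat_dt_def u_def add.commute)
  qed
  finally show ?thesis .
qed

lemma nn_integral_abs_heat_dt:
  assumes s: "0 < s"
  shows "(NN w. ennreal \<bar>heat_dt s (w::'a::euclidean_space)\<bar>) \<le> ennreal (real DIM('a) / s)"
proof -
  have "(NN w. ennreal \<bar>heat_dt s (w::'a)\<bar>)
    \<le> (NN w. ennreal (1 / (4 * s\<^sup>2)) * ennreal (heat s w * (norm (w::'a))\<^sup>2) + ennreal (real DIM('a) / (2 * s)) * ennreal (heat s w))"
  proof (rule nn_integral_mono)
    fix w :: 'a
    have "\<bar>heat_dt s w\<bar> \<le> heat s w * ((norm w)\<^sup>2 / (4 * s\<^sup>2) + real DIM('a) / (2 * s))"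
      using s by (simp add: heat_dt_def abs_mult abs_le_iff mult_left_mono)
    also have "... = 1 / (4 * s\<^sup>2) * (heat s w * (norm w)\<^sup>2) + real DIM('a) / (2 * s) * heat s w"
      by (simp add: algebra_simps)
    finally show "ennreal \<bar>heat_dt s w\<bar> \<le> ennreal (1 / (4 * s\<^sup>2)) * ennreal (heat s w * (norm w)\<^sup>2) + ennreal (real DIM('a) / (2 * s)) * ennreal (heat s w)"
      using s by (simp add: ennreal_mult'[symmetric] ennreal_plus[symmetric] del: ennreal_plus)
  qed
  also have "... = ennreal (1 / (4 * s\<^sup>2)) * ennreal (2 * real DIM('a) * s) + ennreal (real DIM('a) / (2 * s))"
    by (simp add: nn_integral_add nn_integral_cmult nn_integral_heat[OF s] nn_integral_heat_square[OF s])
  also have "... = ennreal (1 / (4 * s\<^sup>2) * (2 * real DIM('a) * s) + real DIM('a) / (2 * s))"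
    using s by (simp add: ennreal_mult''[symmetric] ennreal_plus[symmetric] del: ennreal_plus)
  also have "1 / (4 * s\<^sup>2) * (2 * real DIM('a) * s) + real DIM('a) / (2 * s) = real DIM('a) / s"
    using s by (simp add: field_simps power2_eq_square)
  finally show ?thesis .
qed

section \<open>Modulus of continuity of the heat gradient in L1\<close>

lemma continuous_heat: "continuous_on UNIV (heat t :: 'a::euclidean_space \<Rightarrow> real)"
  unfolding heat_def by (cases "t = 0") (auto intro!: continuous_intros)

text \<open>Fundamental theorem of calculus along the segment from \<open>x\<close> to
  \<open>x + h\<close>. The bound stays an integral over \<open>\<theta>\<close>, because
  integrating in \<open>x\<close> afterwards removes the shift by translation invariance.\<close>

lemma norm_kern_diff_le:
  fixes x h :: "'a::euclidean_space"
  assumes t: "0 < t"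
  shows "ennreal (norm (kern t (x + h) - kern t x))
    \<le> (NN \<theta>. indicator {0..1} \<theta> * ennreal (norm h * (heat t (x + \<theta> *\<^sub>R h) * (1 / (2 * t) + (norm (x + \<theta> *\<^sub>R h))\<^sup>2 / (4 * t\<^sup>2)))))"
proof -
  let ?p = "\<lambda>\<theta>. x + \<theta> *\<^sub>R h"
  let ?D = "\<lambda>\<theta>. (heat t (?p \<theta>) / (2 * t)) *\<^sub>R h - (heat t (?p \<theta>) * (?p \<theta> \<bullet> h) / (4 * t\<^sup>2)) *\<^sub>R ?p \<theta>"
  let ?B = "\<lambda>\<theta>. norm h * (heat t (?p \<theta>) * (1 / (2 * t) + (norm (?p \<theta>))\<^sup>2 / (4 * t\<^sup>2)))"
  have dh: "((\<lambda>\<theta>. heat t (?p \<theta>)) has_real_derivative - heat t (?p \<theta>) * (?p \<theta> \<bullet> h) / (2 * t)) (at \<theta>)" for \<theta>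
  proof -
    have "((\<lambda>\<theta>. (norm (?p \<theta>))\<^sup>2) has_real_derivative 2 * (?p \<theta> \<bullet> h)) (at \<theta>)"
      unfolding power2_norm_eq_inner inner_add_left inner_add_right inner_scaleR_left inner_scaleR_right
      by (auto intro!: derivative_eq_intros simp: inner_commute algebra_simps)
    from DERIV_cmult[OF DERIV_fun_exp[OF DERIV_cdivide[OF DERIV_minus[OF this], of "4 * t"]], of "(4 * pi * t) powr (- real DIM('a) / 2)"]
    show ?thesis
      unfolding heat_def by (rule DERIV_cong) (use t in \<open>simp add: field_simps\<close>)
  qed
  have der: "((\<lambda>\<theta>. kern t (?p \<theta>)) has_vector_derivative ?D \<theta>) (at \<theta>)" for \<theta>
  proof -
    have d1: "((\<lambda>\<theta>. heat t (?p \<theta>) / (2 * t)) has_real_derivative - heat t (?p \<theta>) * (?p \<theta> \<bullet> h) / (2 * t) / (2 * t)) (at \<theta>)"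
      using DERIV_cdivide[OF dh] .
    have d2: "(?p has_vector_derivative h) (at \<theta>)"
      by (auto intro!: derivative_eq_intros)
    show ?thesis
      unfolding kern_def
      by (rule has_vector_derivative_eq_rhs[OF has_vector_derivative_scaleR[OF d1 d2]])
        (use t in \<open>simp add: power2_eq_square\<close>)
  qed
  have I: "(?D has_integral kern t (?p 1) - kern t (?p 0)) {0..1}"
    by (rule fundamental_theorem_of_calculus) (auto intro!: has_vector_derivative_at_within der)
  have cont: "continuous_on {0..1} ?B"
    by (intro continuous_intros continuous_on_compose2[OF continuous_heat]) (use t in auto)
  then have Bi: "?B integrable_on {0..1}" by (rule integrable_continuous_interval)
  have "norm (kern t (?p 1) - kern t (?p 0)) = norm (integral {0..1} ?D)"
    using I by (simp add: integral_unique)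
  also have "... \<le> integral {0..1} ?B"
  proof (rule integral_norm_bound_integral)
    show "?D integrable_on {0..1}" using I by blast
    fix \<theta> :: real
    have "norm (?D \<theta>) \<le> heat t (?p \<theta>) / (2 * t) * norm h + heat t (?p \<theta>) * \<bar>?p \<theta> \<bullet> h\<bar> / (4 * t\<^sup>2) * norm (?p \<theta>)"
      using t by (intro order_trans[OF norm_triangle_ineq4]) (simp add: abs_mult)
    also have "... \<le> heat t (?p \<theta>) / (2 * t) * norm h + heat t (?p \<theta>) * (norm (?p \<theta>) * norm h) / (4 * t\<^sup>2) * norm (?p \<theta>)"
      using Cauchy_Schwarz_ineq2[of "?p \<theta>" h]
      by (intro add_left_mono mult_right_mono divide_right_mono mult_left_mono) auto
    also have "... = ?B \<theta>" by (simp add: algebra_simps power2_eq_square)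
    finally show "norm (?D \<theta>) \<le> ?B \<theta>" .
  qed (rule Bi)
  finally have "ennreal (norm (kern t (x + h) - kern t x)) \<le> ennreal (integral {0..1} ?B)"
    by (simp add: ennreal_leI)
  also have "... = (NN \<theta>. ennreal (indicator {0..1} \<theta> * ?B \<theta>))"
    using Bi by (intro nn_integral_has_integral_lebesgue[symmetric]) (use t in \<open>auto simp: has_integral_integral\<close>)
  finally show ?thesis by (simp add: ennreal_mult' ennreal_indicator)
qed

lemma nn_integral_kern_diff:
  fixes h :: "'a::euclidean_space"
  assumes t: "0 < t"
  shows "(NN x. ennreal (norm (kern t (x + h) - kern t x))) \<le> ennreal (real DIM('a) * norm h / t)"
proof -
  let ?b = "\<lambda>x::'a. heat t x * (1 / (2 * t) + (norm x)\<^sup>2 / (4 * t\<^sup>2))"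
  have b: "(NN x. ennreal (?b x)) \<le> ennreal (real DIM('a) / t)"
  proof -
    have "(NN x. ennreal (?b x)) = (NN x. ennreal (1 / (2 * t)) * ennreal (heat t x) + ennreal (1 / (4 * t\<^sup>2)) * ennreal (heat t x * (norm (x::'a))\<^sup>2))"
      by (intro nn_integral_cong) (use t in \<open>simp add: ennreal_mult'[symmetric] ennreal_plus[symmetric] distrib_left mult.commute del: ennreal_plus\<close>)
    also have "... = ennreal (1 / (2 * t)) + ennreal (1 / (4 * t\<^sup>2)) * ennreal (2 * real DIM('a) * t)"
      by (simp add: nn_integral_add nn_integral_cmult nn_integral_heat[OF t] nn_integral_heat_square[OF t])
    also have "... = ennreal (1 / (2 * t) + 1 / (4 * t\<^sup>2) * (2 * real DIM('a) * t))"
      using t by (simp add: ennreal_mult''[symmetric] ennreal_plus[symmetric] del: ennreal_plus)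
    also have "... \<le> ennreal (real DIM('a) / t)"
    proof (rule ennreal_leI)
      have D: "1 \<le> real DIM('a)" by (simp add: Suc_le_eq)
      have "1 / (2 * t) + 1 / (4 * t\<^sup>2) * (2 * real DIM('a) * t) = (1 + real DIM('a)) / (2 * t)"
        using t by (simp add: field_simps power2_eq_square)
      also have "... \<le> (2 * real DIM('a)) / (2 * t)" using D t by (intro divide_right_mono) auto
      finally show "1 / (2 * t) + 1 / (4 * t\<^sup>2) * (2 * real DIM('a) * t) \<le> real DIM('a) / t" using t by simp
    qed
    finally show ?thesis .
  qed
  have "(NN x. ennreal (norm (kern t (x + h) - kern t x)))
    \<le> (NN x. NN \<theta>. indicator {0..1} \<theta> * ennreal (norm h * ?b (x + \<theta> *\<^sub>R h)))"
    by (intro nn_integral_mono norm_kern_diff_le[OF t])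
  also have "... = (NN \<theta>. NN x. indicator {0..1} \<theta> * ennreal (norm h * ?b (x + \<theta> *\<^sub>R h)))"
    by (rule lborel_pair.Fubini'[symmetric]) measurable
  also have "... \<le> (NN \<theta>. indicator {0..1::real} \<theta> * ennreal (real DIM('a) * norm h / t))"
  proof (rule nn_integral_mono)
    fix \<theta> :: real
    have "(NN x. indicator {0..1} \<theta> * ennreal (norm h * ?b (x + \<theta> *\<^sub>R h)))
      = indicator {0..1} \<theta> * (ennreal (norm h) * (NN x. ennreal (?b (\<theta> *\<^sub>R h + x))))"
      by (simp add: nn_integral_cmult ennreal_mult' add.commute)
    also have "(NN x. ennreal (?b (\<theta> *\<^sub>R h + x))) = (NN x. ennreal (?b x))"
      by (rule nn_integral_shift) simp
    also have "indicator {0..1} \<theta> * (ennreal (norm h) * (NN x. ennreal (?b x)))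
       \<le> indicator {0..1} \<theta> * (ennreal (norm h) * ennreal (real DIM('a) / t))"
      by (intro mult_left_mono b) auto
    finally show "(NN x. indicator {0..1} \<theta> * ennreal (norm h * ?b (x + \<theta> *\<^sub>R h)))
       \<le> indicator {0..1::real} \<theta> * ennreal (real DIM('a) * norm h / t)"
      by (simp add: ennreal_mult'[symmetric] mult.commute)
  qed
  also have "... = ennreal (real DIM('a) * norm h / t)"
    by (simp add: nn_integral_multc)
  finally show ?thesis .
qed

section \<open>Interpolation of weighted integrals on the half-line\<close>

lemma integrableI_nn_le:
  fixes f :: "'a \<Rightarrow> 'b::{banach,second_countable_topology}"
  assumes "f \<in> borel_measurable M" "(\<integral>\<^sup>+x. ennreal (norm (f x)) \<partial>M) \<le> ennreal C"
  shows "integrable M f"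
  using assms by (intro integrableI_bounded) (auto intro: order_le_less_trans[OF _ ennreal_less_top])

text \<open>The power weight of the half-line, extended by 0. Fractional integrals become integrals
  over the whole line, so that shifts and convolutions need no change of domain.\<close>

definition pw :: "real \<Rightarrow> real \<Rightarrow> real" where
  "pw p t = (if 0 < t then t powr p else 0)"

lemma pw_measurable[measurable (raw)]:
  assumes [measurable]: "f \<in> borel_measurable M"
  shows "(\<lambda>x. pw p (f x)) \<in> borel_measurable M"
  unfolding pw_def by measurable

lemma pw_nonneg[simp]: "0 \<le> pw p t" by (simp add: pw_def)

lemma pw_nonpos: "t \<le> 0 \<Longrightarrow> pw p t = 0" by (simp add: pw_def)

lemma nn_integral_pw_head:
  assumes "-1 < p" "0 \<le> T"
  shows "(NN t. ennreal (pw p t) * indicator {..T} t) = ennreal (T powr (p + 1) / (p + 1))"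
proof -
  have "(NN t. ennreal (pw p t) * indicator {..T} t) = (NN t. ennreal (t powr p) * indicator {0..T} t)"
    by (intro nn_integral_cong) (auto simp: pw_def indicator_def)
  also have "... = ennreal (T powr (p + 1) / (p + 1))"
    by (rule nn_integral_has_integral_lebesgue') (use has_integral_powr_from_0[OF assms] in auto)
  finally show ?thesis .
qed

lemma nn_integral_pw_tail:
  assumes "p < -1" "0 < T"
  shows "(NN t. ennreal (pw p t) * indicator {T<..} t) = ennreal (- (T powr (p + 1)) / (p + 1))"
proof -
  have "(NN t. ennreal (pw p t) * indicator {T<..} t) = (NN t. ennreal (t powr p) * indicator {T..} t)"
    by (intro nn_integral_cong_AE eventually_mono[OF AE_lborel_singleton[of T]]) (use assms in \<open>auto simp: pw_def indicator_def\<close>)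
  also have "... = ennreal (- (T powr (p + 1)) / (p + 1))"
    by (rule nn_integral_has_integral_lebesgue') (use has_integral_powr_to_inf[OF assms] in auto)
  finally show ?thesis .
qed

text \<open>Expresses a difference of powers as an integral, so that the integration by parts in
  \<open>weighted_integral_bound\<close> can be done by Fubini. The case \<open>b = 0\<close> is
  included, with 0 on both sides.\<close>

lemma integral_pw_between:
  assumes "0 < T" "T \<le> t"
  shows "(LBINT u. (if T < u \<and> u < t then b * pw (- b - 1) u else 0)) = T powr (- b) - t powr (- b)"
proof -
  have "has_bochner_integral lborel (\<lambda>u. indicator {T..t} u *\<^sub>R (b * u powr (- b - 1))) (- (t powr (- b)) - - (T powr (- b)))"
  proof (rule has_bochner_integral_FTC_Icc)
    fix u :: real assume u: "T \<le> u" "u \<le> t"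
    then have "((\<lambda>u. - (u powr (- b))) has_real_derivative b * u powr (- b - 1)) (at u)"
      using assms by (auto intro!: derivative_eq_intros)
    then show "((\<lambda>u. - (u powr (- b))) has_vector_derivative b * u powr (- b - 1)) (at u within {T..t})"
      by (simp add: has_real_derivative_iff_has_vector_derivative has_vector_derivative_at_within)
  qed (use assms in \<open>auto intro!: continuous_intros\<close>)
  then have "(LBINT u. indicator {T..t} u *\<^sub>R (b * u powr (- b - 1))) = T powr (- b) - t powr (- b)"
    by (simp add: has_bochner_integral_integral_eq)
  also have "(LBINT u. indicator {T..t} u *\<^sub>R (b * u powr (- b - 1))) = (LBINT u. (if T < u \<and> u < t then b * pw (- b - 1) u else 0))"
  proof (rule integral_cong_AE)
    show "AE u in lborel. indicator {T..t} u *\<^sub>R (b * u powr (- b - 1)) = (if T < u \<and> u < t then b * pw (- b - 1) u else 0)"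
      using AE_lborel_singleton[of T] AE_lborel_singleton[of t]
      by eventually_elim (use assms in \<open>auto simp: pw_def indicator_def\<close>)
  qed measurable
  finally show ?thesis .
qed

text \<open>Mean value theorem: the intermediate point exceeds \<open>t / 2\<close>, which costs
  \<open>2 powr (2 - a) \<le> 4\<close>.\<close>

lemma powr_diff_le:
  fixes t u a :: real
  assumes a: "0 < a" "a < 1" and u: "0 < u" and t: "2 * u < t"
  shows "(t - u) powr (a - 1) - t powr (a - 1) \<le> 4 * u * t powr (a - 2)"
proof -
  have "\<exists>z. t - u < z \<and> z < t \<and> t powr (a - 1) - (t - u) powr (a - 1) = (t - (t - u)) * ((a - 1) * z powr (a - 1 - 1))"
  proof (rule MVT2)
    fix x assume "t - u \<le> x" "x \<le> t"
    then show "((\<lambda>x. x powr (a - 1)) has_real_derivative (a - 1) * x powr (a - 1 - 1)) (at x)"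
      using u t by (auto intro!: derivative_eq_intros)
  qed (use u in simp)
  then obtain z where z: "t - u < z" "z < t" "t powr (a - 1) - (t - u) powr (a - 1) = u * ((a - 1) * z powr (a - 2))"
    by (auto simp: algebra_simps)
  have "z powr (a - 2) \<le> (t / 2) powr (a - 2)"
    using z u t a by (intro powr_mono2') auto
  also have "... = 2 powr (2 - a) * t powr (a - 2)"
    using u t by (simp add: powr_divide powr_minus_divide[of 2 "2 - a", simplified] field_simps)
  also have "... \<le> 2 powr 2 * t powr (a - 2)"
    using a by (intro mult_right_mono powr_mono) auto
  finally have zz: "z powr (a - 2) \<le> 4 * t powr (a - 2)" by simp
  have "(t - u) powr (a - 1) - t powr (a - 1) = u * ((1 - a) * z powr (a - 2))"
    using z(3) by (simp add: algebra_simps)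
  also have "... \<le> u * (1 * (4 * t powr (a - 2)))"
    using u a zz by (intro mult_left_mono mult_mono) auto
  finally show ?thesis by simp
qed

text \<open>
  The tail \<open>Y u\<close> differs from the Riemann--Liouville integral at \<open>u\<close>, which is bounded by
  assumption, by an integral that scales like a constant.
\<close>

lemma tail_bound:
  fixes h :: "real \<Rightarrow> real"
  assumes a: "0 < a" "a < 1" and [measurable]: "h \<in> borel_measurable borel"
    and M0: "0 \<le> M0" and hD: "\<And>t. 0 < t \<Longrightarrow> \<bar>h t\<bar> \<le> M0 * t powr (- a)"
    and int: "integrable lborel (\<lambda>t. pw (a - 1) t * h t)"
    and H0: "\<And>s. 0 < s \<Longrightarrow> \<bar>LBINT t. pw (a - 1) t * h (t + s)\<bar> \<le> M0"
    and u: "0 < u"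
  shows "\<bar>LBINT t. indicator {u<..} t * (pw (a - 1) t * h t)\<bar> \<le> (1 / a + 3) * M0"
proof -
  let ?\<Delta> = "\<lambda>t. indicator {u<..} t * (pw (a - 1) t * h t) - pw (a - 1) (t - u) * h t"
  \<comment> \<open>For \<open>u < t \<le> 2 * u\<close> the weight
    \<open>(t - u) powr (a - 1)\<close> dominates; beyond \<open>2 * u\<close> the two weights
    nearly cancel and leave the decay \<open>u / t\<^sup>2\<close>. Together with \<open>hD\<close>
    these ranges give the summands 1 / a and 2 of the constant, and \<open>H0\<close> gives the
    remaining 1.\<close>
  have pt: "norm (?\<Delta> t) \<le> M0 * (u powr (- a) * (pw (a - 1) (t - u) * indicator {..u} (t - u)) + 4 * u * (pw (- 2) t * indicator {2 * u<..} t))" for t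
  proof (cases "u < t")
    case True
    have p0: "t powr (a - 1) \<le> (t - u) powr (a - 1)"
      using a u True by (intro powr_mono2') auto
    have "\<bar>?\<Delta> t\<bar> = ((t - u) powr (a - 1) - t powr (a - 1)) * \<bar>h t\<bar>"
    proof -
      have "?\<Delta> t = - (((t - u) powr (a - 1) - t powr (a - 1)) * h t)"
        using True u by (simp add: pw_def algebra_simps)
      then show ?thesis using p0 by (simp add: abs_mult)
    qed
    also have "... \<le> ((t - u) powr (a - 1) - t powr (a - 1)) * (M0 * t powr (- a))"
      using p0 hD[of t] True u by (intro mult_left_mono) auto
    also have "... \<le> M0 * (u powr (- a) * (pw (a - 1) (t - u) * indicator {..u} (t - u)) + 4 * u * (pw (- 2) t * indicator {2 * u<..} t))"
    proof (cases "t \<le> 2 * u")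
      case le: True
      have "t powr (- a) \<le> u powr (- a)" using a u True by (intro powr_mono2') auto
      then have "((t - u) powr (a - 1) - t powr (a - 1)) * (M0 * t powr (- a)) \<le> (t - u) powr (a - 1) * (M0 * u powr (- a))"
        using p0 M0 by (intro mult_mono) auto
      then show ?thesis using le True by (simp add: pw_def mult_ac)
    next
      case False
      have "((t - u) powr (a - 1) - t powr (a - 1)) * (M0 * t powr (- a)) \<le> (4 * u * t powr (a - 2)) * (M0 * t powr (- a))"
        using powr_diff_le[OF a u, of t] False M0 by (intro mult_right_mono) auto
      also have "... = M0 * (4 * u * (t powr (a - 2) * t powr (- a)))" by simp
      also have "t powr (a - 2) * t powr (- a) = t powr (- 2)" by (simp flip: powr_add)
      finally show ?thesis using False True u by (simp add: pw_def)
    qed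
    finally show ?thesis by simp
  next
    case False
    then show ?thesis using M0 u by (auto simp: pw_def indicator_def)
  qed
  have nn: "(NN t. ennreal (norm (?\<Delta> t))) \<le> ennreal ((1 / a + 2) * M0)"
  proof -
    have "(NN t. ennreal (norm (?\<Delta> t)))
      \<le> (NN t. ennreal M0 * (ennreal (u powr (- a)) * (ennreal (pw (a - 1) (- u + t)) * indicator {..u} (- u + t)) + ennreal (4 * u) * (ennreal (pw (- 2) t) * indicator {2 * u<..} t)))"
    proof (rule nn_integral_mono)
      fix t :: real
      have "ennreal (norm (?\<Delta> t)) \<le> ennreal (M0 * (u powr (- a) * (pw (a - 1) (t - u) * indicator {..u} (t - u)) + 4 * u * (pw (- 2) t * indicator {2 * u<..} t)))"
        using pt by (rule ennreal_leI)
      also have "... = ennreal M0 * (ennreal (u powr (- a)) * (ennreal (pw (a - 1) (- u + t)) * indicator {..u} (- u + t)) + ennreal (4 * u) * (ennreal (pw (- 2) t) * indicator {2 * u<..} t))"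
        using M0 u by (simp add: ennreal_mult ennreal_plus ennreal_indicator)
      finally show "ennreal (norm (?\<Delta> t)) \<le> ..." .
    qed
    also have "... = ennreal M0 * (ennreal (u powr (- a)) * (NN t. ennreal (pw (a - 1) (- u + t)) * indicator {..u} (- u + t))
        + ennreal (4 * u) * (NN t. ennreal (pw (- 2) t) * indicator {2 * u<..} t))"
      by (simp add: nn_integral_cmult nn_integral_add)
    also have "(NN t. ennreal (pw (a - 1) (- u + t)) * indicator {..u} (- u + t)) = (NN t. ennreal (pw (a - 1) t) * indicator {..u} t)"
      by (rule nn_integral_shift) simp
    also have "... = ennreal (u powr a / a)" using nn_integral_pw_head[of "a - 1" u] a u by simp
    also have "(NN t. ennreal (pw (- 2) t) * indicator {2 * u<..} t) = ennreal (1 / (2 * u))"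
      using nn_integral_pw_tail[of "- 2" "2 * u"] u by (simp add: powr_minus_divide)
    also have "ennreal M0 * (ennreal (u powr (- a)) * ennreal (u powr a / a) + ennreal (4 * u) * ennreal (1 / (2 * u)))
      = ennreal (M0 * (u powr (- a) * (u powr a / a) + 4 * u * (1 / (2 * u))))"
    proof -
      have nn: "0 \<le> u powr (- a)" "0 \<le> u powr a / a" "0 \<le> 4 * u" "0 \<le> 1 / (2 * u)" "0 \<le> u powr (- a) * (u powr a / a)" "0 \<le> 4 * u * (1 / (2 * u))"
        "0 \<le> u powr (- a) * (u powr a / a) + 4 * u * (1 / (2 * u))"
        using u a by auto
      show ?thesis
        by (simp only: ennreal_mult[OF M0 nn(7)] ennreal_plus[OF nn(5,6)] ennreal_mult[OF nn(1,2)] ennreal_mult[OF nn(3,4)])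
    qed
    also have "u powr (- a) * (u powr a / a) + 4 * u * (1 / (2 * u)) = 1 / a + 2"
      using u by (simp add: powr_minus_divide)
    finally show ?thesis by (simp add: mult.commute)
  qed
  have i1: "integrable lborel (\<lambda>t. indicator {u<..} t * (pw (a - 1) t * h t))"
    by (rule Bochner_Integration.integrable_bound[OF int]) (auto simp: indicator_def)
  have i2: "integrable lborel ?\<Delta>"
    by (rule integrableI_nn_le[OF _ nn]) simp
  have i3: "integrable lborel (\<lambda>t. pw (a - 1) (t - u) * h t)"
    using Bochner_Integration.integrable_diff[OF i1 i2] by simp
  have "(LBINT t. ?\<Delta> t) = (LBINT t. indicator {u<..} t * (pw (a - 1) t * h t)) - (LBINT t. pw (a - 1) (t - u) * h t)"
    by (rule Bochner_Integration.integral_diff[OF i1 i3])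
  moreover have "(LBINT t. pw (a - 1) (t - u) * h t) = (LBINT t. pw (a - 1) t * h (t + u))"
    using integral_shift[of "\<lambda>t. pw (a - 1) (t - u) * h t" u] by (simp add: add.commute)
  moreover have "\<bar>LBINT t. ?\<Delta> t\<bar> \<le> (1 / a + 2) * M0"
    using norm_integral_le_nn[OF nn] a M0 by simp
  ultimately show ?thesis using H0[OF u] by (simp add: algebra_simps)
qed

text \<open>The head up to \<open>T\<close> is estimated by \<open>hM\<close>. On the tail the
  pointwise bound \<open>hD\<close> would give \<open>T powr (- b) / b\<close>, which is useless as
  \<open>b\<close> tends to 0; instead the decreasing weight \<open>t powr (- b)\<close> is
  integrated by parts against the tails of \<open>pw (a - 1) t * h t\<close>, which
  \<open>tail_bound\<close> controls with all cancellation kept. Boundary term and integral cost one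
  copy of that bound each, hence the factor 2.\<close>

lemma weighted_integral_bound:
  fixes h :: "real \<Rightarrow> real"
  assumes a: "0 < a" "a < 1" and b: "0 \<le> b" "b < a" and [measurable]: "h \<in> borel_measurable borel"
    and M0: "0 \<le> M0" and Ma: "0 \<le> Ma" and hM: "\<And>t. 0 < t \<Longrightarrow> \<bar>h t\<bar> \<le> Ma"
    and hD: "\<And>t. 0 < t \<Longrightarrow> \<bar>h t\<bar> \<le> M0 * t powr (- a)"
    and int: "integrable lborel (\<lambda>t. pw (a - 1) t * h t)"
    and H0: "\<And>s. 0 < s \<Longrightarrow> \<bar>LBINT t. pw (a - 1) t * h (t + s)\<bar> \<le> M0"
    and T: "0 < T"
  shows "\<bar>LBINT t. pw (a - b - 1) t * h t\<bar> \<le> Ma * T powr (a - b) / (a - b) + 2 * (1 / a + 3) * M0 * T powr (- b)"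
proof -
  define y where "y = (\<lambda>t. pw (a - 1) t * h t)"
  have ym[measurable]: "y \<in> borel_measurable borel" unfolding y_def by measurable
  have yint: "integrable lborel y" using int by (simp add: y_def)
  define B where "B = (1 / a + 3) * M0"
  have B0: "0 \<le> B" using a M0 by (simp add: B_def)
  define Y where "Y = (\<lambda>u. LBINT t. indicator {u<..} t * y t)"
  have YB: "\<bar>Y u\<bar> \<le> B" if "0 < u" for u
    unfolding Y_def y_def B_def by (rule tail_bound[OF a _ M0 hD int H0 that]) auto
  let ?hd = "\<lambda>t. indicator {..T} t * (pw (a - b - 1) t * h t)"
  let ?tl = "\<lambda>t. indicator {T<..} t * (pw (- b) t * y t)"
  have split: "pw (a - b - 1) t * h t = ?hd t + ?tl t" for t
  proof (cases "t \<le> T")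
    case False
    then have "t powr (a - b - 1) = t powr (- b) * t powr (a - 1)"
      using T by (simp flip: powr_add add: algebra_simps)
    then show ?thesis using False T by (simp add: pw_def y_def)
  qed simp
  have nh: "(NN t. ennreal (norm (?hd t))) \<le> ennreal (Ma * T powr (a - b) / (a - b))"
  proof -
    have "(NN t. ennreal (norm (?hd t))) \<le> (NN t. ennreal Ma * (ennreal (pw (a - b - 1) t) * indicator {..T} t))"
    proof (rule nn_integral_mono)
      fix t :: real
      have "norm (?hd t) \<le> Ma * (pw (a - b - 1) t * indicator {..T} t)"
        using hM[of t] by (auto simp: indicator_def pw_def abs_mult mult.commute intro: mult_right_mono)
      then show "ennreal (norm (?hd t)) \<le> ennreal Ma * (ennreal (pw (a - b - 1) t) * indicator {..T} t)"
        using Ma by (metis ennreal_indicator ennreal_leI ennreal_mult indicator_pos_le mult_nonneg_nonneg pw_nonneg)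
    qed
    also have "... = ennreal (Ma * T powr (a - b) / (a - b))"
      using nn_integral_pw_head[of "a - b - 1" T] a b T Ma by (simp add: nn_integral_cmult ennreal_mult'[symmetric])
    finally show ?thesis .
  qed
  have ih: "integrable lborel ?hd"
    by (rule integrableI_nn_le[OF _ nh]) simp
  have bh: "\<bar>LBINT t. ?hd t\<bar> \<le> Ma * T powr (a - b) / (a - b)"
    using norm_integral_le_nn[OF nh] a b Ma by simp
  have iT: "integrable lborel (\<lambda>t. indicator {T<..} t * y t)"
    by (rule Bochner_Integration.integrable_bound[OF yint]) (auto simp: indicator_def)
  have it: "integrable lborel ?tl"
  proof (rule Bochner_Integration.integrable_bound[OF integrable_mult_right[OF yint, of "T powr (- b)"]])
    have "norm (?tl t) \<le> norm (T powr (- b) * y t)" for t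
    proof (cases "T < t")
      case True
      then have "t powr (- b) \<le> T powr (- b)" using b T by (intro powr_mono2') auto
      then show ?thesis using True T by (simp add: pw_def abs_mult mult_right_mono)
    qed simp
    then show "AE t in lborel. norm (?tl t) \<le> norm (T powr (- b) * y t)" by simp
  qed simp
  \<comment> \<open>Exchanging the integrals of this kernel is the integration by parts: on the tail
    \<open>t powr (- b)\<close> is \<open>T powr (- b)\<close> minus an integral over
    \<open>T < u < t\<close>, and the other order produces the tails \<open>Y u\<close>.\<close>
  let ?F = "\<lambda>t u. y t * (if T < u \<and> u < t then b * pw (- b - 1) u else 0)"
  have nnw: "(NN u. ennreal (if T < u then b * pw (- b - 1) u else 0)) \<le> ennreal (T powr (- b))"
  proof (cases "b = 0")
    case False
    then have b0: "0 < b" using b by simp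
    have "(NN u. ennreal (if T < u then b * pw (- b - 1) u else 0)) = (NN u. ennreal b * (ennreal (pw (- b - 1) u) * indicator {T<..} u))"
      by (intro nn_integral_cong) (use b0 in \<open>auto simp: ennreal_mult\<close>)
    also have "... = ennreal (T powr (- b))"
      using nn_integral_pw_tail[of "- b - 1" T] b0 T by (simp add: nn_integral_cmult ennreal_mult'[symmetric])
    finally show ?thesis by simp
  next
    case True
    then have "(if T < u then b * pw (- b - 1) u else 0) = 0" for u by simp
    then show ?thesis by simp
  qed
  have Ffin: "(NN t. NN u. ennreal (norm (?F t u))) < \<infinity>"
  proof -
    have "(NN t. NN u. ennreal (norm (?F t u))) \<le> (NN t. ennreal (norm (y t)) * ennreal (T powr (- b)))"
    proof (rule nn_integral_mono)
      fix t :: real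
      have "(NN u. ennreal (norm (?F t u))) \<le> (NN u. ennreal (norm (y t)) * ennreal (if T < u then b * pw (- b - 1) u else 0))"
        using b by (intro nn_integral_mono) (auto simp: abs_mult ennreal_mult)
      also have "... \<le> ennreal (norm (y t)) * ennreal (T powr (- b))"
        by (simp add: nn_integral_cmult nnw mult_left_mono)
      finally show "(NN u. ennreal (norm (?F t u))) \<le> ennreal (norm (y t)) * ennreal (T powr (- b))" .
    qed
    also have "... = (NN t. ennreal (norm (y t))) * ennreal (T powr (- b))"
      by (rule nn_integral_multc) simp
    also have "... < \<infinity>"
      using yint by (simp add: integrable_iff_bounded ennreal_mult_less_top)
    finally show ?thesis .
  qed
  have Fm: "(\<lambda>(t, u). ?F t u) \<in> borel_measurable (lborel \<Otimes>\<^sub>M lborel)" by measurable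
  have tl: "(LBINT t. ?tl t) = T powr (- b) * Y T - (LBINT u. (if T < u then b * pw (- b - 1) u else 0) * Y u)"
  proof -
    have "?tl t = T powr (- b) * (indicator {T<..} t * y t) - (LBINT u. ?F t u)" for t
    proof (cases "T < t")
      case True
      have "(LBINT u. ?F t u) = y t * (T powr (- b) - t powr (- b))"
        using integral_pw_between[of T t b] T True by simp
      then show ?thesis using True T by (simp add: pw_def algebra_simps)
    next
      case False
      then have "(\<lambda>u. ?F t u) = (\<lambda>u. 0)" by (auto simp: fun_eq_iff)
      then show ?thesis using False by simp
    qed
    then have "(LBINT t. ?tl t) = (LBINT t. T powr (- b) * (indicator {T<..} t * y t) - (LBINT u. ?F t u))"
      by presburger
    also have "... = (LBINT t. T powr (- b) * (indicator {T<..} t * y t)) - (LBINT t. LBINT u. ?F t u)"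
      by (rule Bochner_Integration.integral_diff[OF integrable_mult_right[OF iT] Fubini_lborel(2)[OF Fm Ffin]])
    also have "(LBINT t. T powr (- b) * (indicator {T<..} t * y t)) = T powr (- b) * Y T"
      by (simp add: Y_def)
    also have "(LBINT t. LBINT u. ?F t u) = (LBINT u. LBINT t. ?F t u)"
      by (rule Fubini_lborel(1)[OF Fm Ffin])
    also have "... = (LBINT u. (if T < u then b * pw (- b - 1) u else 0) * Y u)"
    proof (rule Bochner_Integration.integral_cong[OF refl])
      fix u :: real
      have "(\<lambda>t. ?F t u) = (\<lambda>t. (if T < u then b * pw (- b - 1) u else 0) * (indicator {u<..} t * y t))"
        by (auto simp: fun_eq_iff indicator_def)
      then show "(LBINT t. ?F t u) = (if T < u then b * pw (- b - 1) u else 0) * Y u"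
        by (simp add: Y_def)
    qed
    finally show ?thesis .
  qed
  have "\<bar>LBINT u. (if T < u then b * pw (- b - 1) u else 0) * Y u\<bar> \<le> T powr (- b) * B"
  proof -
    have "(NN u. ennreal (norm ((if T < u then b * pw (- b - 1) u else 0) * Y u)))
      \<le> (NN u. ennreal (if T < u then b * pw (- b - 1) u else 0) * ennreal B)"
    proof (rule nn_integral_mono)
      fix u :: real
      have "norm ((if T < u then b * pw (- b - 1) u else 0) * Y u) \<le> (if T < u then b * pw (- b - 1) u else 0) * B"
        using YB[of u] T b by (auto simp: abs_mult intro!: mult_left_mono)
      then show "ennreal (norm ((if T < u then b * pw (- b - 1) u else 0) * Y u)) \<le> ennreal (if T < u then b * pw (- b - 1) u else 0) * ennreal B"
        using B0 b by (metis ennreal_leI ennreal_mult'' )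
    qed
    also have "... \<le> ennreal (T powr (- b)) * ennreal B"
      by (simp add: nn_integral_multc nnw mult_right_mono)
    also have "... = ennreal (T powr (- b) * B)" using B0 by (simp add: ennreal_mult)
    finally show ?thesis using norm_integral_le_nn[of lborel "\<lambda>u. (if T < u then b * pw (- b - 1) u else 0) * Y u" "T powr (- b) * B"] B0 by simp
  qed
  moreover have "\<bar>T powr (- b) * Y T\<bar> \<le> T powr (- b) * B"
    using YB[OF T] by (simp add: abs_mult mult_left_mono)
  ultimately have bt: "\<bar>LBINT t. ?tl t\<bar> \<le> 2 * B * T powr (- b)"
    unfolding tl by (simp add: algebra_simps abs_le_iff)
  have "(LBINT t. pw (a - b - 1) t * h t) = (LBINT t. ?hd t) + (LBINT t. ?tl t)"
    using Bochner_Integration.integral_add[OF ih it] by (simp only: split[symmetric])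
  moreover have "2 * B * T powr (- b) = 2 * (1 / a + 3) * M0 * T powr (- b)"
    by (simp only: B_def mult.assoc)
  ultimately show ?thesis using bh bt by linarith
qed

section \<open>Beta integrals and the composition of fractional integrals\<close>

lemma nn_integral_Beta:
  assumes "0 < x" "0 < y"
  shows "(NN u. ennreal (pw (x - 1) u * pw (y - 1) (1 - u))) = ennreal (Beta x y)"
proof -
  have "(NN u. ennreal (pw (x - 1) u * pw (y - 1) (1 - u)))
    = (NN u. ennreal (u powr (x - 1) * (1 - u) powr (y - 1)) * indicator {0..1} u)"
    by (intro nn_integral_cong) (auto simp: pw_def indicator_def)
  also have "... = ennreal (Beta x y)"
    by (rule nn_integral_has_integral_lebesgue') (use has_integral_Beta_real[OF assms] in auto)
  finally show ?thesis .
qed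

lemma Beta_real_pos: "0 < x \<Longrightarrow> 0 < y \<Longrightarrow> 0 < Beta x (y::real)"
  by (simp add: Beta_def)

text \<open>For \<open>y \<le> 1\<close> the factor \<open>(1 - u) powr (y - 1)\<close> is at least
  1. This keeps the pole of the Beta function at \<open>x = 0\<close>, which later compensates the
  singular factor \<open>1 / (a - b)\<close>.\<close>

lemma Beta_ge_inverse:
  fixes x y :: real
  assumes "0 < x" "0 < y" "y \<le> 1"
  shows "1 / x \<le> Beta x y"
proof -
  have "ennreal (1 / x) = (NN u. ennreal (pw (x - 1) u) * indicator {..1} u)"
    using nn_integral_pw_head[of "x - 1" 1] assms by simp
  also have "... \<le> (NN u. ennreal (pw (x - 1) u * pw (y - 1) (1 - u)))"
  proof (rule nn_integral_mono_AE, rule eventually_mono[OF AE_lborel_singleton[of 1]])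
    fix u :: real assume "u \<noteq> 1"
    moreover have "1 \<le> (1 - u) powr (y - 1)" if "0 < u" "u < 1"
      using powr_mono2'[of "y - 1" "1 - u" 1] that assms by simp
    ultimately show "ennreal (pw (x - 1) u) * indicator {..1} u \<le> ennreal (pw (x - 1) u * pw (y - 1) (1 - u))"
      by (auto simp: indicator_def pw_def intro!: ennreal_leI)
  qed
  also have "... = ennreal (Beta x y)" by (rule nn_integral_Beta[OF assms(1,2)])
  finally show ?thesis
    using Beta_real_pos[of x y] assms by (simp add: ennreal_le_iff2)
qed

lemma nn_integral_pw_conv:
  assumes "0 < x" "0 < y"
  shows "(NN s. ennreal (pw (x - 1) s * pw (y - 1) (\<sigma> - s))) = ennreal (Beta x y * pw (x + y - 1) \<sigma>)"
proof (cases "0 < \<sigma>")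
  case True
  have "(NN s. ennreal (pw (x - 1) s * pw (y - 1) (\<sigma> - s)))
    = ennreal \<sigma> * (NN u. ennreal (pw (x - 1) (\<sigma> * u) * pw (y - 1) (\<sigma> - \<sigma> * u)))"
    using nn_integral_real_affine[of "\<lambda>s. ennreal (pw (x - 1) s * pw (y - 1) (\<sigma> - s))" \<sigma> 0] True by simp
  also have "(NN u. ennreal (pw (x - 1) (\<sigma> * u) * pw (y - 1) (\<sigma> - \<sigma> * u)))
    = (NN u. ennreal (\<sigma> powr (x - 1) * \<sigma> powr (y - 1)) * ennreal (pw (x - 1) u * pw (y - 1) (1 - u)))"
  proof (rule nn_integral_cong)
    fix u :: real
    have e: "\<sigma> - \<sigma> * u = \<sigma> * (1 - u)" by (simp add: algebra_simps)
    have "pw (x - 1) (\<sigma> * u) * pw (y - 1) (\<sigma> - \<sigma> * u) = (\<sigma> powr (x - 1) * \<sigma> powr (y - 1)) * (pw (x - 1) u * pw (y - 1) (1 - u))"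
      unfolding e using True by (auto simp: pw_def zero_less_mult_iff powr_mult)
    then show "ennreal (pw (x - 1) (\<sigma> * u) * pw (y - 1) (\<sigma> - \<sigma> * u)) = ennreal (\<sigma> powr (x - 1) * \<sigma> powr (y - 1)) * ennreal (pw (x - 1) u * pw (y - 1) (1 - u))"
      by (simp add: ennreal_mult)
  qed
  also have "... = ennreal (\<sigma> powr (x - 1) * \<sigma> powr (y - 1)) * ennreal (Beta x y)"
    by (subst nn_integral_cmult) (simp_all add: nn_integral_Beta[OF assms])
  also have "ennreal \<sigma> * ... = ennreal (\<sigma> * (\<sigma> powr (x - 1) * \<sigma> powr (y - 1)) * Beta x y)"
    using True Beta_real_pos[OF assms] by (simp add: ennreal_mult mult.assoc)
  also have "\<sigma> * (\<sigma> powr (x - 1) * \<sigma> powr (y - 1)) = \<sigma> powr (x + y - 1)"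
  proof -
    have "\<sigma> * (\<sigma> powr (x - 1) * \<sigma> powr (y - 1)) = \<sigma> powr 1 * \<sigma> powr (x - 1 + (y - 1))"
      using True by (simp only: powr_add powr_one)
    also have "... = \<sigma> powr (x + y - 1)" unfolding powr_add[symmetric] by (simp add: algebra_simps)
    finally show ?thesis .
  qed
  finally show ?thesis using True by (simp add: pw_def mult.commute)
next
  case False
  then have z: "pw (x - 1) s * pw (y - 1) (\<sigma> - s) = 0" for s by (auto simp: pw_def)
  show ?thesis unfolding z using False by (simp add: pw_nonpos)
qed

text \<open>Semigroup law of fractional integrals over the half-line, evaluated at 0; the Beta
  factor appears because the Gamma normalisation is left out. Absolute convergence of the composite
  integral justifies Fubini.\<close>

lemma Riemann_Liouville_compose:
  fixes g :: "real \<Rightarrow> real"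
  assumes xy: "0 < x" "0 < y" and [measurable]: "g \<in> borel_measurable borel"
    and int: "integrable lborel (\<lambda>\<sigma>. pw (x + y - 1) \<sigma> * g \<sigma>)"
  shows "integrable lborel (\<lambda>s. pw (x - 1) s * (LBINT t. pw (y - 1) t * g (t + s)))"
    and "(LBINT s. pw (x - 1) s * (LBINT t. pw (y - 1) t * g (t + s))) = Beta x y * (LBINT \<sigma>. pw (x + y - 1) \<sigma> * g \<sigma>)"
proof -
  let ?F = "\<lambda>s \<sigma>. pw (x - 1) s * pw (y - 1) (\<sigma> - s) * g \<sigma>"
  have Fm: "(\<lambda>(s, \<sigma>). ?F s \<sigma>) \<in> borel_measurable (lborel \<Otimes>\<^sub>M lborel)" by measurable
  have nn: "(NN s. ennreal (norm (?F s \<sigma>))) = ennreal (Beta x y) * ennreal (norm (pw (x + y - 1) \<sigma> * g \<sigma>))" for \<sigma>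
  proof -
    have "(NN s. ennreal (norm (?F s \<sigma>))) = (NN s. ennreal (pw (x - 1) s * pw (y - 1) (\<sigma> - s)) * ennreal \<bar>g \<sigma>\<bar>)"
      by (simp add: abs_mult ennreal_mult)
    also have "... = ennreal (Beta x y * pw (x + y - 1) \<sigma>) * ennreal \<bar>g \<sigma>\<bar>"
      by (simp add: nn_integral_multc nn_integral_pw_conv[OF xy])
    finally show ?thesis using Beta_real_pos[OF xy] by (simp add: abs_mult ennreal_mult mult.assoc)
  qed
  have fin: "(NN s. NN \<sigma>. ennreal (norm (?F s \<sigma>))) < \<infinity>"
  proof -
    have "(NN s. NN \<sigma>. ennreal (norm (?F s \<sigma>))) = (NN \<sigma>. NN s. ennreal (norm (?F s \<sigma>)))"
      by (rule lborel_pair.Fubini'[symmetric]) measurable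
    also have "... = ennreal (Beta x y) * (NN \<sigma>. ennreal (norm (pw (x + y - 1) \<sigma> * g \<sigma>)))"
      unfolding nn by (rule nn_integral_cmult) simp
    also have "... < \<infinity>" using int by (simp add: integrable_iff_bounded ennreal_mult_less_top)
    finally show ?thesis .
  qed
  have in1: "(LBINT \<sigma>. ?F s \<sigma>) = pw (x - 1) s * (LBINT t. pw (y - 1) t * g (t + s))" for s
  proof -
    have "(LBINT \<sigma>. ?F s \<sigma>) = pw (x - 1) s * (LBINT \<sigma>. pw (y - 1) (\<sigma> - s) * g \<sigma>)"
      by (simp add: mult.assoc)
    also have "(LBINT \<sigma>. pw (y - 1) (\<sigma> - s) * g \<sigma>) = (LBINT t. pw (y - 1) t * g (t + s))"
      using integral_shift[of "\<lambda>t. pw (y - 1) (t - s) * g t" s] by (simp add: add.commute)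
    finally show ?thesis .
  qed
  have in2: "(LBINT s. ?F s \<sigma>) = Beta x y * (pw (x + y - 1) \<sigma> * g \<sigma>)" for \<sigma>
  proof -
    have "(LBINT s. pw (x - 1) s * pw (y - 1) (\<sigma> - s)) = Beta x y * pw (x + y - 1) \<sigma>"
      using nn_integral_pw_conv[OF xy] Beta_real_pos[OF xy]
      by (subst integral_eq_nn_integral) auto
    then show ?thesis unfolding integral_mult_left_zero by (simp only: mult.assoc)
  qed
  show "integrable lborel (\<lambda>s. pw (x - 1) s * (LBINT t. pw (y - 1) t * g (t + s)))"
    using Fubini_lborel(2)[OF Fm fin] by (simp add: in1)
  show "(LBINT s. pw (x - 1) s * (LBINT t. pw (y - 1) t * g (t + s))) = Beta x y * (LBINT \<sigma>. pw (x + y - 1) \<sigma> * g \<sigma>)"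
    using Fubini_lborel(1)[OF Fm fin] unfolding in1 in2 by simp
qed

lemma integrable_pw_decay:
  fixes g :: "real \<Rightarrow> real"
  assumes [measurable]: "g \<in> borel_measurable borel" and p: "-1 < p" "p < 0" and s: "0 \<le> s" and D: "0 \<le> D"
    and g: "\<And>t. 0 < t \<Longrightarrow> \<bar>g t\<bar> \<le> D" "\<And>t. 0 < t \<Longrightarrow> \<bar>g t\<bar> \<le> D / t"
  shows "integrable lborel (\<lambda>\<sigma>. pw p \<sigma> * g (\<sigma> + s))"
proof (rule integrableI_nn_le)
  have "(NN \<sigma>. ennreal (norm (pw p \<sigma> * g (\<sigma> + s))))
    \<le> (NN \<sigma>. ennreal D * (ennreal (pw p \<sigma>) * indicator {..1} \<sigma> + ennreal (pw (p - 1) \<sigma>) * indicator {1<..} \<sigma>))"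
  proof (rule nn_integral_mono)
    fix \<sigma> :: real
    have "norm (pw p \<sigma> * g (\<sigma> + s)) \<le> D * (pw p \<sigma> * indicator {..1} \<sigma> + pw (p - 1) \<sigma> * indicator {1<..} \<sigma>)"
    proof (cases "0 < \<sigma>")
      case pos: True
      show ?thesis
      proof (cases "\<sigma> \<le> 1")
        case True
        then show ?thesis using pos mult_left_mono[OF g(1)[of "\<sigma> + s"], of "pw p \<sigma>"] s by (simp add: abs_mult mult.commute)
      next
        case False
        have "\<bar>g (\<sigma> + s)\<bar> \<le> D / (\<sigma> + s)" using g(2)[of "\<sigma> + s"] pos s by simp
        also have "... \<le> D / \<sigma>" using pos s D by (intro divide_left_mono) auto
        finally have "pw p \<sigma> * \<bar>g (\<sigma> + s)\<bar> \<le> pw p \<sigma> * (D / \<sigma>)" by (rule mult_left_mono) simp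
        also have "... = D * pw (p - 1) \<sigma>" using pos by (simp add: pw_def powr_diff)
        finally show ?thesis using False by (simp add: abs_mult)
      qed
    qed (simp add: pw_def)
    then have "ennreal (norm (pw p \<sigma> * g (\<sigma> + s))) \<le> ennreal (D * (pw p \<sigma> * indicator {..1} \<sigma> + pw (p - 1) \<sigma> * indicator {1<..} \<sigma>))"
      by (rule ennreal_leI)
    also have "... = ennreal D * (ennreal (pw p \<sigma>) * indicator {..1} \<sigma> + ennreal (pw (p - 1) \<sigma>) * indicator {1<..} \<sigma>)"
      using D by (simp add: ennreal_mult ennreal_plus ennreal_indicator)
    finally show "ennreal (norm (pw p \<sigma> * g (\<sigma> + s))) \<le> ..." .
  qed
  also have "... = ennreal D * (ennreal (1 / (p + 1)) + ennreal (- 1 / p))"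
    using p nn_integral_pw_head[of p 1] nn_integral_pw_tail[of "p - 1" 1]
    by (simp add: nn_integral_cmult nn_integral_add)
  also have "... = ennreal (D * (1 / (p + 1) + - 1 / p))"
  proof -
    have "0 \<le> 1 / (p + 1)" "0 \<le> - 1 / p" using p by (simp_all add: field_simps)
    then show ?thesis using D by (simp only: ennreal_plus[symmetric] ennreal_mult'[symmetric])
  qed
  finally show "(NN \<sigma>. ennreal (norm (pw p \<sigma> * g (\<sigma> + s)))) \<le> ennreal (D * (1 / (p + 1) + - 1 / p))" .
qed measurable

text \<open>Split at \<open>\<tau> = t\<close>. Below, \<open>g (\<tau> + t)\<close> is bounded by
  its estimate at \<open>t\<close> and the weight is integrable at 0; above, the estimate at
  \<open>\<tau>\<close> leaves \<open>\<tau> powr (- 1 - a)\<close>. The pieces give the two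
  summands of the constant.\<close>

lemma fractional_smoothing_bound:
  fixes g :: "real \<Rightarrow> real"
  assumes [measurable]: "g \<in> borel_measurable borel" and a: "0 < a" "a < 1 / 2" and M: "0 \<le> M" and t: "0 < t"
    and g: "\<And>t. 0 < t \<Longrightarrow> \<bar>g t\<bar> \<le> M * t powr (- 1 / 2)"
  shows "\<bar>LBINT \<tau>. pw (- 1 / 2 - a) \<tau> * g (\<tau> + t)\<bar> \<le> (1 / (1 / 2 - a) + 1 / a) * M * t powr (- a)"
proof -
  have pt: "norm (pw (- 1 / 2 - a) \<tau> * g (\<tau> + t))
    \<le> M * (t powr (- 1 / 2) * (pw (- 1 / 2 - a) \<tau> * indicator {..t} \<tau>) + pw (- 1 - a) \<tau> * indicator {t<..} \<tau>)" for \<tau>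
  proof (cases "0 < \<tau>")
    case pos: True
    have le: "\<bar>g (\<tau> + t)\<bar> \<le> M * r powr (- 1 / 2)" if "0 < r" "r \<le> \<tau> + t" for r
    proof -
      have "\<bar>g (\<tau> + t)\<bar> \<le> M * (\<tau> + t) powr (- 1 / 2)" using g[of "\<tau> + t"] pos t by simp
      also have "... \<le> M * r powr (- 1 / 2)" using that M by (intro mult_left_mono powr_mono2') auto
      finally show ?thesis .
    qed
    show ?thesis
    proof (cases "\<tau> \<le> t")
      case True
      have "pw (- 1 / 2 - a) \<tau> * \<bar>g (\<tau> + t)\<bar> \<le> pw (- 1 / 2 - a) \<tau> * (M * t powr (- 1 / 2))"
        using le[of t] pos t by (intro mult_left_mono) auto
      then show ?thesis using True by (simp add: abs_mult mult_ac)
    next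
      case False
      have "pw (- 1 / 2 - a) \<tau> * \<bar>g (\<tau> + t)\<bar> \<le> pw (- 1 / 2 - a) \<tau> * (M * \<tau> powr (- 1 / 2))"
        using le[of \<tau>] pos t by (intro mult_left_mono) auto
      also have "... = M * (\<tau> powr (- 1 / 2 - a) * \<tau> powr (- 1 / 2))" using pos by (simp add: pw_def)
      also have "\<tau> powr (- 1 / 2 - a) * \<tau> powr (- 1 / 2) = pw (- 1 - a) \<tau>" using pos by (simp add: pw_def flip: powr_add)
      finally show ?thesis using False by (simp add: abs_mult)
    qed
  qed (simp add: pw_def)
  have "(NN \<tau>. ennreal (norm (pw (- 1 / 2 - a) \<tau> * g (\<tau> + t))))
    \<le> (NN \<tau>. ennreal M * (ennreal (t powr (- 1 / 2)) * (ennreal (pw (- 1 / 2 - a) \<tau>) * indicator {..t} \<tau>) + ennreal (pw (- 1 - a) \<tau>) * indicator {t<..} \<tau>))"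
  proof (rule nn_integral_mono)
    fix \<tau> :: real
    have "ennreal (norm (pw (- 1 / 2 - a) \<tau> * g (\<tau> + t))) \<le> ennreal (M * (t powr (- 1 / 2) * (pw (- 1 / 2 - a) \<tau> * indicator {..t} \<tau>) + pw (- 1 - a) \<tau> * indicator {t<..} \<tau>))"
      by (rule ennreal_leI[OF pt])
    also have "... = ennreal M * (ennreal (t powr (- 1 / 2)) * (ennreal (pw (- 1 / 2 - a) \<tau>) * indicator {..t} \<tau>) + ennreal (pw (- 1 - a) \<tau>) * indicator {t<..} \<tau>)"
      using M by (simp add: ennreal_mult ennreal_plus ennreal_indicator)
    finally show "ennreal (norm (pw (- 1 / 2 - a) \<tau> * g (\<tau> + t))) \<le> ..." .
  qed
  also have "... = ennreal M * (ennreal (t powr (- 1 / 2)) * ennreal (t powr (1 / 2 - a) / (1 / 2 - a)) + ennreal (t powr (- a) / a))"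
  proof -
    have h: "(NN \<tau>. ennreal (pw (- 1 / 2 - a) \<tau>) * indicator {..t} \<tau>) = ennreal (t powr (1 / 2 - a) / (1 / 2 - a))"
      using nn_integral_pw_head[of "- 1 / 2 - a" t] a t by simp
    have l: "(NN \<tau>. ennreal (pw (- 1 - a) \<tau>) * indicator {t<..} \<tau>) = ennreal (t powr (- a) / a)"
      using nn_integral_pw_tail[of "- 1 - a" t] a t by simp
    show ?thesis
      by (subst nn_integral_cmult, simp, subst nn_integral_add, simp, simp, subst nn_integral_cmult, simp, simp only: h l)
  qed
  also have "... = ennreal (M * (t powr (- 1 / 2) * (t powr (1 / 2 - a) / (1 / 2 - a)) + t powr (- a) / a))"
  proof -
    have "0 \<le> t powr (- 1 / 2)" "0 \<le> t powr (1 / 2 - a) / (1 / 2 - a)" "0 \<le> t powr (- a) / a"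
       "0 \<le> t powr (- 1 / 2) * (t powr (1 / 2 - a) / (1 / 2 - a))"
      using a by auto
    then show ?thesis using M by (simp only: ennreal_plus[symmetric] ennreal_mult'[symmetric])
  qed
  also have "t powr (- 1 / 2) * (t powr (1 / 2 - a) / (1 / 2 - a)) = t powr (- a) / (1 / 2 - a)"
    using t by (simp flip: powr_add)
  also have "M * (t powr (- a) / (1 / 2 - a) + t powr (- a) / a) = (1 / (1 / 2 - a) + 1 / a) * M * t powr (- a)"
    by (simp add: algebra_simps)
  finally have nn: "(NN \<tau>. ennreal (norm (pw (- 1 / 2 - a) \<tau> * g (\<tau> + t)))) \<le> ennreal ((1 / (1 / 2 - a) + 1 / a) * M * t powr (- a))" .
  show ?thesis using norm_integral_le_nn[OF nn] a M by simp
qed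

text \<open>Let \<open>h\<close> be the fractional integral of \<open>g\<close> of order
  \<open>1 / 2 - a\<close>. It is bounded by \<open>Ma\<close>, and its own fractional integral of
  order \<open>a\<close> is the one of \<open>g\<close> of order 1/2, controlled by
  \<open>M0\<close>. Hence \<open>weighted_integral_bound\<close> applies to \<open>h\<close>, and
  the integral of \<open>h\<close> of order \<open>a - b\<close> is a multiple of the wanted one.
  Here \<open>a\<close> and \<open>b\<close> stand for \<alpha> / 2 and \<beta> / 2, since time
  scales like length squared.\<close>

lemma fractional_interpolation:
  fixes g :: "real \<Rightarrow> real"
  assumes [measurable]: "g \<in> borel_measurable borel" and a: "0 < a" "a < 1 / 2" and b: "0 \<le> b" "b < a" and T: "0 < T"
    and D: "0 \<le> D" "\<And>t. 0 < t \<Longrightarrow> \<bar>g t\<bar> \<le> D" "\<And>t. 0 < t \<Longrightarrow> \<bar>g t\<bar> \<le> D / t"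
    and M0: "0 \<le> M0" and Ma: "0 \<le> Ma"
    and g0: "\<And>t. 0 < t \<Longrightarrow> \<bar>g t\<bar> \<le> M0 * t powr (- 1 / 2)"
    and gM0: "\<And>s. 0 < s \<Longrightarrow> \<bar>LBINT t. pw (- 1 / 2) t * g (t + s)\<bar> \<le> M0"
    and gMa: "\<And>s. 0 < s \<Longrightarrow> \<bar>LBINT t. pw (- 1 / 2 - a) t * g (t + s)\<bar> \<le> Ma"
  shows "\<bar>LBINT \<sigma>. pw (- 1 / 2 - b) \<sigma> * g \<sigma>\<bar>
    \<le> (a - b) * (Ma * T powr (a - b) / (a - b) + 2 * (1 / a + 3) * ((Beta a (1 / 2 - a) + 1 / (1 / 2 - a) + 1 / a) * M0) * T powr (- b))"
proof -
  define h where "h = (\<lambda>s. LBINT t. pw (- 1 / 2 - a) t * g (t + s))"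
  \<comment> \<open>One constant in two roles: it dominates the smoothing constant in the pointwise
    decay of \<open>h\<close> and the Beta factor in the bound on its fractional integral.\<close>
  define K where "K = Beta a (1 / 2 - a) + 1 / (1 / 2 - a) + 1 / a"
  have B0: "0 < Beta a (1 / 2 - a)" using a by (intro Beta_real_pos) auto
  have K0: "0 \<le> K" "Beta a (1 / 2 - a) \<le> K" "1 / (1 / 2 - a) + 1 / a \<le> K"
    using a B0 by (auto simp: K_def)
  have hm[measurable]: "h \<in> borel_measurable borel" unfolding h_def by measurable
  have e: "1 / 2 - a - 1 = - 1 / 2 - a" by simp
  have bound: "\<bar>LBINT t. pw (a - b - 1) t * h t\<bar> \<le> Ma * T powr (a - b) / (a - b) + 2 * (1 / a + 3) * (K * M0) * T powr (- b)"
  proof (rule weighted_integral_bound)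
    show "\<bar>h t\<bar> \<le> Ma" if "0 < t" for t using gMa[OF that] by (simp add: h_def)
    show "\<bar>h t\<bar> \<le> K * M0 * t powr (- a)" if "0 < t" for t
    proof -
      have "\<bar>h t\<bar> \<le> (1 / (1 / 2 - a) + 1 / a) * M0 * t powr (- a)"
        unfolding h_def by (rule fractional_smoothing_bound[OF _ a M0 that g0]) auto
      also have "... \<le> K * M0 * t powr (- a)" using K0 M0 by (intro mult_right_mono) auto
      finally show ?thesis .
    qed
    have i0: "integrable lborel (\<lambda>\<sigma>. pw (a + (1 / 2 - a) - 1) \<sigma> * g (\<sigma> + s))" if "0 \<le> s" for s
      using integrable_pw_decay[of g "- 1 / 2" s D] that D by simp
    show "integrable lborel (\<lambda>t. pw (a - 1) t * h t)"
      using Riemann_Liouville_compose(1)[of a "1 / 2 - a" g] i0[of 0] a unfolding h_def e by simp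
    show "\<bar>LBINT t. pw (a - 1) t * h (t + s)\<bar> \<le> K * M0" if s: "0 < s" for s
    proof -
      have "(LBINT t. pw (a - 1) t * h (t + s)) = Beta a (1 / 2 - a) * (LBINT \<sigma>. pw (a + (1 / 2 - a) - 1) \<sigma> * g (\<sigma> + s))"
        using Riemann_Liouville_compose(2)[of a "1 / 2 - a" "\<lambda>t. g (t + s)"] i0[of s] a s unfolding h_def e
        by (simp add: add.assoc)
      also have "\<bar>...\<bar> \<le> K * M0"
        using gM0[OF s] B0 K0 M0 by (simp add: abs_mult mult_mono)
      finally show ?thesis .
    qed
  qed (use a b T M0 Ma K0 in auto)
  have c: "(LBINT t. pw (a - b - 1) t * h t) = Beta (a - b) (1 / 2 - a) * (LBINT \<sigma>. pw (- 1 / 2 - b) \<sigma> * g \<sigma>)"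
  proof -
    have e2: "a - b + (1 / 2 - a) - 1 = - 1 / 2 - b" by simp
    have "integrable lborel (\<lambda>\<sigma>. pw (- 1 / 2 - b) \<sigma> * g (\<sigma> + 0))"
      by (rule integrable_pw_decay[of g _ 0 D]) (use a b D in auto)
    then show ?thesis
      using Riemann_Liouville_compose(2)[of "a - b" "1 / 2 - a" g] a b unfolding h_def e e2 by simp
  qed
  have "\<bar>LBINT \<sigma>. pw (- 1 / 2 - b) \<sigma> * g \<sigma>\<bar> \<le> (a - b) * \<bar>LBINT t. pw (a - b - 1) t * h t\<bar>"
  proof -
    \<comment> \<open>Undoing the composition divides by this Beta value, which is at least
      \<open>1 / (a - b)\<close>. The gained factor \<open>a - b\<close> keeps the result bounded as
      \<open>b\<close> approaches \<open>a\<close>.\<close>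
    have "1 \<le> (a - b) * Beta (a - b) (1 / 2 - a)"
      using Beta_ge_inverse[of "a - b" "1 / 2 - a"] a b by (simp add: field_simps)
    then have "1 * \<bar>LBINT \<sigma>. pw (- 1 / 2 - b) \<sigma> * g \<sigma>\<bar> \<le> ((a - b) * Beta (a - b) (1 / 2 - a)) * \<bar>LBINT \<sigma>. pw (- 1 / 2 - b) \<sigma> * g \<sigma>\<bar>"
      by (rule mult_right_mono) simp
    also have "... = (a - b) * \<bar>LBINT t. pw (a - b - 1) t * h t\<bar>"
      unfolding c using Beta_real_pos[of "a - b" "1 / 2 - a"] a b by (simp add: abs_mult)
    finally show ?thesis by simp
  qed
  also have "... \<le> (a - b) * (Ma * T powr (a - b) / (a - b) + 2 * (1 / a + 3) * (K * M0) * T powr (- b))"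
    using bound b by (intro mult_left_mono) auto
  finally show ?thesis by (simp add: K_def)
qed

section \<open>Test fields under the heat flow\<close>

lemma integral_dominated_convergence_at_right:
  fixes s :: "real \<Rightarrow> 'a \<Rightarrow> 'b::{banach,second_countable_topology}"
  assumes f: "f \<in> borel_measurable M" and s: "\<And>\<epsilon>. 0 < \<epsilon> \<Longrightarrow> s \<epsilon> \<in> borel_measurable M" and w: "integrable M w"
    and lim: "AE x in M. ((\<lambda>\<epsilon>. s \<epsilon> x) \<longlongrightarrow> f x) (at_right 0)"
    and bound: "\<And>\<epsilon>. 0 < \<epsilon> \<Longrightarrow> AE x in M. norm (s \<epsilon> x) \<le> w x"
  shows "((\<lambda>\<epsilon>. integral\<^sup>L M (s \<epsilon>)) \<longlongrightarrow> integral\<^sup>L M f) (at_right 0)"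
  unfolding tendsto_at_iff_sequentially comp_def
proof (intro allI impI)
  fix X :: "nat \<Rightarrow> real" assume X: "\<forall>i. X i \<in> {0<..} - {0}" "X \<longlonglongrightarrow> 0"
  show "(\<lambda>i. integral\<^sup>L M (s (X i))) \<longlonglongrightarrow> integral\<^sup>L M f"
  proof (rule integral_dominated_convergence[OF f _ w])
    show "s (X i) \<in> borel_measurable M" for i using X s by auto
    show "AE x in M. norm (s (X i) x) \<le> w x" for i using X bound by auto
    show "AE x in M. (\<lambda>i. s (X i) x) \<longlonglongrightarrow> f x"
      using lim by eventually_elim (use X in \<open>auto simp: tendsto_at_iff_sequentially comp_def\<close>)
  qed
qed

text \<open>All that the heat estimates use of a test field. The class is stable under translation
  with the same \<open>L\<close>, as uniformity over translates is needed throughout.\<close>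

definition lip_test :: "real \<Rightarrow> ('a::euclidean_space \<Rightarrow> 'a) \<Rightarrow> bool" where
  "lip_test L \<phi> \<longleftrightarrow> (\<forall>x. norm (\<phi> x) \<le> 1) \<and> (\<forall>x y. norm (\<phi> x - \<phi> y) \<le> L * norm (x - y)) \<and> integrable lborel \<phi>"

lemma
  assumes "lip_test L (\<phi> :: 'a::euclidean_space \<Rightarrow> 'a)"
  shows lip_test_le1: "norm (\<phi> x) \<le> 1"
    and lip_test_lip: "norm (\<phi> x - \<phi> y) \<le> L * norm (x - y)"
    and lip_test_integrable: "integrable lborel \<phi>"
    and lip_test_measurable: "\<phi> \<in> borel_measurable borel"
    and lip_test_nonneg: "0 \<le> L"
    and lip_test_shift: "lip_test L (\<lambda>w. \<phi> (w + z))"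
proof -
  show "norm (\<phi> x) \<le> 1" "norm (\<phi> x - \<phi> y) \<le> L * norm (x - y)" and int: "integrable lborel \<phi>"
    using assms by (auto simp: lip_test_def)
  show m[measurable]: "\<phi> \<in> borel_measurable borel"
    using int by (auto dest: borel_measurable_integrable)
  obtain b :: 'a where b: "b \<in> Basis" by (meson nonempty_Basis ex_in_conv)
  have "0 \<le> norm (\<phi> b - \<phi> 0)" by simp
  also have "... \<le> L * norm (b - 0)" using assms by (simp only: lip_test_def)
  finally show "0 \<le> L" using b by simp
  have "integrable lborel (\<lambda>w. \<phi> (w + z))"
    using integrable_shift[of \<phi> z] int by (simp add: add.commute)
  moreover have "norm (\<phi> (x + z) - \<phi> (y + z)) \<le> L * norm (x - y)" for x y
  proof -
    have "norm (\<phi> (x + z) - \<phi> (y + z)) \<le> L * norm (x + z - (y + z))"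
      using assms by (simp only: lip_test_def)
    then show ?thesis by simp
  qed
  ultimately show "lip_test L (\<lambda>w. \<phi> (w + z))"
    using assms by (simp add: lip_test_def)
qed

definition heat_div_trunc :: "real \<Rightarrow> real \<Rightarrow> ('a::euclidean_space \<Rightarrow> 'a) \<Rightarrow> 'a \<Rightarrow> real" where
  "heat_div_trunc \<epsilon> \<sigma> \<phi> x = (LBINT y. indicator {y. \<epsilon> < norm y} y * (kern \<sigma> y \<bullet> \<phi> (x + y)))"

text \<open>The divergence of the heat extension of the field with the derivative placed on the
  kernel, so that it makes sense for merely bounded fields; \<open>heat_div_eq_classical\<close>
  identifies it for smooth ones.\<close>

definition heat_div :: "real \<Rightarrow> ('a::euclidean_space \<Rightarrow> 'a) \<Rightarrow> 'a \<Rightarrow> real" where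
  "heat_div \<sigma> \<phi> x = (LBINT y. kern \<sigma> y \<bullet> \<phi> (x + y))"

text \<open>A negative radius truncates nothing. Every bound for the truncated integral therefore
  specialises to \<open>heat_div\<close>, through \<open>\<epsilon> = -1\<close> in
  \<open>heat_div_bounds\<close>.\<close>

lemma heat_div_trunc_negative: "\<epsilon> < 0 \<Longrightarrow> heat_div_trunc \<epsilon> = heat_div"
proof -
  assume "\<epsilon> < 0"
  then have "indicator {y. \<epsilon> < norm y} y = (1::real)" for y :: 'a
    by (simp add: order.strict_trans2[OF _ norm_ge_zero])
  then show ?thesis by (simp add: heat_div_trunc_def heat_div_def fun_eq_iff)
qed

lemma heat_div_trunc_measurable[measurable (raw)]:
  assumes [measurable]: "f \<in> borel_measurable M" "g \<in> borel_measurable M" "\<phi> \<in> borel_measurable borel"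
  shows "(\<lambda>x. heat_div_trunc \<epsilon> (f x) \<phi> (g x :: 'a::euclidean_space)) \<in> borel_measurable M"
  unfolding heat_div_trunc_def by measurable

lemma heat_div_measurable[measurable (raw)]:
  assumes [measurable]: "f \<in> borel_measurable M" "g \<in> borel_measurable M" "\<phi> \<in> borel_measurable borel"
  shows "(\<lambda>x. heat_div (f x) \<phi> (g x :: 'a::euclidean_space)) \<in> borel_measurable M"
  unfolding heat_div_def by measurable

lemma integrable_kern_inner:
  assumes \<phi>: "lip_test L (\<phi> :: 'a::euclidean_space \<Rightarrow> 'a)" and \<sigma>: "0 < \<sigma>"
  shows "integrable lborel (\<lambda>y. kern \<sigma> y \<bullet> \<phi> (x + y))"
proof (rule Bochner_Integration.integrable_bound[OF integrable_kern[OF \<sigma>]])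
  note [measurable] = lip_test_measurable[OF \<phi>]
  show "(\<lambda>y. kern \<sigma> y \<bullet> \<phi> (x + y)) \<in> borel_measurable lborel" by measurable
  have "\<bar>kern \<sigma> y \<bullet> \<phi> (x + y)\<bar> \<le> norm (kern \<sigma> y) * 1" for y
    by (rule order_trans[OF Cauchy_Schwarz_ineq2]) (intro mult_left_mono lip_test_le1[OF \<phi>], simp)
  then show "AE y in lborel. norm (kern \<sigma> y \<bullet> \<phi> (x + y)) \<le> norm (kern \<sigma> y)" by simp
qed

text \<open>The kernel is odd, so \<open>\<phi> (x + y)\<close> may be replaced by \<open>\<phi> (x + y) - \<phi> x\<close>.\<close>

lemma heat_div_trunc_le_Lipschitz:
  assumes \<phi>: "lip_test L (\<phi> :: 'a::euclidean_space \<Rightarrow> 'a)" and \<sigma>: "0 < \<sigma>"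
  shows "\<bar>heat_div_trunc \<epsilon> \<sigma> \<phi> x\<bar> \<le> L * real DIM('a)"
proof -
  note [measurable] = lip_test_measurable[OF \<phi>]
  note L = lip_test_nonneg[OF \<phi>]
  let ?i = "\<lambda>y::'a. indicator {y. \<epsilon> < norm y} y :: real"
  have i1: "integrable lborel (\<lambda>y. ?i y * (kern \<sigma> y \<bullet> \<phi> (x + y)))"
    by (rule Bochner_Integration.integrable_bound[OF integrable_kern_inner[OF \<phi> \<sigma>, of x]]) (auto simp: indicator_def)
  have i2: "integrable lborel (\<lambda>y. ?i y * (kern \<sigma> y \<bullet> \<phi> x))"
  proof (rule Bochner_Integration.integrable_bound)
    show "integrable lborel (\<lambda>y. kern \<sigma> y \<bullet> \<phi> x)"
      by (intro integrable_inner_left integrable_kern \<sigma>)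
  qed (auto simp: indicator_def)
  have z: "(LBINT y. ?i y * (kern \<sigma> y \<bullet> \<phi> x)) = 0"
    by (rule integral_odd_eq_0) (auto simp: indicator_def)
  have "heat_div_trunc \<epsilon> \<sigma> \<phi> x = (LBINT y. ?i y * (kern \<sigma> y \<bullet> \<phi> (x + y)) - ?i y * (kern \<sigma> y \<bullet> \<phi> x))"
    unfolding Bochner_Integration.integral_diff[OF i1 i2] z by (simp add: heat_div_trunc_def)
  moreover have "(NN y. ennreal (norm (?i y * (kern \<sigma> y \<bullet> \<phi> (x + y)) - ?i y * (kern \<sigma> y \<bullet> \<phi> x)))) \<le> ennreal (L * real DIM('a))"
  proof -
    have "(NN y. ennreal (norm (?i y * (kern \<sigma> y \<bullet> \<phi> (x + y)) - ?i y * (kern \<sigma> y \<bullet> \<phi> x))))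
      \<le> (NN y. ennreal L * ennreal (norm (kern \<sigma> y) * norm (y::'a)))"
    proof (rule nn_integral_mono)
      fix y
      have "norm (?i y * (kern \<sigma> y \<bullet> \<phi> (x + y)) - ?i y * (kern \<sigma> y \<bullet> \<phi> x)) \<le> \<bar>kern \<sigma> y \<bullet> (\<phi> (x + y) - \<phi> x)\<bar>"
        by (auto simp: indicator_def inner_diff_right)
      also have "... \<le> norm (kern \<sigma> y) * norm (\<phi> (x + y) - \<phi> x)" by (rule Cauchy_Schwarz_ineq2)
      also have "... \<le> norm (kern \<sigma> y) * (L * norm (x + y - x))"
        by (intro mult_left_mono lip_test_lip[OF \<phi>]) simp
      finally have "norm (?i y * (kern \<sigma> y \<bullet> \<phi> (x + y)) - ?i y * (kern \<sigma> y \<bullet> \<phi> x)) \<le> L * (norm (kern \<sigma> y) * norm y)"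
        by (simp add: mult_ac)
      then show "ennreal (norm (?i y * (kern \<sigma> y \<bullet> \<phi> (x + y)) - ?i y * (kern \<sigma> y \<bullet> \<phi> x))) \<le> ennreal L * ennreal (norm (kern \<sigma> y) * norm y)"
        using L by (simp add: ennreal_mult[symmetric] ennreal_leI del: ennreal_mult)
    qed
    also have "... = ennreal (L * real DIM('a))"
      using L by (subst nn_integral_cmult, simp, subst nn_integral_norm_kern_times_norm[OF \<sigma>], simp add: ennreal_mult)
    finally show ?thesis .
  qed
  ultimately show ?thesis
    using norm_integral_le_nn[of lborel "\<lambda>y. ?i y * (kern \<sigma> y \<bullet> \<phi> (x + y)) - ?i y * (kern \<sigma> y \<bullet> \<phi> x)" "L * real DIM('a)"] L
    by simp
qed

lemma heat_div_trunc_le_decay: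
  assumes \<phi>: "lip_test L (\<phi> :: 'a::euclidean_space \<Rightarrow> 'a)" and \<sigma>: "0 < \<sigma>"
  shows "\<bar>heat_div_trunc \<epsilon> \<sigma> \<phi> x\<bar> \<le> \<sigma> powr (- (real DIM('a) + 1) / 2) * (LBINT y. norm (\<phi> y))"
proof -
  note [measurable] = lip_test_measurable[OF \<phi>]
  have int: "integrable lborel (\<lambda>y. norm (\<phi> (x + y)))"
    using lip_test_integrable[OF \<phi>] by (subst integrable_shift[of "\<lambda>y. norm (\<phi> y)"]) auto
  have "norm (heat_div_trunc \<epsilon> \<sigma> \<phi> x) \<le> (LBINT y. \<sigma> powr (- (real DIM('a) + 1) / 2) * norm (\<phi> (x + y)))"
    unfolding heat_div_trunc_def
  proof (rule Bochner_Integration.integral_norm_bound_integral)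
    show "integrable lborel (\<lambda>y. indicator {y. \<epsilon> < norm y} y * (kern \<sigma> y \<bullet> \<phi> (x + y)))"
      by (rule Bochner_Integration.integrable_bound[OF integrable_kern_inner[OF \<phi> \<sigma>, of x]]) (auto simp: indicator_def)
    fix y :: 'a
    have "\<bar>kern \<sigma> y \<bullet> \<phi> (x + y)\<bar> \<le> norm (kern \<sigma> y) * norm (\<phi> (x + y))" by (rule Cauchy_Schwarz_ineq2)
    also have "... \<le> \<sigma> powr (- (real DIM('a) + 1) / 2) * norm (\<phi> (x + y))"
      by (intro mult_right_mono norm_kern_le \<sigma>) simp
    finally show "norm (indicator {y. \<epsilon> < norm y} y * (kern \<sigma> y \<bullet> \<phi> (x + y))) \<le> \<sigma> powr (- (real DIM('a) + 1) / 2) * norm (\<phi> (x + y))"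
      by (auto simp: indicator_def)
  qed (use int in simp)
  also have "... = \<sigma> powr (- (real DIM('a) + 1) / 2) * (LBINT y. norm (\<phi> y))"
    by (simp add: integral_shift[of "\<lambda>y. norm (\<phi> y)"])
  finally show ?thesis by simp
qed

text \<open>In contrast to the two bounds before, the constant depends on the dimension only; this
  is the pointwise decay that reaches the final inequality.\<close>

lemma heat_div_le_scale:
  assumes \<phi>: "lip_test L (\<phi> :: 'a::euclidean_space \<Rightarrow> 'a)" and \<sigma>: "0 < \<sigma>"
  shows "\<bar>heat_div \<sigma> \<phi> x\<bar> \<le> real DIM('a) * \<sigma> powr (- 1 / 2)"
proof -
  have "(NN y. ennreal (norm (kern \<sigma> y \<bullet> \<phi> (x + y)))) \<le> (NN y. ennreal (norm (kern \<sigma> (y::'a))))"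
  proof (intro nn_integral_mono ennreal_leI)
    fix y :: 'a
    have "\<bar>kern \<sigma> y \<bullet> \<phi> (x + y)\<bar> \<le> norm (kern \<sigma> y) * 1"
      by (rule order_trans[OF Cauchy_Schwarz_ineq2]) (intro mult_left_mono lip_test_le1[OF \<phi>], simp)
    then show "norm (kern \<sigma> y \<bullet> \<phi> (x + y)) \<le> norm (kern \<sigma> y)" by simp
  qed
  also have "... \<le> ennreal (real DIM('a) * \<sigma> powr (- 1 / 2))" by (rule nn_integral_norm_kern[OF \<sigma>])
  finally show ?thesis
    using norm_integral_le_nn[of lborel "\<lambda>y. kern \<sigma> y \<bullet> \<phi> (x + y)"] by (simp add: heat_div_def)
qed

text \<open>A constant that depends on the field but not on its translates. It serves integrability
  and dominated convergence only, and disappears from the final inequality.\<close>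

definition test_bound :: "real \<Rightarrow> ('a::euclidean_space \<Rightarrow> 'a) \<Rightarrow> real" where
  "test_bound L \<phi> = L * real DIM('a) + (LBINT y. norm (\<phi> y))"

lemma test_bound_shift:
  assumes "lip_test L \<phi>" shows "test_bound L (\<lambda>w. \<phi> (w + z)) = test_bound L \<phi>"
proof -
  note [measurable] = lip_test_measurable[OF assms]
  show ?thesis
    using integral_shift[of "\<lambda>y. norm (\<phi> y)" z] by (simp add: test_bound_def add.commute)
qed

lemma test_bound_nonneg: "lip_test L \<phi> \<Longrightarrow> 0 \<le> test_bound L \<phi>"
  by (simp add: test_bound_def lip_test_nonneg)

lemma heat_div_trunc_bounds:
  assumes \<phi>: "lip_test L (\<phi> :: 'a::euclidean_space \<Rightarrow> 'a)" and \<sigma>: "0 < \<sigma>"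
  shows "\<bar>heat_div_trunc \<epsilon> \<sigma> \<phi> x\<bar> \<le> test_bound L \<phi>"
    and "\<bar>heat_div_trunc \<epsilon> \<sigma> \<phi> x\<bar> \<le> test_bound L \<phi> / \<sigma>"
proof -
  have I: "0 \<le> (LBINT y. norm (\<phi> y))" by simp
  have LD: "0 \<le> L * real DIM('a)" using lip_test_nonneg[OF \<phi>] by simp
  show 1: "\<bar>heat_div_trunc \<epsilon> \<sigma> \<phi> x\<bar> \<le> test_bound L \<phi>"
    using heat_div_trunc_le_Lipschitz[OF \<phi> \<sigma>, of \<epsilon> x] I unfolding test_bound_def by linarith
  show "\<bar>heat_div_trunc \<epsilon> \<sigma> \<phi> x\<bar> \<le> test_bound L \<phi> / \<sigma>"
  proof (cases "\<sigma> \<le> 1")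
    case True
    then have "test_bound L \<phi> * \<sigma> \<le> test_bound L \<phi>"
      using test_bound_nonneg[OF \<phi>] by (simp add: mult_left_le)
    then have "test_bound L \<phi> \<le> test_bound L \<phi> / \<sigma>" using \<sigma> by (simp add: field_simps)
    then show ?thesis using 1 by simp
  next
    case False
    have D: "1 \<le> real DIM('a)" by (simp add: Suc_le_eq)
    \<comment> \<open>The exponent \<open>(n + 1) / 2\<close> equals 1 in dimension one, so
      \<open>1 / \<sigma>\<close> is the decay available in every dimension.\<close>
    have "\<sigma> powr (- (real DIM('a) + 1) / 2) \<le> \<sigma> powr (- 1)"
      using False D by (intro powr_mono) auto
    then have "\<sigma> powr (- (real DIM('a) + 1) / 2) * (LBINT y. norm (\<phi> y)) \<le> 1 / \<sigma> * test_bound L \<phi>"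
      using LD I \<sigma> by (intro mult_mono) (auto simp: test_bound_def powr_minus_divide)
    then show ?thesis using heat_div_trunc_le_decay[OF \<phi> \<sigma>, of \<epsilon> x] by simp
  qed
qed

lemmas heat_div_bounds = heat_div_trunc_bounds[where \<epsilon> = "-1", unfolded heat_div_trunc_negative[of "-1", simplified]]

section \<open>The pairing of an integrable function with the heat flow\<close>

definition heat_pairing :: "('a::euclidean_space \<Rightarrow> real) \<Rightarrow> ('a \<Rightarrow> 'a) \<Rightarrow> real \<Rightarrow> real" where
  "heat_pairing f \<phi> \<sigma> = (LBINT x. f x * heat_div \<sigma> \<phi> x)"

lemma heat_pairing_measurable[measurable (raw)]:
  assumes [measurable]: "f \<in> borel_measurable borel" "\<phi> \<in> borel_measurable borel" "s \<in> borel_measurable M"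
  shows "(\<lambda>x. heat_pairing f \<phi> (s x)) \<in> borel_measurable M"
  unfolding heat_pairing_def by measurable

lemma integral_mult_bound:
  fixes f g :: "'a::euclidean_space \<Rightarrow> real"
  assumes f: "integrable M f" and g: "g \<in> borel_measurable M" "\<And>x. \<bar>g x\<bar> \<le> B"
  shows "integrable M (\<lambda>x. f x * g x)" and "\<bar>\<integral>x. f x * g x \<partial>M\<bar> \<le> (\<integral>x. \<bar>f x\<bar> \<partial>M) * B"
proof -
  have le: "\<bar>f x * g x\<bar> \<le> \<bar>f x\<bar> * B" for x by (simp add: abs_mult g mult_left_mono)
  have i: "integrable M (\<lambda>x. \<bar>f x\<bar> * B)" using f by simp
  show int: "integrable M (\<lambda>x. f x * g x)"
  proof (rule Bochner_Integration.integrable_bound[OF i])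
    show "(\<lambda>x. f x * g x) \<in> borel_measurable M" using f g by auto
    have "norm (f x * g x) \<le> norm (\<bar>f x\<bar> * B)" for x using le[of x] by simp
    then show "AE x in M. norm (f x * g x) \<le> norm (\<bar>f x\<bar> * B)" by simp
  qed
  have "norm (\<integral>x. f x * g x \<partial>M) \<le> (\<integral>x. \<bar>f x\<bar> * B \<partial>M)"
    using int i le by (intro Bochner_Integration.integral_norm_bound_integral) auto
  then show "\<bar>\<integral>x. f x * g x \<partial>M\<bar> \<le> (\<integral>x. \<bar>f x\<bar> \<partial>M) * B" by simp
qed

lemma heat_pairing_bounds:
  assumes f: "integrable lborel f" and \<phi>: "lip_test L (\<phi> :: 'a::euclidean_space \<Rightarrow> 'a)" and \<sigma>: "0 < \<sigma>"
  shows "\<bar>heat_pairing f \<phi> \<sigma>\<bar> \<le> (LBINT x. \<bar>f x\<bar>) * test_bound L \<phi>"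
    and "\<bar>heat_pairing f \<phi> \<sigma>\<bar> \<le> (LBINT x. \<bar>f x\<bar>) * test_bound L \<phi> / \<sigma>"
    and "\<bar>heat_pairing f \<phi> \<sigma>\<bar> \<le> real DIM('a) * (LBINT x. \<bar>f x\<bar>) * \<sigma> powr (- 1 / 2)"
proof -
  note [measurable] = lip_test_measurable[OF \<phi>]
  show "\<bar>heat_pairing f \<phi> \<sigma>\<bar> \<le> (LBINT x. \<bar>f x\<bar>) * test_bound L \<phi>"
    unfolding heat_pairing_def by (rule integral_mult_bound(2)[OF f]) (auto intro: heat_div_bounds(1)[OF \<phi> \<sigma>])
  show "\<bar>heat_pairing f \<phi> \<sigma>\<bar> \<le> (LBINT x. \<bar>f x\<bar>) * test_bound L \<phi> / \<sigma>"
    unfolding heat_pairing_def times_divide_eq_right[symmetric]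
    by (rule integral_mult_bound(2)[OF f]) (auto intro: heat_div_bounds(2)[OF \<phi> \<sigma>])
  have "\<bar>heat_pairing f \<phi> \<sigma>\<bar> \<le> (LBINT x. \<bar>f x\<bar>) * (real DIM('a) * \<sigma> powr (- 1 / 2))"
    unfolding heat_pairing_def by (rule integral_mult_bound(2)[OF f]) (auto intro: heat_div_le_scale[OF \<phi> \<sigma>, simplified])
  then show "\<bar>heat_pairing f \<phi> \<sigma>\<bar> \<le> real DIM('a) * (LBINT x. \<bar>f x\<bar>) * \<sigma> powr (- 1 / 2)"
    by (simp add: mult_ac)
qed

text \<open>Flowing for the additional time \<open>s\<close> averages the divergence at time
  \<open>t\<close> over translates of the field, with the probability density \<open>heat s\<close>.
  This is \<open>kern_semigroup\<close> followed by Fubini and a translation.\<close>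

lemma heat_div_semigroup:
  assumes \<phi>: "lip_test L (\<phi> :: 'a::euclidean_space \<Rightarrow> 'a)" and t: "0 < t" and s: "0 < s"
  shows "heat_div (t + s) \<phi> x = (LBINT z. heat s z * heat_div t (\<lambda>w. \<phi> (w + z)) x)"
proof -
  note [measurable] = lip_test_measurable[OF \<phi>]
  let ?F = "\<lambda>z y. heat s z * (kern t (y - z) \<bullet> \<phi> (x + y))"
  have Fm: "(\<lambda>(z, y). ?F z y) \<in> borel_measurable (lborel \<Otimes>\<^sub>M lborel)" by measurable
  have fin: "(NN z. NN y. ennreal (norm (?F z y))) < \<infinity>"
  proof -
    have "(NN z. NN y. ennreal (norm (?F z y)))
      \<le> (NN z. ennreal (heat s (z::'a)) * ennreal (real DIM('a) * t powr (- 1 / 2)))"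
    proof (rule nn_integral_mono)
      fix z :: 'a
      have "(NN y. ennreal (norm (?F z y))) \<le> (NN y. ennreal (heat s z) * ennreal (norm (kern t (- z + y))))"
      proof (rule nn_integral_mono)
        fix y :: 'a
        have "\<bar>kern t (y - z) \<bullet> \<phi> (x + y)\<bar> \<le> norm (kern t (y - z)) * 1"
          by (rule order_trans[OF Cauchy_Schwarz_ineq2]) (intro mult_left_mono lip_test_le1[OF \<phi>], simp)
        then have "norm (?F z y) \<le> heat s z * norm (kern t (- z + y))"
          by (simp add: abs_mult mult_left_mono)
        then show "ennreal (norm (?F z y)) \<le> ennreal (heat s z) * ennreal (norm (kern t (- z + y)))"
          by (simp add: ennreal_mult'[symmetric] ennreal_leI)
      qed
      also have "... = ennreal (heat s z) * (NN y. ennreal (norm (kern t (- z + y))))"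
        by (rule nn_integral_cmult) simp
      also have "(NN y. ennreal (norm (kern t (- z + y)))) = (NN y. ennreal (norm (kern t (y::'a))))"
        by (rule nn_integral_shift) simp
      also have "ennreal (heat s z) * ... \<le> ennreal (heat s z) * ennreal (real DIM('a) * t powr (- 1 / 2))"
        by (intro mult_left_mono nn_integral_norm_kern t) simp
      finally show "(NN y. ennreal (norm (?F z y))) \<le> ennreal (heat s z) * ennreal (real DIM('a) * t powr (- 1 / 2))" .
    qed
    also have "... = ennreal (real DIM('a) * t powr (- 1 / 2))"
      by (simp add: nn_integral_multc nn_integral_heat[OF s])
    also have "... < \<infinity>" by simp
    finally show ?thesis .
  qed
  have ik: "integrable lborel (\<lambda>z. heat s z *\<^sub>R kern t (y - z))" for y :: 'a
  proof (rule Bochner_Integration.integrable_bound[OF integrable_mult_right[OF integrable_heat[OF s], of "t powr (- (real DIM('a) + 1) / 2)"]])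
    show "AE z in lborel. norm (heat s z *\<^sub>R kern t (y - z)) \<le> norm (t powr (- (real DIM('a) + 1) / 2) * heat s z)"
    proof (rule AE_I2)
      fix z
      have "heat s z * norm (kern t (y - z)) \<le> heat s z * t powr (- (real DIM('a) + 1) / 2)"
        by (intro mult_left_mono norm_kern_le t) simp
      then show "norm (heat s z *\<^sub>R kern t (y - z)) \<le> norm (t powr (- (real DIM('a) + 1) / 2) * heat s z)"
        by (simp add: mult.commute)
    qed
  qed simp
  have "heat_div (t + s) \<phi> x = (LBINT y. (LBINT z. heat s z *\<^sub>R kern t (y - z)) \<bullet> \<phi> (x + y))"
    by (simp add: heat_div_def kern_semigroup[OF t s])
  also have "... = (LBINT y. LBINT z. ?F z y)"
    by (subst integral_inner_left[symmetric]) (simp_all add: ik)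
  also have "... = (LBINT z. LBINT y. ?F z y)"
    by (rule Fubini_lborel(1)[OF Fm fin, symmetric])
  also have "... = (LBINT z. heat s z * heat_div t (\<lambda>w. \<phi> (w + z)) x)"
  proof (rule Bochner_Integration.integral_cong[OF refl])
    fix z :: 'a
    have "(LBINT y. kern t (y - z) \<bullet> \<phi> (x + y)) = (LBINT y. kern t (z + y - z) \<bullet> \<phi> (x + (z + y)))"
      by (rule integral_shift[symmetric]) measurable
    also have "... = heat_div t (\<lambda>w. \<phi> (w + z)) x"
      by (simp add: heat_div_def add_ac)
    finally show "(LBINT y. ?F z y) = heat s z * heat_div t (\<lambda>w. \<phi> (w + z)) x" by simp
  qed
  finally show ?thesis .
qed

lemma heat_pairing_semigroup:
  assumes f: "integrable lborel f" and \<phi>: "lip_test L (\<phi> :: 'a::euclidean_space \<Rightarrow> 'a)" and t: "0 < t" and s: "0 < s"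
  shows "heat_pairing f \<phi> (t + s) = (LBINT z. heat s z * heat_pairing f (\<lambda>w. \<phi> (w + z)) t)"
proof -
  note [measurable] = lip_test_measurable[OF \<phi>] borel_measurable_integrable[OF f, simplified]
  let ?F = "\<lambda>x z. f x * (heat s z * heat_div t (\<lambda>w. \<phi> (w + z)) x)"
  let ?C = "test_bound L \<phi>"
  have C0: "0 \<le> ?C" by (rule test_bound_nonneg[OF \<phi>])
  have Fm: "(\<lambda>(x, z). ?F x z) \<in> borel_measurable (lborel \<Otimes>\<^sub>M lborel)"
    unfolding heat_div_def by measurable
  have b: "\<bar>heat_div t (\<lambda>w. \<phi> (w + z)) x\<bar> \<le> ?C" for z x
    using heat_div_bounds(1)[OF lip_test_shift[OF \<phi>] t, of z x] by (simp add: test_bound_shift[OF \<phi>])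
  have fin: "(NN x. NN z. ennreal (norm (?F x z))) < \<infinity>"
  proof -
    have "(NN x. NN z. ennreal (norm (?F x z)))
      \<le> (NN x. NN z. ennreal (?C * \<bar>f x\<bar>) * ennreal (heat s (z::'a)))"
    proof (intro nn_integral_mono)
      fix x z :: 'a
      have "norm (?F x z) \<le> \<bar>f x\<bar> * (heat s z * ?C)"
        by (simp add: abs_mult mult_left_mono b)
      also have "... = ?C * \<bar>f x\<bar> * heat s z" by simp
      finally show "ennreal (norm (?F x z)) \<le> ennreal (?C * \<bar>f x\<bar>) * ennreal (heat s z)"
        using C0 by (simp add: ennreal_mult'[symmetric] ennreal_leI)
    qed
    also have "... = (NN x. ennreal (norm (?C * f x)))"
      using C0 by (simp add: nn_integral_cmult nn_integral_heat[OF s] abs_mult)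
    also have "... < \<infinity>"
      using integrable_mult_right[OF f, of ?C] by (simp only: integrable_iff_bounded)
    finally show ?thesis .
  qed
  have "heat_pairing f \<phi> (t + s) = (LBINT x. LBINT z. ?F x z)"
    by (simp add: heat_pairing_def heat_div_semigroup[OF \<phi> t s])
  also have "... = (LBINT z. LBINT x. ?F x z)"
    by (rule Fubini_lborel(1)[OF Fm fin])
  also have "... = (LBINT z. heat s z * heat_pairing f (\<lambda>w. \<phi> (w + z)) t)"
    unfolding heat_pairing_def
    by (subst integral_mult_right_zero[symmetric]) (simp add: mult_ac)
  finally show ?thesis .
qed

text \<open>By the semigroup property a shift by \<open>s\<close> in time is an average over
  translates of \<open>\<phi>\<close> against a density of mass 1, so a bound uniform over
  translates passes to the shifted integral with the same constant. This supplies the hypotheses of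
  the half-line inequality at every \<open>s > 0\<close>.\<close>

lemma heat_pairing_weighted_bound:
  assumes f: "integrable lborel f" and \<phi>: "lip_test L (\<phi> :: 'a::euclidean_space \<Rightarrow> 'a)" and s: "0 < s"
    and p: "-1 < p" "p < 0" and M: "0 \<le> M"
    and bd: "\<And>z. \<bar>LBINT t. pw p t * heat_pairing f (\<lambda>w. \<phi> (w + z)) t\<bar> \<le> M"
  shows "\<bar>LBINT t. pw p t * heat_pairing f \<phi> (t + s)\<bar> \<le> M"
proof -
  note [measurable] = lip_test_measurable[OF \<phi>] borel_measurable_integrable[OF f, simplified]
  let ?F = "\<lambda>t z. pw p t * (heat s z * heat_pairing f (\<lambda>w. \<phi> (w + z)) t)"
  define D where "D = (LBINT x. \<bar>f x\<bar>) * test_bound L \<phi>"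
  have D0: "0 \<le> D" by (simp add: D_def test_bound_nonneg[OF \<phi>])
  have b: "\<bar>heat_pairing f (\<lambda>w. \<phi> (w + z)) t\<bar> \<le> D" "\<bar>heat_pairing f (\<lambda>w. \<phi> (w + z)) t\<bar> \<le> D / t" if "0 < t" for z t
    using heat_pairing_bounds(1,2)[OF f lip_test_shift[OF \<phi>] that, of z] by (simp_all add: test_bound_shift[OF \<phi>] D_def)
  define w where "w = (\<lambda>t. pw p t * min D (D / t))"
  have wint: "integrable lborel w"
    using integrable_pw_decay[of "\<lambda>t. min D (D / t)" p 0 D] p D0 unfolding w_def by simp
  have w0: "0 \<le> w t" for t using D0 by (auto simp: w_def pw_def)
  have ptw: "pw p t * \<bar>heat_pairing f (\<lambda>w. \<phi> (w + z)) t\<bar> \<le> w t" for t z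
    using b[of t z] by (auto simp: w_def pw_def intro!: mult_left_mono)
  have Fm: "(\<lambda>(t, z). ?F t z) \<in> borel_measurable (lborel \<Otimes>\<^sub>M lborel)"
    unfolding heat_pairing_def heat_div_def by measurable
  have fin: "(NN t. NN z. ennreal (norm (?F t z))) < \<infinity>"
  proof -
    have "(NN t. NN z. ennreal (norm (?F t z)))
      \<le> (NN t. NN z. ennreal (norm (w t)) * ennreal (heat s (z::'a)))"
    proof (intro nn_integral_mono)
      fix t :: real and z :: 'a
      have "norm (?F t z) = heat s z * (pw p t * \<bar>heat_pairing f (\<lambda>w. \<phi> (w + z)) t\<bar>)" by (simp add: abs_mult)
      also have "... \<le> heat s z * w t" by (intro mult_left_mono ptw) simp
      finally show "ennreal (norm (?F t z)) \<le> ennreal (norm (w t)) * ennreal (heat s z)"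
        using w0 by (simp add: ennreal_mult'[symmetric] ennreal_leI mult.commute)
    qed
    also have "... = (NN t. ennreal (norm (w t)))"
      by (simp add: nn_integral_cmult nn_integral_heat[OF s])
    also have "... < \<infinity>" using wint by (simp add: integrable_iff_bounded)
    finally show ?thesis .
  qed
  have "(LBINT t. pw p t * heat_pairing f \<phi> (t + s)) = (LBINT t. LBINT z. ?F t z)"
  proof (rule Bochner_Integration.integral_cong[OF refl])
    fix t :: real
    show "pw p t * heat_pairing f \<phi> (t + s) = (LBINT z. ?F t z)"
      by (cases "0 < t") (simp_all add: heat_pairing_semigroup[OF f \<phi> _ s] pw_nonpos)
  qed
  also have "... = (LBINT z. LBINT t. ?F t z)"
    by (rule Fubini_lborel(1)[OF Fm fin])
  also have "... = (LBINT z. heat s z * (LBINT t. pw p t * heat_pairing f (\<lambda>w. \<phi> (w + z)) t))"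
    by (subst integral_mult_right_zero[symmetric]) (simp add: mult_ac)
  also have "\<bar>...\<bar> \<le> (LBINT z. \<bar>heat s (z::'a)\<bar>) * M"
    by (rule integral_mult_bound(2)[OF integrable_heat[OF s] _ bd])
      (unfold heat_pairing_def heat_div_def, measurable)
  also have "... = M" using s by simp
  finally show ?thesis .
qed

section \<open>Principal values as superpositions of heat kernels\<close>

text \<open>The value of \<open>norm (kern \<tau> y)\<close> at unit vectors \<open>y\<close>, from
  which all other \<open>y\<close> are reached by parabolic scaling.\<close>

definition heat_profile :: "real \<Rightarrow> real \<Rightarrow> real" where
  "heat_profile n \<tau> = (4 * pi * \<tau>) powr (- n / 2) * exp (- 1 / (4 * \<tau>)) / (2 * \<tau>)"

lemma heat_profile_measurable[measurable (raw)]: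
  assumes [measurable]: "f \<in> borel_measurable M"
  shows "(\<lambda>x. heat_profile n (f x)) \<in> borel_measurable M"
  unfolding heat_profile_def by measurable

lemma heat_profile_nonneg: "0 < \<tau> \<Longrightarrow> 0 \<le> heat_profile n \<tau>"
  by (simp add: heat_profile_def)

lemma heat_scaling:
  fixes y :: "'a::euclidean_space"
  assumes y: "y \<noteq> 0" and \<tau>: "0 < \<tau>"
  shows "heat ((norm y)\<^sup>2 * \<tau>) y / (2 * ((norm y)\<^sup>2 * \<tau>)) = norm y powr (- real DIM('a) - 2) * heat_profile (real DIM('a)) \<tau>"
proof -
  define r where "r = norm y"
  have r: "0 < r" using y by (simp add: r_def)
  have "(4 * pi * (r\<^sup>2 * \<tau>)) powr (- real DIM('a) / 2) = ((4 * pi * \<tau>) * r\<^sup>2) powr (- real DIM('a) / 2)"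
    by (simp add: mult_ac)
  also have "... = (4 * pi * \<tau>) powr (- real DIM('a) / 2) * (r\<^sup>2) powr (- real DIM('a) / 2)"
    using \<tau> by (simp add: powr_mult)
  also have "(r\<^sup>2) powr (- real DIM('a) / 2) = r powr (- real DIM('a))"
    using r by (simp add: powr_powr flip: powr_numeral)
  finally have p: "(4 * pi * (r\<^sup>2 * \<tau>)) powr (- real DIM('a) / 2) = (4 * pi * \<tau>) powr (- real DIM('a) / 2) * r powr (- real DIM('a))" .
  have e: "- r\<^sup>2 / (4 * (r\<^sup>2 * \<tau>)) = - 1 / (4 * \<tau>)" using r by simp
  have q: "r powr (- real DIM('a) - 2) = r powr (- real DIM('a)) / r\<^sup>2"
    using r by (simp add: powr_diff flip: powr_numeral)
  show ?thesis
    unfolding heat_def heat_profile_def r_def[symmetric] p e q using r \<tau> by (simp add: mult_ac)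
qed

text \<open>A basis vector realises the profile as the norm of a value of \<open>kern\<close>, to
  which the sup bound applies.\<close>

lemma heat_profile_le:
  assumes \<tau>: "0 < \<tau>"
  shows "heat_profile (real DIM('a::euclidean_space)) \<tau> \<le> \<tau> powr (- (real DIM('a) + 1) / 2)"
proof -
  obtain b :: 'a where b: "b \<in> Basis" by (meson nonempty_Basis ex_in_conv)
  have "norm (kern \<tau> b) = heat_profile (real DIM('a)) \<tau>"
    using b \<tau> by (simp add: kern_def heat_def heat_profile_def)
  then show ?thesis using norm_kern_le[OF \<tau>, of b] by simp
qed

lemma power_le_fact_exp:
  assumes "0 \<le> (x::real)" shows "x ^ m \<le> fact m * exp x"
proof -
  have "x ^ m /\<^sub>R fact m \<le> (\<Sum>k. x ^ k /\<^sub>R fact k)"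
    using sum_le_suminf[OF summable_exp_generic[of x], of "{m}"] assms by simp
  then show ?thesis by (simp add: exp_def field_simps)
qed

lemma heat_profile_bound:
  obtains D where "0 \<le> D" "\<And>\<tau>. 0 < \<tau> \<Longrightarrow> heat_profile (real DIM('a::euclidean_space)) \<tau> \<le> D"
    "\<And>\<tau>. 0 < \<tau> \<Longrightarrow> heat_profile (real DIM('a)) \<tau> \<le> D / \<tau>"
proof -
  let ?n = "DIM('a)"
  \<comment> \<open>From \<open>x ^ m \<le> fact m * exp x\<close> with \<open>m = n + 1\<close> and
    \<open>x = 1 / (4 * \<tau>)\<close>: for \<open>\<tau> \<le> 1\<close> the exponential absorbs
    both the normalisation, at most \<open>\<tau> powr (- n)\<close>, and the factor
    \<open>1 / \<tau>\<close>.\<close>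
  define D :: real where "D = fact (?n + 1) * 4 ^ (?n + 1)"
  have "1 * 1 \<le> (fact (?n + 1) :: real) * 4 ^ (?n + 1)"
    by (intro mult_mono fact_ge_1 one_le_power) simp_all
  then have D1: "1 \<le> D" by (simp add: D_def)
  have n1: "1 \<le> real ?n" by (simp add: Suc_le_eq)
  have small: "heat_profile (real ?n) \<tau> \<le> D" if \<tau>: "0 < \<tau>" "\<tau> \<le> 1" for \<tau>
  proof -
    have "exp (- 1 / (4 * \<tau>)) \<le> D * \<tau> ^ (?n + 1)"
    proof -
      have "(1 / (4 * \<tau>)) ^ (?n + 1) \<le> fact (?n + 1) * exp (1 / (4 * \<tau>))"
        by (rule power_le_fact_exp) (use \<tau> in simp)
      then have "(1 / (4 * \<tau>)) ^ (?n + 1) * (4 * \<tau>) ^ (?n + 1) \<le> fact (?n + 1) * exp (1 / (4 * \<tau>)) * (4 * \<tau>) ^ (?n + 1)"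
        by (rule mult_right_mono) (use \<tau> in simp)
      also have "(1 / (4 * \<tau>)) ^ (?n + 1) * (4 * \<tau>) ^ (?n + 1) = 1"
        unfolding power_mult_distrib[symmetric] using \<tau> by simp
      also have "fact (?n + 1) * exp (1 / (4 * \<tau>)) * (4 * \<tau>) ^ (?n + 1) = D * \<tau> ^ (?n + 1) * exp (1 / (4 * \<tau>))"
        unfolding D_def power_mult_distrib by (simp only: mult_ac)
      finally have "1 / exp (1 / (4 * \<tau>)) \<le> D * \<tau> ^ (?n + 1)"
        by (simp only: pos_divide_le_eq[OF exp_gt_zero])
      then show ?thesis by (simp add: exp_minus inverse_eq_divide)
    qed
    moreover have "(4 * pi * \<tau>) powr (- real ?n / 2) \<le> \<tau> powr (- real ?n)"
    proof -
      have "(4 * pi * \<tau>) powr (- real ?n / 2) \<le> \<tau> powr (- real ?n / 2)"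
        using \<tau> pi_gt3 by (intro powr_mono2') auto
      also have "... \<le> \<tau> powr (- real ?n)"
        using \<tau> by (intro powr_mono') auto
      finally show ?thesis .
    qed
    moreover have "1 / (2 * \<tau>) \<le> 1 / \<tau>" using \<tau> by (simp add: field_simps)
    ultimately have "(4 * pi * \<tau>) powr (- real ?n / 2) * exp (- 1 / (4 * \<tau>)) * (1 / (2 * \<tau>)) \<le> \<tau> powr (- real ?n) * (D * \<tau> ^ (?n + 1)) * (1 / \<tau>)"
      using \<tau> D1 by (intro mult_mono mult_nonneg_nonneg) simp_all
    then have "heat_profile (real ?n) \<tau> \<le> \<tau> powr (- real ?n) * (D * \<tau> ^ (?n + 1)) * (1 / \<tau>)"
      by (simp add: heat_profile_def)
    also have "\<tau> powr (- real ?n) = 1 / \<tau> ^ ?n"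
      using \<tau> by (simp add: powr_minus_divide powr_realpow)
    finally show ?thesis using \<tau> by simp
  qed
  have large: "heat_profile (real ?n) \<tau> \<le> 1 / \<tau>" if \<tau>: "1 < \<tau>" for \<tau>
  proof -
    have "heat_profile (real ?n) \<tau> \<le> \<tau> powr (- (real ?n + 1) / 2)"
      using heat_profile_le[of \<tau>, where 'a = 'a] \<tau> by simp
    also have "... \<le> \<tau> powr (- 1)" using \<tau> n1 by (intro powr_mono) auto
    finally show ?thesis using \<tau> by (simp add: powr_minus_divide)
  qed
  show ?thesis
  proof (rule that[of D])
    fix \<tau> :: real assume \<tau>: "0 < \<tau>"
    show "heat_profile (real ?n) \<tau> \<le> D"
    proof (cases "\<tau> \<le> 1")
      case False
      then have "1 / \<tau> \<le> 1" by simp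
      moreover have "heat_profile (real ?n) \<tau> \<le> 1 / \<tau>" using large False by simp
      ultimately show ?thesis using D1 by linarith
    qed (use small \<tau> in simp)
    show "heat_profile (real ?n) \<tau> \<le> D / \<tau>"
    proof (cases "\<tau> \<le> 1")
      case True
      then have "D * \<tau> \<le> D" using D1 by simp
      then have "D \<le> D / \<tau>" using \<tau> by (simp add: field_simps)
      then show ?thesis using small[OF \<tau> True] by simp
    next
      case False
      have "1 / \<tau> \<le> D / \<tau>" using D1 \<tau> by (intro divide_right_mono) auto
      then show ?thesis using large[of \<tau>] False by simp
    qed
  qed (use D1 in simp)
qed

text \<open>A Gamma-type integral that relates superpositions of heat gradients to powers of
  \<open>norm y\<close>. Its closed form is never computed; positivity and a lower bound uniform in
  \<open>q\<close> are enough.\<close>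

definition heat_const :: "real \<Rightarrow> real \<Rightarrow> real" where
  "heat_const n q = (LBINT \<tau>. pw q \<tau> * heat_profile n \<tau>)"

lemma integrable_heat_profile:
  assumes "-1 < q" "q < 0"
  shows "integrable lborel (\<lambda>\<tau>. pw q \<tau> * heat_profile (real DIM('a::euclidean_space)) \<tau>)"
proof -
  obtain D where D: "0 \<le> D" "\<And>\<tau>. 0 < \<tau> \<Longrightarrow> heat_profile (real DIM('a)) \<tau> \<le> D"
    "\<And>\<tau>. 0 < \<tau> \<Longrightarrow> heat_profile (real DIM('a)) \<tau> \<le> D / \<tau>"
    using heat_profile_bound[where 'a = 'a] by blast
  have "integrable lborel (\<lambda>\<tau>. pw q \<tau> * heat_profile (real DIM('a)) (\<tau> + 0))"
    by (rule integrable_pw_decay[of _ q 0 D]) (use D assms heat_profile_nonneg in \<open>auto\<close>)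
  then show ?thesis by simp
qed

text \<open>Restricting the integral to [1, 2] bounds every factor below without reference to
  \<open>q\<close>: the power by 1/2 and \<open>1 / (2 * \<tau>)\<close> by 1/4. Uniformity in
  \<open>q\<close> becomes uniformity in \<beta>.\<close>

lemma heat_const_ge:
  assumes "-1 < q" "q < 0"
  shows "(8 * pi) powr (- real DIM('a::euclidean_space) / 2) * exp (- 1 / 4) / 8 \<le> heat_const (real DIM('a)) q"
proof -
  let ?n = "real DIM('a)"
  let ?c = "(8 * pi) powr (- ?n / 2) * exp (- 1 / 4) / 8"
  have "?c = (LBINT \<tau>. indicator {1..2::real} \<tau> *\<^sub>R ?c)" by simp
  also have "... \<le> (LBINT \<tau>. pw q \<tau> * heat_profile ?n \<tau>)"
  proof (rule integral_mono)
    show "integrable lborel (\<lambda>\<tau>. pw q \<tau> * heat_profile ?n \<tau>)"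
      by (rule integrable_heat_profile[OF assms])
    fix \<tau> :: real
    show "indicator {1..2} \<tau> *\<^sub>R ?c \<le> pw q \<tau> * heat_profile ?n \<tau>"
    proof (cases "\<tau> \<in> {1..2}")
      case True
      then have \<tau>: "1 \<le> \<tau>" "\<tau> \<le> 2" by auto
      have a1: "1 / 2 \<le> pw q \<tau>"
      proof -
        have "(1/2::real) = 2 powr (- 1)" by (simp add: powr_minus_divide)
        also have "... \<le> \<tau> powr (- 1)" using \<tau> by (intro powr_mono2') auto
        also have "... \<le> \<tau> powr q" using \<tau> assms by (intro powr_mono) auto
        finally show ?thesis using \<tau> by (simp add: pw_def)
      qed
      have a2: "(8 * pi) powr (- ?n / 2) \<le> (4 * pi * \<tau>) powr (- ?n / 2)"
        using \<tau> by (intro powr_mono2') auto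
      have a3: "exp (- 1 / 4) \<le> exp (- 1 / (4 * \<tau>))" using \<tau> by (simp add: field_simps)
      have a4: "1 / 4 \<le> 1 / (2 * \<tau>)" using \<tau> by (simp add: field_simps)
      have "(8 * pi) powr (- ?n / 2) * exp (- 1 / 4) * (1 / 4) \<le> (4 * pi * \<tau>) powr (- ?n / 2) * exp (- 1 / (4 * \<tau>)) * (1 / (2 * \<tau>))"
        using a2 a3 a4 by (intro mult_mono) auto
      then have "(8 * pi) powr (- ?n / 2) * exp (- 1 / 4) * (1 / 4) \<le> heat_profile ?n \<tau>"
        by (simp add: heat_profile_def)
      then have "1 / 2 * ((8 * pi) powr (- ?n / 2) * exp (- 1 / 4) * (1 / 4)) \<le> pw q \<tau> * heat_profile ?n \<tau>"
        using a1 by (intro mult_mono) auto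
      then show ?thesis using True by simp
    next
      case False
      then show ?thesis
        by (cases "0 < \<tau>") (simp_all add: heat_profile_nonneg pw_nonpos)
    qed
  qed simp
  finally show ?thesis by (simp add: heat_const_def)
qed

lemma heat_const_pos: "-1 < q \<Longrightarrow> q < 0 \<Longrightarrow> 0 < heat_const (real DIM('a::euclidean_space)) q"
  by (rule order.strict_trans2[OF _ heat_const_ge]) auto

text \<open>The Riesz-type kernels are superpositions of heat kernels, by the substitution \<open>\<sigma> = \<bar>y\<bar>\<^sup>2 \<tau>\<close>.\<close>

lemma pw_heat_scaling:
  fixes y :: "'a::euclidean_space"
  assumes y: "y \<noteq> 0"
  shows "pw q ((norm y)\<^sup>2 * \<tau>) * (heat ((norm y)\<^sup>2 * \<tau>) y / (2 * ((norm y)\<^sup>2 * \<tau>)))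
    = norm y powr (2 * q - real DIM('a) - 2) * (pw q \<tau> * heat_profile (real DIM('a)) \<tau>)"
proof (cases "0 < \<tau>")
  case True
  have "((norm y)\<^sup>2 * \<tau>) powr q = norm y powr (2 * q) * \<tau> powr q"
    using True y by (simp add: powr_mult powr_powr flip: powr_numeral)
  moreover have "norm y powr (2 * q - real DIM('a) - 2) = norm y powr (2 * q) * norm y powr (- real DIM('a) - 2)"
    by (simp flip: powr_add add: algebra_simps)
  ultimately show ?thesis
    unfolding heat_scaling[OF y True] using True y by (simp add: pw_def)
next
  case False
  then have "(norm y)\<^sup>2 * \<tau> \<le> 0" by (simp add: mult_nonneg_nonpos)
  then show ?thesis using False by (simp add: pw_nonpos)
qed

text \<open>With \<open>q = - (1 + \<beta>) / 2\<close> the exponent \<open>2 * q - n\<close> is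
  \<open>- (n + \<beta> + 1)\<close>, so that multiplication by \<open>y\<close> gives the kernel of
  the fractional divergence; \<open>q = - 1 / 2\<close> gives the Riesz kernel.\<close>

lemma
  fixes y :: "'a::euclidean_space"
  assumes y: "y \<noteq> 0" and q: "-1 < q" "q < 0"
  shows integrable_pw_heat: "integrable lborel (\<lambda>\<sigma>. pw q \<sigma> * (heat \<sigma> y / (2 * \<sigma>)))"
    and integral_pw_heat: "(LBINT \<sigma>. pw q \<sigma> * (heat \<sigma> y / (2 * \<sigma>))) = heat_const (real DIM('a)) q * norm y powr (2 * q - real DIM('a))"
proof -
  let ?f = "\<lambda>\<sigma>. pw q \<sigma> * (heat \<sigma> y / (2 * \<sigma>))"
  have r: "(norm y)\<^sup>2 \<noteq> 0" using y by simp
  have eq: "?f (0 + (norm y)\<^sup>2 * \<tau>) = norm y powr (2 * q - real DIM('a) - 2) * (pw q \<tau> * heat_profile (real DIM('a)) \<tau>)" for \<tau>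
    using pw_heat_scaling[OF y, of q \<tau>] by simp
  have "integrable lborel (\<lambda>\<tau>. ?f (0 + (norm y)\<^sup>2 * \<tau>))"
    unfolding eq by (intro integrable_mult_right integrable_heat_profile q)
  then show "integrable lborel ?f"
    using lborel_integrable_real_affine_iff[OF r, of ?f 0] by simp
  have "(LBINT \<sigma>. ?f \<sigma>) = (norm y)\<^sup>2 * (norm y powr (2 * q - real DIM('a) - 2) * heat_const (real DIM('a)) q)"
    using lborel_integral_real_affine[OF r, of ?f 0] unfolding eq by (simp add: heat_const_def)
  also have "(norm y)\<^sup>2 * (norm y powr (2 * q - real DIM('a) - 2) * heat_const (real DIM('a)) q) = heat_const (real DIM('a)) q * norm y powr (2 * q - real DIM('a))"
    using y by (simp add: powr_diff flip: powr_numeral)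
  finally show "(LBINT \<sigma>. ?f \<sigma>) = heat_const (real DIM('a)) q * norm y powr (2 * q - real DIM('a))" .
qed

section \<open>The fractional divergence as a superposition of heat divergences\<close>

definition div_trunc :: "real \<Rightarrow> ('a::euclidean_space \<Rightarrow> 'a) \<Rightarrow> 'a \<Rightarrow> real \<Rightarrow> real" where
  "div_trunc \<beta> \<phi> x \<epsilon> = (LBINT y. indicator {y. \<epsilon> < norm y} y * ((y \<bullet> \<phi> (x + y)) / norm y powr (real DIM('a) + \<beta> + 1)))"

lemma div_trunc_eq_heat:
  assumes \<phi>: "lip_test L (\<phi> :: 'a::euclidean_space \<Rightarrow> 'a)" and \<beta>: "0 \<le> \<beta>" "\<beta> < 1" and \<epsilon>: "0 < \<epsilon>"
  shows "heat_const (real DIM('a)) (- (1 + \<beta>) / 2) * div_trunc \<beta> \<phi> x \<epsilon> = (LBINT \<sigma>. pw (- (1 + \<beta>) / 2) \<sigma> * heat_div_trunc \<epsilon> \<sigma> \<phi> x)"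
proof -
  note [measurable] = lip_test_measurable[OF \<phi>]
  define q where "q = - (1 + \<beta>) / 2"
  have q: "-1 < q" "q < 0" using \<beta> by (simp_all add: q_def)
  define \<kappa> where "\<kappa> = heat_const (real DIM('a)) q"
  have \<kappa>: "0 < \<kappa>" unfolding \<kappa>_def by (rule heat_const_pos[OF q])
  let ?F = "\<lambda>y \<sigma>. indicator {y. \<epsilon> < norm y} y * (y \<bullet> \<phi> (x + y)) * (pw q \<sigma> * (heat \<sigma> y / (2 * \<sigma>)))"
  have Fm: "(\<lambda>(y, \<sigma>). ?F y \<sigma>) \<in> borel_measurable (lborel \<Otimes>\<^sub>M lborel)" by measurable
  have e: "2 * q - real DIM('a) = - (real DIM('a) + \<beta> + 1)" by (simp add: q_def)
  have inner: "(LBINT \<sigma>. ?F y \<sigma>) = \<kappa> * (indicator {y. \<epsilon> < norm y} y * ((y \<bullet> \<phi> (x + y)) / norm y powr (real DIM('a) + \<beta> + 1)))" for y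
  proof (cases "\<epsilon> < norm y")
    case True
    then have y: "y \<noteq> 0" using \<epsilon> by auto
    have "(LBINT \<sigma>. ?F y \<sigma>) = indicator {y. \<epsilon> < norm y} y * (y \<bullet> \<phi> (x + y)) * (LBINT \<sigma>. pw q \<sigma> * (heat \<sigma> y / (2 * \<sigma>)))"
      by (rule integral_mult_right_zero)
    also have "(LBINT \<sigma>. pw q \<sigma> * (heat \<sigma> y / (2 * \<sigma>))) = \<kappa> / norm y powr (real DIM('a) + \<beta> + 1)"
      unfolding integral_pw_heat[OF y q] e \<kappa>_def[symmetric] powr_minus_divide by simp
    finally show ?thesis by simp
  qed simp
  have fin: "(NN y. NN \<sigma>. ennreal (norm (?F y \<sigma>))) < \<infinity>"
  proof -
    \<comment> \<open>Outside the ball of radius \<epsilon> the kernel, of homogeneity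
      \<open>- (n + \<beta>)\<close>, is at most a constant multiple of its size at distance
      \<epsilon>, and \<open>\<phi>\<close> is integrable.\<close>
    have "(NN y. NN \<sigma>. ennreal (norm (?F y \<sigma>)))
      \<le> (NN y. ennreal (norm ((\<kappa> * \<epsilon> powr (- (real DIM('a) + \<beta>))) *\<^sub>R \<phi> (x + y))))"
    proof (rule nn_integral_mono)
      fix y :: 'a
      show "(NN \<sigma>. ennreal (norm (?F y \<sigma>))) \<le> ennreal (norm ((\<kappa> * \<epsilon> powr (- (real DIM('a) + \<beta>))) *\<^sub>R \<phi> (x + y)))"
      proof (cases "\<epsilon> < norm y")
        case True
        then have y: "y \<noteq> 0" using \<epsilon> by auto
        have nn0: "0 \<le> pw q \<sigma> * (heat \<sigma> y / (2 * \<sigma>))" for \<sigma> by (cases "0 < \<sigma>") (simp_all add: pw_nonpos)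
        have "(NN \<sigma>. ennreal (norm (?F y \<sigma>))) = (NN \<sigma>. ennreal \<bar>y \<bullet> \<phi> (x + y)\<bar> * ennreal (pw q \<sigma> * (heat \<sigma> y / (2 * \<sigma>))))"
        proof (rule nn_integral_cong)
          fix \<sigma> :: real
          have "norm (?F y \<sigma>) = \<bar>y \<bullet> \<phi> (x + y)\<bar> * \<bar>pw q \<sigma> * (heat \<sigma> y / (2 * \<sigma>))\<bar>"
            using True by (simp add: abs_mult)
          then show "ennreal (norm (?F y \<sigma>)) = ennreal \<bar>y \<bullet> \<phi> (x + y)\<bar> * ennreal (pw q \<sigma> * (heat \<sigma> y / (2 * \<sigma>)))"
            unfolding abs_of_nonneg[OF nn0] by (simp only: ennreal_mult'[OF abs_ge_zero])
        qed
        also have "... = ennreal \<bar>y \<bullet> \<phi> (x + y)\<bar> * ennreal (\<kappa> * norm y powr (- (real DIM('a) + \<beta> + 1)))"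
          using nn_integral_eq_integral[OF integrable_pw_heat[OF y q]] nn0 integral_pw_heat[OF y q]
          by (simp add: nn_integral_cmult e \<kappa>_def[symmetric])
        also have "... = ennreal (\<bar>y \<bullet> \<phi> (x + y)\<bar> * (\<kappa> * norm y powr (- (real DIM('a) + \<beta> + 1))))"
          by (simp add: ennreal_mult'[symmetric])
        also have "... \<le> ennreal (norm ((\<kappa> * \<epsilon> powr (- (real DIM('a) + \<beta>))) *\<^sub>R \<phi> (x + y)))"
        proof (rule ennreal_leI)
          have "\<bar>y \<bullet> \<phi> (x + y)\<bar> * (\<kappa> * norm y powr (- (real DIM('a) + \<beta> + 1))) \<le> (norm y * norm (\<phi> (x + y))) * (\<kappa> * norm y powr (- (real DIM('a) + \<beta> + 1)))"
            using \<kappa> by (intro mult_right_mono Cauchy_Schwarz_ineq2) auto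
          also have "... = \<kappa> * norm (\<phi> (x + y)) * (norm y powr 1 * norm y powr (- (real DIM('a) + \<beta> + 1)))" by simp
          also have "norm y powr 1 * norm y powr (- (real DIM('a) + \<beta> + 1)) = norm y powr (- (real DIM('a) + \<beta>))"
            by (simp only: powr_add[symmetric]) (simp add: algebra_simps)
          also have "\<kappa> * norm (\<phi> (x + y)) * norm y powr (- (real DIM('a) + \<beta>)) \<le> \<kappa> * norm (\<phi> (x + y)) * \<epsilon> powr (- (real DIM('a) + \<beta>))"
            using \<kappa> \<beta> \<epsilon> True by (intro mult_left_mono powr_mono2') auto
          finally show "\<bar>y \<bullet> \<phi> (x + y)\<bar> * (\<kappa> * norm y powr (- (real DIM('a) + \<beta> + 1))) \<le> norm ((\<kappa> * \<epsilon> powr (- (real DIM('a) + \<beta>))) *\<^sub>R \<phi> (x + y))"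
            using \<kappa> by (simp add: mult_ac)
        qed
        finally show ?thesis .
      qed simp
    qed
    also have "... < \<infinity>"
    proof -
      have "integrable lborel (\<lambda>y. (\<kappa> * \<epsilon> powr (- (real DIM('a) + \<beta>))) *\<^sub>R \<phi> (x + y))"
        using lip_test_integrable[OF \<phi>] by (intro integrable_scaleR_right) (simp add: integrable_shift)
      then show ?thesis by (simp only: integrable_iff_bounded)
    qed
    finally show ?thesis .
  qed
  have "\<kappa> * div_trunc \<beta> \<phi> x \<epsilon> = (LBINT y. LBINT \<sigma>. ?F y \<sigma>)"
    unfolding inner div_trunc_def by (rule integral_mult_right_zero[symmetric])
  also have "... = (LBINT \<sigma>. LBINT y. ?F y \<sigma>)"
    by (rule Fubini_lborel(1)[OF Fm fin])
  also have "... = (LBINT \<sigma>. pw q \<sigma> * heat_div_trunc \<epsilon> \<sigma> \<phi> x)"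
  proof (rule Bochner_Integration.integral_cong[OF refl])
    fix \<sigma> :: real
    have "?F y \<sigma> = pw q \<sigma> * (indicator {y. \<epsilon> < norm y} y * (kern \<sigma> y \<bullet> \<phi> (x + y)))" for y
      by (simp add: kern_def mult_ac)
    then show "(LBINT y. ?F y \<sigma>) = pw q \<sigma> * heat_div_trunc \<epsilon> \<sigma> \<phi> x"
      by (simp add: heat_div_trunc_def)
  qed
  finally show ?thesis by (simp add: \<kappa>_def q_def)
qed

lemma eventually_indicator_norm:
  assumes "(y::'a::real_normed_vector) \<noteq> 0"
  shows "eventually (\<lambda>\<epsilon>. indicator {y. \<epsilon> < norm y} y = (1::real)) (at_right 0)"
  using assms by (auto simp: eventually_at_right_field indicator_def intro!: exI[of _ "norm y"])

lemma tendsto_heat_div_trunc: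
  assumes \<phi>: "lip_test L (\<phi> :: 'a::euclidean_space \<Rightarrow> 'a)" and \<sigma>: "0 < \<sigma>"
  shows "((\<lambda>\<epsilon>. heat_div_trunc \<epsilon> \<sigma> \<phi> x) \<longlongrightarrow> heat_div \<sigma> \<phi> x) (at_right 0)"
  unfolding heat_div_trunc_def heat_div_def
proof (rule integral_dominated_convergence_at_right)
  note [measurable] = lip_test_measurable[OF \<phi>]
  show "integrable lborel (\<lambda>y. norm (kern \<sigma> y \<bullet> \<phi> (x + y)))"
    by (rule integrable_norm[OF integrable_kern_inner[OF \<phi> \<sigma>]])
  show "AE y in lborel. ((\<lambda>\<epsilon>. indicator {y. \<epsilon> < norm y} y * (kern \<sigma> y \<bullet> \<phi> (x + y))) \<longlongrightarrow> kern \<sigma> y \<bullet> \<phi> (x + y)) (at_right 0)"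
  proof (rule AE_I2)
    fix y :: 'a
    show "((\<lambda>\<epsilon>. indicator {y. \<epsilon> < norm y} y * (kern \<sigma> y \<bullet> \<phi> (x + y))) \<longlongrightarrow> kern \<sigma> y \<bullet> \<phi> (x + y)) (at_right 0)"
    proof (cases "y = 0")
      case False
      show ?thesis
        by (rule tendsto_eventually, rule eventually_mono[OF eventually_indicator_norm[OF False]]) simp
    qed (simp add: kern_def)
  qed
  show "(\<lambda>y. kern \<sigma> y \<bullet> \<phi> (x + y)) \<in> borel_measurable lborel" by measurable
  show "(\<lambda>y. indicator {y. \<epsilon> < norm y} y * (kern \<sigma> y \<bullet> \<phi> (x + y))) \<in> borel_measurable lborel" for \<epsilon>
    by measurable
  show "AE y in lborel. norm (indicator {y. \<epsilon> < norm y} y * (kern \<sigma> y \<bullet> \<phi> (x + y))) \<le> norm (kern \<sigma> y \<bullet> \<phi> (x + y))" for \<epsilon>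
    by (rule AE_I2) (auto simp: indicator_def)
qed

lemma integrable_pw_heat_div:
  assumes \<phi>: "lip_test L (\<phi> :: 'a::euclidean_space \<Rightarrow> 'a)" and q: "-1 < q" "q < 0"
  shows "integrable lborel (\<lambda>\<sigma>. pw q \<sigma> * min (test_bound L \<phi>) (test_bound L \<phi> / \<sigma>))"
    and "norm (pw q \<sigma> * heat_div_trunc \<epsilon> \<sigma> \<phi> x) \<le> pw q \<sigma> * min (test_bound L \<phi>) (test_bound L \<phi> / \<sigma>)"
    and "norm (pw q \<sigma> * heat_div \<sigma> \<phi> x) \<le> pw q \<sigma> * min (test_bound L \<phi>) (test_bound L \<phi> / \<sigma>)"
proof -
  have "integrable lborel (\<lambda>\<sigma>. pw q \<sigma> * min (test_bound L \<phi>) (test_bound L \<phi> / (\<sigma> + 0)))"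
    by (rule integrable_pw_decay[of _ q 0 "test_bound L \<phi>"]) (use q test_bound_nonneg[OF \<phi>] in auto)
  then show "integrable lborel (\<lambda>\<sigma>. pw q \<sigma> * min (test_bound L \<phi>) (test_bound L \<phi> / \<sigma>))" by simp
  show "norm (pw q \<sigma> * heat_div_trunc \<epsilon> \<sigma> \<phi> x) \<le> pw q \<sigma> * min (test_bound L \<phi>) (test_bound L \<phi> / \<sigma>)"
    by (cases "0 < \<sigma>") (auto simp: abs_mult pw_nonpos intro!: mult_left_mono heat_div_trunc_bounds[OF \<phi>])
  show "norm (pw q \<sigma> * heat_div \<sigma> \<phi> x) \<le> pw q \<sigma> * min (test_bound L \<phi>) (test_bound L \<phi> / \<sigma>)"
    by (cases "0 < \<sigma>") (auto simp: abs_mult pw_nonpos intro!: mult_left_mono heat_div_bounds[OF \<phi>])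
qed

text \<open>The principal value exists at every point: the truncated heat divergences are bounded
  uniformly in \<epsilon>, since the truncation set is symmetric and the kernel odd, and this bound
  dominates the limit under the \<open>\<sigma>\<close> integral.\<close>

lemma tendsto_div_trunc:
  assumes \<phi>: "lip_test L (\<phi> :: 'a::euclidean_space \<Rightarrow> 'a)" and \<beta>: "0 \<le> \<beta>" "\<beta> < 1"
  shows "(div_trunc \<beta> \<phi> x \<longlongrightarrow> (LBINT \<sigma>. pw (- (1 + \<beta>) / 2) \<sigma> * heat_div \<sigma> \<phi> x) / heat_const (real DIM('a)) (- (1 + \<beta>) / 2)) (at_right 0)"
proof -
  note [measurable] = lip_test_measurable[OF \<phi>]
  define q where "q = - (1 + \<beta>) / 2"
  have q: "-1 < q" "q < 0" using \<beta> by (simp_all add: q_def)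
  define \<kappa> where "\<kappa> = heat_const (real DIM('a)) q"
  have \<kappa>: "0 < \<kappa>" unfolding \<kappa>_def by (rule heat_const_pos[OF q])
  have "((\<lambda>\<epsilon>. LBINT \<sigma>. pw q \<sigma> * heat_div_trunc \<epsilon> \<sigma> \<phi> x) \<longlongrightarrow> (LBINT \<sigma>. pw q \<sigma> * heat_div \<sigma> \<phi> x)) (at_right 0)"
  proof (rule integral_dominated_convergence_at_right[OF _ _ integrable_pw_heat_div(1)[OF \<phi> q]])
    show "AE \<sigma> in lborel. ((\<lambda>\<epsilon>. pw q \<sigma> * heat_div_trunc \<epsilon> \<sigma> \<phi> x) \<longlongrightarrow> pw q \<sigma> * heat_div \<sigma> \<phi> x) (at_right 0)"
    proof (rule AE_I2)
      fix \<sigma> :: real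
      show "((\<lambda>\<epsilon>. pw q \<sigma> * heat_div_trunc \<epsilon> \<sigma> \<phi> x) \<longlongrightarrow> pw q \<sigma> * heat_div \<sigma> \<phi> x) (at_right 0)"
      proof (cases "0 < \<sigma>")
        case True
        show ?thesis by (rule tendsto_mult_left[OF tendsto_heat_div_trunc[OF \<phi> True]])
      qed (simp add: pw_nonpos)
    qed
    show "(\<lambda>\<sigma>. pw q \<sigma> * heat_div \<sigma> \<phi> x) \<in> borel_measurable lborel" by measurable
    show "(\<lambda>\<sigma>. pw q \<sigma> * heat_div_trunc \<epsilon> \<sigma> \<phi> x) \<in> borel_measurable lborel" for \<epsilon>
      by measurable
    show "AE \<sigma> in lborel. norm (pw q \<sigma> * heat_div_trunc \<epsilon> \<sigma> \<phi> x) \<le> pw q \<sigma> * min (test_bound L \<phi>) (test_bound L \<phi> / \<sigma>)" for \<epsilon>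
      by (rule AE_I2) (rule integrable_pw_heat_div(2)[OF \<phi> q])
  qed
  then have "((\<lambda>\<epsilon>. (LBINT \<sigma>. pw q \<sigma> * heat_div_trunc \<epsilon> \<sigma> \<phi> x) / \<kappa>) \<longlongrightarrow> (LBINT \<sigma>. pw q \<sigma> * heat_div \<sigma> \<phi> x) / \<kappa>) (at_right 0)"
    using \<kappa> by (intro tendsto_divide tendsto_const) auto
  moreover have "eventually (\<lambda>\<epsilon>. (LBINT \<sigma>. pw q \<sigma> * heat_div_trunc \<epsilon> \<sigma> \<phi> x) / \<kappa> = div_trunc \<beta> \<phi> x \<epsilon>) (at_right 0)"
    unfolding eventually_at_right_field
  proof (intro exI[of _ 1] conjI allI impI)
    fix \<epsilon> :: real assume "0 < \<epsilon>"
    then have "\<kappa> * div_trunc \<beta> \<phi> x \<epsilon> = (LBINT \<sigma>. pw q \<sigma> * heat_div_trunc \<epsilon> \<sigma> \<phi> x)"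
      using div_trunc_eq_heat[OF \<phi> \<beta>] by (simp add: \<kappa>_def q_def)
    then show "(LBINT \<sigma>. pw q \<sigma> * heat_div_trunc \<epsilon> \<sigma> \<phi> x) / \<kappa> = div_trunc \<beta> \<phi> x \<epsilon>"
      using \<kappa> by (simp add: field_simps)
  qed simp
  ultimately show ?thesis
    unfolding \<kappa>_def q_def by (rule Lim_transform_eventually)
qed

text \<open>The weight \<open>v\<close> covers two cases: the constant 1 for the full fractional
  divergence, and \<open>cut \<delta>\<close> for the truncated Riesz pairing.\<close>

lemma integral_heat_div_superposition:
  fixes v :: "real \<Rightarrow> real"
  assumes f: "integrable lborel f" and \<phi>: "lip_test L (\<phi> :: 'a::euclidean_space \<Rightarrow> 'a)" and q: "-1 < q" "q < 0"
    and [measurable]: "v \<in> borel_measurable borel" and v: "\<And>\<sigma>. \<bar>v \<sigma>\<bar> \<le> 1"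
  shows "(LBINT x. f x * (LBINT \<sigma>. v \<sigma> * (pw q \<sigma> * heat_div \<sigma> \<phi> x))) = (LBINT \<sigma>. v \<sigma> * (pw q \<sigma> * heat_pairing f \<phi> \<sigma>))"
proof -
  note [measurable] = lip_test_measurable[OF \<phi>] borel_measurable_integrable[OF f, simplified]
  define w where "w = (\<lambda>\<sigma>. pw q \<sigma> * min (test_bound L \<phi>) (test_bound L \<phi> / \<sigma>))"
  have w: "integrable lborel w" "\<And>\<sigma> x. norm (pw q \<sigma> * heat_div \<sigma> \<phi> x) \<le> w \<sigma>"
    unfolding w_def by (rule integrable_pw_heat_div[OF \<phi> q])+
  have w0: "0 \<le> w \<sigma>" for \<sigma> using w(2)[of \<sigma> undefined] by (rule order_trans[OF norm_ge_zero])
  let ?F = "\<lambda>x \<sigma>. f x * (v \<sigma> * (pw q \<sigma> * heat_div \<sigma> \<phi> x))"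
  have Fm: "(\<lambda>(x, \<sigma>). ?F x \<sigma>) \<in> borel_measurable (lborel \<Otimes>\<^sub>M lborel)" by measurable
  have "(NN x. NN \<sigma>. ennreal (norm (?F x \<sigma>))) \<le> (NN x. NN \<sigma>. ennreal (norm (f x)) * ennreal (norm (w \<sigma>)))"
  proof (intro nn_integral_mono)
    fix x \<sigma>
    have "\<bar>v \<sigma>\<bar> * norm (pw q \<sigma> * heat_div \<sigma> \<phi> x) \<le> 1 * w \<sigma>" by (intro mult_mono w v) auto
    then have "norm (?F x \<sigma>) \<le> norm (f x) * norm (w \<sigma>)"
      using w0 by (simp add: abs_mult mult_left_mono)
    then show "ennreal (norm (?F x \<sigma>)) \<le> ennreal (norm (f x)) * ennreal (norm (w \<sigma>))"
      by (simp add: ennreal_mult'[symmetric] ennreal_leI)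
  qed
  also have "... = (NN x. ennreal (norm (f x))) * (NN \<sigma>. ennreal (norm (w \<sigma>)))"
    using w by (simp add: nn_integral_cmult nn_integral_multc)
  also have "... < \<infinity>" using f w(1) by (simp only: integrable_iff_bounded) (simp add: ennreal_mult_less_top)
  finally have fin: "(NN x. NN \<sigma>. ennreal (norm (?F x \<sigma>))) < \<infinity>" .
  have "(LBINT x. f x * (LBINT \<sigma>. v \<sigma> * (pw q \<sigma> * heat_div \<sigma> \<phi> x))) = (LBINT x. LBINT \<sigma>. ?F x \<sigma>)"
    by simp
  also have "... = (LBINT \<sigma>. LBINT x. ?F x \<sigma>)" by (rule Fubini_lborel(1)[OF Fm fin])
  also have "... = (LBINT \<sigma>. v \<sigma> * (pw q \<sigma> * heat_pairing f \<phi> \<sigma>))"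
  proof (rule Bochner_Integration.integral_cong[OF refl])
    fix \<sigma>
    have eq: "?F x \<sigma> = v \<sigma> * pw q \<sigma> * (f x * heat_div \<sigma> \<phi> x)" for x by simp
    show "(LBINT x. ?F x \<sigma>) = v \<sigma> * (pw q \<sigma> * heat_pairing f \<phi> \<sigma>)"
      unfolding eq heat_pairing_def integral_mult_right_zero by simp
  qed
  finally show ?thesis .
qed

section \<open>The truncated Riesz transform: square integrability and smoothness\<close>

text \<open>A correlation and not a convolution, to match the argument \<open>x + y\<close> in the
  Riesz transform.\<close>

definition vconv :: "('a::euclidean_space \<Rightarrow> 'a) \<Rightarrow> ('a \<Rightarrow> real) \<Rightarrow> 'a \<Rightarrow> 'a" where
  "vconv k u x = (LBINT y. u (x + y) *\<^sub>R k y)"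

lemma vconv_measurable[measurable (raw)]:
  assumes [measurable]: "k \<in> borel_measurable borel" "u \<in> borel_measurable borel" "g \<in> borel_measurable M"
  shows "(\<lambda>x. vconv k u (g x :: 'a::euclidean_space)) \<in> borel_measurable M"
  unfolding vconv_def by measurable

definition autocorr :: "('a::euclidean_space \<Rightarrow> real) \<Rightarrow> 'a \<Rightarrow> real" where
  "autocorr u w = (LBINT x. u x * u (x + w))"

lemma autocorr_measurable[measurable]:
  assumes [measurable]: "u \<in> borel_measurable borel"
  shows "autocorr u \<in> borel_measurable borel"
  unfolding autocorr_def by measurable

lemma abs_autocorr_le:
  assumes [measurable]: "u \<in> borel_measurable borel" and sq: "integrable lborel (\<lambda>x. (u x)\<^sup>2)"
  shows "\<bar>autocorr u w\<bar> \<le> (LBINT x. (u x)\<^sup>2)"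
proof -
  have sh: "integrable lborel (\<lambda>x. (u (x + w))\<^sup>2)"
    using sq integrable_shift[of "\<lambda>x. (u x)\<^sup>2" w] by (simp add: add.commute)
  have i: "integrable lborel (\<lambda>x. ((u x)\<^sup>2 + (u (x + w))\<^sup>2) / 2)" using sq sh by simp
  have le: "\<bar>u x * u (x + w)\<bar> \<le> ((u x)\<^sup>2 + (u (x + w))\<^sup>2) / 2" for x
  proof -
    have "0 \<le> (\<bar>u x\<bar> - \<bar>u (x + w)\<bar>)\<^sup>2" by simp
    then show ?thesis by (simp add: power2_diff abs_mult)
  qed
  have i2: "integrable lborel (\<lambda>x. u x * u (x + w))"
    by (rule Bochner_Integration.integrable_bound[OF i]) (use le in \<open>auto simp: order_trans[OF le abs_ge_self]\<close>)
  have "norm (autocorr u w) \<le> (LBINT x. ((u x)\<^sup>2 + (u (x + w))\<^sup>2) / 2)"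
    unfolding autocorr_def by (rule Bochner_Integration.integral_norm_bound_integral) (use i i2 le in auto)
  also have "... = ((LBINT x. (u x)\<^sup>2) + (LBINT x. (u (x + w))\<^sup>2)) / 2"
    using sq sh by simp
  also have "(LBINT x. (u (x + w))\<^sup>2) = (LBINT x. (u x)\<^sup>2)"
    using integral_shift[of "\<lambda>x. (u x)\<^sup>2" w] by (simp add: add.commute)
  finally show ?thesis by simp
qed

lemma integrable_finite_nn:
  fixes k :: "'a::euclidean_space \<Rightarrow> 'b::{banach,second_countable_topology}"
  assumes "integrable lborel k"
  shows "(NN y. ennreal (norm (k y))) = ennreal (LBINT y. norm (k y))"
  using assms by (intro nn_integral_eq_integral) auto

lemma
  fixes k :: "'a::euclidean_space \<Rightarrow> 'a" and u :: "'a \<Rightarrow> real"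
  assumes k: "integrable lborel k" and u: "integrable lborel u" and B: "\<And>x. \<bar>u x\<bar> \<le> B"
  shows integrable_vconv: "integrable lborel (vconv k u)"
    and norm_vconv_le: "norm (vconv k u x) \<le> B * (LBINT y. norm (k y))"
    and integrable_vconv_integrand: "integrable lborel (\<lambda>y. u (x + y) *\<^sub>R k y)"
proof -
  have [measurable]: "k \<in> borel_measurable borel" "u \<in> borel_measurable borel"
    using k u by (auto dest: borel_measurable_integrable)
  let ?F = "\<lambda>x y. u (x + y) *\<^sub>R k y"
  have B0: "0 \<le> B" using B[of 0] by linarith
  have "(NN x. NN y. ennreal (norm (?F x y))) = (NN y. NN x. ennreal (norm (?F x y)))"
    by (rule lborel_pair.Fubini'[symmetric]) measurable
  also have "... = (NN y. ennreal (norm (k y)) * (NN x. ennreal (norm (u (y + x)))))"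
  proof (rule nn_integral_cong)
    fix y
    have "(NN x. ennreal (norm (k y)) * ennreal (norm (u (y + x)))) = ennreal (norm (k y)) * (NN x. ennreal (norm (u (y + x))))"
      by (rule nn_integral_cmult) measurable
    then show "(NN x. ennreal (norm (?F x y))) = ennreal (norm (k y)) * (NN x. ennreal (norm (u (y + x))))"
      by (simp add: ennreal_mult mult.commute add.commute)
  qed
  also have "... = (NN y. ennreal (norm (k y)) * (NN x. ennreal (norm (u x))))"
    by (subst nn_integral_shift[of "\<lambda>x. ennreal (norm (u x))"]) auto
  also have "... = (NN y. ennreal (norm (k y))) * (NN x. ennreal (norm (u x)))"
    by (rule nn_integral_multc) simp
  also have "... < \<infinity>"
    unfolding integrable_finite_nn[OF k] integrable_finite_nn[OF u] by (simp add: ennreal_mult_less_top)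
  finally have fin: "(NN x. NN y. ennreal (norm (?F x y))) < \<infinity>" .
  show "integrable lborel (vconv k u)"
    unfolding vconv_def by (rule Fubini_lborel(2)[OF _ fin]) measurable
  have ptw: "norm (?F x y) \<le> B * norm (k y)" for x y by (simp add: mult_right_mono B)
  show i: "integrable lborel (\<lambda>y. ?F x y)" for x
    by (rule Bochner_Integration.integrable_bound[OF integrable_mult_right[OF integrable_norm[OF k], of B]])
      (use ptw B0 in auto)
  have "norm (vconv k u x) \<le> (LBINT y. B * norm (k y))"
    unfolding vconv_def
    by (rule Bochner_Integration.integral_norm_bound_integral) (use i ptw k in auto)
  then show "norm (vconv k u x) \<le> B * (LBINT y. norm (k y))" by simp
qed

text \<open>Stands in for Plancherel's identity: the function enters only through its
  autocorrelation, and the kernels only through their own correlation, which is explicit for heat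
  gradients.\<close>

lemma integral_vconv_inner_vconv:
  fixes k l :: "'a::euclidean_space \<Rightarrow> 'a" and u :: "'a \<Rightarrow> real"
  assumes k: "integrable lborel k" and l: "integrable lborel l" and u: "integrable lborel u" and B: "\<And>x. \<bar>u x\<bar> \<le> B"
  shows "(LBINT x. vconv k u x \<bullet> vconv l u x) = (LBINT w. autocorr u w * (LBINT y. k y \<bullet> l (w + y)))"
proof -
  have [measurable]: "k \<in> borel_measurable borel" "l \<in> borel_measurable borel" "u \<in> borel_measurable borel"
    using k l u by (auto dest: borel_measurable_integrable)
  have B0: "0 \<le> B" using B[of 0] by linarith
  define kI where "kI = (LBINT y. norm (k y))"
  define lI where "lI = (LBINT y. norm (l y))"
  have kI: "(NN y. ennreal (norm (k y))) = ennreal kI" "0 \<le> kI" and lI: "(NN y. ennreal (norm (l y))) = ennreal lI" "0 \<le> lI"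
    by (simp_all add: kI_def lI_def integrable_finite_nn k l)
  \<comment> \<open>Absorbs the innermost integral, so that each exchange below concerns two
    variables only.\<close>
  define H where "H = (\<lambda>z y. LBINT w. u (z + w) * (k y \<bullet> l (w + y)))"
  have Hm[measurable]: "(\<lambda>(z, y). H z y) \<in> borel_measurable (borel \<Otimes>\<^sub>M borel)" unfolding H_def by measurable
  have shl: "(NN w. ennreal (norm (l (w + y)))) = ennreal lI" for y
    using nn_integral_shift[of "\<lambda>w. ennreal (norm (l w))" y] lI by (simp add: add.commute)
  have nnw: "(NN w. ennreal (norm (u (z + w) * (k y \<bullet> l (w + y))))) \<le> ennreal (B * (norm (k y) * lI))" for z y
  proof -
    have "(NN w. ennreal (norm (u (z + w) * (k y \<bullet> l (w + y))))) \<le> (NN w. ennreal (B * norm (k y)) * ennreal (norm (l (w + y))))"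
    proof (rule nn_integral_mono)
      fix w
      have "norm (u (z + w) * (k y \<bullet> l (w + y))) \<le> B * (norm (k y) * norm (l (w + y)))"
        unfolding real_norm_def abs_mult by (intro mult_mono B Cauchy_Schwarz_ineq2 B0) auto
      then show "ennreal (norm (u (z + w) * (k y \<bullet> l (w + y)))) \<le> ennreal (B * norm (k y)) * ennreal (norm (l (w + y)))"
        using B0 by (simp add: ennreal_mult'[symmetric] ennreal_leI mult.assoc)
    qed
    also have "... = ennreal (B * norm (k y)) * ennreal lI"
      by (simp add: nn_integral_cmult shl)
    finally show ?thesis using B0 lI by (simp add: ennreal_mult'[symmetric] mult.assoc)
  qed
  have Hle: "norm (H z y) \<le> B * (norm (k y) * lI)" for z y
    unfolding H_def by (rule norm_integral_le_nn[OF nnw]) (use B0 lI in simp)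
  have e1: "vconv k u x \<bullet> vconv l u x = (LBINT y. u (x + y) * H (x + y) y)" for x
  proof -
    have "vconv k u x \<bullet> vconv l u x = (LBINT y. (u (x + y) *\<^sub>R k y) \<bullet> vconv l u x)"
      unfolding vconv_def[of k] by (rule integral_inner_left[symmetric]) (rule integrable_vconv_integrand[OF k u B])
    also have "... = (LBINT y. u (x + y) * H (x + y) y)"
    proof (rule Bochner_Integration.integral_cong[OF refl])
      fix y
      have "vconv l u x = (LBINT w. u (x + (y + w)) *\<^sub>R l (y + w))"
        unfolding vconv_def by (rule integral_shift[symmetric]) measurable
      moreover have "integrable lborel (\<lambda>w. u (x + (y + w)) *\<^sub>R l (y + w))"
        using integrable_shift[of "\<lambda>w. u (x + w) *\<^sub>R l w" y] integrable_vconv_integrand[OF l u B] by simp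
      ultimately have "k y \<bullet> vconv l u x = H (x + y) y"
        by (simp add: H_def integral_inner_right[symmetric] add_ac)
      then show "(u (x + y) *\<^sub>R k y) \<bullet> vconv l u x = u (x + y) * H (x + y) y" by simp
    qed
    finally show ?thesis .
  qed
  have "(LBINT x. vconv k u x \<bullet> vconv l u x) = (LBINT x. LBINT y. u (x + y) * H (x + y) y)"
    unfolding e1 ..
  also have "... = (LBINT y. LBINT x. u (x + y) * H (x + y) y)"
  proof (rule Fubini_lborel(1))
    have "(NN x. NN y. ennreal (norm (u (x + y) * H (x + y) y)))
      \<le> (NN x. NN y. ennreal (norm (u (x + y))) * (ennreal (B * lI) * ennreal (norm (k y))))"
    proof (intro nn_integral_mono)
      fix x y
      have "norm (u (x + y) * H (x + y) y) \<le> norm (u (x + y)) * (B * (norm (k y) * lI))"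
        unfolding norm_mult by (rule mult_left_mono[OF Hle]) simp
      then show "ennreal (norm (u (x + y) * H (x + y) y)) \<le> ennreal (norm (u (x + y))) * (ennreal (B * lI) * ennreal (norm (k y)))"
        using B0 lI by (simp add: ennreal_mult'[symmetric] ennreal_leI mult_ac)
    qed
    also have "... = (NN y. NN x. ennreal (norm (u (x + y))) * (ennreal (B * lI) * ennreal (norm (k y))))"
      by (rule lborel_pair.Fubini'[symmetric]) measurable
    also have "... = (NN y. ennreal (LBINT x. norm (u x)) * (ennreal (B * lI) * ennreal (norm (k y))))"
    proof (rule nn_integral_cong)
      fix y
      have "(NN x. ennreal (norm (u (x + y)))) = ennreal (LBINT x. norm (u x))"
        using nn_integral_shift[of "\<lambda>w. ennreal (norm (u w))" y] integrable_finite_nn[OF u] by (simp add: add.commute)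
      then show "(NN x. ennreal (norm (u (x + y))) * (ennreal (B * lI) * ennreal (norm (k y)))) = ennreal (LBINT x. norm (u x)) * (ennreal (B * lI) * ennreal (norm (k y)))"
        by (subst nn_integral_multc) auto
    qed
    also have "... = ennreal (LBINT x. norm (u x)) * (ennreal (B * lI) * ennreal kI)"
      by (subst nn_integral_cmult, simp, subst nn_integral_cmult, simp, simp only: kI)
    also have "... < \<infinity>" by (simp add: ennreal_mult_less_top)
    finally show "(NN x. NN y. ennreal (norm (u (x + y) * H (x + y) y))) < \<infinity>" .
  qed measurable
  also have "... = (LBINT y. LBINT z. u z * H z y)"
  proof (rule Bochner_Integration.integral_cong[OF refl])
    fix y
    show "(LBINT x. u (x + y) * H (x + y) y) = (LBINT z. u z * H z y)"
      using integral_shift[of "\<lambda>z. u z * H z y" y] by (simp add: add.commute)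
  qed
  also have "... = (LBINT y. LBINT w. autocorr u w * (k y \<bullet> l (w + y)))"
  proof (rule Bochner_Integration.integral_cong[OF refl])
    fix y
    have "(LBINT z. u z * H z y) = (LBINT z. LBINT w. u z * (u (z + w) * (k y \<bullet> l (w + y))))"
      by (simp add: H_def)
    also have "... = (LBINT w. LBINT z. u z * (u (z + w) * (k y \<bullet> l (w + y))))"
    proof (rule Fubini_lborel(1))
      have "(NN z. NN w. ennreal (norm (u z * (u (z + w) * (k y \<bullet> l (w + y))))))
        \<le> (NN z. ennreal (norm (u z)) * ennreal (B * (norm (k y) * lI)))"
      proof (rule nn_integral_mono)
        fix z
        have "(NN w. ennreal (norm (u z * (u (z + w) * (k y \<bullet> l (w + y))))))
          = ennreal (norm (u z)) * (NN w. ennreal (norm (u (z + w) * (k y \<bullet> l (w + y)))))"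
          unfolding norm_mult[of "u z"] by (subst nn_integral_cmult[symmetric]) (auto simp: ennreal_mult')
        also have "... \<le> ennreal (norm (u z)) * ennreal (B * (norm (k y) * lI))"
          by (intro mult_left_mono nnw) simp
        finally show "(NN w. ennreal (norm (u z * (u (z + w) * (k y \<bullet> l (w + y)))))) \<le> ennreal (norm (u z)) * ennreal (B * (norm (k y) * lI))" .
      qed
      also have "... = ennreal (LBINT x. norm (u x)) * ennreal (B * (norm (k y) * lI))"
        by (subst nn_integral_multc) (simp_all add: integrable_finite_nn[OF u, simplified])
      also have "... < \<infinity>" by (simp add: ennreal_mult_less_top)
      finally show "(NN z. NN w. ennreal (norm (u z * (u (z + w) * (k y \<bullet> l (w + y)))))) < \<infinity>" .
    qed measurable
    also have "... = (LBINT w. autocorr u w * (k y \<bullet> l (w + y)))"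
    proof (rule Bochner_Integration.integral_cong[OF refl])
      fix w
      have eq: "u z * (u (z + w) * (k y \<bullet> l (w + y))) = u z * u (z + w) * (k y \<bullet> l (w + y))" for z by simp
      show "(LBINT z. u z * (u (z + w) * (k y \<bullet> l (w + y)))) = autocorr u w * (k y \<bullet> l (w + y))"
        unfolding eq autocorr_def by (rule integral_mult_left_zero)
    qed
    finally show "(LBINT z. u z * H z y) = (LBINT w. autocorr u w * (k y \<bullet> l (w + y)))" .
  qed
  also have "... = (LBINT w. LBINT y. autocorr u w * (k y \<bullet> l (w + y)))"
  proof (rule Fubini_lborel(1))
    define Q where "Q = (LBINT x. \<bar>u x\<bar>) * B"
    have Q0: "0 \<le> Q" using B0 by (simp add: Q_def)
    have Q: "\<bar>autocorr u w\<bar> \<le> Q" for w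
      unfolding autocorr_def Q_def by (rule integral_mult_bound(2)[OF u _ B]) measurable
    have "(NN y. NN w. ennreal (norm (autocorr u w * (k y \<bullet> l (w + y)))))
      \<le> (NN y. NN w. ennreal (Q * norm (k y)) * ennreal (norm (l (w + y))))"
    proof (intro nn_integral_mono)
      fix y w
      have "norm (autocorr u w * (k y \<bullet> l (w + y))) \<le> Q * (norm (k y) * norm (l (w + y)))"
        unfolding real_norm_def abs_mult by (intro mult_mono Q Cauchy_Schwarz_ineq2 Q0) auto
      then show "ennreal (norm (autocorr u w * (k y \<bullet> l (w + y)))) \<le> ennreal (Q * norm (k y)) * ennreal (norm (l (w + y)))"
        using Q0 by (simp add: ennreal_mult'[symmetric] ennreal_leI mult.assoc)
    qed
    also have "... = (NN y. ennreal (Q * lI) * ennreal (norm (k y)))"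
    proof (rule nn_integral_cong)
      fix y
      have "(NN w. ennreal (Q * norm (k y)) * ennreal (norm (l (w + y)))) = ennreal (Q * norm (k y)) * ennreal lI"
        by (subst nn_integral_cmult) (simp_all only: shl, measurable)
      then show "(NN w. ennreal (Q * norm (k y)) * ennreal (norm (l (w + y)))) = ennreal (Q * lI) * ennreal (norm (k y))"
        using Q0 lI by (simp add: ennreal_mult'[symmetric] mult_ac)
    qed
    also have "... = ennreal (Q * lI) * ennreal kI" by (subst nn_integral_cmult) (simp_all add: kI)
    also have "... < \<infinity>" by (simp add: ennreal_mult_less_top)
    finally show "(NN y. NN w. ennreal (norm (autocorr u w * (k y \<bullet> l (w + y))))) < \<infinity>" .
  qed measurable
  also have "... = (LBINT w. autocorr u w * (LBINT y. k y \<bullet> l (w + y)))" by simp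
  finally show ?thesis .
qed

text \<open>
  \<open>energy u s\<close> is \<open>- d/ds \<langle>heat s * u, u\<rangle>\<close>; it equals \<open>\<parallel>\<nabla> heat (s/2) * u\<parallel>\<^sup>2\<close>, hence is nonnegative,
  and its integral over any interval is at most \<open>2 \<parallel>u\<parallel>\<^sup>2\<close>.
\<close>

definition energy :: "('a::euclidean_space \<Rightarrow> real) \<Rightarrow> real \<Rightarrow> real" where
  "energy u s = - (LBINT w. autocorr u w * heat_dt s w)"

lemma energy_measurable[measurable (raw)]:
  assumes [measurable]: "u \<in> borel_measurable borel" "g \<in> borel_measurable M"
  shows "(\<lambda>x. energy u (g x)) \<in> borel_measurable M"
  unfolding energy_def by measurable

lemma energy_nonneg:
  fixes u :: "'a::euclidean_space \<Rightarrow> real"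
  assumes u: "integrable lborel u" and B: "\<And>x. \<bar>u x\<bar> \<le> B" and s: "0 < s"
  shows "0 \<le> energy u s"
proof -
  have h: "0 < s / 2" using s by simp
  have "0 \<le> (LBINT x. vconv (kern (s / 2)) u x \<bullet> vconv (kern (s / 2)) u x)" by simp
  also have "... = energy u s"
    unfolding integral_vconv_inner_vconv[OF integrable_kern[OF h] integrable_kern[OF h] u B] integral_kern_inner_kern[OF h h]
    by (simp add: energy_def)
  finally show ?thesis .
qed

text \<open>Integrating minus the time derivative leaves the difference of \<open>heat s\<close> and
  \<open>heat t\<close> against the autocorrelation. The latter is bounded by the squared L2 norm of
  \<open>u\<close>, and each kernel has mass 1.\<close>

lemma nn_integral_energy:
  fixes u :: "'a::euclidean_space \<Rightarrow> real"
  assumes u: "integrable lborel u" and B: "\<And>x. \<bar>u x\<bar> \<le> B" and st: "0 < s" "s \<le> t"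
    and sq: "integrable lborel (\<lambda>x. (u x)\<^sup>2)"
  shows "(NN r. ennreal (energy u r) * indicator {s..t} r) \<le> ennreal (2 * (LBINT x. (u x)\<^sup>2))"
proof -
  have [measurable]: "u \<in> borel_measurable borel"
    using u by (auto dest: borel_measurable_integrable)
  define Q where "Q = (LBINT x. (u x)\<^sup>2)"
  have Q: "\<bar>autocorr u w\<bar> \<le> Q" for w unfolding Q_def by (rule abs_autocorr_le[OF _ sq]) simp
  have Q0: "0 \<le> Q" by (simp add: Q_def)
  let ?F = "\<lambda>r w. indicator {s..t} r * (autocorr u w * heat_dt r w)"
  have Fm: "(\<lambda>(r, w). ?F r w) \<in> borel_measurable (lborel \<Otimes>\<^sub>M lborel)" by measurable
  have "(NN r. NN w. ennreal (norm (?F r w))) \<le> (NN r. ennreal (Q * (real DIM('a) / s)) * indicator {s..t} r)"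
  proof (rule nn_integral_mono)
    fix r
    show "(NN w. ennreal (norm (?F r w))) \<le> ennreal (Q * (real DIM('a) / s)) * indicator {s..t} r"
    proof (cases "r \<in> {s..t}")
      case True
      then have r: "0 < r" using st by simp
      have "(NN w. ennreal (norm (?F r w))) \<le> (NN w. ennreal Q * ennreal \<bar>heat_dt r (w::'a)\<bar>)"
        using True Q Q0 by (intro nn_integral_mono) (simp add: abs_mult ennreal_mult'[symmetric] ennreal_leI mult_right_mono)
      also have "... = ennreal Q * (NN w. ennreal \<bar>heat_dt r (w::'a)\<bar>)" by (rule nn_integral_cmult) simp
      also have "... \<le> ennreal Q * ennreal (real DIM('a) / r)" by (intro mult_left_mono nn_integral_abs_heat_dt r) simp
      also have "... \<le> ennreal (Q * (real DIM('a) / s))"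
        using Q0 True st r by (subst ennreal_mult'[symmetric]) (auto intro!: ennreal_leI mult_left_mono divide_left_mono)
      finally show ?thesis using True by simp
    qed simp
  qed
  also have "... < \<infinity>" using st by (simp add: nn_integral_cmult ennreal_mult_less_top)
  finally have fin: "(NN r. NN w. ennreal (norm (?F r w))) < \<infinity>" .
  have inner: "(LBINT w. ?F r w) = - (indicator {s..t} r * energy u r)" for r by (simp add: energy_def)
  have FTC: "(LBINT r. ?F r w) = autocorr u w * (heat t w - heat s w)" for w
  proof -
    have "has_bochner_integral lborel (\<lambda>r. indicator {s..t} r *\<^sub>R heat_dt r w) (heat t w - heat s w)"
    proof (rule has_bochner_integral_FTC_Icc)
      show "continuous_on {s..t} (\<lambda>r. heat_dt r w)"
        unfolding heat_dt_def heat_def using st by (auto intro!: continuous_intros)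
      show "((\<lambda>r. heat r w) has_vector_derivative heat_dt r w) (at r within {s..t})" if "s \<le> r" "r \<le> t" for r
        using has_derivative_heat_time[of r w] that st
        by (simp add: has_real_derivative_iff_has_vector_derivative has_vector_derivative_at_within)
    qed (rule st)
    then have "(LBINT r. indicator {s..t} r * heat_dt r w) = heat t w - heat s w"
      by (simp add: has_bochner_integral_integral_eq)
    moreover have eq: "?F r w = autocorr u w * (indicator {s..t} r * heat_dt r w)" for r by simp
    ultimately show ?thesis unfolding eq integral_mult_right_zero by simp
  qed
  have "(LBINT r. indicator {s..t} r * energy u r) = - (LBINT r. LBINT w. ?F r w)"
    unfolding inner by simp
  also have "(LBINT r. LBINT w. ?F r w) = (LBINT w. (heat t w - heat s w) * autocorr u w)"
    unfolding Fubini_lborel(1)[OF Fm fin] FTC by (simp add: mult.commute)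
  also have "\<bar>- (LBINT w. (heat t w - heat s w) * autocorr u w)\<bar> \<le> (LBINT w. \<bar>heat t (w::'a) - heat s w\<bar>) * Q"
    unfolding abs_minus_cancel
    by (rule integral_mult_bound(2)) (use st Q in auto)
  also have "... \<le> 2 * Q"
  proof (rule mult_right_mono[OF _ Q0])
    have "(LBINT w. \<bar>heat t (w::'a) - heat s w\<bar>) \<le> (LBINT w. heat t (w::'a) + heat s w)"
    proof (rule integral_mono)
      show "\<bar>heat t w - heat s w\<bar> \<le> heat t w + heat s w" for w :: 'a
        using heat_nonneg[of t w] heat_nonneg[of s w] by linarith
    qed (use st in auto)
    also have "... = 2" using st by simp
    finally show "(LBINT w. \<bar>heat t (w::'a) - heat s w\<bar>) \<le> 2" .
  qed
  finally have le: "\<bar>LBINT r. indicator {s..t} r * energy u r\<bar> \<le> 2 * Q" .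
  have int: "integrable lborel (\<lambda>r. indicator {s..t} r * energy u r)"
    using Bochner_Integration.integrable_minus[OF Fubini_lborel(2)[OF Fm fin]] unfolding inner by simp
  have nonneg: "0 \<le> indicator {s..t} r * energy u r" for r
    using energy_nonneg[OF u B, of r] st by (auto simp: indicator_def)
  have "(NN r. ennreal (energy u r) * indicator {s..t} r) = (NN r. ennreal (indicator {s..t} r * energy u r))"
    by (intro nn_integral_cong) (auto simp: indicator_def)
  also have "... = ennreal (LBINT r. indicator {s..t} r * energy u r)"
    by (rule nn_integral_eq_integral[OF int]) (use nonneg in simp)
  also have "... \<le> ennreal (2 * Q)" using le by (intro ennreal_leI) simp
  finally show ?thesis by (simp add: Q_def)
qed

section \<open>The Riesz kernel truncated in heat time\<close>

definition cut :: "real \<Rightarrow> real \<Rightarrow> real" where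
  "cut \<delta> \<sigma> = (if \<delta> < \<sigma> \<and> \<sigma> * \<delta> \<le> 1 then 1 else 0)"

text \<open>The exponent -1/2 belongs to \<beta> = 0. Cutting small times makes the resulting kernel
  bounded; cutting both ends makes it integrable, the uncut integral being logarithmically divergent
  there.\<close>

definition cutw :: "real \<Rightarrow> real \<Rightarrow> real" where
  "cutw \<delta> \<sigma> = cut \<delta> \<sigma> * pw (- 1 / 2) \<sigma>"

lemma cut_measurable[measurable]: "cut \<delta> \<in> borel_measurable borel"
  unfolding cut_def by measurable

lemma cutw_measurable[measurable]: "cutw \<delta> \<in> borel_measurable borel"
  unfolding cutw_def by measurable

lemma abs_cut_le: "\<bar>cut \<delta> \<sigma>\<bar> \<le> 1" by (simp add: cut_def)

lemma cutw_nonneg[simp]: "0 \<le> cutw \<delta> \<sigma>" by (simp add: cutw_def cut_def)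

lemma cutw_le: "cutw \<delta> \<sigma> \<le> pw (- 1 / 2) \<sigma>" by (simp add: cutw_def cut_def)

lemma cutw_eq_0: "\<sigma> \<le> \<delta> \<Longrightarrow> cutw \<delta> \<sigma> = 0" by (simp add: cutw_def cut_def)

lemma integrable_cutw:
  assumes "0 < \<delta>"
  shows "integrable lborel (cutw \<delta>)"
proof (rule integrableI_nn_le)
  have "(NN \<sigma>. ennreal (norm (cutw \<delta> \<sigma>))) \<le> (NN \<sigma>. ennreal (pw (- 1 / 2) \<sigma>) * indicator {..1 / \<delta>} \<sigma>)"
    using assms by (intro nn_integral_mono) (auto simp: cutw_def cut_def indicator_def field_simps)
  also have "... = ennreal ((1 / \<delta>) powr (1 / 2) / (1 / 2))"
    using nn_integral_pw_head[of "- 1 / 2" "1 / \<delta>"] assms by simp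
  finally show "(NN \<sigma>. ennreal (norm (cutw \<delta> \<sigma>))) \<le> ..." .
qed simp

text \<open>As \<open>\<delta>\<close> tends to 0 this approximates
  \<open>heat_const n (- 1 / 2)\<close> times \<open>y / norm y ^ (n + 1)\<close>, the Riesz kernel
  without its normalisation \<open>frac_mu\<close>. For fixed \<open>\<delta>\<close> it is bounded
  and integrable, so no principal value is involved.\<close>

definition riesz_kern :: "real \<Rightarrow> 'a::euclidean_space \<Rightarrow> 'a" where
  "riesz_kern \<delta> y = (LBINT \<sigma>. cutw \<delta> \<sigma> *\<^sub>R kern \<sigma> y)"

lemma riesz_kern_measurable[measurable]: "riesz_kern \<delta> \<in> borel_measurable borel"
  unfolding riesz_kern_def by measurable

lemma riesz_kern_minus: "riesz_kern \<delta> (- y) = - riesz_kern \<delta> y"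
  by (simp add: riesz_kern_def)

lemma norm_cutw_kern_le:
  assumes \<delta>: "0 < \<delta>"
  shows "norm (cutw \<delta> \<sigma> *\<^sub>R kern \<sigma> (y::'a::euclidean_space)) \<le> \<delta> powr (- (real DIM('a) + 1) / 2) * cutw \<delta> \<sigma>"
proof (cases "\<sigma> \<le> \<delta>")
  case False
  then have "norm (kern \<sigma> y) \<le> \<sigma> powr (- (real DIM('a) + 1) / 2)" using \<delta> by (intro norm_kern_le) simp
  also have "... \<le> \<delta> powr (- (real DIM('a) + 1) / 2)" using False \<delta> by (intro powr_mono2') auto
  finally show ?thesis by (simp add: mult.commute mult_left_mono)
qed (simp add: cutw_eq_0)

lemma nn_integral_cutw: "0 < \<delta> \<Longrightarrow> (NN \<sigma>. ennreal (cutw \<delta> \<sigma>)) = ennreal (LBINT \<sigma>. cutw \<delta> \<sigma>)"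
  by (rule nn_integral_eq_integral[OF integrable_cutw]) auto

lemma integral_cutw_nonneg: "0 \<le> (LBINT \<sigma>. cutw \<delta> \<sigma>)"
  by (rule Bochner_Integration.integral_nonneg) simp

lemma nn_integral_norm_cutw_kern:
  assumes \<delta>: "0 < \<delta>"
  shows "(NN \<sigma>. ennreal (norm (cutw \<delta> \<sigma> *\<^sub>R kern \<sigma> (y::'a::euclidean_space))))
     \<le> ennreal (\<delta> powr (- (real DIM('a) + 1) / 2) * (LBINT \<sigma>. cutw \<delta> \<sigma>))"
proof -
  have "(NN \<sigma>. ennreal (norm (cutw \<delta> \<sigma> *\<^sub>R kern \<sigma> y)))
    \<le> (NN \<sigma>. ennreal (\<delta> powr (- (real DIM('a) + 1) / 2)) * ennreal (cutw \<delta> \<sigma>))"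
    using norm_cutw_kern_le[OF \<delta>, of _ y] by (intro nn_integral_mono) (simp only: ennreal_mult'[OF powr_ge_zero, symmetric] ennreal_leI)
  also have "... = ennreal (\<delta> powr (- (real DIM('a) + 1) / 2)) * ennreal (LBINT \<sigma>. cutw \<delta> \<sigma>)"
    by (simp add: nn_integral_cmult nn_integral_cutw[OF \<delta>])
  finally show ?thesis by (simp add: ennreal_mult')
qed

lemma integrable_cutw_kern:
  assumes \<delta>: "0 < \<delta>"
  shows "integrable lborel (\<lambda>\<sigma>. cutw \<delta> \<sigma> *\<^sub>R kern \<sigma> (y::'a::euclidean_space))"
  by (rule integrableI_nn_le[OF _ nn_integral_norm_cutw_kern[OF \<delta>]]) measurable

lemma norm_riesz_kern_le:
  assumes \<delta>: "0 < \<delta>"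
  shows "norm (riesz_kern \<delta> (y::'a::euclidean_space)) \<le> \<delta> powr (- (real DIM('a) + 1) / 2) * (LBINT \<sigma>. cutw \<delta> \<sigma>)"
  unfolding riesz_kern_def
  by (rule norm_integral_le_nn[OF nn_integral_norm_cutw_kern[OF \<delta>]]) (simp add: integral_cutw_nonneg)

lemma cutw_powr_le:
  assumes \<delta>: "0 < \<delta>"
  shows "cutw \<delta> \<sigma> * \<sigma> powr (- 1 / 2) \<le> \<delta> powr (- 1 / 2) * cutw \<delta> \<sigma>"
proof (cases "\<sigma> \<le> \<delta>")
  case False
  then have "\<sigma> powr (- 1 / 2) \<le> \<delta> powr (- 1 / 2)" using \<delta> by (intro powr_mono2') auto
  then show ?thesis by (simp add: mult.commute mult_left_mono)
qed (simp add: cutw_eq_0)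

lemma nn_integral_cutw_kern_space:
  assumes \<delta>: "0 < \<delta>"
  shows "(NN y. ennreal (norm (cutw \<delta> \<sigma> *\<^sub>R kern \<sigma> (y::'a::euclidean_space))))
    \<le> ennreal (real DIM('a) * \<delta> powr (- 1 / 2)) * ennreal (cutw \<delta> \<sigma>)"
proof (cases "\<sigma> \<le> \<delta>")
  case False
  then have \<sigma>: "0 < \<sigma>" using \<delta> by simp
  have "(NN y. ennreal (norm (cutw \<delta> \<sigma> *\<^sub>R kern \<sigma> (y::'a)))) = ennreal (cutw \<delta> \<sigma>) * (NN y. ennreal (norm (kern \<sigma> (y::'a))))"
    by (subst nn_integral_cmult[symmetric]) (auto simp: ennreal_mult')
  also have "... \<le> ennreal (cutw \<delta> \<sigma>) * ennreal (real DIM('a) * \<sigma> powr (- 1 / 2))"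
    by (intro mult_left_mono nn_integral_norm_kern \<sigma>) simp
  also have "... = ennreal (real DIM('a) * (cutw \<delta> \<sigma> * \<sigma> powr (- 1 / 2)))"
    by (subst ennreal_mult'[symmetric]) (simp_all add: mult_ac)
  also have "... \<le> ennreal (real DIM('a) * (\<delta> powr (- 1 / 2) * cutw \<delta> \<sigma>))"
    by (intro ennreal_leI mult_left_mono cutw_powr_le \<delta>) simp
  also have "... = ennreal (real DIM('a) * \<delta> powr (- 1 / 2)) * ennreal (cutw \<delta> \<sigma>)"
    by (subst ennreal_mult'[symmetric]) (simp_all add: mult_ac)
  finally show ?thesis .
qed (simp add: cutw_eq_0)

lemma integrable_riesz_kern:
  assumes \<delta>: "0 < \<delta>"
  shows "integrable lborel (riesz_kern \<delta> :: 'a::euclidean_space \<Rightarrow> 'a)"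
proof -
  have Fm: "(\<lambda>(\<sigma>, y). cutw \<delta> \<sigma> *\<^sub>R kern \<sigma> (y::'a)) \<in> borel_measurable (lborel \<Otimes>\<^sub>M lborel)" by measurable
  have "(NN \<sigma>. NN y. ennreal (norm (cutw \<delta> \<sigma> *\<^sub>R kern \<sigma> (y::'a))))
    \<le> (NN \<sigma>. ennreal (real DIM('a) * \<delta> powr (- 1 / 2)) * ennreal (cutw \<delta> \<sigma>))"
    by (intro nn_integral_mono nn_integral_cutw_kern_space \<delta>)
  also have "... < \<infinity>" by (simp add: nn_integral_cmult nn_integral_cutw[OF \<delta>] ennreal_mult_less_top)
  finally have fin: "(NN \<sigma>. NN y. ennreal (norm (cutw \<delta> \<sigma> *\<^sub>R kern \<sigma> (y::'a)))) < \<infinity>" .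
  show ?thesis using Fubini_lborel(3)[OF Fm fin] by (simp add: riesz_kern_def[abs_def])
qed

text \<open>Duality is exact at each \<open>\<delta>\<close>: moving the kernel onto the field
  reflects it, and oddness yields the minus sign. The inner integral on the right is the truncated
  superposition that represents the divergence of order 0.\<close>

lemma integral_vconv_riesz_kern_inner:
  assumes u: "integrable lborel u" and \<phi>: "lip_test L (\<phi> :: 'a::euclidean_space \<Rightarrow> 'a)" and \<delta>: "0 < \<delta>"
  shows "(LBINT x. vconv (riesz_kern \<delta>) u x \<bullet> \<phi> x) = - (LBINT x. u x * (LBINT \<sigma>. cut \<delta> \<sigma> * (pw (- 1 / 2) \<sigma> * heat_div \<sigma> \<phi> x)))"
proof -
  note [measurable] = lip_test_measurable[OF \<phi>] borel_measurable_integrable[OF u, simplified]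
  define K where "K = \<delta> powr (- (real DIM('a) + 1) / 2) * (LBINT \<sigma>. cutw \<delta> \<sigma>)"
  have K: "norm (riesz_kern \<delta> y) \<le> K" for y :: 'a unfolding K_def by (rule norm_riesz_kern_le[OF \<delta>])
  have K0: "0 \<le> K" using order_trans[OF norm_ge_zero K] .
  let ?F = "\<lambda>x z. u z * (riesz_kern \<delta> (z - x) \<bullet> \<phi> x)"
  have Fm: "(\<lambda>(x, z). ?F x z) \<in> borel_measurable (lborel \<Otimes>\<^sub>M lborel)" by measurable
  have "(NN x. NN z. ennreal (norm (?F x z))) \<le> (NN x. NN z. ennreal (K * norm (\<phi> x)) * ennreal (norm (u z)))"
  proof (intro nn_integral_mono)
    fix x z
    have "norm (?F x z) \<le> norm (u z) * (norm (riesz_kern \<delta> (z - x)) * norm (\<phi> x))"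
      unfolding norm_mult by (intro mult_left_mono) (auto intro: Cauchy_Schwarz_ineq2)
    also have "... \<le> norm (u z) * (K * norm (\<phi> x))" by (intro mult_left_mono mult_right_mono K) auto
    finally show "ennreal (norm (?F x z)) \<le> ennreal (K * norm (\<phi> x)) * ennreal (norm (u z))"
      using K0 by (simp add: ennreal_mult'[symmetric] ennreal_leI mult.commute)
  qed
  also have "... = (NN x. ennreal K * ennreal (norm (\<phi> x)) * ennreal (LBINT z. norm (u z)))"
    using K0 by (simp add: nn_integral_cmult integrable_finite_nn[OF u, simplified] ennreal_mult')
  also have "... = ennreal K * ennreal (LBINT x. norm (\<phi> x)) * ennreal (LBINT z. norm (u z))"
    by (simp add: nn_integral_multc nn_integral_cmult integrable_finite_nn[OF lip_test_integrable[OF \<phi>]])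
  also have "... < \<infinity>" by (simp add: ennreal_mult_less_top)
  finally have fin: "(NN x. NN z. ennreal (norm (?F x z))) < \<infinity>" .
  have intk: "integrable lborel (\<lambda>z. u z *\<^sub>R riesz_kern \<delta> (z - x))" for x
  proof (rule Bochner_Integration.integrable_bound[OF integrable_mult_right[OF u, of K]])
    show "AE z in lborel. norm (u z *\<^sub>R riesz_kern \<delta> (z - x)) \<le> norm (K * u z)"
    proof (rule AE_I2)
      fix z
      show "norm (u z *\<^sub>R riesz_kern \<delta> (z - x)) \<le> norm (K * u z)"
        using mult_left_mono[OF K[of "z - x"], of "\<bar>u z\<bar>"] K0 by (simp add: abs_mult mult.commute)
    qed
  qed measurable
  have 1: "vconv (riesz_kern \<delta>) u x \<bullet> \<phi> x = (LBINT z. ?F x z)" for x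
  proof -
    have "vconv (riesz_kern \<delta>) u x = (LBINT z. u z *\<^sub>R riesz_kern \<delta> (z - x))"
      unfolding vconv_def using integral_shift[of "\<lambda>z. u z *\<^sub>R riesz_kern \<delta> (z - x)" x] by simp
    then show ?thesis using intk[of x] by (simp add: integral_inner_left[symmetric])
  qed
  have 2: "(LBINT x. ?F x z) = - (u z * (LBINT \<sigma>. cut \<delta> \<sigma> * (pw (- 1 / 2) \<sigma> * heat_div \<sigma> \<phi> z)))" for z
  proof -
    have "(LBINT x. riesz_kern \<delta> (z - x) \<bullet> \<phi> x) = (LBINT y. riesz_kern \<delta> (z - (z + y)) \<bullet> \<phi> (z + y))"
      by (rule integral_shift[symmetric]) measurable
    also have "... = - (LBINT y. riesz_kern \<delta> y \<bullet> \<phi> (z + y))" by (simp add: riesz_kern_minus)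
    also have "(LBINT y. riesz_kern \<delta> y \<bullet> \<phi> (z + y)) = (LBINT y. LBINT \<sigma>. (cutw \<delta> \<sigma> *\<^sub>R kern \<sigma> y) \<bullet> \<phi> (z + y))"
      unfolding riesz_kern_def by (subst integral_inner_left[symmetric]) (auto intro!: integrable_cutw_kern[OF \<delta>])
    also have "... = (LBINT \<sigma>. LBINT y. (cutw \<delta> \<sigma> *\<^sub>R kern \<sigma> y) \<bullet> \<phi> (z + y))"
    proof (rule Fubini_lborel(1)[symmetric])
      have "(NN \<sigma>. NN y. ennreal (norm ((cutw \<delta> \<sigma> *\<^sub>R kern \<sigma> y) \<bullet> \<phi> (z + y))))
        \<le> (NN \<sigma>. NN y. ennreal (norm (cutw \<delta> \<sigma> *\<^sub>R kern \<sigma> (y::'a))))"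
      proof (intro nn_integral_mono ennreal_leI)
        fix \<sigma> y
        have "\<bar>(cutw \<delta> \<sigma> *\<^sub>R kern \<sigma> y) \<bullet> \<phi> (z + y)\<bar> \<le> norm (cutw \<delta> \<sigma> *\<^sub>R kern \<sigma> y) * 1"
          by (rule order_trans[OF Cauchy_Schwarz_ineq2]) (intro mult_left_mono lip_test_le1[OF \<phi>], simp)
        then show "norm ((cutw \<delta> \<sigma> *\<^sub>R kern \<sigma> y) \<bullet> \<phi> (z + y)) \<le> norm (cutw \<delta> \<sigma> *\<^sub>R kern \<sigma> y)" by simp
      qed
      also have "... \<le> (NN \<sigma>. ennreal (real DIM('a) * \<delta> powr (- 1 / 2)) * ennreal (cutw \<delta> \<sigma>))"
        by (intro nn_integral_mono nn_integral_cutw_kern_space \<delta>)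
      also have "... < \<infinity>" by (simp add: nn_integral_cmult nn_integral_cutw[OF \<delta>] ennreal_mult_less_top)
      finally show "(NN \<sigma>. NN y. ennreal (norm ((cutw \<delta> \<sigma> *\<^sub>R kern \<sigma> y) \<bullet> \<phi> (z + y)))) < \<infinity>" .
    qed measurable
    also have "... = (LBINT \<sigma>. cut \<delta> \<sigma> * (pw (- 1 / 2) \<sigma> * heat_div \<sigma> \<phi> z))"
      by (simp add: heat_div_def cutw_def mult.assoc)
    finally show ?thesis by simp
  qed
  show ?thesis
    unfolding 1 Fubini_lborel(1)[OF Fm fin] 2 by simp
qed

lemma
  fixes x :: "'a::euclidean_space"
  assumes u: "integrable lborel u" and \<delta>: "0 < \<delta>"
  shows vconv_riesz_kern_eq: "vconv (riesz_kern \<delta>) u x = (LBINT \<sigma>. cutw \<delta> \<sigma> *\<^sub>R vconv (kern \<sigma>) u x)"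
    and integrable_cutw_vconv: "integrable lborel (\<lambda>\<sigma>. cutw \<delta> \<sigma> *\<^sub>R vconv (kern \<sigma>) u x)"
proof -
  note [measurable] = borel_measurable_integrable[OF u, simplified]
  let ?F = "\<lambda>y \<sigma>. u (x + y) *\<^sub>R (cutw \<delta> \<sigma> *\<^sub>R kern \<sigma> y)"
  have Fm: "(\<lambda>(y, \<sigma>). ?F y \<sigma>) \<in> borel_measurable (lborel \<Otimes>\<^sub>M lborel)" by measurable
  let ?K = "\<delta> powr (- (real DIM('a) + 1) / 2) * (LBINT \<sigma>. cutw \<delta> \<sigma>)"
  have "(NN y. NN \<sigma>. ennreal (norm (?F y \<sigma>))) \<le> (NN y. ennreal (norm (u (x + y))) * ennreal ?K)"
  proof (rule nn_integral_mono)
    fix y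
    have "(NN \<sigma>. ennreal (norm (?F y \<sigma>))) = ennreal (norm (u (x + y))) * (NN \<sigma>. ennreal (norm (cutw \<delta> \<sigma> *\<^sub>R kern \<sigma> y)))"
      unfolding norm_scaleR[of "u (x + y)"] by (subst nn_integral_cmult[symmetric]) (simp_all only: ennreal_mult'[OF abs_ge_zero] real_norm_def, measurable)
    also have "... \<le> ennreal (norm (u (x + y))) * ennreal ?K"
      by (intro mult_left_mono nn_integral_norm_cutw_kern \<delta>) simp
    finally show "(NN \<sigma>. ennreal (norm (?F y \<sigma>))) \<le> ennreal (norm (u (x + y))) * ennreal ?K" .
  qed
  also have "... = ennreal (LBINT y. norm (u y)) * ennreal ?K"
    using nn_integral_shift[of "\<lambda>w. ennreal (norm (u w))" x] integrable_finite_nn[OF u] by (simp add: nn_integral_multc)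
  also have "... < \<infinity>" by (simp add: ennreal_mult_less_top)
  finally have fin: "(NN y. NN \<sigma>. ennreal (norm (?F y \<sigma>))) < \<infinity>" .
  have in2: "(LBINT y. ?F y \<sigma>) = cutw \<delta> \<sigma> *\<^sub>R vconv (kern \<sigma>) u x" for \<sigma>
  proof -
    have eq: "?F y \<sigma> = cutw \<delta> \<sigma> *\<^sub>R (u (x + y) *\<^sub>R kern \<sigma> y)" for y by simp
    show ?thesis unfolding eq vconv_def by (rule integral_scaleR_right)
  qed
  have "vconv (riesz_kern \<delta>) u x = (LBINT y. LBINT \<sigma>. ?F y \<sigma>)"
    unfolding vconv_def riesz_kern_def by (subst integral_scaleR_right) (rule refl)
  also have "... = (LBINT \<sigma>. LBINT y. ?F y \<sigma>)" by (rule Fubini_lborel(1)[OF Fm fin])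
  finally show "vconv (riesz_kern \<delta>) u x = (LBINT \<sigma>. cutw \<delta> \<sigma> *\<^sub>R vconv (kern \<sigma>) u x)"
    unfolding in2 .
  show "integrable lborel (\<lambda>\<sigma>. cutw \<delta> \<sigma> *\<^sub>R vconv (kern \<sigma>) u x)"
    using Fubini_lborel(3)[OF Fm fin] unfolding in2 .
qed

lemma ennreal_norm_integral_le:
  fixes f :: "'a \<Rightarrow> 'b::{banach,second_countable_topology}"
  shows "ennreal (norm (\<integral>x. f x \<partial>M)) \<le> (\<integral>\<^sup>+x. ennreal (norm (f x)) \<partial>M)"
  by (cases "integrable M f") (auto intro: integral_norm_bound_ennreal simp: not_integrable_integral_eq)

lemma nn_integral_norm_vconv_le:
  fixes k :: "'a::euclidean_space \<Rightarrow> 'a" and u :: "'a \<Rightarrow> real"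
  assumes [measurable]: "k \<in> borel_measurable borel" "u \<in> borel_measurable borel"
  shows "(NN x. ennreal (norm (vconv k u x))) \<le> (NN y. ennreal (norm (k y))) * (NN x. ennreal (norm (u x)))"
proof -
  have "(NN x. ennreal (norm (vconv k u x))) \<le> (NN x. NN y. ennreal (norm (u (x + y) *\<^sub>R k y)))"
    unfolding vconv_def by (intro nn_integral_mono ennreal_norm_integral_le)
  also have "... = (NN y. NN x. ennreal (norm (u (x + y) *\<^sub>R k y)))"
    by (rule lborel_pair.Fubini'[symmetric]) measurable
  also have "... = (NN y. ennreal (norm (k y)) * (NN x. ennreal (norm (u x))))"
  proof (rule nn_integral_cong)
    fix y
    have "(NN x. ennreal (norm (u (x + y) *\<^sub>R k y))) = (NN x. ennreal (norm (k y)) * ennreal (norm (u (y + x))))"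
      by (intro nn_integral_cong) (simp add: ennreal_mult mult.commute add.commute)
    also have "... = ennreal (norm (k y)) * (NN x. ennreal (norm (u (y + x))))"
      by (rule nn_integral_cmult) measurable
    also have "(NN x. ennreal (norm (u (y + x)))) = (NN x. ennreal (norm (u x)))"
      by (rule nn_integral_shift) measurable
    finally show "(NN x. ennreal (norm (u (x + y) *\<^sub>R k y))) = ennreal (norm (k y)) * (NN x. ennreal (norm (u x)))" .
  qed
  also have "... = (NN y. ennreal (norm (k y))) * (NN x. ennreal (norm (u x)))"
    by (rule nn_integral_multc) measurable
  finally show ?thesis .
qed

lemma vconv_kern_measurable[measurable (raw)]:
  assumes [measurable]: "s \<in> borel_measurable M" "u \<in> borel_measurable borel" "g \<in> borel_measurable M"
  shows "(\<lambda>x. vconv (kern (s x)) u (g x :: 'a::euclidean_space)) \<in> borel_measurable M"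
  unfolding vconv_def by measurable

lemma nn_integral_cutw_vconv:
  fixes u :: "'a::euclidean_space \<Rightarrow> real"
  assumes u: "integrable lborel u" and \<delta>: "0 < \<delta>"
  shows "ennreal (cutw \<delta> \<sigma>) * (NN x. ennreal (norm (vconv (kern \<sigma>) u x)))
    \<le> ennreal (real DIM('a) * \<delta> powr (- 1 / 2) * (LBINT x. norm (u x))) * ennreal (cutw \<delta> \<sigma>)"
proof -
  note [measurable] = borel_measurable_integrable[OF u, simplified]
  have "ennreal (cutw \<delta> \<sigma>) * (NN x. ennreal (norm (vconv (kern \<sigma>) u x)))
    \<le> ennreal (cutw \<delta> \<sigma>) * ((NN y. ennreal (norm (kern \<sigma> (y::'a)))) * (NN x. ennreal (norm (u x))))"
    by (intro mult_left_mono nn_integral_norm_vconv_le) auto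
  also have "... = (NN y. ennreal (norm (cutw \<delta> \<sigma> *\<^sub>R kern \<sigma> (y::'a)))) * (NN x. ennreal (norm (u x)))"
    by (subst mult.assoc[symmetric], subst nn_integral_cmult[symmetric]) (auto simp: ennreal_mult')
  also have "... \<le> (ennreal (real DIM('a) * \<delta> powr (- 1 / 2)) * ennreal (cutw \<delta> \<sigma>)) * ennreal (LBINT x. norm (u x))"
    unfolding integrable_finite_nn[OF u] by (intro mult_right_mono nn_integral_cutw_kern_space \<delta>) simp
  also have "... = ennreal (real DIM('a) * \<delta> powr (- 1 / 2) * (LBINT x. norm (u x))) * ennreal (cutw \<delta> \<sigma>)"
    by (simp add: ennreal_mult' ennreal_mult'' mult_ac)
  finally show ?thesis .
qed

text \<open>Expanding both factors over heat times leaves L2 products of two heat gradients of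
  \<open>u\<close>, and each of these is the energy at the sum of the two times.\<close>

lemma integral_vconv_riesz_kern_square:
  fixes u :: "'a::euclidean_space \<Rightarrow> real"
  assumes u: "integrable lborel u" and B: "\<And>x. \<bar>u x\<bar> \<le> B" and \<delta>: "0 < \<delta>"
  shows "(LBINT x. vconv (riesz_kern \<delta>) u x \<bullet> vconv (riesz_kern \<delta>) u x)
    = (LBINT \<sigma>. cutw \<delta> \<sigma> * (LBINT \<tau>. cutw \<delta> \<tau> * energy u (\<sigma> + \<tau>)))"
proof -
  note [measurable] = borel_measurable_integrable[OF u, simplified]
  define V where "V = vconv (riesz_kern \<delta>) u"
  define k where "k = (\<lambda>\<sigma>. vconv (kern \<sigma>) u)"
  have B0: "0 \<le> B" using B[of 0] by linarith
  have [measurable]: "V \<in> borel_measurable borel" unfolding V_def by measurable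
  have km[measurable]: "(\<lambda>(\<sigma>, x). k \<sigma> x) \<in> borel_measurable (borel \<Otimes>\<^sub>M borel)" unfolding k_def by measurable
  have km'[measurable (raw)]: "(\<lambda>x. k (s x) (g x)) \<in> borel_measurable M"
    if [measurable]: "s \<in> borel_measurable M" "g \<in> borel_measurable M" for M :: "'z measure" and s g
    unfolding k_def by measurable
  have km1: "k \<sigma> \<in> borel_measurable borel" for \<sigma> unfolding k_def by measurable
  define Vm where "Vm = B * (LBINT y. norm (riesz_kern \<delta> (y::'a)))"
  have Vm: "norm (V x) \<le> Vm" for x
    unfolding V_def Vm_def by (rule norm_vconv_le[OF integrable_riesz_kern[OF \<delta>] u B])
  have Vm0: "0 \<le> Vm" using order_trans[OF norm_ge_zero Vm[of 0]] .
  define N where "N = real DIM('a) * \<delta> powr (- 1 / 2) * (LBINT x. norm (u x))"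
  have N0: "0 \<le> N" by (simp add: N_def)
  have kN: "ennreal (cutw \<delta> \<sigma>) * (NN x. ennreal (norm (k \<sigma> x))) \<le> ennreal N * ennreal (cutw \<delta> \<sigma>)" for \<sigma>
    unfolding k_def N_def by (rule nn_integral_cutw_vconv[OF u \<delta>])
  have Vk: "V x \<bullet> w = (LBINT \<sigma>. cutw \<delta> \<sigma> * (k \<sigma> x \<bullet> w))" for x w
  proof -
    have "V x \<bullet> w = (LBINT \<sigma>. (cutw \<delta> \<sigma> *\<^sub>R k \<sigma> x) \<bullet> w)"
      unfolding V_def k_def vconv_riesz_kern_eq[OF u \<delta>]
      by (rule integral_inner_left[symmetric]) (rule integrable_cutw_vconv[OF u \<delta>])
    then show ?thesis by simp
  qed
  have inner_fin: "(NN \<sigma>. NN x. ennreal (norm (cutw \<delta> \<sigma> * (k \<sigma> x \<bullet> W x)))) < \<infinity>"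
    if [measurable]: "W \<in> borel_measurable borel" and W: "\<And>x. norm (W x) \<le> R" for W R
  proof -
    have R0: "0 \<le> R" using order_trans[OF norm_ge_zero W[of 0]] .
    have "(NN \<sigma>. NN x. ennreal (norm (cutw \<delta> \<sigma> * (k \<sigma> x \<bullet> W x))))
      \<le> (NN \<sigma>. ennreal (R * N) * ennreal (cutw \<delta> \<sigma>))"
    proof (rule nn_integral_mono)
      fix \<sigma> :: real
      have "(NN x. ennreal (norm (cutw \<delta> \<sigma> * (k \<sigma> x \<bullet> W x)))) \<le> (NN x. (ennreal R * ennreal (cutw \<delta> \<sigma>)) * ennreal (norm (k \<sigma> x)))"
      proof (rule nn_integral_mono)
        fix x
        have "\<bar>k \<sigma> x \<bullet> W x\<bar> \<le> norm (k \<sigma> x) * R"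
          by (rule order_trans[OF Cauchy_Schwarz_ineq2]) (intro mult_left_mono W, simp)
        then have "norm (cutw \<delta> \<sigma> * (k \<sigma> x \<bullet> W x)) \<le> R * cutw \<delta> \<sigma> * norm (k \<sigma> x)"
          using mult_left_mono[OF _ cutw_nonneg[of \<delta> \<sigma>], of "\<bar>k \<sigma> x \<bullet> W x\<bar>" "norm (k \<sigma> x) * R"] by (simp add: abs_mult mult_ac)
        then show "ennreal (norm (cutw \<delta> \<sigma> * (k \<sigma> x \<bullet> W x))) \<le> (ennreal R * ennreal (cutw \<delta> \<sigma>)) * ennreal (norm (k \<sigma> x))"
          using R0 by (simp add: ennreal_mult'[symmetric] ennreal_leI)
      qed
      also have "... = ennreal R * (ennreal (cutw \<delta> \<sigma>) * (NN x. ennreal (norm (k \<sigma> x))))"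
        by (subst nn_integral_cmult) (use km1 in \<open>simp_all add: mult.assoc\<close>)
      also have "... \<le> ennreal R * (ennreal N * ennreal (cutw \<delta> \<sigma>))"
        by (intro mult_left_mono kN) simp
      also have "... = ennreal (R * N) * ennreal (cutw \<delta> \<sigma>)"
        using R0 by (simp add: ennreal_mult' mult.assoc)
      finally show "(NN x. ennreal (norm (cutw \<delta> \<sigma> * (k \<sigma> x \<bullet> W x)))) \<le> ennreal (R * N) * ennreal (cutw \<delta> \<sigma>)" .
    qed
    also have "... < \<infinity>" by (simp add: nn_integral_cmult nn_integral_cutw[OF \<delta>] ennreal_mult_less_top)
    finally show ?thesis .
  qed
  have "(LBINT x. V x \<bullet> V x) = (LBINT x. LBINT \<sigma>. cutw \<delta> \<sigma> * (k \<sigma> x \<bullet> V x))"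
    by (subst Vk) (rule refl)
  also have "... = (LBINT \<sigma>. LBINT x. cutw \<delta> \<sigma> * (k \<sigma> x \<bullet> V x))"
    by (rule Fubini_lborel(1)[symmetric, OF _ inner_fin[OF _ Vm]]) measurable
  also have "... = (LBINT \<sigma>. cutw \<delta> \<sigma> * (LBINT \<tau>. cutw \<delta> \<tau> * energy u (\<sigma> + \<tau>)))"
  proof (rule Bochner_Integration.integral_cong[OF refl])
    fix \<sigma> :: real
    show "(LBINT x. cutw \<delta> \<sigma> * (k \<sigma> x \<bullet> V x)) = cutw \<delta> \<sigma> * (LBINT \<tau>. cutw \<delta> \<tau> * energy u (\<sigma> + \<tau>))"
    proof (cases "\<sigma> \<le> \<delta>")
      case False
      then have \<sigma>: "0 < \<sigma>" using \<delta> by simp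
      have kb: "norm (k \<sigma> x) \<le> B * (LBINT y. norm (kern \<sigma> (y::'a)))" for x
        unfolding k_def by (rule norm_vconv_le[OF integrable_kern[OF \<sigma>] u B])
      have "(LBINT x. k \<sigma> x \<bullet> V x) = (LBINT x. LBINT \<tau>. cutw \<delta> \<tau> * (k \<tau> x \<bullet> k \<sigma> x))"
        by (subst inner_commute, subst Vk) (rule refl)
      also have "... = (LBINT \<tau>. LBINT x. cutw \<delta> \<tau> * (k \<tau> x \<bullet> k \<sigma> x))"
        by (rule Fubini_lborel(1)[symmetric, OF _ inner_fin[OF km1 kb]]) measurable
      also have "... = (LBINT \<tau>. cutw \<delta> \<tau> * energy u (\<sigma> + \<tau>))"
      proof (rule Bochner_Integration.integral_cong[OF refl])
        fix \<tau> :: real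
        show "(LBINT x. cutw \<delta> \<tau> * (k \<tau> x \<bullet> k \<sigma> x)) = cutw \<delta> \<tau> * energy u (\<sigma> + \<tau>)"
        proof (cases "\<tau> \<le> \<delta>")
          case False
          then have \<tau>: "0 < \<tau>" using \<delta> by simp
          have "(LBINT x. k \<tau> x \<bullet> k \<sigma> x) = energy u (\<tau> + \<sigma>)"
            unfolding k_def integral_vconv_inner_vconv[OF integrable_kern[OF \<tau>] integrable_kern[OF \<sigma>] u B] integral_kern_inner_kern[OF \<tau> \<sigma>]
            by (simp add: energy_def)
          then show ?thesis by (simp add: add.commute)
        qed (simp add: cutw_eq_0)
      qed
      finally show ?thesis by simp
    qed (simp add: cutw_eq_0)
  qed
  finally show ?thesis by (simp add: V_def)
qed

text \<open>For fixed total time \<open>s\<close> the product of the two weights integrates to at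
  most \<open>Beta (1 / 2) (1 / 2)\<close>, whatever \<open>s\<close> is. What remains is the energy
  over an interval containing all sums of admissible times, and \<open>nn_integral_energy\<close>
  bounds it independently of \<open>\<delta>\<close>.\<close>

lemma nn_integral_cutw_energy:
  fixes u :: "'a::euclidean_space \<Rightarrow> real"
  assumes u: "integrable lborel u" and B: "\<And>x. \<bar>u x\<bar> \<le> B" and \<delta>: "0 < \<delta>" "\<delta> < 1"
    and sq: "integrable lborel (\<lambda>x. (u x)\<^sup>2)"
  shows "(NN \<sigma>. NN \<tau>. ennreal (cutw \<delta> \<sigma> * (cutw \<delta> \<tau> * energy u (\<sigma> + \<tau>))))
    \<le> ennreal (Beta (1 / 2) (1 / 2) * (2 * (LBINT x. (u x)\<^sup>2)))"
proof -
  note [measurable] = borel_measurable_integrable[OF u, simplified]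
  define e where "e = (\<lambda>s. ennreal (energy u s) * indicator {2 * \<delta>..2 / \<delta>} s)"
  have [measurable]: "e \<in> borel_measurable borel" unfolding e_def by measurable
  have B1: "0 < Beta (1 / 2) (1 / 2 :: real)" by (rule Beta_real_pos) auto
  let ?p = "pw (- 1 / 2)"
  have "(NN \<sigma>. NN \<tau>. ennreal (cutw \<delta> \<sigma> * (cutw \<delta> \<tau> * energy u (\<sigma> + \<tau>))))
    \<le> (NN \<sigma>. NN \<tau>. ennreal (?p \<sigma> * ?p (\<sigma> + \<tau> - \<sigma>)) * e (\<sigma> + \<tau>))"
  proof (intro nn_integral_mono)
    fix \<sigma> \<tau> :: real
    show "ennreal (cutw \<delta> \<sigma> * (cutw \<delta> \<tau> * energy u (\<sigma> + \<tau>))) \<le> ennreal (?p \<sigma> * ?p (\<sigma> + \<tau> - \<sigma>)) * e (\<sigma> + \<tau>)"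
    proof (cases "\<delta> < \<sigma> \<and> \<sigma> * \<delta> \<le> 1 \<and> \<delta> < \<tau> \<and> \<tau> * \<delta> \<le> 1")
      case True
      then have "\<sigma> + \<tau> \<in> {2 * \<delta>..2 / \<delta>}" using \<delta> by (auto simp: field_simps)
      moreover have "0 \<le> energy u (\<sigma> + \<tau>)" using True \<delta> by (intro energy_nonneg[OF u B]) auto
      ultimately show ?thesis using True by (simp add: e_def cutw_def cut_def ennreal_mult'[symmetric] mult.assoc)
    qed (auto simp: cutw_def cut_def)
  qed
  also have "... = (NN \<sigma>. NN s. ennreal (?p \<sigma> * ?p (s - \<sigma>)) * e s)"
  proof (rule nn_integral_cong)
    fix \<sigma> :: real
    show "(NN \<tau>. ennreal (?p \<sigma> * ?p (\<sigma> + \<tau> - \<sigma>)) * e (\<sigma> + \<tau>)) = (NN s. ennreal (?p \<sigma> * ?p (s - \<sigma>)) * e s)"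
      by (rule nn_integral_shift[of "\<lambda>s. ennreal (?p \<sigma> * ?p (s - \<sigma>)) * e s"]) measurable
  qed
  also have "... = (NN s. NN \<sigma>. ennreal (?p \<sigma> * ?p (s - \<sigma>)) * e s)"
    by (rule lborel_pair.Fubini'[symmetric]) measurable
  also have "... \<le> (NN s. ennreal (Beta (1 / 2) (1 / 2)) * e s)"
  proof (rule nn_integral_mono)
    fix s :: real
    have "(NN \<sigma>. ennreal (?p \<sigma> * ?p (s - \<sigma>)) * e s) = (NN \<sigma>. ennreal (?p \<sigma> * ?p (s - \<sigma>))) * e s"
      by (rule nn_integral_multc) measurable
    also have "(NN \<sigma>. ennreal (?p \<sigma> * ?p (s - \<sigma>))) = ennreal (Beta (1 / 2) (1 / 2) * pw 0 s)"
      using nn_integral_pw_conv[of "1 / 2" "1 / 2" s] by simp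
    also have "... * e s \<le> ennreal (Beta (1 / 2) (1 / 2)) * e s"
      using B1 by (intro mult_right_mono ennreal_leI) (auto simp: pw_def)
    finally show "(NN \<sigma>. ennreal (?p \<sigma> * ?p (s - \<sigma>)) * e s) \<le> ennreal (Beta (1 / 2) (1 / 2)) * e s" .
  qed
  also have "... = ennreal (Beta (1 / 2) (1 / 2)) * (NN s. e s)" by (rule nn_integral_cmult) measurable
  also have "... \<le> ennreal (Beta (1 / 2) (1 / 2)) * ennreal (2 * (LBINT x. (u x)\<^sup>2))"
  proof (rule mult_left_mono)
    have "2 * \<delta> \<le> 2 / \<delta>" using \<delta> by (simp add: field_simps mult_le_one)
    then show "(NN s. e s) \<le> ennreal (2 * (LBINT x. (u x)\<^sup>2))"
      unfolding e_def using \<delta> by (intro nn_integral_energy[OF u B _ _ sq]) auto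
  qed simp
  also have "... = ennreal (Beta (1 / 2) (1 / 2) * (2 * (LBINT x. (u x)\<^sup>2)))"
    using B1 by (simp add: ennreal_mult')
  finally show ?thesis .
qed

lemma integrable_square_of_bounded:
  fixes u :: "'a::euclidean_space \<Rightarrow> real"
  assumes u: "integrable lborel u" and B: "\<And>x. \<bar>u x\<bar> \<le> B"
  shows "integrable lborel (\<lambda>x. (u x)\<^sup>2)" and "(LBINT x. (u x)\<^sup>2) \<le> (LBINT x. \<bar>u x\<bar>) * B"
proof -
  note [measurable] = borel_measurable_integrable[OF u, simplified]
  have sq: "(u x)\<^sup>2 = u x * u x" for x by (simp add: power2_eq_square)
  show "integrable lborel (\<lambda>x. (u x)\<^sup>2)" unfolding sq by (rule integral_mult_bound(1)[OF u _ B]) measurable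
  have "\<bar>LBINT x. u x * u x\<bar> \<le> (LBINT x. \<bar>u x\<bar>) * B"
    by (rule integral_mult_bound(2)[OF u _ B]) measurable
  then show "(LBINT x. (u x)\<^sup>2) \<le> (LBINT x. \<bar>u x\<bar>) * B" unfolding sq by linarith
qed

text \<open>Plays the role of the boundedness of the Fourier symbol of the Riesz transform: the
  constant is the same for all truncations.\<close>

lemma
  fixes u :: "'a::euclidean_space \<Rightarrow> real"
  assumes u: "integrable lborel u" and B: "\<And>x. \<bar>u x\<bar> \<le> B" and \<delta>: "0 < \<delta>" "\<delta> < 1"
  shows integrable_vconv_riesz_kern_square: "integrable lborel (\<lambda>x. (norm (vconv (riesz_kern \<delta>) u x))\<^sup>2)"
    and vconv_riesz_kern_L2: "(LBINT x. (norm (vconv (riesz_kern \<delta>) u x))\<^sup>2) \<le> 2 * Beta (1 / 2) (1 / 2) * (LBINT x. (u x)\<^sup>2)"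
proof -
  note [measurable] = borel_measurable_integrable[OF u, simplified]
  note sq = integrable_square_of_bounded(1)[OF u B]
  define V where "V = vconv (riesz_kern \<delta>) u"
  define Vm where "Vm = B * (LBINT y. norm (riesz_kern \<delta> (y::'a)))"
  have Vm: "norm (V x) \<le> Vm" for x
    unfolding V_def Vm_def by (rule norm_vconv_le[OF integrable_riesz_kern[OF \<delta>(1)] u B])
  have Vi: "integrable lborel (\<lambda>x. norm (V x))"
    unfolding V_def by (intro integrable_norm integrable_vconv[OF integrable_riesz_kern[OF \<delta>(1)] u B])
  have "integrable lborel (\<lambda>x. (norm (V x))\<^sup>2)"
    by (rule integrable_square_of_bounded(1)[OF Vi, of Vm]) (simp add: Vm)
  then show "integrable lborel (\<lambda>x. (norm (vconv (riesz_kern \<delta>) u x))\<^sup>2)" by (simp add: V_def)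
  have Q0: "0 \<le> 2 * Beta (1 / 2) (1 / 2) * (LBINT x. (u x)\<^sup>2)"
    using Beta_real_pos[of "1 / 2" "1 / 2"] by simp
  have "ennreal (LBINT x. (norm (V x))\<^sup>2) \<le> ennreal (norm (LBINT \<sigma>. cutw \<delta> \<sigma> * (LBINT \<tau>. cutw \<delta> \<tau> * energy u (\<sigma> + \<tau>))))"
    unfolding power2_norm_eq_inner V_def integral_vconv_riesz_kern_square[OF u B \<delta>(1)] by (intro ennreal_leI) simp
  also have "... \<le> (NN \<sigma>. ennreal (norm (cutw \<delta> \<sigma> * (LBINT \<tau>. cutw \<delta> \<tau> * energy u (\<sigma> + \<tau>)))))"
    by (rule ennreal_norm_integral_le)
  also have "... \<le> (NN \<sigma>. NN \<tau>. ennreal (cutw \<delta> \<sigma> * (cutw \<delta> \<tau> * energy u (\<sigma> + \<tau>))))"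
  proof (rule nn_integral_mono)
    fix \<sigma> :: real
    have "ennreal (norm (cutw \<delta> \<sigma> * (LBINT \<tau>. cutw \<delta> \<tau> * energy u (\<sigma> + \<tau>))))
      = ennreal (norm (LBINT \<tau>. cutw \<delta> \<sigma> * (cutw \<delta> \<tau> * energy u (\<sigma> + \<tau>))))" by simp
    also have "... \<le> (NN \<tau>. ennreal (norm (cutw \<delta> \<sigma> * (cutw \<delta> \<tau> * energy u (\<sigma> + \<tau>)))))"
      by (rule ennreal_norm_integral_le)
    also have "... = (NN \<tau>. ennreal (cutw \<delta> \<sigma> * (cutw \<delta> \<tau> * energy u (\<sigma> + \<tau>))))"
    proof (rule nn_integral_cong)
      fix \<tau> :: real
      have "0 \<le> cutw \<delta> \<sigma> * (cutw \<delta> \<tau> * energy u (\<sigma> + \<tau>))"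
      proof (cases "\<sigma> \<le> \<delta> \<or> \<tau> \<le> \<delta>")
        case False
        then have "0 \<le> energy u (\<sigma> + \<tau>)" using \<delta> by (intro energy_nonneg[OF u B]) auto
        then show ?thesis by simp
      qed (auto simp: cutw_eq_0)
      then show "ennreal (norm (cutw \<delta> \<sigma> * (cutw \<delta> \<tau> * energy u (\<sigma> + \<tau>)))) = ennreal (cutw \<delta> \<sigma> * (cutw \<delta> \<tau> * energy u (\<sigma> + \<tau>)))"
        by (simp only: real_norm_def abs_of_nonneg)
    qed
    finally show "ennreal (norm (cutw \<delta> \<sigma> * (LBINT \<tau>. cutw \<delta> \<tau> * energy u (\<sigma> + \<tau>)))) \<le> ..." .
  qed
  also have "... \<le> ennreal (Beta (1 / 2) (1 / 2) * (2 * (LBINT x. (u x)\<^sup>2)))"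
    by (rule nn_integral_cutw_energy[OF u B \<delta> sq])
  finally show "(LBINT x. (norm (vconv (riesz_kern \<delta>) u x))\<^sup>2) \<le> 2 * Beta (1 / 2) (1 / 2) * (LBINT x. (u x)\<^sup>2)"
    using Q0 by (simp add: V_def ennreal_le_iff mult_ac)
qed

section \<open>Hoermander's condition for the truncated kernels\<close>

lemma nn_integral_kern_diff_far:
  fixes h :: "'a::euclidean_space"
  assumes \<sigma>: "0 < \<sigma>" and r: "0 < r" "norm h \<le> r"
  shows "(NN x. ennreal (norm (kern \<sigma> (x + h) - kern \<sigma> x)) * indicator {x. 2 * r \<le> norm x} x) \<le> ennreal (2 * real DIM('a) / r)"
proof -
  have "(NN x. ennreal (norm (kern \<sigma> (x + h) - kern \<sigma> x)) * indicator {x. 2 * r \<le> norm x} x)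
    \<le> (NN x. ennreal (1 / r) * (ennreal (norm (kern \<sigma> (h + x)) * norm (h + x)) + ennreal (norm (kern \<sigma> x) * norm x)))"
  proof (rule nn_integral_mono)
    fix x :: 'a
    show "ennreal (norm (kern \<sigma> (x + h) - kern \<sigma> x)) * indicator {x. 2 * r \<le> norm x} x
      \<le> ennreal (1 / r) * (ennreal (norm (kern \<sigma> (h + x)) * norm (h + x)) + ennreal (norm (kern \<sigma> x) * norm x))"
    proof (cases "2 * r \<le> norm x")
      case True
      \<comment> \<open>Both points have norm at least \<open>r\<close>, so cancellation is given up
        and each term is paid for by \<open>1 / r\<close> times the scale-invariant moment of
        \<open>kern\<close>.\<close>
      have x1: "r \<le> norm (h + x)" using True r norm_triangle_ineq2[of x "- h"] by (simp add: add.commute)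
      have x2: "r \<le> norm x" using True r by simp
      have "norm (kern \<sigma> (x + h) - kern \<sigma> x) \<le> norm (kern \<sigma> (h + x)) + norm (kern \<sigma> x)"
        using norm_triangle_ineq4[of "kern \<sigma> (x + h)" "kern \<sigma> x"] by (simp add: add.commute)
      then have "r * norm (kern \<sigma> (x + h) - kern \<sigma> x) \<le> r * (norm (kern \<sigma> (h + x)) + norm (kern \<sigma> x))"
        using r by (intro mult_left_mono) auto
      also have "... \<le> norm (kern \<sigma> (h + x)) * norm (h + x) + norm (kern \<sigma> x) * norm x"
        using mult_left_mono[OF x1 norm_ge_zero[of "kern \<sigma> (h + x)"]] mult_left_mono[OF x2 norm_ge_zero[of "kern \<sigma> x"]]
        by (simp add: algebra_simps)
      finally have "norm (kern \<sigma> (x + h) - kern \<sigma> x) \<le> 1 / r * (norm (kern \<sigma> (h + x)) * norm (h + x) + norm (kern \<sigma> x) * norm x)"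
        using r by (simp add: field_simps)
      then have "ennreal (norm (kern \<sigma> (x + h) - kern \<sigma> x)) \<le> ennreal (1 / r * (norm (kern \<sigma> (h + x)) * norm (h + x) + norm (kern \<sigma> x) * norm x))"
        by (rule ennreal_leI)
      also have "... = ennreal (1 / r) * (ennreal (norm (kern \<sigma> (h + x)) * norm (h + x)) + ennreal (norm (kern \<sigma> x) * norm x))"
      proof -
        have "0 \<le> 1 / r" "0 \<le> norm (kern \<sigma> (h + x)) * norm (h + x)" "0 \<le> norm (kern \<sigma> x) * norm x" using r by auto
        then show ?thesis by (simp only: ennreal_mult' ennreal_plus)
      qed
      finally show ?thesis using True by simp
    qed simp
  qed
  also have "... = ennreal (1 / r) * ((NN x. ennreal (norm (kern \<sigma> (h + x)) * norm (h + x))) + (NN x. ennreal (norm (kern \<sigma> x) * norm (x::'a))))"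
    by (subst nn_integral_cmult, measurable, subst nn_integral_add, measurable)
  also have "(NN x. ennreal (norm (kern \<sigma> (h + x)) * norm (h + x))) = (NN x. ennreal (norm (kern \<sigma> x) * norm (x::'a)))"
    by (rule nn_integral_shift) measurable
  also have "ennreal (1 / r) * ((NN x. ennreal (norm (kern \<sigma> x) * norm (x::'a))) + (NN x. ennreal (norm (kern \<sigma> x) * norm (x::'a)))) = ennreal (2 * real DIM('a) / r)"
    unfolding nn_integral_norm_kern_times_norm[OF \<sigma>]
    by (subst ennreal_plus[symmetric], simp, simp, subst ennreal_mult'[symmetric]) (use r in simp_all)
  finally show ?thesis .
qed

text \<open>At time \<open>\<sigma>\<close> the L1 difference of heat gradients is at most
  \<open>n * r / \<sigma>\<close> by smoothness and \<open>2 * n / r\<close> by decay. Splitting at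
  \<open>\<sigma> = r\<^sup>2\<close>, where both have the same order, the weight
  \<open>\<sigma> powr (- 1 / 2)\<close> gives 4 n from small and 2 n from large times, for every
  \<open>\<delta>\<close> and \<open>r\<close>.\<close>

lemma riesz_kern_Hoermander:
  fixes h :: "'a::euclidean_space"
  assumes \<delta>: "0 < \<delta>" and r: "0 < r" "norm h \<le> r"
  shows "(NN x. ennreal (norm (riesz_kern \<delta> (x + h) - riesz_kern \<delta> x)) * indicator {x. 2 * r \<le> norm x} x) \<le> ennreal (6 * real DIM('a))"
proof -
  let ?i = "\<lambda>x::'a. indicator {x. 2 * r \<le> norm x} x :: ennreal"
  define J where "J = (\<lambda>\<sigma>. NN x. ennreal (norm (kern \<sigma> (x + h) - kern \<sigma> x)) * ?i x)"
  have J1: "J \<sigma> \<le> ennreal (real DIM('a) * r / \<sigma>)" if \<sigma>: "0 < \<sigma>" for \<sigma>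
  proof -
    have "J \<sigma> \<le> (NN x. ennreal (norm (kern \<sigma> (x + h) - kern \<sigma> x)))"
      unfolding J_def by (intro nn_integral_mono) (auto simp: indicator_def)
    also have "... \<le> ennreal (real DIM('a) * norm h / \<sigma>)" by (rule nn_integral_kern_diff[OF \<sigma>])
    also have "... \<le> ennreal (real DIM('a) * r / \<sigma>)" using r \<sigma> by (intro ennreal_leI divide_right_mono mult_left_mono) auto
    finally show ?thesis .
  qed
  have J2: "J \<sigma> \<le> ennreal (2 * real DIM('a) / r)" if "0 < \<sigma>" for \<sigma>
    unfolding J_def by (rule nn_integral_kern_diff_far[OF that r])
  have diff: "ennreal (norm (riesz_kern \<delta> (x + h) - riesz_kern \<delta> x)) \<le> (NN \<sigma>. ennreal (cutw \<delta> \<sigma>) * ennreal (norm (kern \<sigma> (x + h) - kern \<sigma> x)))" for x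
  proof -
    have "riesz_kern \<delta> (x + h) - riesz_kern \<delta> x = (LBINT \<sigma>. cutw \<delta> \<sigma> *\<^sub>R kern \<sigma> (x + h) - cutw \<delta> \<sigma> *\<^sub>R kern \<sigma> x)"
      unfolding riesz_kern_def by (rule Bochner_Integration.integral_diff[symmetric]) (rule integrable_cutw_kern[OF \<delta>])+
    also have "ennreal (norm ...) \<le> (NN \<sigma>. ennreal (norm (cutw \<delta> \<sigma> *\<^sub>R kern \<sigma> (x + h) - cutw \<delta> \<sigma> *\<^sub>R kern \<sigma> x)))"
      by (rule ennreal_norm_integral_le)
    also have "... = (NN \<sigma>. ennreal (cutw \<delta> \<sigma>) * ennreal (norm (kern \<sigma> (x + h) - kern \<sigma> x)))"
      by (intro nn_integral_cong) (simp add: scaleR_diff_right[symmetric] ennreal_mult' del: scaleR_diff_right)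
    finally show ?thesis .
  qed
  have "(NN x. ennreal (norm (riesz_kern \<delta> (x + h) - riesz_kern \<delta> x)) * ?i x)
    \<le> (NN x. NN \<sigma>. ennreal (cutw \<delta> \<sigma>) * ennreal (norm (kern \<sigma> (x + h) - kern \<sigma> x)) * ?i x)"
  proof (rule nn_integral_mono)
    fix x :: 'a
    show "ennreal (norm (riesz_kern \<delta> (x + h) - riesz_kern \<delta> x)) * ?i x \<le> (NN \<sigma>. ennreal (cutw \<delta> \<sigma>) * ennreal (norm (kern \<sigma> (x + h) - kern \<sigma> x)) * ?i x)"
      using mult_right_mono[OF diff[of x], of "?i x"] by (subst nn_integral_multc) auto
  qed
  also have "... = (NN \<sigma>. NN x. ennreal (cutw \<delta> \<sigma>) * ennreal (norm (kern \<sigma> (x + h) - kern \<sigma> x)) * ?i x)"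
    by (rule lborel_pair.Fubini'[symmetric]) measurable
  also have "... = (NN \<sigma>. ennreal (cutw \<delta> \<sigma>) * J \<sigma>)"
    unfolding J_def mult.assoc by (subst nn_integral_cmult) measurable
  also have "... \<le> (NN \<sigma>. ennreal (2 * real DIM('a) / r) * (ennreal (pw (- 1 / 2) \<sigma>) * indicator {..r\<^sup>2} \<sigma>) + ennreal (real DIM('a) * r) * (ennreal (pw (- 3 / 2) \<sigma>) * indicator {r\<^sup>2<..} \<sigma>))"
  proof (rule nn_integral_mono)
    fix \<sigma> :: real
    show "ennreal (cutw \<delta> \<sigma>) * J \<sigma> \<le> ennreal (2 * real DIM('a) / r) * (ennreal (pw (- 1 / 2) \<sigma>) * indicator {..r\<^sup>2} \<sigma>) + ennreal (real DIM('a) * r) * (ennreal (pw (- 3 / 2) \<sigma>) * indicator {r\<^sup>2<..} \<sigma>)"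
    proof (cases "0 < \<sigma>")
      case pos: True
      show ?thesis
      proof (cases "\<sigma> \<le> r\<^sup>2")
        case True
        have "ennreal (cutw \<delta> \<sigma>) * J \<sigma> \<le> ennreal (pw (- 1 / 2) \<sigma>) * ennreal (2 * real DIM('a) / r)"
          by (intro mult_mono ennreal_leI cutw_le J2 pos) auto
        then show ?thesis using True by (simp add: mult.commute)
      next
        case False
        have "ennreal (cutw \<delta> \<sigma>) * J \<sigma> \<le> ennreal (pw (- 1 / 2) \<sigma>) * ennreal (real DIM('a) * r / \<sigma>)"
          by (intro mult_mono ennreal_leI cutw_le J1 pos) auto
        also have "... = ennreal (real DIM('a) * r * (\<sigma> powr (- 1 / 2) / \<sigma>))"
        proof -
          have "pw (- 1 / 2) \<sigma> * (real DIM('a) * r / \<sigma>) = real DIM('a) * r * (\<sigma> powr (- 1 / 2) / \<sigma>)"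
            using pos by (simp add: pw_def)
          then show ?thesis by (simp only: ennreal_mult'[OF pw_nonneg, symmetric])
        qed
        also have "\<sigma> powr (- 1 / 2) / \<sigma> = pw (- 3 / 2) \<sigma>"
          using pos powr_diff[of \<sigma> "- 1 / 2" 1] by (simp add: pw_def)
        finally show ?thesis using False r by (simp add: ennreal_mult')
      qed
    next
      case False
      then have "cutw \<delta> \<sigma> = 0" using \<delta> by (intro cutw_eq_0) simp
      then show ?thesis by simp
    qed
  qed
  also have "... = ennreal (2 * real DIM('a) / r) * ennreal (2 * r) + ennreal (real DIM('a) * r) * ennreal (2 / r)"
  proof -
    have h: "(NN \<sigma>. ennreal (pw (- 1 / 2) \<sigma>) * indicator {..r\<^sup>2} \<sigma>) = ennreal (2 * r)"
      using nn_integral_pw_head[of "- 1 / 2" "r\<^sup>2"] r by (simp add: powr_half_sqrt)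
    have l: "(NN \<sigma>. ennreal (pw (- 3 / 2) \<sigma>) * indicator {r\<^sup>2<..} \<sigma>) = ennreal (2 / r)"
      using nn_integral_pw_tail[of "- 3 / 2" "r\<^sup>2"] r by (simp add: powr_minus_divide powr_half_sqrt)
    show ?thesis
      by (subst nn_integral_add, measurable, subst nn_integral_cmult, measurable, subst nn_integral_cmult, measurable, simp only: h l)
  qed
  also have "... = ennreal (2 * real DIM('a) / r * (2 * r) + real DIM('a) * r * (2 / r))"
    using r by (simp only: ennreal_mult'[symmetric] ennreal_plus[symmetric] mult_nonneg_nonneg divide_nonneg_nonneg of_nat_0_le_iff order.strict_implies_order zero_le_numeral)
  also have "2 * real DIM('a) / r * (2 * r) + real DIM('a) * r * (2 / r) = 6 * real DIM('a)" using r by simp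
  finally show ?thesis .
qed

section \<open>Calderon--Zygmund decomposition\<close>

text \<open>Grid cubes are encoded as the fibres of this map, which sends a point to the lower
  corner of the half-open cube of side \<open>s\<close> containing it. Cubes of one size then
  partition the space by construction.\<close>

definition corner :: "real \<Rightarrow> 'a::euclidean_space \<Rightarrow> 'a" where
  "corner s x = (\<Sum>b\<in>Basis. (s * of_int \<lfloor>x \<bullet> b / s\<rfloor>) *\<^sub>R b)"

definition cell :: "real \<Rightarrow> 'a::euclidean_space \<Rightarrow> 'a set" where
  "cell s v = {y. corner s y = v}"

lemma corner_inner: "b \<in> Basis \<Longrightarrow> corner s x \<bullet> b = s * of_int \<lfloor>x \<bullet> b / s\<rfloor>"
  by (simp add: corner_def inner_sum_left inner_Basis if_distrib sum.delta' cong: if_cong)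

lemma corner_eq_iff:
  assumes s: "0 < s"
  shows "corner s x = corner s y \<longleftrightarrow> (\<forall>b\<in>Basis. \<lfloor>x \<bullet> b / s\<rfloor> = \<lfloor>y \<bullet> b / s\<rfloor>)"
  using s by (subst euclidean_eq_iff) (simp add: corner_inner)

lemma corner_measurable[measurable (raw)]:
  assumes [measurable]: "f \<in> borel_measurable M"
  shows "(\<lambda>x. corner s (f x)) \<in> borel_measurable M"
  unfolding corner_def by measurable

lemma cell_sets[measurable]: "cell s v \<in> sets borel"
proof -
  have "{y \<in> space borel. corner s y = v} \<in> sets borel" by measurable
  then show ?thesis by (simp add: cell_def)
qed

lemma countable_range_corner: "countable (range (corner s :: 'a::euclidean_space \<Rightarrow> 'a))"
proof (rule countable_subset)
  show "range (corner s :: 'a \<Rightarrow> 'a) \<subseteq> (\<lambda>f. \<Sum>b\<in>Basis. (s * of_int (f b)) *\<^sub>R b) ` (PiE (Basis::'a set) (\<lambda>_. UNIV::int set))"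
  proof
    fix v assume "v \<in> range (corner s :: 'a \<Rightarrow> 'a)"
    then obtain x :: 'a where v: "v = corner s x" by auto
    let ?f = "restrict (\<lambda>b. \<lfloor>x \<bullet> b / s\<rfloor>) (Basis::'a set)"
    have "v = (\<Sum>b\<in>Basis. (s * of_int (?f b)) *\<^sub>R b)" by (simp add: v corner_def)
    moreover have "?f \<in> PiE (Basis::'a set) (\<lambda>_. UNIV::int set)" by auto
    ultimately show "v \<in> (\<lambda>f. \<Sum>b\<in>Basis. (s * of_int (f b)) *\<^sub>R b) ` (PiE (Basis::'a set) (\<lambda>_. UNIV::int set))"
      by blast
  qed
  show "countable ((\<lambda>f. \<Sum>b\<in>(Basis::'a set). (s * of_int (f b)) *\<^sub>R b) ` (PiE (Basis::'a set) (\<lambda>_. UNIV::int set)))"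
    by (intro countable_image countable_PiE) auto
qed

text \<open>\<open>corner s\<close> takes countably many values, so any predicate of the corner cuts
  out a countable union of cells.\<close>

lemma pred_corner: "Measurable.pred borel (\<lambda>x::'a::euclidean_space. R (corner s x))"
proof -
  have "{x::'a. R (corner s x)} = (\<Union>v\<in>{v \<in> range (corner s). R v}. cell s v)"
    by (auto simp: cell_def)
  also have "... \<in> sets borel"
    by (rule sets.countable_UN') (auto intro: countable_subset[OF _ countable_range_corner])
  finally show ?thesis by (simp add: pred_def)
qed

lemma borel_measurable_corner_compose:
  fixes F :: "'a::euclidean_space \<Rightarrow> 'b::topological_space"
  shows "(\<lambda>x. F (corner s x)) \<in> borel_measurable borel"
proof (rule measurableI)
  fix B :: "'b set" assume "B \<in> sets borel"
  show "(\<lambda>x. F (corner s x)) -` B \<inter> space borel \<in> sets borel"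
    using pred_corner[of "\<lambda>v. F v \<in> B" s] by (simp add: pred_def vimage_def)
qed simp

lemma corner_bounds:
  assumes s: "0 < s" and b: "b \<in> Basis"
  shows "corner s x \<bullet> b \<le> x \<bullet> b" and "x \<bullet> b < corner s x \<bullet> b + s"
proof -
  have "s * of_int \<lfloor>x \<bullet> b / s\<rfloor> \<le> s * (x \<bullet> b / s)" using s by (intro mult_left_mono) auto
  then show "corner s x \<bullet> b \<le> x \<bullet> b" using s b by (simp add: corner_inner)
  have "x \<bullet> b / s < of_int \<lfloor>x \<bullet> b / s\<rfloor> + 1" by linarith
  then show "x \<bullet> b < corner s x \<bullet> b + s" using s b by (simp add: corner_inner field_simps)
qed

lemma norm_diff_corner_le:
  assumes s: "0 < s"
  shows "norm (x - corner s (x::'a::euclidean_space)) \<le> real DIM('a) * s"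
proof -
  have "norm (x - corner s x) \<le> (\<Sum>b\<in>Basis. \<bar>(x - corner s x) \<bullet> b\<bar>)" by (rule norm_le_l1)
  also have "... \<le> (\<Sum>b\<in>(Basis::'a set). s)"
  proof (rule sum_mono)
    fix b :: 'a assume b: "b \<in> Basis"
    show "\<bar>(x - corner s x) \<bullet> b\<bar> \<le> s"
      using corner_bounds[OF s b, of x] unfolding inner_diff_left by linarith
  qed
  finally show ?thesis by simp
qed

lemma emeasure_cell:
  assumes s: "0 < s"
  shows "emeasure lborel (cell s (corner s (x::'a::euclidean_space))) = ennreal (s ^ DIM('a))"
proof (rule antisym)
  define c where "c = corner s x"
  define u where "u = c + (\<Sum>b\<in>Basis. s *\<^sub>R b)"
  have ub: "u \<bullet> b = c \<bullet> b + s" if "b \<in> Basis" for b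
    using that by (simp add: u_def inner_add_left inner_sum_left inner_Basis if_distrib cong: if_cong)
  have pr: "(\<Prod>b\<in>(Basis::'a set). (u - c) \<bullet> b) = s ^ DIM('a)"
    using ub by (simp add: inner_diff_left)
  have le: "c \<bullet> b \<le> u \<bullet> b" if "b \<in> Basis" for b using ub[OF that] s by simp
  have cb: "emeasure lborel (cbox c u) = ennreal (s ^ DIM('a))" "emeasure lborel (box c u) = ennreal (s ^ DIM('a))"
    unfolding pr[symmetric] by (rule emeasure_lborel_cbox[OF le] emeasure_lborel_box[OF le], assumption)+
  have "cell s c \<subseteq> cbox c u"
  proof
    fix y assume "y \<in> cell s c"
    then have "corner s y = c" by (simp add: cell_def)
    then show "y \<in> cbox c u"
      unfolding mem_box using corner_bounds[OF s, of _ y] ub by (auto intro: less_imp_le)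
  qed
  then show "emeasure lborel (cell s (corner s x)) \<le> ennreal (s ^ DIM('a))"
    unfolding cb(1)[symmetric] c_def[symmetric] by (intro emeasure_mono) auto
  have "box c u \<subseteq> cell s c"
  proof
    fix y assume y: "y \<in> box c u"
    have "\<lfloor>y \<bullet> b / s\<rfloor> = \<lfloor>x \<bullet> b / s\<rfloor>" if b: "b \<in> Basis" for b
    proof (rule floor_unique)
      have c: "c \<bullet> b = s * of_int \<lfloor>x \<bullet> b / s\<rfloor>" using b by (simp add: c_def corner_inner)
      have yb: "c \<bullet> b < y \<bullet> b" "y \<bullet> b < c \<bullet> b + s"
        using y b ub[OF b] unfolding mem_box by auto
      show "of_int \<lfloor>x \<bullet> b / s\<rfloor> \<le> y \<bullet> b / s"
        unfolding pos_le_divide_eq[OF s] using yb(1) c by (simp only: mult.commute less_imp_le)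
      show "y \<bullet> b / s < of_int \<lfloor>x \<bullet> b / s\<rfloor> + 1"
        unfolding pos_divide_less_eq[OF s] distrib_right using yb(2) c by (simp only: mult.commute mult_1_left)
    qed
    then show "y \<in> cell s c" by (simp add: cell_def c_def corner_eq_iff[OF s])
  qed
  then show "ennreal (s ^ DIM('a)) \<le> emeasure lborel (cell s (corner s x))"
    unfolding cb(2)[symmetric] c_def[symmetric] by (intro emeasure_mono) auto
qed

text \<open>Dyadic nesting is arithmetic: the floor at the coarser scale is the floor at the finer
  one, divided as an integer by a power of two.\<close>

lemma corner_nested:
  assumes A: "0 < A" and jk: "j \<le> k" and eq: "corner (A / 2 ^ k) x = corner (A / 2 ^ k) y"
  shows "corner (A / 2 ^ j) x = corner (A / 2 ^ j) (y :: 'a::euclidean_space)"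
proof -
  have pos: "0 < A / 2 ^ i" for i :: nat using A by simp
  have fl: "\<lfloor>u / (A / 2 ^ j)\<rfloor> = \<lfloor>u / (A / 2 ^ k)\<rfloor> div 2 ^ (k - j)" for u
  proof -
    have "u / (A / 2 ^ j) = u / (A / 2 ^ k) / of_int (2 ^ (k - j))"
    proof -
      have "(2::real) ^ k = 2 ^ j * 2 ^ (k - j)" using jk by (simp flip: power_add)
      then show ?thesis using A by (simp add: field_simps)
    qed
    then show ?thesis using floor_divide_real_eq_div[of "2 ^ (k - j)" "u / (A / 2 ^ k)"] by simp
  qed
  show ?thesis using eq unfolding corner_eq_iff[OF pos] fl by simp
qed

text \<open>Selection of the maximal dyadic cubes with an arbitrary property \<open>P\<close> of
  generation and corner; generation 0 is the coarsest, of side \<open>A\<close>. It is kept abstract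
  because two properties are used: a large average of |f|, and lying in an open set while meeting an
  exceptional set.\<close>

locale dyadic_stopping =
  fixes A :: real and P :: "nat \<Rightarrow> 'a::euclidean_space \<Rightarrow> bool"
  assumes A: "0 < A"
begin

definition crn :: "nat \<Rightarrow> 'a \<Rightarrow> 'a" where "crn k x = corner (A / 2 ^ k) x"

definition stopped :: "'a set" where "stopped = {x. \<exists>k. P k (crn k x)}"

definition gen :: "'a \<Rightarrow> nat" where "gen x = (LEAST k. P k (crn k x))"

definition stop_cell :: "'a \<Rightarrow> 'a set" where "stop_cell x = {y. crn (gen x) y = crn (gen x) x}"

lemma side_pos[simp]: "0 < A / 2 ^ k" using A by simp

lemma stop_cell_eq: "stop_cell x = cell (A / 2 ^ gen x) (corner (A / 2 ^ gen x) x)"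
  by (simp add: stop_cell_def cell_def crn_def)

lemma crn_measurable[measurable]: "crn k \<in> borel_measurable borel"
  unfolding crn_def[abs_def] by measurable

lemma P_crn_measurable[measurable]: "Measurable.pred borel (\<lambda>x. P k (crn k x))"
  unfolding crn_def by (rule pred_corner)

lemma gen_measurable[measurable]: "gen \<in> measurable borel (count_space UNIV)"
  unfolding gen_def[abs_def] by measurable

lemma stopped_sets[measurable]: "stopped \<in> sets borel"
proof -
  have "{x \<in> space borel. \<exists>k. P k (crn k x)} \<in> sets borel" by measurable
  then show ?thesis by (simp add: stopped_def)
qed

lemma stop_cell_sets[measurable]: "stop_cell x \<in> sets borel"
  unfolding stop_cell_eq by measurable

lemma P_gen: "x \<in> stopped \<Longrightarrow> P (gen x) (crn (gen x) x)"
  unfolding stopped_def gen_def by (auto intro: LeastI)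

lemma not_P_less: "k < gen x \<Longrightarrow> \<not> P k (crn k x)"
  unfolding gen_def by (rule not_less_Least)

lemma crn_nested: "j \<le> k \<Longrightarrow> crn k x = crn k y \<Longrightarrow> crn j x = crn j y"
  unfolding crn_def by (rule corner_nested[OF A])

text \<open>Points of one cell share the corners of all coarser generations, so they fail and
  satisfy \<open>P\<close> together up to the stopping generation. Disjointness of the selected
  cubes follows.\<close>

lemma stop_cell_gen:
  assumes x: "x \<in> stopped" and y: "y \<in> stop_cell x"
  shows "y \<in> stopped" and "gen y = gen x" and "stop_cell y = stop_cell x"
proof -
  have eq: "crn j y = crn j x" if "j \<le> gen x" for j
    using crn_nested[OF that, of y x] y by (simp add: stop_cell_def)
  have Py: "P (gen x) (crn (gen x) y)" using P_gen[OF x] eq[of "gen x"] by simp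
  then show "y \<in> stopped" by (auto simp: stopped_def)
  have "(LEAST k. P k (crn k y)) = gen x"
  proof (rule Least_equality[where P = "\<lambda>k. P k (crn k y)", OF Py])
    fix k assume "P k (crn k y)"
    then show "gen x \<le> k" using not_P_less[of k x] eq[of k] by (cases "k < gen x") auto
  qed
  then show g: "gen y = gen x" by (simp add: gen_def)
  show "stop_cell y = stop_cell x" using eq[of "gen x"] by (simp add: stop_cell_def g)
qed

lemma mem_stop_cell[simp]: "x \<in> stop_cell x" by (simp add: stop_cell_def)

lemma stop_cell_subset: "x \<in> stopped \<Longrightarrow> stop_cell x \<subseteq> stopped"
  using stop_cell_gen(1) by blast

lemma emeasure_stop_cell: "emeasure lborel (stop_cell x) = ennreal ((A / 2 ^ gen x) ^ DIM('a))"
  unfolding stop_cell_eq by (rule emeasure_cell) simp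

lemma countable_stop_cells: "countable (stop_cell ` stopped)"
proof (rule countable_subset)
  show "stop_cell ` stopped \<subseteq> (\<lambda>(k, v). {y. crn k y = v}) ` (SIGMA k:UNIV. range (crn k))"
    by (auto simp: stop_cell_def)
  show "countable ((\<lambda>(k, v). {y. crn k y = v}) ` (SIGMA k:UNIV. range (crn k)))"
  proof (rule countable_image, rule countable_SIGMA)
    show "countable (range (crn k))" for k
      using countable_range_corner[of "A / 2 ^ k", where 'a = 'a] by (simp add: crn_def[abs_def])
  qed simp
qed

lemma disjoint_stop_cells: "disjoint_family_on (\<lambda>Q. Q) (stop_cell ` stopped)"
proof -
  have "stop_cell x = stop_cell y" if "x \<in> stopped" "y \<in> stopped" "z \<in> stop_cell x" "z \<in> stop_cell y" for x y z
    using stop_cell_gen(3)[OF that(1,3)] stop_cell_gen(3)[OF that(2,4)] by simp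
  then show ?thesis by (auto simp: disjoint_family_on_def)
qed

lemma Union_stop_cells: "(\<Union>Q\<in>stop_cell ` stopped. Q) = stopped"
proof
  show "(\<Union>Q\<in>stop_cell ` stopped. Q) \<subseteq> stopped" using stop_cell_subset by auto
  show "stopped \<subseteq> (\<Union>Q\<in>stop_cell ` stopped. Q)" using mem_stop_cell by blast
qed

text \<open>The selected cubes are countable and disjoint, so comparisons on single cubes add up.
  Sums over cubes are thereby hidden in integrals over the stopped set.\<close>

lemma nn_integral_stopped_le:
  assumes [measurable]: "h \<in> borel_measurable borel" "w \<in> borel_measurable borel"
    and le: "\<And>x. x \<in> stopped \<Longrightarrow> (NN y. h y * indicator (stop_cell x) y) \<le> (NN y. w y * indicator (stop_cell x) y)"
  shows "(NN y. h y * indicator stopped y) \<le> (NN y. w y * indicator stopped y)"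
proof -
  have eq: "(NN y. h y * indicator stopped y) = (\<integral>\<^sup>+Q. emeasure (density lborel h) Q \<partial>count_space (stop_cell ` stopped))"
    if [measurable]: "h \<in> borel_measurable borel" for h
  proof -
    have "(NN y. h y * indicator stopped y) = emeasure (density lborel h) stopped"
      by (simp add: emeasure_density)
    also have "... = emeasure (density lborel h) (\<Union>Q\<in>stop_cell ` stopped. Q)" by (simp only: Union_stop_cells)
    also have "... = (\<integral>\<^sup>+Q. emeasure (density lborel h) Q \<partial>count_space (stop_cell ` stopped))"
      by (rule emeasure_UN_countable) (auto intro: countable_stop_cells disjoint_stop_cells)
    finally show ?thesis .
  qed
  show ?thesis
    unfolding eq[OF assms(1)] eq[OF assms(2)]
  proof (rule nn_integral_mono)
    fix Q assume "Q \<in> space (count_space (stop_cell ` stopped))"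
    then obtain x where "x \<in> stopped" "Q = stop_cell x" by auto
    then show "emeasure (density lborel h) Q \<le> emeasure (density lborel w) Q"
      using le[of x] by (simp add: emeasure_density)
  qed
qed

text \<open>The positive and negative parts of \<open>F\<close> have equal integrals over each
  selected cube, and the comparison for nonnegative functions in both directions extends this to the
  stopped set.\<close>

lemma integral_stopped_eq_0:
  fixes F :: "'a \<Rightarrow> real"
  assumes F: "integrable lborel F" and z: "\<And>x. x \<in> stopped \<Longrightarrow> (LBINT y. indicator (stop_cell x) y * F y) = 0"
  shows "(LBINT y. indicator stopped y * F y) = 0"
proof -
  have [measurable]: "F \<in> borel_measurable borel" using F by (auto dest: borel_measurable_integrable)
  have I: "integrable lborel (\<lambda>y. indicator S y * G y)" if "integrable lborel G" and [measurable]: "S \<in> sets borel" for S and G :: "'a \<Rightarrow> real"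
    using integrable_mult_indicator[OF _ that(1), of S] by simp
  define p where "p = (\<lambda>y. max (F y) 0)"
  define m where "m = (\<lambda>y. max (- F y) 0)"
  have pi: "integrable lborel p" "integrable lborel m" using F by (auto simp: p_def m_def)
  have Fpm: "F y = p y - m y" for y by (auto simp: p_def m_def)
  have nonneg: "0 \<le> p y" "0 \<le> m y" for y by (auto simp: p_def m_def)
  have [measurable]: "p \<in> borel_measurable borel" "m \<in> borel_measurable borel" unfolding p_def m_def by measurable
  have nn: "(NN y. ennreal (G y) * indicator S y) = ennreal (LBINT y. indicator S y * G y)"
    if "integrable lborel G" "\<And>y. 0 \<le> G y" "S \<in> sets borel" for S and G :: "'a \<Rightarrow> real"
  proof -
    have "(NN y. ennreal (G y) * indicator S y) = (NN y. ennreal (indicator S y * G y))"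
      by (intro nn_integral_cong) (auto simp: indicator_def)
    also have "... = ennreal (LBINT y. indicator S y * G y)"
      using that by (intro nn_integral_eq_integral I) auto
    finally show ?thesis .
  qed
  have diff: "(LBINT y. indicator S y * F y) = (LBINT y. indicator S y * p y) - (LBINT y. indicator S y * m y)"
    if "S \<in> sets borel" for S
    unfolding Fpm right_diff_distrib by (rule Bochner_Integration.integral_diff) (use I pi that in auto)
  have cells: "(NN y. ennreal (p y) * indicator (stop_cell x) y) = (NN y. ennreal (m y) * indicator (stop_cell x) y)"
    if x: "x \<in> stopped" for x
    using z[OF x] diff[of "stop_cell x"] pi nonneg by (simp add: nn)
  have "(NN y. ennreal (p y) * indicator stopped y) = (NN y. ennreal (m y) * indicator stopped y)"
    by (intro antisym nn_integral_stopped_le) (simp_all add: cells)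
  then have "(LBINT y. indicator stopped y * p y) = (LBINT y. indicator stopped y * m y)"
    using pi nonneg by (simp add: nn)
  then show ?thesis using diff[of stopped] by simp
qed

text \<open>The ball about the corner has twice the radius known to contain the cube. Outside it a
  point is at distance at least \<open>2 * r\<close> from the corner, while points of the cube are
  within \<open>r\<close> of it: the geometry of Hoermander's condition.\<close>

definition halo :: "'a set" where
  "halo = (\<Union>x\<in>stopped. ball (crn (gen x) x) (2 * (real DIM('a) * (A / 2 ^ gen x))))"

lemma open_halo: "open halo" unfolding halo_def by auto

text \<open>One ball per cube suffices, because points of a cube share corner and generation. The
  ball of a cube of side \<open>s\<close> has radius \<open>2 * n * s\<close> and fits into a box of
  volume \<open>(4 * n * s) ^ n\<close>.\<close>

lemma emeasure_halo_le: "emeasure lborel halo \<le> ennreal ((4 * real DIM('a)) ^ DIM('a)) * emeasure lborel stopped"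
proof -
  define rep where "rep = (\<lambda>Q. SOME x. x \<in> stopped \<and> stop_cell x = Q)"
  have rep: "rep Q \<in> stopped \<and> stop_cell (rep Q) = Q" if "Q \<in> stop_cell ` stopped" for Q
    unfolding rep_def by (rule someI_ex) (use that in auto)
  define Bq where "Bq = (\<lambda>Q. ball (crn (gen (rep Q)) (rep Q)) (2 * (real DIM('a) * (A / 2 ^ gen (rep Q)))))"
  have sub: "halo \<subseteq> (\<Union>Q\<in>stop_cell ` stopped. Bq Q)"
  proof
    fix y assume "y \<in> halo"
    then obtain x where x: "x \<in> stopped" "y \<in> ball (crn (gen x) x) (2 * (real DIM('a) * (A / 2 ^ gen x)))" by (auto simp: halo_def)
    obtain z where z: "rep (stop_cell x) = z" by blast
    have zs: "stop_cell z = stop_cell x" using rep[of "stop_cell x"] x(1) z by auto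
    have zc: "z \<in> stop_cell x" using mem_stop_cell[of z] unfolding zs .
    have "gen z = gen x" by (rule stop_cell_gen(2)[OF x(1) zc])
    moreover have "crn (gen x) z = crn (gen x) x" using zc unfolding stop_cell_def by (rule CollectD)
    ultimately have "y \<in> Bq (stop_cell x)" using x(2) unfolding Bq_def z by simp
    then show "y \<in> (\<Union>Q\<in>stop_cell ` stopped. Bq Q)" using x by blast
  qed
  have ball_le: "emeasure lborel (ball c r) \<le> ennreal ((2 * r) ^ DIM('a))" if r: "0 < r" for c :: 'a and r
  proof -
    define o' where "o' = (\<Sum>b\<in>(Basis::'a set). r *\<^sub>R b)"
    have o: "o' \<bullet> b = r" if "b \<in> Basis" for b
      using that by (simp add: o'_def inner_sum_left inner_Basis if_distrib cong: if_cong)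
    have "ball c r \<subseteq> cbox (c - o') (c + o')"
    proof
      fix y assume "y \<in> ball c r"
      then have n: "norm (y - c) < r" by (simp add: dist_norm norm_minus_commute)
      show "y \<in> cbox (c - o') (c + o')"
        unfolding mem_box
      proof
        fix b :: 'a assume b: "b \<in> Basis"
        have "\<bar>y \<bullet> b - c \<bullet> b\<bar> < r" using Basis_le_norm[OF b, of "y - c"] n unfolding inner_diff_left by linarith
        then show "(c - o') \<bullet> b \<le> y \<bullet> b \<and> y \<bullet> b \<le> (c + o') \<bullet> b"
          unfolding inner_diff_left inner_add_left o[OF b] by linarith
      qed
    qed
    then have "emeasure lborel (ball c r) \<le> emeasure lborel (cbox (c - o') (c + o'))" by (intro emeasure_mono) auto
    also have "... = ennreal (\<Prod>b\<in>(Basis::'a set). (c + o' - (c - o')) \<bullet> b)"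
      using r by (intro emeasure_lborel_cbox) (simp add: inner_diff_left inner_add_left o)
    also have "(\<Prod>b\<in>(Basis::'a set). (c + o' - (c - o')) \<bullet> b) = (\<Prod>b\<in>(Basis::'a set). 2 * r)"
      by (rule prod.cong) (auto simp: inner_diff_left inner_add_left o)
    finally show ?thesis by simp
  qed
  have Bq: "emeasure lborel (Bq Q) \<le> ennreal ((4 * real DIM('a)) ^ DIM('a)) * emeasure lborel Q" if Q: "Q \<in> stop_cell ` stopped" for Q
  proof -
    let ?s = "A / 2 ^ gen (rep Q)"
    have "emeasure lborel (Bq Q) \<le> ennreal ((2 * (2 * (real DIM('a) * ?s))) ^ DIM('a))"
      unfolding Bq_def using A by (intro ball_le) simp
    also have "(2 * (2 * (real DIM('a) * ?s))) ^ DIM('a) = (4 * real DIM('a)) ^ DIM('a) * ?s ^ DIM('a)"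
    proof -
      have e: "2 * (2 * (real DIM('a) * ?s)) = (4 * real DIM('a)) * ?s" by simp
      show ?thesis unfolding e by (rule power_mult_distrib)
    qed
    also have "ennreal ... = ennreal ((4 * real DIM('a)) ^ DIM('a)) * ennreal (?s ^ DIM('a))"
      using A by (intro ennreal_mult) auto
    also have "ennreal (?s ^ DIM('a)) = emeasure lborel Q"
      using rep[OF Q] emeasure_stop_cell[of "rep Q"] by simp
    finally show ?thesis .
  qed
  show ?thesis
  proof (cases "stopped = {}")
    case False
    define I where "I = stop_cell ` stopped"
    have I: "countable I" "I \<noteq> {}" using countable_stop_cells False by (auto simp: I_def)
    \<comment> \<open>An enumeration of the cubes, and with \<open>Y\<close> of their balls, with
      the empty set at indices that name no cube; the balls are only subadditive, the disjoint cubes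
      are additive.\<close>
    define X where "X = (\<lambda>n. if n \<in> to_nat_on I ` I then from_nat_into I n else {})"
    define Y where "Y = (\<lambda>n. if n \<in> to_nat_on I ` I then Bq (from_nat_into I n) else {})"
    have fI: "from_nat_into I n \<in> I" for n using from_nat_into[OF I(2)] .
    have Is: "Q \<in> sets borel" if "Q \<in> I" for Q using that by (auto simp: I_def)
    have Xs: "range X \<subseteq> sets lborel" using Is[OF fI] by (auto simp: X_def)
    have Ys: "range Y \<subseteq> sets lborel" by (auto simp: Y_def Bq_def)
    have sub3: "(\<Union>n. X n) \<subseteq> stopped"
    proof (rule UN_least)
      fix n
      obtain x where "x \<in> stopped" "from_nat_into I n = stop_cell x" using fI[of n] by (auto simp: I_def)
      then show "X n \<subseteq> stopped" using stop_cell_subset[of x] by (simp add: X_def)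
    qed
    have "(\<Union>Q\<in>I. Bq Q) \<subseteq> (\<Union>n. Y n)"
    proof
      fix y assume "y \<in> (\<Union>Q\<in>I. Bq Q)"
      then obtain Q where "Q \<in> I" "y \<in> Bq Q" by auto
      then have "y \<in> Y (to_nat_on I Q)" using I by (simp add: Y_def)
      then show "y \<in> (\<Union>n. Y n)" by auto
    qed
    then have "emeasure lborel halo \<le> emeasure lborel (\<Union>n. Y n)"
      using sub Ys by (intro emeasure_mono) (auto simp: I_def)
    also have "... \<le> (\<Sum>n. emeasure lborel (Y n))" by (rule emeasure_subadditive_countably[OF Ys])
    also have "... \<le> (\<Sum>n. ennreal ((4 * real DIM('a)) ^ DIM('a)) * emeasure lborel (X n))"
    proof (rule suminf_le)
      show "emeasure lborel (Y n) \<le> ennreal ((4 * real DIM('a)) ^ DIM('a)) * emeasure lborel (X n)" for n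
        using Bq[of "from_nat_into I n"] fI[of n] by (auto simp: X_def Y_def I_def)
    qed auto
    also have "... = ennreal ((4 * real DIM('a)) ^ DIM('a)) * (\<Sum>n. emeasure lborel (X n))"
      by simp
    also have "(\<Sum>n. emeasure lborel (X n)) = emeasure lborel (\<Union>n. X n)"
    proof (rule suminf_emeasure[OF Xs])
      show "disjoint_family X"
        unfolding disjoint_family_on_def
      proof (intro ballI impI)
        fix i j :: nat assume ij: "i \<noteq> j"
        show "X i \<inter> X j = {}"
        proof (cases "i \<in> to_nat_on I ` I \<and> j \<in> to_nat_on I ` I")
          case True
          then have "from_nat_into I i \<noteq> from_nat_into I j"
            using ij I by (metis to_nat_on_from_nat_into)
          then show ?thesis using disjoint_stop_cells fI True
            unfolding disjoint_family_on_def X_def I_def[symmetric] by simp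
        qed (auto simp: X_def)
      qed
    qed
    also have "ennreal ((4 * real DIM('a)) ^ DIM('a)) * emeasure lborel (\<Union>n. X n) \<le> ennreal ((4 * real DIM('a)) ^ DIM('a)) * emeasure lborel stopped"
      by (intro mult_left_mono emeasure_mono sub3) auto
    finally show ?thesis .
  qed (simp add: halo_def)
qed

end

text \<open>\<open>A_large\<close> makes the average of |f| over every cube of generation 0 at most
  \<open>lam\<close>, so that each selected cube has an unselected parent.\<close>

locale calderon_zygmund =
  fixes f :: "'a::euclidean_space \<Rightarrow> real" and lam A :: real
  assumes f: "integrable lborel f" and lam: "0 < lam" and A0: "0 < A"
    and A_large: "(LBINT x. \<bar>f x\<bar>) \<le> lam * A ^ DIM('a)"
begin

definition bad :: "nat \<Rightarrow> 'a \<Rightarrow> bool" where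
  "bad k v \<longleftrightarrow> ennreal (lam * (A / 2 ^ k) ^ DIM('a)) < (NN y. ennreal \<bar>f y\<bar> * indicator (cell (A / 2 ^ k) v) y)"

sublocale dyadic_stopping A bad
  by unfold_locales (rule A0)

lemma f_measurable[measurable]: "f \<in> borel_measurable borel"
  using f by (auto dest: borel_measurable_integrable)

lemma nn_integral_f: "(NN y. ennreal \<bar>f y\<bar>) = ennreal (LBINT x. \<bar>f x\<bar>)"
  using integrable_finite_nn[OF f] by simp

lemma side_power_pos: "0 < (A / 2 ^ k) ^ DIM('a)"
  using side_pos by (rule zero_less_power)

lemma stop_cell_lower:
  assumes "x \<in> stopped"
  shows "ennreal lam * emeasure lborel (stop_cell x) \<le> (NN y. ennreal \<bar>f y\<bar> * indicator (stop_cell x) y)"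
  using P_gen[OF assms] lam unfolding bad_def emeasure_stop_cell crn_def stop_cell_eq[symmetric]
  by (simp add: ennreal_mult'[symmetric] less_imp_le)

text \<open>The parent cube was not selected and has \<open>2 ^ n\<close> times the volume. A parent
  exists, since at generation 0 the mass of a cube is at most the total mass, which
  \<open>A_large\<close> bounds.\<close>

lemma stop_cell_upper:
  assumes x: "x \<in> stopped"
  shows "(NN y. ennreal \<bar>f y\<bar> * indicator (stop_cell x) y) \<le> ennreal (2 ^ DIM('a) * lam * (A / 2 ^ gen x) ^ DIM('a))"
proof -
  have g0: "gen x \<noteq> 0"
  proof
    assume "gen x = 0"
    then have "ennreal (lam * A ^ DIM('a)) < (NN y. ennreal \<bar>f y\<bar> * indicator (cell (A / 2 ^ 0) (crn 0 x)) y)"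
      using P_gen[OF x] by (simp add: bad_def)
    also have "... \<le> (NN y. ennreal \<bar>f y\<bar>)" by (intro nn_integral_mono) (auto simp: indicator_def)
    also have "... \<le> ennreal (lam * A ^ DIM('a))" unfolding nn_integral_f by (rule ennreal_leI[OF A_large])
    finally show False by simp
  qed
  then obtain j where j: "gen x = Suc j" by (cases "gen x") auto
  have "\<not> bad j (crn j x)" using not_P_less[of j x] j by simp
  then have "(NN y. ennreal \<bar>f y\<bar> * indicator (cell (A / 2 ^ j) (crn j x)) y) \<le> ennreal (lam * (A / 2 ^ j) ^ DIM('a))"
    by (simp add: bad_def not_less)
  moreover have "(NN y. ennreal \<bar>f y\<bar> * indicator (stop_cell x) y) \<le> (NN y. ennreal \<bar>f y\<bar> * indicator (cell (A / 2 ^ j) (crn j x)) y)"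
  proof (rule nn_integral_mono)
    fix y
    have "y \<in> cell (A / 2 ^ j) (crn j x)" if "y \<in> stop_cell x"
    proof -
      have "crn j y = crn j x" using that j by (intro crn_nested[of j "gen x"]) (auto simp: stop_cell_def)
      then show ?thesis by (simp add: cell_def crn_def)
    qed
    then show "ennreal \<bar>f y\<bar> * indicator (stop_cell x) y \<le> ennreal \<bar>f y\<bar> * indicator (cell (A / 2 ^ j) (crn j x)) y"
      by (auto simp: indicator_def)
  qed
  moreover have "lam * (A / 2 ^ j) ^ DIM('a) = 2 ^ DIM('a) * lam * (A / 2 ^ gen x) ^ DIM('a)"
  proof -
    have "A / 2 ^ j = 2 * (A / 2 ^ gen x)" using j by simp
    then show ?thesis by (simp only: power_mult_distrib mult_ac)
  qed
  ultimately show ?thesis by simp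
qed

lemma measure_stopped: "ennreal lam * emeasure lborel stopped \<le> (NN y. ennreal \<bar>f y\<bar> * indicator stopped y)"
proof -
  have "ennreal lam * emeasure lborel stopped = (NN y. ennreal lam * indicator stopped y)"
    by (simp add: nn_integral_cmult)
  also have "... \<le> (NN y. ennreal \<bar>f y\<bar> * indicator stopped y)"
    by (rule nn_integral_stopped_le) (simp_all add: nn_integral_cmult stop_cell_lower)
  finally show ?thesis .
qed

text \<open>
  Outside the stopped set \<open>\<bar>f\<bar> \<le> lam\<close> almost everywhere.  Instead of Lebesgue's differentiation theorem
  we stop once more, at the first cell inside an open neighbourhood of the exceptional set.
\<close>

lemma AE_not_stopped: "AE x in lborel. x \<notin> stopped \<longrightarrow> \<bar>f x\<bar> \<le> lam"
proof -
  define Z where "Z = {x. x \<notin> stopped \<and> lam < \<bar>f x\<bar>}"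
  have Zs[measurable]: "Z \<in> sets borel"
  proof -
    have "{x \<in> space borel. x \<notin> stopped \<and> lam < \<bar>f x\<bar>} \<in> sets borel" by measurable
    then show ?thesis by (simp add: Z_def)
  qed
  have "ennreal lam * emeasure lborel Z = (NN y. ennreal lam * indicator Z y)"
    by (simp add: nn_integral_cmult)
  also have "... \<le> (NN y. ennreal \<bar>f y\<bar>)"
    by (intro nn_integral_mono) (auto simp: Z_def indicator_def intro!: ennreal_leI)
  also have "... < \<infinity>" by (simp add: nn_integral_f)
  finally have Zfin: "ennreal lam * emeasure lborel Z < \<infinity>" .
  have le: "(NN y. ennreal \<bar>f y\<bar> * indicator Z y) \<le> ennreal lam * emeasure lborel Z"
  proof (rule ennreal_le_epsilon)
    fix e :: real assume e: "0 < e"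
    obtain U where U: "open U" "Z \<subseteq> U" "emeasure lborel (U - Z) \<le> ennreal (e / lam)"
      using outer_regular_lborel_le[OF Zs, of "e / lam"] e lam by auto
    \<comment> \<open>Second stopping rule: a cube inside \<open>U\<close> containing a point of
      \<open>Z\<close>. Such a point was never stopped by the first rule, so the average of |f| over
      this cube is at most \<open>lam\<close>.\<close>
    define R where "R = (\<lambda>k v. cell (A / 2 ^ k) v \<subseteq> U \<and> (\<exists>z\<in>Z. corner (A / 2 ^ k) z = v))"
    interpret U: dyadic_stopping A R by unfold_locales (rule A0)
    have sub1: "Z \<subseteq> U.stopped"
    proof
      fix z assume z: "z \<in> Z"
      then obtain r where r: "0 < r" "ball z r \<subseteq> U" using U(1,2) open_contains_ball by blast
      obtain k where k: "2 * (real DIM('a) * A) / r < 2 ^ k" using real_arch_pow[of 2] by auto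
      have "2 * (real DIM('a) * A) < 2 ^ k * r" using k by (simp only: pos_divide_less_eq[OF r(1)])
      then have "2 * (real DIM('a) * A) / 2 ^ k < r" by (simp add: pos_divide_less_eq mult.commute)
      moreover have "2 * (real DIM('a) * (A / 2 ^ k)) = 2 * (real DIM('a) * A) / 2 ^ k" by simp
      ultimately have kr: "2 * (real DIM('a) * (A / 2 ^ k)) < r" by (simp only:)
      have "cell (A / 2 ^ k) (corner (A / 2 ^ k) z) \<subseteq> ball z r"
      proof
        fix y assume "y \<in> cell (A / 2 ^ k) (corner (A / 2 ^ k) z)"
        then have y: "corner (A / 2 ^ k) y = corner (A / 2 ^ k) z" by (simp add: cell_def)
        have "norm (z - y) = norm ((z - corner (A / 2 ^ k) z) - (y - corner (A / 2 ^ k) y))" by (simp add: y)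
        also have "... \<le> norm (z - corner (A / 2 ^ k) z) + norm (y - corner (A / 2 ^ k) y)" by (rule norm_triangle_ineq4)
        also have "... \<le> real DIM('a) * (A / 2 ^ k) + real DIM('a) * (A / 2 ^ k)"
          by (intro add_mono norm_diff_corner_le side_pos)
        also have "... < r" unfolding mult_2[symmetric] by (rule kr)
        finally show "y \<in> ball z r" by (simp add: dist_norm)
      qed
      then have "R k (U.crn k z)" using r(2) z by (auto simp: R_def U.crn_def)
      then show "z \<in> U.stopped" by (auto simp: U.stopped_def)
    qed
    have sub2: "U.stopped \<subseteq> U"
    proof
      fix x assume "x \<in> U.stopped"
      from U.P_gen[OF this] have "cell (A / 2 ^ U.gen x) (U.crn (U.gen x) x) \<subseteq> U" by (simp add: R_def)
      then show "x \<in> U" by (auto simp: cell_def U.crn_def)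
    qed
    have "(NN y. ennreal \<bar>f y\<bar> * indicator Z y) \<le> (NN y. ennreal \<bar>f y\<bar> * indicator U.stopped y)"
      using sub1 by (intro nn_integral_mono) (auto simp: indicator_def)
    also have "... \<le> (NN y. ennreal lam * indicator U.stopped y)"
    proof (rule U.nn_integral_stopped_le)
      fix x assume x: "x \<in> U.stopped"
      obtain z where z: "z \<in> Z" "corner (A / 2 ^ U.gen x) z = U.crn (U.gen x) x"
        using U.P_gen[OF x] by (auto simp: R_def)
      have "z \<notin> stopped" using z(1) by (simp add: Z_def)
      then have "\<not> bad (U.gen x) (crn (U.gen x) z)" by (auto simp: stopped_def)
      then have "(NN y. ennreal \<bar>f y\<bar> * indicator (cell (A / 2 ^ U.gen x) (crn (U.gen x) z)) y) \<le> ennreal (lam * (A / 2 ^ U.gen x) ^ DIM('a))"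
        by (simp add: bad_def not_less)
      also have "cell (A / 2 ^ U.gen x) (crn (U.gen x) z) = U.stop_cell x"
        unfolding U.stop_cell_eq crn_def z(2) U.crn_def ..
      also have "ennreal (lam * (A / 2 ^ U.gen x) ^ DIM('a)) = ennreal lam * emeasure lborel (U.stop_cell x)"
        unfolding U.emeasure_stop_cell using lam by (simp add: ennreal_mult')
      also have "... = (NN y. ennreal lam * indicator (U.stop_cell x) y)" by (simp add: nn_integral_cmult)
      finally show "(NN y. ennreal \<bar>f y\<bar> * indicator (U.stop_cell x) y) \<le> (NN y. ennreal lam * indicator (U.stop_cell x) y)" .
    qed measurable
    also have "... = ennreal lam * emeasure lborel U.stopped" by (simp add: nn_integral_cmult)
    also have "... \<le> ennreal lam * (emeasure lborel Z + ennreal (e / lam))"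
    proof (rule mult_left_mono)
      have "emeasure lborel U.stopped \<le> emeasure lborel (Z \<union> (U - Z))"
        using sub2 U(1) by (intro emeasure_mono) auto
      also have "... \<le> emeasure lborel Z + emeasure lborel (U - Z)"
        using U(1) by (intro emeasure_subadditive) auto
      also have "... \<le> emeasure lborel Z + ennreal (e / lam)" by (intro add_left_mono U(3))
      finally show "emeasure lborel U.stopped \<le> emeasure lborel Z + ennreal (e / lam)" .
    qed simp
    also have "... = ennreal lam * emeasure lborel Z + ennreal e"
      using lam by (simp add: distrib_left ennreal_mult'[symmetric])
    finally show "(NN y. ennreal \<bar>f y\<bar> * indicator Z y) \<le> ennreal lam * emeasure lborel Z + ennreal e" .
  qed
  \<comment> \<open>On \<open>Z\<close> the integrand exceeds \<open>lam\<close>, yet its integral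
    is at most \<open>lam\<close> times the measure of \<open>Z\<close>; that measure being finite,
    it may be cancelled, and the excess vanishes almost everywhere.\<close>
  have "(NN y. ennreal (\<bar>f y\<bar> - lam) * indicator Z y) + ennreal lam * emeasure lborel Z
    = (NN y. ennreal (\<bar>f y\<bar> - lam) * indicator Z y + ennreal lam * indicator Z y)"
    by (subst nn_integral_add) (simp_all add: nn_integral_cmult)
  also have "... = (NN y. ennreal \<bar>f y\<bar> * indicator Z y)"
    by (intro nn_integral_cong) (use lam in \<open>auto simp: Z_def indicator_def ennreal_plus[symmetric] simp del: ennreal_plus\<close>)
  finally have "(NN y. ennreal (\<bar>f y\<bar> - lam) * indicator Z y) + ennreal lam * emeasure lborel Z \<le> 0 + ennreal lam * emeasure lborel Z"
    using le by simp
  then have "(NN y. ennreal (\<bar>f y\<bar> - lam) * indicator Z y) = 0"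
    using Zfin by (auto simp add: ennreal_add_left_cancel_le add.commute del: add_0_left)
  then have "AE y in lborel. ennreal (\<bar>f y\<bar> - lam) * indicator Z y = 0"
    by (subst (asm) nn_integral_0_iff_AE) measurable
  then show ?thesis
    by eventually_elim (auto simp: ennreal_eq_0_iff Z_def indicator_def not_less split: if_splits)
qed

definition cell_avg :: "nat \<Rightarrow> 'a \<Rightarrow> real" where
  "cell_avg k v = (LBINT y. indicator (cell (A / 2 ^ k) v) y * f y) / (A / 2 ^ k) ^ DIM('a)"

text \<open>The value 0 on the null set where |f| exceeds \<open>lam\<close> off the stopped set
  makes the bound on \<open>good\<close> hold at every point, as the convolution estimates
  demand.\<close>

definition good :: "'a \<Rightarrow> real" where
  "good x = (if x \<in> stopped then cell_avg (gen x) (crn (gen x) x) else if \<bar>f x\<bar> \<le> lam then f x else 0)"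

text \<open>The corner serves as reference point of the cube; only its distance from the points of
  the cube matters.\<close>

definition center :: "'a \<Rightarrow> 'a" where
  "center x = crn (gen x) x"

lemma center_measurable[measurable]: "center \<in> borel_measurable borel"
  unfolding center_def[abs_def] by (rule measurable_compose_countable[OF _ gen_measurable]) measurable

lemma good_measurable[measurable]: "good \<in> borel_measurable borel"
proof -
  have [measurable]: "(\<lambda>x. cell_avg (gen x) (crn (gen x) x)) \<in> borel_measurable borel"
  proof (rule measurable_compose_countable[OF _ gen_measurable])
    show "(\<lambda>x. cell_avg k (crn k x)) \<in> borel_measurable borel" for k
      unfolding crn_def by (rule borel_measurable_corner_compose)
  qed
  show ?thesis unfolding good_def[abs_def] by measurable
qed

lemma integrable_indicator_f: "S \<in> sets borel \<Longrightarrow> integrable lborel (\<lambda>y. indicator S y * f y)"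
  using integrable_mult_indicator[OF _ f, of S] by simp

lemma good_on_stop_cell:
  assumes x: "x \<in> stopped" and y: "y \<in> stop_cell x"
  shows "good y = cell_avg (gen x) (crn (gen x) x)" and "center y = center x"
  using stop_cell_gen[OF x y] y by (simp_all add: good_def center_def stop_cell_def)

lemma abs_cell_avg_le:
  assumes x: "x \<in> stopped"
  shows "ennreal \<bar>cell_avg (gen x) (crn (gen x) x)\<bar> * emeasure lborel (stop_cell x) \<le> (NN y. ennreal \<bar>f y\<bar> * indicator (stop_cell x) y)"
proof -
  define V where "V = (A / 2 ^ gen x) ^ DIM('a)"
  have V: "0 < V" unfolding V_def by (rule side_power_pos)
  have "\<bar>cell_avg (gen x) (crn (gen x) x)\<bar> * V = \<bar>LBINT y. indicator (stop_cell x) y * f y\<bar>"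
    using V unfolding cell_avg_def crn_def stop_cell_eq[symmetric] V_def[symmetric] by (simp add: abs_divide)
  then have "ennreal \<bar>cell_avg (gen x) (crn (gen x) x)\<bar> * ennreal V = ennreal \<bar>LBINT y. indicator (stop_cell x) y * f y\<bar>"
    by (simp add: ennreal_mult'[symmetric])
  also have "... \<le> (NN y. ennreal (norm (indicator (stop_cell x) y * f y)))"
    using ennreal_norm_integral_le[of lborel "\<lambda>y. indicator (stop_cell x) y * f y"] by simp
  also have "... = (NN y. ennreal \<bar>f y\<bar> * indicator (stop_cell x) y)"
    by (intro nn_integral_cong) (auto simp: indicator_def)
  finally show ?thesis by (simp add: emeasure_stop_cell V_def)
qed

lemma abs_good_le: "\<bar>good x\<bar> \<le> 2 ^ DIM('a) * lam"
proof (cases "x \<in> stopped")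
  case True
  define V where "V = (A / 2 ^ gen x) ^ DIM('a)"
  have V: "0 < V" unfolding V_def by (rule side_power_pos)
  have "ennreal (\<bar>cell_avg (gen x) (crn (gen x) x)\<bar> * V) \<le> ennreal (2 ^ DIM('a) * lam * V)"
    using order_trans[OF abs_cell_avg_le[OF True] stop_cell_upper[OF True]]
    by (simp add: emeasure_stop_cell V_def[symmetric] ennreal_mult')
  then have "\<bar>cell_avg (gen x) (crn (gen x) x)\<bar> * V \<le> 2 ^ DIM('a) * lam * V"
    using V lam by (subst (asm) ennreal_le_iff) auto
  then show ?thesis using V True by (simp add: good_def)
next
  case False
  have "1 * lam \<le> 2 ^ DIM('a) * lam" using lam by (intro mult_right_mono) auto
  then have le: "lam \<le> 2 ^ DIM('a) * lam" by simp
  show ?thesis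
  proof (cases "\<bar>f x\<bar> \<le> lam")
    case True
    then show ?thesis using False order_trans[OF True le] by (simp add: good_def)
  next
    case f: False
    then show ?thesis using False lam by (simp add: good_def)
  qed
qed

lemma nn_integral_good_stopped:
  "(NN y. ennreal \<bar>good y\<bar> * indicator stopped y) \<le> (NN y. ennreal \<bar>f y\<bar> * indicator stopped y)"
proof (rule nn_integral_stopped_le)
  fix x assume x: "x \<in> stopped"
  have "(NN y. ennreal \<bar>good y\<bar> * indicator (stop_cell x) y) = (NN y. ennreal \<bar>cell_avg (gen x) (crn (gen x) x)\<bar> * indicator (stop_cell x) y)"
    by (intro nn_integral_cong) (auto simp: indicator_def good_on_stop_cell(1)[OF x])
  also have "... = ennreal \<bar>cell_avg (gen x) (crn (gen x) x)\<bar> * emeasure lborel (stop_cell x)"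
    by (simp add: nn_integral_cmult)
  also have "... \<le> (NN y. ennreal \<bar>f y\<bar> * indicator (stop_cell x) y)" by (rule abs_cell_avg_le[OF x])
  finally show "(NN y. ennreal \<bar>good y\<bar> * indicator (stop_cell x) y) \<le> (NN y. ennreal \<bar>f y\<bar> * indicator (stop_cell x) y)" .
qed measurable

lemma nn_integral_good: "(NN y. ennreal \<bar>good y\<bar>) \<le> (NN y. ennreal \<bar>f y\<bar>)"
proof -
  have split: "(NN y. ennreal \<bar>G y\<bar>) = (NN y. ennreal \<bar>G y\<bar> * indicator stopped y) + (NN y. ennreal \<bar>G y\<bar> * indicator (- stopped) y)"
    if [measurable]: "G \<in> borel_measurable borel" for G :: "'a \<Rightarrow> real"
    by (subst nn_integral_add[symmetric]) (auto intro!: nn_integral_cong simp: indicator_def)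
  show ?thesis
    unfolding split[OF good_measurable] split[OF f_measurable]
    by (intro add_mono nn_integral_good_stopped nn_integral_mono) (auto simp: good_def indicator_def)
qed

lemma integrable_good: "integrable lborel good"
  using nn_integral_good unfolding nn_integral_f by (intro integrableI_nn_le[of good lborel "LBINT x. \<bar>f x\<bar>"]) auto

lemma integral_abs_good_le: "(LBINT x. \<bar>good x\<bar>) \<le> (LBINT x. \<bar>f x\<bar>)"
  using nn_integral_good integrable_finite_nn[OF integrable_good] unfolding nn_integral_f by simp

definition rest :: "'a \<Rightarrow> real" where "rest x = f x - good x"

lemma integrable_rest: "integrable lborel rest"
  unfolding rest_def[abs_def] using f integrable_good by simp

lemma rest_measurable[measurable]: "rest \<in> borel_measurable borel"
  unfolding rest_def[abs_def] by measurable

lemma AE_rest: "AE x in lborel. rest x = indicator stopped x * rest x"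
  using AE_not_stopped by eventually_elim (auto simp: rest_def good_def indicator_def)

lemma nn_integral_rest: "(NN y. ennreal \<bar>rest y\<bar>) \<le> 2 * (NN y. ennreal \<bar>f y\<bar> * indicator stopped y)"
proof -
  have "(NN y. ennreal \<bar>rest y\<bar>) \<le> (NN y. ennreal \<bar>f y\<bar> * indicator stopped y + ennreal \<bar>good y\<bar> * indicator stopped y)"
  proof (rule nn_integral_mono_AE, use AE_rest in eventually_elim)
    fix y assume y: "rest y = indicator stopped y * rest y"
    show "ennreal \<bar>rest y\<bar> \<le> ennreal \<bar>f y\<bar> * indicator stopped y + ennreal \<bar>good y\<bar> * indicator stopped y"
    proof (cases "y \<in> stopped")
      case True
      have "ennreal \<bar>rest y\<bar> \<le> ennreal (\<bar>f y\<bar> + \<bar>good y\<bar>)" by (intro ennreal_leI) (simp add: rest_def)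
      then show ?thesis using True by simp
    qed (use y in simp)
  qed
  also have "... = (NN y. ennreal \<bar>f y\<bar> * indicator stopped y) + (NN y. ennreal \<bar>good y\<bar> * indicator stopped y)"
    by (rule nn_integral_add) measurable
  also have "... \<le> (NN y. ennreal \<bar>f y\<bar> * indicator stopped y) + (NN y. ennreal \<bar>f y\<bar> * indicator stopped y)"
    by (intro add_left_mono nn_integral_good_stopped)
  finally show ?thesis by (simp add: mult_2)
qed

lemma integral_rest_stop_cell:
  assumes x: "x \<in> stopped"
  shows "(LBINT y. indicator (stop_cell x) y * rest y) = 0"
proof -
  let ?a = "cell_avg (gen x) (crn (gen x) x)"
  define V where "V = (A / 2 ^ gen x) ^ DIM('a)"
  have V: "0 < V" unfolding V_def by (rule side_power_pos)
  have m: "emeasure lborel (stop_cell x) = ennreal V" by (simp add: emeasure_stop_cell V_def)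
  have i2: "integrable lborel (\<lambda>y. indicator (stop_cell x) y * ?a)"
    by (intro integrable_mult_left integrable_real_indicator) (simp_all add: m)
  have "(LBINT y. indicator (stop_cell x) y * rest y) = (LBINT y. indicator (stop_cell x) y * f y - indicator (stop_cell x) y * ?a)"
    by (intro Bochner_Integration.integral_cong) (auto simp: indicator_def rest_def good_on_stop_cell(1)[OF x])
  also have "... = (LBINT y. indicator (stop_cell x) y * f y) - (LBINT y. indicator (stop_cell x) y * ?a)"
    by (rule Bochner_Integration.integral_diff[OF integrable_indicator_f i2]) simp
  also have "(LBINT y. indicator (stop_cell x) y * ?a) = V * ?a"
    using V by (simp add: measure_def m)
  also have "V * ?a = (LBINT y. indicator (stop_cell x) y * f y)"
    using V unfolding cell_avg_def crn_def stop_cell_eq[symmetric] V_def[symmetric] by simp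
  finally show ?thesis by simp
qed

text \<open>\<open>rest\<close> has mean zero on each selected cube, and the subtracted kernel value
  is constant there, so the subtraction changes nothing. The vanishing is checked in coordinates
  because \<open>integral_stopped_eq_0\<close> is about real functions.\<close>

lemma vconv_rest_eq:
  assumes \<delta>: "0 < \<delta>"
  shows "vconv (riesz_kern \<delta>) rest x = (LBINT z. (indicator stopped z * rest z) *\<^sub>R (riesz_kern \<delta> (z - x) - riesz_kern \<delta> (center z - x)))"
proof -
  obtain K where K: "\<And>y::'a. norm (riesz_kern \<delta> y) \<le> K" using norm_riesz_kern_le[OF \<delta>] by blast
  have K0: "0 \<le> K" using order_trans[OF norm_ge_zero K] .
  have ib: "integrable lborel (\<lambda>z. (indicator stopped z * rest z) *\<^sub>R riesz_kern \<delta> (h z))" if [measurable]: "h \<in> borel_measurable borel" for h :: "'a \<Rightarrow> 'a"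
  proof (rule Bochner_Integration.integrable_bound[OF integrable_mult_right[OF integrable_rest, of K]])
    show "AE z in lborel. norm ((indicator stopped z * rest z) *\<^sub>R riesz_kern \<delta> (h z)) \<le> norm (K * rest z)"
    proof (rule AE_I2)
      fix z
      show "norm ((indicator stopped z * rest z) *\<^sub>R riesz_kern \<delta> (h z)) \<le> norm (K * rest z)"
        using mult_left_mono[OF K[of "h z"], of "\<bar>rest z\<bar>"] K0 by (auto simp: indicator_def abs_mult mult.commute)
    qed
  qed measurable
  have zero: "(LBINT z. (indicator stopped z * rest z) *\<^sub>R riesz_kern \<delta> (center z - x)) = 0"
  proof (subst euclidean_eq_iff, intro ballI)
    fix e :: 'a assume e: "e \<in> Basis"
    let ?F = "\<lambda>z. rest z * (riesz_kern \<delta> (center z - x) \<bullet> e)"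
    have "\<bar>riesz_kern \<delta> (center z - x) \<bullet> e\<bar> \<le> K" for z
      using Basis_le_norm[OF e, of "riesz_kern \<delta> (center z - x)"] K[of "center z - x"] by linarith
    then have Fi: "integrable lborel ?F"
      by (intro integral_mult_bound(1)[OF integrable_rest]) measurable
    have "(LBINT z. indicator stopped z * ?F z) = 0"
    proof (rule integral_stopped_eq_0[OF Fi])
      fix y assume y: "y \<in> stopped"
      have "(LBINT z. indicator (stop_cell y) z * ?F z) = (LBINT z. indicator (stop_cell y) z * rest z * (riesz_kern \<delta> (center y - x) \<bullet> e))"
      proof (rule Bochner_Integration.integral_cong[OF refl])
        fix z
        show "indicator (stop_cell y) z * ?F z = indicator (stop_cell y) z * rest z * (riesz_kern \<delta> (center y - x) \<bullet> e)"
        proof (cases "z \<in> stop_cell y")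
          case True
          then show ?thesis unfolding good_on_stop_cell(2)[OF y True] by simp
        qed simp
      qed
      then show "(LBINT z. indicator (stop_cell y) z * ?F z) = 0"
        by (simp only: integral_mult_left_zero integral_rest_stop_cell[OF y] mult_zero_left)
    qed
    moreover have "(LBINT z. (indicator stopped z * rest z) *\<^sub>R riesz_kern \<delta> (center z - x)) \<bullet> e = (LBINT z. indicator stopped z * ?F z)"
      using ib[of "\<lambda>z. center z - x"] by (subst integral_inner_left[symmetric]) (simp_all add: mult.assoc)
    ultimately show "(LBINT z. (indicator stopped z * rest z) *\<^sub>R riesz_kern \<delta> (center z - x)) \<bullet> e = 0 \<bullet> e" by simp
  qed
  have "vconv (riesz_kern \<delta>) rest x = (LBINT z. rest z *\<^sub>R riesz_kern \<delta> (z - x))"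
    unfolding vconv_def using integral_shift[of "\<lambda>z. rest z *\<^sub>R riesz_kern \<delta> (z - x)" x] by simp
  also have "... = (LBINT z. (indicator stopped z * rest z) *\<^sub>R riesz_kern \<delta> (z - x))"
  proof (rule integral_cong_AE)
    show "AE z in lborel. rest z *\<^sub>R riesz_kern \<delta> (z - x) = (indicator stopped z * rest z) *\<^sub>R riesz_kern \<delta> (z - x)"
      using AE_rest by eventually_elim simp
  qed measurable
  also have "... = (LBINT z. (indicator stopped z * rest z) *\<^sub>R riesz_kern \<delta> (z - x)) - (LBINT z. (indicator stopped z * rest z) *\<^sub>R riesz_kern \<delta> (center z - x))"
    unfolding zero by simp
  also have "... = (LBINT z. (indicator stopped z * rest z) *\<^sub>R (riesz_kern \<delta> (z - x) - riesz_kern \<delta> (center z - x)))"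
    unfolding scaleR_diff_right by (rule Bochner_Integration.integral_diff[symmetric]) (rule ib, measurable)+
  finally show ?thesis .
qed

text \<open>Integrating in \<open>x\<close> outside the halo first, the kernel difference falls
  under Hoermander's condition with \<open>h = z - center z\<close>, and what is left is the L1 norm
  of \<open>rest\<close>.\<close>

lemma nn_integral_vconv_rest:
  assumes \<delta>: "0 < \<delta>"
  shows "(NN x. ennreal (norm (vconv (riesz_kern \<delta>) rest x)) * indicator (- halo) x) \<le> ennreal (6 * real DIM('a)) * (NN y. ennreal \<bar>rest y\<bar>)"
proof -
  have [measurable]: "halo \<in> sets borel" using open_halo by simp
  let ?i = "indicator (- halo) :: 'a \<Rightarrow> ennreal"
  let ?d = "\<lambda>x z. ennreal (norm (riesz_kern \<delta> (z - x) - riesz_kern \<delta> (center z - x)))"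
  have "(NN x. ennreal (norm (vconv (riesz_kern \<delta>) rest x)) * ?i x)
    \<le> (NN x. NN z. ennreal \<bar>rest z\<bar> * indicator stopped z * (?d x z * ?i x))"
  proof (rule nn_integral_mono)
    fix x :: 'a
    have "ennreal (norm (vconv (riesz_kern \<delta>) rest x)) \<le> (NN z. ennreal (norm ((indicator stopped z * rest z) *\<^sub>R (riesz_kern \<delta> (z - x) - riesz_kern \<delta> (center z - x)))))"
      unfolding vconv_rest_eq[OF \<delta>] by (rule ennreal_norm_integral_le)
    also have "... = (NN z. ennreal \<bar>rest z\<bar> * indicator stopped z * ?d x z)"
      by (intro nn_integral_cong) (auto simp: indicator_def ennreal_mult')
    finally have "ennreal (norm (vconv (riesz_kern \<delta>) rest x)) * ?i x \<le> (NN z. ennreal \<bar>rest z\<bar> * indicator stopped z * ?d x z) * ?i x"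
      by (rule mult_right_mono) simp
    also have "... = (NN z. ennreal \<bar>rest z\<bar> * indicator stopped z * ?d x z * ?i x)"
      by (rule nn_integral_multc[symmetric]) measurable
    finally show "ennreal (norm (vconv (riesz_kern \<delta>) rest x)) * ?i x \<le> (NN z. ennreal \<bar>rest z\<bar> * indicator stopped z * (?d x z * ?i x))"
      by (simp only: mult.assoc)
  qed
  also have "... = (NN z. NN x. ennreal \<bar>rest z\<bar> * indicator stopped z * (?d x z * ?i x))"
    by (rule lborel_pair.Fubini'[symmetric]) measurable
  also have "... \<le> (NN z. ennreal (6 * real DIM('a)) * ennreal \<bar>rest z\<bar>)"
  proof (rule nn_integral_mono)
    fix z :: 'a
    show "(NN x. ennreal \<bar>rest z\<bar> * indicator stopped z * (?d x z * ?i x)) \<le> ennreal (6 * real DIM('a)) * ennreal \<bar>rest z\<bar>"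
    proof (cases "z \<in> stopped")
      case True
      define r where "r = real DIM('a) * (A / 2 ^ gen z)"
      have r: "0 < r" unfolding r_def by (rule mult_pos_pos) (simp, rule side_pos)
      have h: "norm (z - center z) \<le> r"
        unfolding r_def center_def crn_def by (rule norm_diff_corner_le) simp
      have "(NN x. ?d x z * ?i x)
        \<le> (NN x. ennreal (norm (riesz_kern \<delta> ((center z - x) + (z - center z)) - riesz_kern \<delta> (center z - x))) * indicator {x. 2 * r \<le> norm x} (center z - x))"
      proof (rule nn_integral_mono)
        fix x :: 'a
        have "2 * r \<le> norm (center z - x)" if "x \<notin> halo"
        proof (rule ccontr)
          assume "\<not> 2 * r \<le> norm (center z - x)"
          then have "x \<in> halo" using True by (auto simp: halo_def center_def r_def dist_norm intro!: bexI[of _ z])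
          then show False using that by simp
        qed
        then show "?d x z * ?i x \<le> ennreal (norm (riesz_kern \<delta> ((center z - x) + (z - center z)) - riesz_kern \<delta> (center z - x))) * indicator {x. 2 * r \<le> norm x} (center z - x)"
          by (auto simp: indicator_def)
      qed
      also have "... = (NN x. ennreal (norm (riesz_kern \<delta> (x + (z - center z)) - riesz_kern \<delta> x)) * indicator {x. 2 * r \<le> norm x} x)"
        by (rule nn_integral_reflect) measurable
      also have "... \<le> ennreal (6 * real DIM('a))" by (rule riesz_kern_Hoermander[OF \<delta> r h])
      finally have le: "(NN x. ?d x z * ?i x) \<le> ennreal (6 * real DIM('a))" .
      have "(NN x. ennreal \<bar>rest z\<bar> * indicator stopped z * (?d x z * ?i x)) = ennreal \<bar>rest z\<bar> * (NN x. ?d x z * ?i x)"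
        using True by (subst nn_integral_cmult) auto
      also have "... \<le> ennreal \<bar>rest z\<bar> * ennreal (6 * real DIM('a))" by (intro mult_left_mono le) simp
      finally show ?thesis by (simp only: mult.commute)
    qed simp
  qed
  also have "... = ennreal (6 * real DIM('a)) * (NN y. ennreal \<bar>rest y\<bar>)"
    by (rule nn_integral_cmult) measurable
  finally show ?thesis .
qed

end

section \<open>The Riesz transform controls the heat pairing\<close>

definition trunc_riesz :: "('a::euclidean_space \<Rightarrow> real) \<Rightarrow> 'a \<Rightarrow> real \<Rightarrow> 'a" where
  "trunc_riesz f x \<epsilon> = (LBINT y. indicator {y. \<epsilon> < norm y} y *\<^sub>R ((f (x + y) / norm y ^ (DIM('a) + 1)) *\<^sub>R y))"

lemma trunc_riesz_measurable[measurable (raw)]: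
  assumes [measurable]: "f \<in> borel_measurable borel" "g \<in> borel_measurable M" "e \<in> borel_measurable M"
  shows "(\<lambda>x. trunc_riesz f (g x :: 'a::euclidean_space) (e x)) \<in> borel_measurable M"
  unfolding trunc_riesz_def by measurable

lemma
  fixes f :: "'a::euclidean_space \<Rightarrow> real"
  assumes f: "integrable lborel f" and \<epsilon>: "0 < \<epsilon>"
  shows integrable_trunc_riesz: "integrable lborel (\<lambda>y. indicator {y. \<epsilon> < norm y} y *\<^sub>R ((f (x + y) / norm y ^ (DIM('a) + 1)) *\<^sub>R y))"
    and norm_trunc_riesz_le: "norm (trunc_riesz f x \<epsilon>) \<le> (LBINT y. \<bar>f y\<bar>) / \<epsilon> ^ DIM('a)"
proof -
  note [measurable] = borel_measurable_integrable[OF f, simplified]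
  have sh: "integrable lborel (\<lambda>y. \<bar>f (x + y)\<bar>)" using f by (subst integrable_shift[of "\<lambda>y. \<bar>f y\<bar>"]) auto
  then have i: "integrable lborel (\<lambda>y. \<bar>f (x + y)\<bar> / \<epsilon> ^ DIM('a))" by simp
  have le: "norm (indicator {y. \<epsilon> < norm y} y *\<^sub>R ((f (x + y) / norm y ^ (DIM('a) + 1)) *\<^sub>R y)) \<le> \<bar>f (x + y)\<bar> / \<epsilon> ^ DIM('a)" for y
  proof (cases "\<epsilon> < norm y")
    case True
    then have ny: "0 < norm y" using \<epsilon> by linarith
    have "norm ((f (x + y) / norm y ^ (DIM('a) + 1)) *\<^sub>R y) = \<bar>f (x + y)\<bar> / norm y ^ DIM('a)"
      using ny by simp
    also have "... \<le> \<bar>f (x + y)\<bar> / \<epsilon> ^ DIM('a)"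
      using True \<epsilon> by (intro divide_left_mono power_mono mult_pos_pos zero_less_power) auto
    finally show ?thesis using True by simp
  qed (use \<epsilon> in simp)
  show int: "integrable lborel (\<lambda>y. indicator {y. \<epsilon> < norm y} y *\<^sub>R ((f (x + y) / norm y ^ (DIM('a) + 1)) *\<^sub>R y))"
  proof (rule Bochner_Integration.integrable_bound[OF i])
    show "AE y in lborel. norm (indicator {y. \<epsilon> < norm y} y *\<^sub>R ((f (x + y) / norm y ^ (DIM('a) + 1)) *\<^sub>R y)) \<le> norm (\<bar>f (x + y)\<bar> / \<epsilon> ^ DIM('a))"
      by (rule AE_I2) (rule order_trans[OF le], use \<epsilon> in simp)
  qed measurable
  have "norm (trunc_riesz f x \<epsilon>) \<le> (LBINT y. \<bar>f (x + y)\<bar> / \<epsilon> ^ DIM('a))"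
    unfolding trunc_riesz_def by (rule Bochner_Integration.integral_norm_bound_integral[OF int i le])
  also have "... = (LBINT y. \<bar>f y\<bar>) / \<epsilon> ^ DIM('a)"
    by (simp add: integral_shift[of "\<lambda>y. \<bar>f y\<bar>"])
  finally show "norm (trunc_riesz f x \<epsilon>) \<le> (LBINT y. \<bar>f y\<bar>) / \<epsilon> ^ DIM('a)" .
qed

text \<open>A window in \<open>\<sigma> = r\<^sup>2 * \<tau>\<close> is a shell in the radius
  \<open>r\<close>, written as a difference of two exteriors to match the sharp truncations.
  \<open>\<delta> < 1\<close> makes the first radius the smaller one.\<close>

lemma cut_scale:
  assumes \<delta>: "0 < \<delta>" "\<delta> < 1" and \<tau>: "0 < \<tau>" and r: "0 < r"
  shows "cut \<delta> (r\<^sup>2 * \<tau>) = (if sqrt (\<delta> / \<tau>) < r then 1 else 0) - (if sqrt (1 / (\<delta> * \<tau>)) < r then 1 else 0)"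
proof -
  have sq: "sqrt u < r \<longleftrightarrow> u < r\<^sup>2" if "0 \<le> u" for u
    using r real_sqrt_less_iff[of u "r\<^sup>2"] by simp
  have 1: "sqrt (\<delta> / \<tau>) < r \<longleftrightarrow> \<delta> < r\<^sup>2 * \<tau>"
    using \<delta> \<tau> by (subst sq) (auto simp: pos_divide_less_eq)
  have 2: "sqrt (1 / (\<delta> * \<tau>)) < r \<longleftrightarrow> \<not> r\<^sup>2 * \<tau> * \<delta> \<le> 1"
    using \<delta> \<tau> by (subst sq) (auto simp: pos_divide_less_eq mult_ac not_le)
  have 3: "\<delta> < r\<^sup>2 * \<tau>" if "\<not> r\<^sup>2 * \<tau> * \<delta> \<le> 1"
  proof -
    have "1 < r\<^sup>2 * \<tau> * \<delta>" using that by simp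
    also have "... \<le> r\<^sup>2 * \<tau> * 1" using \<delta> \<tau> by (intro mult_left_mono) auto
    finally show ?thesis using \<delta> by simp
  qed
  show ?thesis unfolding 1 2 cut_def using 3 by auto
qed

text \<open>
  Substituting \<open>\<sigma> = \<bar>y\<bar>\<^sup>2 \<tau>\<close> exhibits the heat truncation of the Riesz kernel as an average over \<open>\<tau>\<close> of
  sharp truncations.
\<close>

lemma vconv_riesz_kern_eq_trunc:
  fixes f :: "'a::euclidean_space \<Rightarrow> real"
  assumes f: "integrable lborel f" and \<delta>: "0 < \<delta>" "\<delta> < 1"
  shows "vconv (riesz_kern \<delta>) f x = (LBINT \<tau>. (pw (- 1 / 2) \<tau> * heat_profile (real DIM('a)) \<tau>) *\<^sub>R
     (trunc_riesz f x (sqrt (\<delta> / \<tau>)) - trunc_riesz f x (sqrt (1 / (\<delta> * \<tau>)))))"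
proof -
  note [measurable] = borel_measurable_integrable[OF f, simplified]
  let ?w = "\<lambda>\<tau>. pw (- 1 / 2) \<tau> * heat_profile (real DIM('a)) \<tau>"
  define G where "G = (\<lambda>(y::'a) \<tau>. cut \<delta> ((norm y)\<^sup>2 * \<tau>) * ?w \<tau> / norm y ^ (DIM('a) + 1))"
  let ?F = "\<lambda>y \<tau>. (f (x + (y::'a)) * G y \<tau>) *\<^sub>R y"
  have Fm: "(\<lambda>(y, \<tau>). ?F y \<tau>) \<in> borel_measurable (lborel \<Otimes>\<^sub>M lborel)" unfolding G_def by measurable
  have G0: "0 \<le> G y \<tau>" for y \<tau>
    by (cases "0 < \<tau>") (auto simp: G_def cut_def pw_nonpos heat_profile_nonneg)
  have scale: "cutw \<delta> ((norm y)\<^sup>2 * \<tau>) * (heat ((norm y)\<^sup>2 * \<tau>) y / (2 * ((norm y)\<^sup>2 * \<tau>))) * (norm y)\<^sup>2 = G y \<tau>"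
    if y: "y \<noteq> 0" for y :: 'a and \<tau>
  proof -
    have "norm y powr (2 * (- 1 / 2) - real DIM('a) - 2) * (norm y)\<^sup>2 = norm y powr (- real (DIM('a) + 1))"
    proof -
      have "norm y powr (2 * (- 1 / 2) - real DIM('a) - 2) * norm y powr 2 = norm y powr (- real (DIM('a) + 1))"
        unfolding powr_add[symmetric] by simp
      then show ?thesis using y by simp
    qed
    also have "... = 1 / norm y ^ (DIM('a) + 1)" using y by (subst powr_minus_divide, subst powr_realpow) auto
    finally have p: "norm y powr (2 * (- 1 / 2) - real DIM('a) - 2) * (norm y)\<^sup>2 = 1 / norm y ^ (DIM('a) + 1)" .
    have "cutw \<delta> ((norm y)\<^sup>2 * \<tau>) * (heat ((norm y)\<^sup>2 * \<tau>) y / (2 * ((norm y)\<^sup>2 * \<tau>))) * (norm y)\<^sup>2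
      = cut \<delta> ((norm y)\<^sup>2 * \<tau>) * (pw (- 1 / 2) ((norm y)\<^sup>2 * \<tau>) * (heat ((norm y)\<^sup>2 * \<tau>) y / (2 * ((norm y)\<^sup>2 * \<tau>)))) * (norm y)\<^sup>2"
      by (simp only: cutw_def mult.assoc)
    also have "... = cut \<delta> ((norm y)\<^sup>2 * \<tau>) * ?w \<tau> * (norm y powr (2 * (- 1 / 2) - real DIM('a) - 2) * (norm y)\<^sup>2)"
      unfolding pw_heat_scaling[OF y] by (simp only: mult_ac)
    finally show ?thesis unfolding p G_def by simp
  qed
  have in1: "(LBINT \<tau>. ?F y \<tau>) = f (x + y) *\<^sub>R riesz_kern \<delta> y" if y: "y \<noteq> 0" for y
  proof -
    have "riesz_kern \<delta> y = \<bar>(norm y)\<^sup>2\<bar> *\<^sub>R (LBINT \<tau>. cutw \<delta> (0 + (norm y)\<^sup>2 * \<tau>) *\<^sub>R kern (0 + (norm y)\<^sup>2 * \<tau>) y)"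
      unfolding riesz_kern_def by (rule lborel_integral_real_affine) (use y in simp)
    also have "... = (LBINT \<tau>. \<bar>(norm y)\<^sup>2\<bar> *\<^sub>R (cutw \<delta> (0 + (norm y)\<^sup>2 * \<tau>) *\<^sub>R kern (0 + (norm y)\<^sup>2 * \<tau>) y))"
      by (rule integral_scaleR_right[symmetric])
    also have "... = (LBINT \<tau>. G y \<tau> *\<^sub>R y)"
      unfolding scale[OF y, symmetric] kern_def by (intro Bochner_Integration.integral_cong) (simp_all only: scaleR_scaleR add_0_left abs_power2 mult_ac)
    finally have "f (x + y) *\<^sub>R riesz_kern \<delta> y = (LBINT \<tau>. f (x + y) *\<^sub>R (G y \<tau> *\<^sub>R y))"
      by (simp only: integral_scaleR_right)
    then show ?thesis by simp
  qed
  \<comment> \<open>Substituting back to \<open>\<sigma>\<close> turns the \<open>\<tau>\<close>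
    integral into the one that defines \<open>riesz_kern\<close>, whose absolute bound does not
    depend on \<open>y\<close>; the rest is integrability of \<open>f\<close>.\<close>
  have fin: "(NN y. NN \<tau>. ennreal (norm (?F y \<tau>))) < \<infinity>"
  proof -
    define C where "C = \<delta> powr (- (real DIM('a) + 1) / 2) * (LBINT \<sigma>. cutw \<delta> \<sigma>)"
    have C0: "0 \<le> C" by (simp add: C_def integral_cutw_nonneg)
    have "(NN y. NN \<tau>. ennreal (norm (?F y \<tau>))) \<le> (NN y. ennreal (norm (C * f (x + y))))"
    proof (rule nn_integral_mono)
      fix y :: 'a
      show "(NN \<tau>. ennreal (norm (?F y \<tau>))) \<le> ennreal (norm (C * f (x + y)))"
      proof (cases "y = 0")
        case y: False
        have "(NN \<tau>. ennreal (norm (?F y \<tau>))) = (NN \<tau>. ennreal \<bar>f (x + y)\<bar> * ennreal (G y \<tau> * norm y))"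
          by (intro nn_integral_cong)
            (simp only: norm_scaleR abs_mult abs_of_nonneg[OF G0] ennreal_mult'[OF abs_ge_zero, symmetric] mult.assoc)
        also have "... = ennreal \<bar>f (x + y)\<bar> * (NN \<tau>. ennreal (G y \<tau> * norm y))"
          by (rule nn_integral_cmult) (unfold G_def, measurable)
        also have "(NN \<tau>. ennreal (G y \<tau> * norm y)) = (NN \<tau>. ennreal \<bar>(norm y)\<^sup>2\<bar> * ennreal (norm (cutw \<delta> (0 + (norm y)\<^sup>2 * \<tau>) *\<^sub>R kern (0 + (norm y)\<^sup>2 * \<tau>) y)))"
        proof (rule nn_integral_cong)
          fix \<tau> :: real
          have "0 \<le> cutw \<delta> ((norm y)\<^sup>2 * \<tau>) * (heat ((norm y)\<^sup>2 * \<tau>) y / (2 * ((norm y)\<^sup>2 * \<tau>)))"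
          proof (cases "0 < \<tau>")
            case False
            then have "(norm y)\<^sup>2 * \<tau> \<le> 0" by (simp add: mult_nonneg_nonpos)
            then have "(norm y)\<^sup>2 * \<tau> \<le> \<delta>" using \<delta> by linarith
            then show ?thesis by (simp add: cutw_eq_0)
          qed simp
          then have "norm (cutw \<delta> ((norm y)\<^sup>2 * \<tau>) *\<^sub>R kern ((norm y)\<^sup>2 * \<tau>) y) = cutw \<delta> ((norm y)\<^sup>2 * \<tau>) * (heat ((norm y)\<^sup>2 * \<tau>) y / (2 * ((norm y)\<^sup>2 * \<tau>))) * norm y"
            unfolding kern_def scaleR_scaleR norm_scaleR by (simp only: abs_of_nonneg)
          then have "G y \<tau> * norm y = \<bar>(norm y)\<^sup>2\<bar> * norm (cutw \<delta> (0 + (norm y)\<^sup>2 * \<tau>) *\<^sub>R kern (0 + (norm y)\<^sup>2 * \<tau>) y)"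
            unfolding scale[OF y, symmetric] by simp
          then show "ennreal (G y \<tau> * norm y) = ennreal \<bar>(norm y)\<^sup>2\<bar> * ennreal (norm (cutw \<delta> (0 + (norm y)\<^sup>2 * \<tau>) *\<^sub>R kern (0 + (norm y)\<^sup>2 * \<tau>) y))"
            by (simp only: ennreal_mult'[OF abs_ge_zero])
        qed
        also have "... = ennreal \<bar>(norm y)\<^sup>2\<bar> * (NN \<tau>. ennreal (norm (cutw \<delta> (0 + (norm y)\<^sup>2 * \<tau>) *\<^sub>R kern (0 + (norm y)\<^sup>2 * \<tau>) y)))"
          by (rule nn_integral_cmult) measurable
        also have "... = (NN \<sigma>. ennreal (norm (cutw \<delta> \<sigma> *\<^sub>R kern \<sigma> y)))"
          by (rule nn_integral_real_affine[symmetric]) (use y in auto)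
        also have "... \<le> ennreal C" unfolding C_def by (rule nn_integral_norm_cutw_kern[OF \<delta>(1)])
        finally have "(NN \<tau>. ennreal (norm (?F y \<tau>))) \<le> ennreal \<bar>f (x + y)\<bar> * ennreal C"
          by (simp add: mult_left_mono)
        then show ?thesis using C0 by (simp add: abs_mult ennreal_mult' mult.commute)
      qed simp
    qed
    also have "... < \<infinity>"
    proof -
      have "integrable lborel (\<lambda>y. C * f (x + y))"
        using f by (intro integrable_mult_right) (simp add: integrable_shift)
      then show ?thesis by (simp only: integrable_iff_bounded)
    qed
    finally show ?thesis .
  qed
  have in2: "(LBINT y. ?F y \<tau>) = ?w \<tau> *\<^sub>R (trunc_riesz f x (sqrt (\<delta> / \<tau>)) - trunc_riesz f x (sqrt (1 / (\<delta> * \<tau>))))" for \<tau>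
  proof (cases "0 < \<tau>")
    case \<tau>: True
    let ?T = "\<lambda>\<epsilon> y. indicator {y. \<epsilon> < norm y} y *\<^sub>R ((f (x + y) / norm y ^ (DIM('a) + 1)) *\<^sub>R y)"
    have "?F y \<tau> = ?w \<tau> *\<^sub>R (?T (sqrt (\<delta> / \<tau>)) y - ?T (sqrt (1 / (\<delta> * \<tau>))) y)" for y
    proof (cases "y = 0")
      case False
      then show ?thesis
        unfolding G_def using cut_scale[OF \<delta> \<tau>, of "norm y"]
        by (simp add: indicator_def scaleR_diff_left[symmetric] mult_ac split del: if_split)
    qed simp
    then have "(LBINT y. ?F y \<tau>) = (LBINT y. ?w \<tau> *\<^sub>R (?T (sqrt (\<delta> / \<tau>)) y - ?T (sqrt (1 / (\<delta> * \<tau>))) y))"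
      by presburger
    also have "... = ?w \<tau> *\<^sub>R (LBINT y. ?T (sqrt (\<delta> / \<tau>)) y - ?T (sqrt (1 / (\<delta> * \<tau>))) y)"
      by (rule integral_scaleR_right)
    also have "(LBINT y. ?T (sqrt (\<delta> / \<tau>)) y - ?T (sqrt (1 / (\<delta> * \<tau>))) y) = trunc_riesz f x (sqrt (\<delta> / \<tau>)) - trunc_riesz f x (sqrt (1 / (\<delta> * \<tau>)))"
      unfolding trunc_riesz_def
      by (rule Bochner_Integration.integral_diff) (rule integrable_trunc_riesz[OF f], use \<delta> \<tau> in simp)+
    finally show ?thesis .
  qed (simp add: G_def pw_nonpos)
  have "vconv (riesz_kern \<delta>) f x = (LBINT y. LBINT \<tau>. ?F y \<tau>)"
    unfolding vconv_def
  proof (rule integral_cong_AE)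
    show "AE y in lborel. f (x + y) *\<^sub>R riesz_kern \<delta> y = (LBINT \<tau>. ?F y \<tau>)"
      using AE_lborel_singleton[of 0] by eventually_elim (simp add: in1)
    show "(\<lambda>y. LBINT \<tau>. ?F y \<tau>) \<in> borel_measurable lborel"
      by (rule lborel.borel_measurable_lebesgue_integral[OF Fm])
  qed measurable
  also have "... = (LBINT \<tau>. LBINT y. ?F y \<tau>)" by (rule Fubini_lborel(1)[OF Fm fin])
  finally show ?thesis unfolding in2 .
qed

text \<open>The heat truncation averages sharp truncations at radii tending to 0, minus those at
  radii tending to infinity, against a fixed integrable weight. Where the principal value exists all
  sharp truncations are bounded, near 0 by convergence and elsewhere by the L1 norm of
  \<open>f\<close>, so dominated convergence applies point by point.\<close>

lemma tendsto_vconv_riesz_kern: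
  fixes f :: "'a::euclidean_space \<Rightarrow> real"
  assumes f: "integrable lborel f" and l: "(trunc_riesz f x \<longlongrightarrow> l) (at_right 0)"
  shows "((\<lambda>\<delta>. vconv (riesz_kern \<delta>) f x) \<longlongrightarrow> heat_const (real DIM('a)) (- 1 / 2) *\<^sub>R l) (at_right 0)"
proof -
  note [measurable] = borel_measurable_integrable[OF f, simplified]
  let ?w = "\<lambda>\<tau>. pw (- 1 / 2) \<tau> * heat_profile (real DIM('a)) \<tau>"
  have w0: "0 \<le> ?w \<tau>" for \<tau> by (cases "0 < \<tau>") (auto simp: pw_nonpos heat_profile_nonneg)
  have wi: "integrable lborel ?w" by (rule integrable_heat_profile) auto
  define N where "N = (LBINT y. \<bar>f y\<bar>)"
  have N0: "0 \<le> N" by (simp add: N_def)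
  have Tle: "norm (trunc_riesz f x \<epsilon>) \<le> N / \<epsilon> ^ DIM('a)" if "0 < \<epsilon>" for \<epsilon>
    unfolding N_def by (rule norm_trunc_riesz_le[OF f that])
  obtain B where B: "\<And>\<epsilon>. 0 < \<epsilon> \<Longrightarrow> norm (trunc_riesz f x \<epsilon>) \<le> B"
  proof -
    have "eventually (\<lambda>\<epsilon>. norm (trunc_riesz f x \<epsilon>) < norm l + 1) (at_right 0)"
      by (rule order_tendstoD(2)[OF tendsto_norm[OF l]]) simp
    then obtain e where e: "0 < e" "\<And>\<epsilon>. 0 < \<epsilon> \<Longrightarrow> \<epsilon> < e \<Longrightarrow> norm (trunc_riesz f x \<epsilon>) < norm l + 1"
      by (auto simp: eventually_at_right_field)
    have "norm (trunc_riesz f x \<epsilon>) \<le> max (norm l + 1) (N / e ^ DIM('a))" if \<epsilon>: "0 < \<epsilon>" for \<epsilon>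
    proof (cases "\<epsilon> < e")
      case True
      then show ?thesis using e(2)[OF \<epsilon>] by linarith
    next
      case False
      have "N / \<epsilon> ^ DIM('a) \<le> N / e ^ DIM('a)"
        using False e N0 \<epsilon> by (intro divide_left_mono power_mono mult_pos_pos zero_less_power) auto
      then show ?thesis using Tle[OF \<epsilon>] by linarith
    qed
    then show ?thesis by (rule that)
  qed
  have B0: "0 \<le> B" using order_trans[OF norm_ge_zero B[of 1]] by simp
  have T0: "(trunc_riesz f x \<longlongrightarrow> 0) at_top"
  proof (rule Lim_null_comparison)
    show "eventually (\<lambda>\<epsilon>. norm (trunc_riesz f x \<epsilon>) \<le> N / \<epsilon> ^ DIM('a)) at_top"
      using eventually_gt_at_top[of 0] by eventually_elim (rule Tle)
    show "((\<lambda>\<epsilon>. N / \<epsilon> ^ DIM('a)) \<longlongrightarrow> 0) at_top"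
      by (intro real_tendsto_divide_at_top[OF tendsto_const] filterlim_pow_at_top filterlim_ident) simp
  qed
  have lim: "((\<lambda>\<delta>. trunc_riesz f x (sqrt (\<delta> / \<tau>)) - trunc_riesz f x (sqrt (1 / (\<delta> * \<tau>)))) \<longlongrightarrow> l - 0) (at_right 0)"
    if \<tau>: "0 < \<tau>" for \<tau>
  proof (rule tendsto_diff)
    have "filterlim (\<lambda>\<delta>. sqrt (\<delta> / \<tau>)) (at_right 0) (at_right 0)"
    proof (rule filterlim_atI[THEN filterlim_mono, OF _ _ order_refl] | rule filterlim_at_withinI)+
      have "((\<lambda>\<delta>. sqrt (\<delta> / \<tau>)) \<longlongrightarrow> sqrt (0 / \<tau>)) (at_right 0)"
        using \<tau> by (intro tendsto_real_sqrt tendsto_divide tendsto_ident_at tendsto_const) auto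
      then show "((\<lambda>\<delta>. sqrt (\<delta> / \<tau>)) \<longlongrightarrow> 0) (at_right 0)" by simp
      show "eventually (\<lambda>\<delta>. sqrt (\<delta> / \<tau>) \<in> {0<..} - {0}) (at_right 0)"
        using eventually_at_right_less[of 0] by eventually_elim (use \<tau> in simp)
    qed
    then show "((\<lambda>\<delta>. trunc_riesz f x (sqrt (\<delta> / \<tau>))) \<longlongrightarrow> l) (at_right 0)"
      by (rule filterlim_compose[OF l])
    have "filterlim (\<lambda>\<delta>. sqrt (1 / (\<delta> * \<tau>))) at_top (at_right 0)"
    proof (rule filterlim_compose[OF sqrt_at_top])
      have "filterlim (\<lambda>\<delta>. (1 / \<tau>) * inverse \<delta>) at_top (at_right 0)"
        using \<tau> by (intro filterlim_tendsto_pos_mult_at_top[OF tendsto_const _ filterlim_inverse_at_top_right]) simp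
      then show "filterlim (\<lambda>\<delta>. 1 / (\<delta> * \<tau>)) at_top (at_right 0)"
        by (simp add: divide_inverse mult.commute)
    qed
    then show "((\<lambda>\<delta>. trunc_riesz f x (sqrt (1 / (\<delta> * \<tau>)))) \<longlongrightarrow> 0) (at_right 0)"
      by (rule filterlim_compose[OF T0])
  qed
  have "((\<lambda>\<delta>. LBINT \<tau>. ?w \<tau> *\<^sub>R (trunc_riesz f x (sqrt (\<delta> / \<tau>)) - trunc_riesz f x (sqrt (1 / (\<delta> * \<tau>)))))
    \<longlongrightarrow> (LBINT \<tau>. ?w \<tau> *\<^sub>R l)) (at_right 0)"
  proof (rule integral_dominated_convergence_at_right)
    show "integrable lborel (\<lambda>\<tau>. ?w \<tau> * (2 * B))" using wi by simp
    show "(\<lambda>\<tau>. ?w \<tau> *\<^sub>R l) \<in> borel_measurable lborel" by measurable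
    show "(\<lambda>\<tau>. ?w \<tau> *\<^sub>R (trunc_riesz f x (sqrt (\<delta> / \<tau>)) - trunc_riesz f x (sqrt (1 / (\<delta> * \<tau>))))) \<in> borel_measurable lborel" for \<delta>
      by measurable
    show "AE \<tau> in lborel. ((\<lambda>\<delta>. ?w \<tau> *\<^sub>R (trunc_riesz f x (sqrt (\<delta> / \<tau>)) - trunc_riesz f x (sqrt (1 / (\<delta> * \<tau>))))) \<longlongrightarrow> ?w \<tau> *\<^sub>R l) (at_right 0)"
    proof (rule AE_I2)
      fix \<tau> :: real
      show "((\<lambda>\<delta>. ?w \<tau> *\<^sub>R (trunc_riesz f x (sqrt (\<delta> / \<tau>)) - trunc_riesz f x (sqrt (1 / (\<delta> * \<tau>))))) \<longlongrightarrow> ?w \<tau> *\<^sub>R l) (at_right 0)"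
      proof (cases "0 < \<tau>")
        case True
        from tendsto_scaleR[OF tendsto_const lim[OF True]] show ?thesis by simp
      qed (simp add: pw_nonpos)
    qed
    show "AE \<tau> in lborel. norm (?w \<tau> *\<^sub>R (trunc_riesz f x (sqrt (\<delta> / \<tau>)) - trunc_riesz f x (sqrt (1 / (\<delta> * \<tau>))))) \<le> ?w \<tau> * (2 * B)"
      if \<delta>: "0 < \<delta>" for \<delta>
    proof (rule AE_I2)
      fix \<tau> :: real
      show "norm (?w \<tau> *\<^sub>R (trunc_riesz f x (sqrt (\<delta> / \<tau>)) - trunc_riesz f x (sqrt (1 / (\<delta> * \<tau>))))) \<le> ?w \<tau> * (2 * B)"
      proof (cases "0 < \<tau>")
        case True
        have "norm (trunc_riesz f x (sqrt (\<delta> / \<tau>)) - trunc_riesz f x (sqrt (1 / (\<delta> * \<tau>)))) \<le> B + B"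
          by (rule order_trans[OF norm_triangle_ineq4]) (intro add_mono B, use True \<delta> in auto)
        then have "?w \<tau> * norm (trunc_riesz f x (sqrt (\<delta> / \<tau>)) - trunc_riesz f x (sqrt (1 / (\<delta> * \<tau>)))) \<le> ?w \<tau> * (2 * B)"
          by (intro mult_left_mono w0) simp
        then show ?thesis unfolding norm_scaleR abs_of_nonneg[OF w0] .
      qed (simp add: pw_nonpos)
    qed
  qed
  also have "(LBINT \<tau>. ?w \<tau> *\<^sub>R l) = heat_const (real DIM('a)) (- 1 / 2) *\<^sub>R l"
    unfolding heat_const_def using wi by simp
  finally have L: "((\<lambda>\<delta>. LBINT \<tau>. ?w \<tau> *\<^sub>R (trunc_riesz f x (sqrt (\<delta> / \<tau>)) - trunc_riesz f x (sqrt (1 / (\<delta> * \<tau>)))))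
    \<longlongrightarrow> heat_const (real DIM('a)) (- 1 / 2) *\<^sub>R l) (at_right 0)" .
  show ?thesis
  proof (rule Lim_transform_eventually[OF L])
    show "eventually (\<lambda>\<delta>. (LBINT \<tau>. ?w \<tau> *\<^sub>R (trunc_riesz f x (sqrt (\<delta> / \<tau>)) - trunc_riesz f x (sqrt (1 / (\<delta> * \<tau>))))) = vconv (riesz_kern \<delta>) f x) (at_right 0)"
      unfolding eventually_at_right_field
      by (intro exI[of _ 1] conjI allI impI) (simp_all only: vconv_riesz_kern_eq_trunc[OF f] zero_less_one)
  qed
qed

lemma integral_superlevel_tendsto_0:
  fixes f :: "'a::euclidean_space \<Rightarrow> real"
  assumes f: "integrable lborel f"
  shows "(\<lambda>m. LBINT x. (if real (Suc m) < \<bar>f x\<bar> then \<bar>f x\<bar> else 0)) \<longlonglongrightarrow> 0"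
proof -
  note [measurable] = borel_measurable_integrable[OF f, simplified]
  have "(\<lambda>m. LBINT x. (if real (Suc m) < \<bar>f x\<bar> then \<bar>f x\<bar> else 0)) \<longlonglongrightarrow> (LBINT (x::'a). 0)"
  proof (rule integral_dominated_convergence)
    show "integrable lborel (\<lambda>x. \<bar>f x\<bar>)" using f by simp
    show "AE x in lborel. (\<lambda>m. if real (Suc m) < \<bar>f x\<bar> then \<bar>f x\<bar> else 0) \<longlonglongrightarrow> 0"
    proof (rule AE_I2)
      fix x
      obtain N where N: "\<bar>f x\<bar> \<le> real N" using real_arch_simple by blast
      have "eventually (\<lambda>m. (if real (Suc m) < \<bar>f x\<bar> then \<bar>f x\<bar> else 0) = 0) sequentially"
        using eventually_ge_at_top[of N] by eventually_elim (use N in auto)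
      then show "(\<lambda>m. if real (Suc m) < \<bar>f x\<bar> then \<bar>f x\<bar> else 0) \<longlonglongrightarrow> 0"
        by (rule tendsto_eventually)
    qed
  qed auto
  then show ?thesis by simp
qed

section \<open>Errors of the decomposition in terms of the mass on the stopped set\<close>

context calderon_zygmund
begin

definition mass :: real where "mass = (LBINT x. indicator stopped x * \<bar>f x\<bar>)"

lemma nn_integral_mass: "(NN y. ennreal \<bar>f y\<bar> * indicator stopped y) = ennreal mass"
proof -
  have "(NN y. ennreal \<bar>f y\<bar> * indicator stopped y) = (NN y. ennreal (norm (indicator stopped y * f y)))"
    by (intro nn_integral_cong) (auto simp: indicator_def)
  also have "... = ennreal (LBINT y. norm (indicator stopped y * f y))"
    by (rule integrable_finite_nn[OF integrable_indicator_f]) simp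
  also have "(LBINT y. norm (indicator stopped y * f y)) = mass"
    unfolding mass_def by (intro Bochner_Integration.integral_cong) (auto simp: indicator_def)
  finally show ?thesis .
qed

lemma mass_nonneg: "0 \<le> mass"
  unfolding mass_def by (rule Bochner_Integration.integral_nonneg) simp

lemma emeasure_stopped_le: "emeasure lborel stopped \<le> ennreal (mass / lam)"
proof -
  have "emeasure lborel stopped = ennreal (1 / lam) * (ennreal lam * emeasure lborel stopped)"
    using lam by (simp add: mult.assoc[symmetric] ennreal_mult'[symmetric])
  also have "... \<le> ennreal (1 / lam) * ennreal mass"
    unfolding nn_integral_mass[symmetric] by (intro mult_left_mono measure_stopped) simp
  also have "... = ennreal (mass / lam)" using lam by (simp add: ennreal_mult'[symmetric])
  finally show ?thesis .
qed

lemma mass_le: "mass \<le> (LBINT x. \<bar>f x\<bar>)"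
proof -
  have "ennreal mass \<le> ennreal (LBINT x. \<bar>f x\<bar>)"
    unfolding nn_integral_mass[symmetric] nn_integral_f[symmetric]
    by (intro nn_integral_mono) (auto simp: indicator_def)
  then show ?thesis by simp
qed

text \<open>Where |f| exceeds \<open>R\<close> the superlevel integral takes over; on the rest of
  the stopped set |f| is at most \<open>R\<close>, and that set has measure at most the L1 norm over
  \<open>lam\<close>. Both terms are small if \<open>R\<close> is large but small against
  \<open>lam\<close>.\<close>

lemma mass_le_superlevel:
  assumes R: "0 \<le> R"
  shows "mass \<le> (LBINT x. (if R < \<bar>f x\<bar> then \<bar>f x\<bar> else 0)) + R * ((LBINT x. \<bar>f x\<bar>) / lam)"
proof -
  let ?t = "\<lambda>x. if R < \<bar>f x\<bar> then \<bar>f x\<bar> else 0"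
  have ti: "integrable lborel ?t"
    by (rule Bochner_Integration.integrable_bound[OF f]) auto
  have tn: "(NN x. ennreal (?t x)) = ennreal (LBINT x. ?t x)"
    by (rule nn_integral_eq_integral[OF ti]) simp
  have t0: "0 \<le> (LBINT x. ?t x)" by (rule Bochner_Integration.integral_nonneg) simp
  have N: "0 \<le> (LBINT x. \<bar>f x\<bar>)" by simp
  have "ennreal mass \<le> (NN x. ennreal (?t x) + ennreal R * indicator stopped x)"
    unfolding nn_integral_mass[symmetric]
  proof (rule nn_integral_mono)
    fix x
    show "ennreal \<bar>f x\<bar> * indicator stopped x \<le> ennreal (?t x) + ennreal R * indicator stopped x"
      by (cases "R < \<bar>f x\<bar>") (auto simp: indicator_def intro!: ennreal_leI add_increasing2)
  qed
  also have "... = ennreal (LBINT x. ?t x) + ennreal R * emeasure lborel stopped"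
    by (subst nn_integral_add) (simp_all add: tn nn_integral_cmult)
  also have "... \<le> ennreal (LBINT x. ?t x) + ennreal R * ennreal ((LBINT x. \<bar>f x\<bar>) / lam)"
  proof (intro add_left_mono mult_left_mono)
    have "ennreal (mass / lam) \<le> ennreal ((LBINT x. \<bar>f x\<bar>) / lam)"
      using mass_le lam by (intro ennreal_leI divide_right_mono) auto
    then show "emeasure lborel stopped \<le> ennreal ((LBINT x. \<bar>f x\<bar>) / lam)"
      using emeasure_stopped_le by (rule order_trans[rotated])
  qed simp
  also have "... = ennreal ((LBINT x. ?t x) + R * ((LBINT x. \<bar>f x\<bar>) / lam))"
  proof -
    have q: "0 \<le> R * ((LBINT x. \<bar>f x\<bar>) / lam)" using R lam N by simp
    show ?thesis by (simp only: ennreal_mult'[OF R] ennreal_plus[OF t0 q])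
  qed
  finally show ?thesis using t0 R lam N by (subst (asm) ennreal_le_iff) auto
qed

lemma integral_abs_rest_le: "(LBINT x. \<bar>rest x\<bar>) \<le> 2 * mass"
proof -
  have "ennreal (LBINT x. \<bar>rest x\<bar>) \<le> 2 * ennreal mass"
    using nn_integral_rest integrable_finite_nn[OF integrable_rest] unfolding nn_integral_mass by simp
  also have "... = ennreal (2 * mass)" by (simp add: ennreal_mult')
  finally show ?thesis using mass_nonneg by simp
qed

lemma emeasure_halo_mass: "emeasure lborel halo \<le> ennreal ((4 * real DIM('a)) ^ DIM('a) * (mass / lam))"
proof -
  have "emeasure lborel halo \<le> ennreal ((4 * real DIM('a)) ^ DIM('a)) * ennreal (mass / lam)"
    by (rule order_trans[OF emeasure_halo_le]) (intro mult_left_mono emeasure_stopped_le, simp)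
  moreover have "0 \<le> (4 * real DIM('a)) ^ DIM('a)" by simp
  ultimately show ?thesis by (simp only: ennreal_mult')
qed

lemma vconv_split:
  assumes \<delta>: "0 < \<delta>"
  shows "vconv (riesz_kern \<delta>) f x = vconv (riesz_kern \<delta>) good x + vconv (riesz_kern \<delta>) rest x"
proof -
  obtain K where K: "\<And>y::'a. norm (riesz_kern \<delta> y) \<le> K" using norm_riesz_kern_le[OF \<delta>] by blast
  have K0: "0 \<le> K" using order_trans[OF norm_ge_zero K] .
  have i: "integrable lborel (\<lambda>y. u (x + y) *\<^sub>R riesz_kern \<delta> y)" if u: "integrable lborel u" for u :: "'a \<Rightarrow> real"
  proof -
    note [measurable] = borel_measurable_integrable[OF u, simplified]
    have "integrable lborel (\<lambda>y. K * u (x + y))" using u by (intro integrable_mult_right) (simp add: integrable_shift)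
    then show ?thesis
    proof (rule Bochner_Integration.integrable_bound)
      show "AE y in lborel. norm (u (x + y) *\<^sub>R riesz_kern \<delta> y) \<le> norm (K * u (x + y))"
      proof (rule AE_I2)
        fix y
        show "norm (u (x + y) *\<^sub>R riesz_kern \<delta> y) \<le> norm (K * u (x + y))"
          using mult_left_mono[OF K[of y], of "\<bar>u (x + y)\<bar>"] K0 by (simp add: abs_mult mult.commute)
      qed
    qed measurable
  qed
  have "vconv (riesz_kern \<delta>) f x = (LBINT y. good (x + y) *\<^sub>R riesz_kern \<delta> y + rest (x + y) *\<^sub>R riesz_kern \<delta> y)"
    unfolding vconv_def by (simp add: scaleR_add_left[symmetric] rest_def)
  also have "... = vconv (riesz_kern \<delta>) good x + vconv (riesz_kern \<delta>) rest x"
    unfolding vconv_def by (rule Bochner_Integration.integral_add[OF i[OF integrable_good] i[OF integrable_rest]])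
  finally show ?thesis .
qed

text \<open>Two regimes. On the halo, and where the truncation is not \<open>\<kappa>\<close>-close
  to \<open>F\<close>, the product is split by the weighted inequality between arithmetic and
  geometric means, with parameter \<open>\<rho>\<close>, and the L2 bound of the good part is used.
  Elsewhere the transform of the good part is that of \<open>f\<close> minus that of
  \<open>rest\<close>, hence at most |F| + \<kappa> plus the latter, which is integrable off the
  halo. The integral of |F| enters with coefficient 1, and all other terms can be made
  small.\<close>

lemma integral_vconv_good_le:
  fixes F :: "'a \<Rightarrow> 'a"
  assumes \<phi>: "lip_test L (\<phi> :: 'a \<Rightarrow> 'a)" and \<delta>: "0 < \<delta>" "\<delta> < 1" and \<rho>: "0 < \<rho>" and \<kappa>: "0 < \<kappa>"
    and F: "integrable lborel F"
  shows "\<bar>LBINT x. vconv (riesz_kern \<delta>) good x \<bullet> \<phi> x\<bar>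
    \<le> \<rho> * (Beta (1 / 2) (1 / 2) * (2 ^ DIM('a) * lam * (LBINT x. \<bar>f x\<bar>)))
      + ((4 * real DIM('a)) ^ DIM('a) * (mass / lam) + (LBINT x. (if \<kappa> < norm (vconv (riesz_kern \<delta>) f x - F x) then norm (\<phi> x) else 0))) / (2 * \<rho>)
      + (LBINT x. norm (F x)) + \<kappa> * (LBINT x. norm (\<phi> x)) + 12 * real DIM('a) * mass"
proof -
  note [measurable] = lip_test_measurable[OF \<phi>] borel_measurable_integrable[OF F, simplified]
  have hs[measurable]: "halo \<in> sets borel" using open_halo by simp
  define V where "V = vconv (riesz_kern \<delta>) f"
  define Vg where "Vg = vconv (riesz_kern \<delta>) good"
  define Vr where "Vr = vconv (riesz_kern \<delta>) rest"
  have [measurable]: "V \<in> borel_measurable borel" "Vg \<in> borel_measurable borel" "Vr \<in> borel_measurable borel"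
    unfolding V_def Vg_def Vr_def by measurable
  have V: "V x = Vg x + Vr x" for x unfolding V_def Vg_def Vr_def by (rule vconv_split[OF \<delta>(1)])
  let ?a = "\<lambda>x. if \<kappa> < norm (V x - F x) then norm (\<phi> x) else 0"
  have \<phi>i: "integrable lborel (\<lambda>x. norm (\<phi> x))" using lip_test_integrable[OF \<phi>] by simp
  have ai: "integrable lborel ?a" by (rule Bochner_Integration.integrable_bound[OF \<phi>i]) auto
  have sq: "integrable lborel (\<lambda>x. (norm (Vg x))\<^sup>2)"
    unfolding Vg_def by (rule integrable_vconv_riesz_kern_square[OF integrable_good abs_good_le \<delta>])
  have L2: "(LBINT x. (norm (Vg x))\<^sup>2) \<le> 2 * (Beta (1 / 2) (1 / 2) * (2 ^ DIM('a) * lam * (LBINT x. \<bar>f x\<bar>)))"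
  proof -
    have B: "0 < Beta (1 / 2) (1 / 2 :: real)" by (rule Beta_real_pos) auto
    have "(LBINT x. (norm (Vg x))\<^sup>2) \<le> 2 * Beta (1 / 2) (1 / 2) * (LBINT x. (good x)\<^sup>2)"
      unfolding Vg_def by (rule vconv_riesz_kern_L2[OF integrable_good abs_good_le \<delta>])
    also have "... \<le> 2 * Beta (1 / 2) (1 / 2) * ((LBINT x. \<bar>f x\<bar>) * (2 ^ DIM('a) * lam))"
    proof (rule mult_left_mono)
      have "(LBINT x. (good x)\<^sup>2) \<le> (LBINT x. \<bar>good x\<bar>) * (2 ^ DIM('a) * lam)"
        by (rule integrable_square_of_bounded(2)[OF integrable_good abs_good_le])
      also have "... \<le> (LBINT x. \<bar>f x\<bar>) * (2 ^ DIM('a) * lam)"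
        using lam by (intro mult_right_mono integral_abs_good_le) simp
      finally show "(LBINT x. (good x)\<^sup>2) \<le> (LBINT x. \<bar>f x\<bar>) * (2 ^ DIM('a) * lam)" .
    qed (use B in simp)
    finally show ?thesis by (simp add: mult_ac)
  qed
  let ?i = "indicator halo :: 'a \<Rightarrow> real"
  have pt: "norm (Vg x \<bullet> \<phi> x) \<le> \<rho> / 2 * (norm (Vg x))\<^sup>2 + (?i x + ?a x) / (2 * \<rho>) + norm (F x) + \<kappa> * norm (\<phi> x) + norm (Vr x) * indicator (- halo) x" for x
  proof -
    have p1: "norm (\<phi> x) \<le> 1" by (rule lip_test_le1[OF \<phi>])
    have cs: "norm (Vg x \<bullet> \<phi> x) \<le> norm (Vg x) * norm (\<phi> x)" by (simp add: Cauchy_Schwarz_ineq2)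
    have nn: "0 \<le> \<rho> / 2 * (norm (Vg x))\<^sup>2" "0 \<le> (?i x + ?a x) / (2 * \<rho>)" "0 \<le> norm (F x)" "0 \<le> \<kappa> * norm (\<phi> x)" "0 \<le> norm (Vr x) * indicator (- halo) x"
      using \<rho> \<kappa> by auto
    show ?thesis
    proof (cases "x \<in> halo \<or> \<kappa> < norm (V x - F x)")
      case True
      have amgm: "norm (Vg x) * norm (\<phi> x) \<le> \<rho> / 2 * (norm (Vg x))\<^sup>2 + (norm (\<phi> x))\<^sup>2 / (2 * \<rho>)"
      proof -
        have "0 \<le> (\<rho> * norm (Vg x) - norm (\<phi> x))\<^sup>2" by simp
        then have "2 * \<rho> * (norm (Vg x) * norm (\<phi> x)) \<le> \<rho>\<^sup>2 * (norm (Vg x))\<^sup>2 + (norm (\<phi> x))\<^sup>2"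
          by (simp add: power2_diff power_mult_distrib mult_ac)
        then have "norm (Vg x) * norm (\<phi> x) \<le> (\<rho>\<^sup>2 * (norm (Vg x))\<^sup>2 + (norm (\<phi> x))\<^sup>2) / (2 * \<rho>)"
          using \<rho> by (simp add: pos_le_divide_eq mult_ac)
        also have "... = \<rho> / 2 * (norm (Vg x))\<^sup>2 + (norm (\<phi> x))\<^sup>2 / (2 * \<rho>)"
          using \<rho> by (simp add: add_divide_distrib power2_eq_square)
        finally show ?thesis .
      qed
      have "(norm (\<phi> x))\<^sup>2 \<le> norm (\<phi> x) * 1" unfolding power2_eq_square using p1 by (intro mult_left_mono) auto
      then have "(norm (\<phi> x))\<^sup>2 \<le> ?i x + ?a x" using True p1 by (auto simp: indicator_def)
      then have "(norm (\<phi> x))\<^sup>2 / (2 * \<rho>) \<le> (?i x + ?a x) / (2 * \<rho>)" using \<rho> by (intro divide_right_mono) auto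
      then show ?thesis using cs amgm nn by linarith
    next
      case False
      have "norm (Vg x) \<le> norm (F x) + \<kappa> + norm (Vr x)"
      proof -
        have "Vg x = F x + (V x - F x) - Vr x" by (simp add: V)
        then have "norm (Vg x) \<le> norm (F x + (V x - F x)) + norm (Vr x)" by (metis norm_triangle_ineq4)
        also have "norm (F x + (V x - F x)) \<le> norm (F x) + norm (V x - F x)" by (rule norm_triangle_ineq)
        finally show ?thesis using False by linarith
      qed
      then have "norm (Vg x) * norm (\<phi> x) \<le> (norm (F x) + \<kappa> + norm (Vr x)) * norm (\<phi> x)" by (rule mult_right_mono) simp
      also have "... = norm (F x) * norm (\<phi> x) + \<kappa> * norm (\<phi> x) + norm (Vr x) * norm (\<phi> x)" by (simp add: algebra_simps)
      also have "... \<le> norm (F x) + \<kappa> * norm (\<phi> x) + norm (Vr x)"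
        using mult_left_mono[OF p1 norm_ge_zero[of "F x"]] mult_left_mono[OF p1 norm_ge_zero[of "Vr x"]] by simp
      finally have "norm (Vg x) * norm (\<phi> x) \<le> norm (F x) + \<kappa> * norm (\<phi> x) + norm (Vr x) * indicator (- halo) x"
        using False by simp
      then show ?thesis using cs nn by linarith
    qed
  qed
  have hfin: "emeasure lborel halo < \<infinity>" by (rule order_le_less_trans[OF emeasure_halo_mass]) simp
  have hm: "measure lborel halo \<le> (4 * real DIM('a)) ^ DIM('a) * (mass / lam)"
    using emeasure_halo_mass mass_nonneg lam by (simp add: measure_def enn2real_leI)
  have hi: "integrable lborel ?i" using hfin by (intro integrable_real_indicator) auto
  have ri: "(NN x. ennreal (norm (norm (Vr x) * indicator (- halo) x))) \<le> ennreal (6 * real DIM('a) * (2 * mass))"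
  proof -
    have "(NN x. ennreal (norm (norm (Vr x) * indicator (- halo) x))) = (NN x. ennreal (norm (Vr x)) * indicator (- halo) x)"
      by (intro nn_integral_cong) (auto simp: indicator_def)
    also have "... \<le> ennreal (6 * real DIM('a)) * (NN y. ennreal \<bar>rest y\<bar>)"
      unfolding Vr_def by (rule nn_integral_vconv_rest[OF \<delta>(1)])
    also have "(NN y. ennreal \<bar>rest y\<bar>) = ennreal (LBINT x. \<bar>rest x\<bar>)"
      using integrable_finite_nn[OF integrable_rest] by simp
    also have "ennreal (6 * real DIM('a)) * ... \<le> ennreal (6 * real DIM('a)) * ennreal (2 * mass)"
      by (intro mult_left_mono ennreal_leI integral_abs_rest_le) simp
    also have "... = ennreal (6 * real DIM('a) * (2 * mass))" by (subst ennreal_mult'[symmetric]) simp_all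
    finally show ?thesis .
  qed
  have rint: "integrable lborel (\<lambda>x. norm (Vr x) * indicator (- halo) x)"
    by (rule integrableI_nn_le[OF _ ri]) measurable
  have rle: "(LBINT x. norm (Vr x) * indicator (- halo) x) \<le> 12 * real DIM('a) * mass"
    using norm_integral_le_nn[OF ri] mass_nonneg by simp
  have gi: "integrable lborel (\<lambda>x. Vg x \<bullet> \<phi> x)"
  proof (rule Bochner_Integration.integrable_bound[of lborel "\<lambda>x. \<rho> / 2 * (norm (Vg x))\<^sup>2 + (?i x + ?a x) / (2 * \<rho>) + norm (F x) + \<kappa> * norm (\<phi> x) + norm (Vr x) * indicator (- halo) x"])
    show "integrable lborel (\<lambda>x. \<rho> / 2 * (norm (Vg x))\<^sup>2 + (?i x + ?a x) / (2 * \<rho>) + norm (F x) + \<kappa> * norm (\<phi> x) + norm (Vr x) * indicator (- halo) x)"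
      by (intro Bochner_Integration.integrable_add integrable_mult_right integrable_divide sq hi ai rint \<phi>i integrable_norm F)
    show "AE x in lborel. norm (Vg x \<bullet> \<phi> x) \<le> norm (\<rho> / 2 * (norm (Vg x))\<^sup>2 + (?i x + ?a x) / (2 * \<rho>) + norm (F x) + \<kappa> * norm (\<phi> x) + norm (Vr x) * indicator (- halo) x)"
      by (rule AE_I2) (rule order_trans[OF pt], simp)
  qed measurable
  have "norm (LBINT x. Vg x \<bullet> \<phi> x) \<le> (LBINT x. \<rho> / 2 * (norm (Vg x))\<^sup>2 + (?i x + ?a x) / (2 * \<rho>) + norm (F x) + \<kappa> * norm (\<phi> x) + norm (Vr x) * indicator (- halo) x)"
    by (rule Bochner_Integration.integral_norm_bound_integral[OF gi _ pt])
      (intro Bochner_Integration.integrable_add integrable_mult_right integrable_divide sq hi ai rint \<phi>i integrable_norm F)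
  also have "... = \<rho> / 2 * (LBINT x. (norm (Vg x))\<^sup>2) + (measure lborel halo + (LBINT x. ?a x)) / (2 * \<rho>) + (LBINT x. norm (F x)) + \<kappa> * (LBINT x. norm (\<phi> x)) + (LBINT x. norm (Vr x) * indicator (- halo) x)"
  proof -
    note F' = integrable_norm[OF F]
    note i1 = integrable_mult_right[OF sq, of "\<rho> / 2"]
    note i2 = integrable_divide[OF Bochner_Integration.integrable_add[OF hi ai], of "2 * \<rho>"]
    note i3 = integrable_mult_right[OF \<phi>i, of \<kappa>]
    note j1 = Bochner_Integration.integrable_add[OF i1 i2]
    note j2 = Bochner_Integration.integrable_add[OF j1 F']
    note j3 = Bochner_Integration.integrable_add[OF j2 i3]
    have "(LBINT x. (?i x + ?a x) / (2 * \<rho>)) = (measure lborel halo + (LBINT x. ?a x)) / (2 * \<rho>)"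
      by (simp only: integral_divide_zero Bochner_Integration.integral_add[OF hi ai]) simp
    then show ?thesis
      unfolding Bochner_Integration.integral_add[OF j3 rint] Bochner_Integration.integral_add[OF j2 i3]
        Bochner_Integration.integral_add[OF j1 F'] Bochner_Integration.integral_add[OF i1 i2] integral_mult_right_zero by simp
  qed
  also have "... \<le> \<rho> * (Beta (1 / 2) (1 / 2) * (2 ^ DIM('a) * lam * (LBINT x. \<bar>f x\<bar>))) + ((4 * real DIM('a)) ^ DIM('a) * (mass / lam) + (LBINT x. ?a x)) / (2 * \<rho>)
      + (LBINT x. norm (F x)) + \<kappa> * (LBINT x. norm (\<phi> x)) + 12 * real DIM('a) * mass"
  proof (intro add_mono order_refl rle)
    have "\<rho> / 2 * (LBINT x. (norm (Vg x))\<^sup>2) \<le> \<rho> / 2 * (2 * (Beta (1 / 2) (1 / 2) * (2 ^ DIM('a) * lam * (LBINT x. \<bar>f x\<bar>))))"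
      using \<rho> by (intro mult_left_mono L2) simp
    then show "\<rho> / 2 * (LBINT x. (norm (Vg x))\<^sup>2) \<le> \<rho> * (Beta (1 / 2) (1 / 2) * (2 ^ DIM('a) * lam * (LBINT x. \<bar>f x\<bar>)))"
      by simp
    show "(measure lborel halo + (LBINT x. ?a x)) / (2 * \<rho>) \<le> ((4 * real DIM('a)) ^ DIM('a) * (mass / lam) + (LBINT x. ?a x)) / (2 * \<rho>)"
      using \<rho> hm by (intro divide_right_mono) auto
  qed
  finally show ?thesis by (simp only: Vg_def V_def real_norm_def)
qed

end

context calderon_zygmund
begin

text \<open>Only the good part goes through the Riesz kernel. For a Lipschitz field the truncated
  divergence is bounded uniformly in \<open>\<delta>\<close>, so its pairing with
  \<open>rest\<close> is at most a multiple of \<open>mass\<close>; that the multiple depends on the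
  field is harmless because \<open>mass\<close> tends to 0.\<close>

lemma truncated_pairing_le:
  fixes F :: "'a \<Rightarrow> 'a"
  assumes \<phi>: "lip_test L (\<phi> :: 'a \<Rightarrow> 'a)" and \<delta>: "0 < \<delta>" "\<delta> < 1" and \<theta>: "0 < \<theta>" and \<kappa>: "0 < \<kappa>"
    and F: "integrable lborel F"
  shows "\<bar>LBINT \<sigma>. cut \<delta> \<sigma> * (pw (- 1 / 2) \<sigma> * heat_pairing f \<phi> \<sigma>)\<bar>
    \<le> \<theta> * (Beta (1 / 2) (1 / 2) * 2 ^ DIM('a) * (LBINT x. \<bar>f x\<bar>))
      + ((4 * real DIM('a)) ^ DIM('a) * mass + lam * (LBINT x. (if \<kappa> < norm (vconv (riesz_kern \<delta>) f x - F x) then norm (\<phi> x) else 0))) / (2 * \<theta>)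
      + (LBINT x. norm (F x)) + \<kappa> * (LBINT x. norm (\<phi> x))
      + (12 * real DIM('a) + 2 * (LBINT \<sigma>. pw (- 1 / 2) \<sigma> * min (test_bound L \<phi>) (test_bound L \<phi> / \<sigma>))) * mass"
proof -
  note [measurable] = lip_test_measurable[OF \<phi>]
  define D where "D x = (LBINT \<sigma>. cut \<delta> \<sigma> * (pw (- 1 / 2) \<sigma> * heat_div \<sigma> \<phi> x))" for x
  define C where "C = (LBINT \<sigma>. pw (- 1 / 2) \<sigma> * min (test_bound L \<phi>) (test_bound L \<phi> / \<sigma>))"
  have Dm[measurable]: "D \<in> borel_measurable borel" unfolding D_def by measurable
  note w = integrable_pw_heat_div[OF \<phi>, of "- 1 / 2", simplified]
  have le: "norm (cut \<delta> \<sigma> * (pw (- 1 / 2) \<sigma> * heat_div \<sigma> \<phi> x)) \<le> pw (- 1 / 2) \<sigma> * min (test_bound L \<phi>) (test_bound L \<phi> / \<sigma>)" for \<sigma> x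
  proof -
    have "\<bar>cut \<delta> \<sigma>\<bar> * norm (pw (- 1 / 2) \<sigma> * heat_div \<sigma> \<phi> x) \<le> 1 * norm (pw (- 1 / 2) \<sigma> * heat_div \<sigma> \<phi> x)"
      by (intro mult_right_mono abs_cut_le norm_ge_zero)
    also have "... \<le> pw (- 1 / 2) \<sigma> * min (test_bound L \<phi>) (test_bound L \<phi> / \<sigma>)"
      using integrable_pw_heat_div(3)[OF \<phi>, of "- 1 / 2" \<sigma> x] by simp
    finally show ?thesis by (simp only: real_norm_def abs_mult)
  qed
  have wi: "integrable lborel (\<lambda>\<sigma>. pw (- 1 / 2) \<sigma> * min (test_bound L \<phi>) (test_bound L \<phi> / \<sigma>))"
    by (rule integrable_pw_heat_div(1)[OF \<phi>]) auto
  have Dle: "\<bar>D x\<bar> \<le> C" for x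
  proof -
    have i: "integrable lborel (\<lambda>\<sigma>. cut \<delta> \<sigma> * (pw (- 1 / 2) \<sigma> * heat_div \<sigma> \<phi> x))"
      by (rule Bochner_Integration.integrable_bound[OF wi])
        (measurable, rule AE_I2, rule order_trans[OF le], simp)
    show ?thesis unfolding D_def C_def
      using Bochner_Integration.integral_norm_bound_integral[OF i wi le] by simp
  qed
  have sup: "(LBINT \<sigma>. cut \<delta> \<sigma> * (pw (- 1 / 2) \<sigma> * heat_pairing f \<phi> \<sigma>)) = (LBINT x. f x * D x)"
    unfolding D_def by (rule integral_heat_div_superposition[OF f \<phi>, symmetric]) (auto simp: abs_cut_le)
  have "(LBINT x. f x * D x) = (LBINT x. good x * D x + rest x * D x)"
    by (simp add: rest_def algebra_simps)
  also have "... = (LBINT x. good x * D x) + (LBINT x. rest x * D x)"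
    by (intro Bochner_Integration.integral_add integral_mult_bound(1)[OF integrable_good _ Dle]
        integral_mult_bound(1)[OF integrable_rest _ Dle]) measurable
  also have "(LBINT x. good x * D x) = - (LBINT x. vconv (riesz_kern \<delta>) good x \<bullet> \<phi> x)"
    unfolding D_def integral_vconv_riesz_kern_inner[OF integrable_good \<phi> \<delta>(1)] by simp
  finally have I: "\<bar>LBINT \<sigma>. cut \<delta> \<sigma> * (pw (- 1 / 2) \<sigma> * heat_pairing f \<phi> \<sigma>)\<bar>
    \<le> \<bar>LBINT x. vconv (riesz_kern \<delta>) good x \<bullet> \<phi> x\<bar> + \<bar>LBINT x. rest x * D x\<bar>"
    unfolding sup by linarith
  have C0: "0 \<le> C" using Dle[of 0] by linarith
  have "\<bar>LBINT x. rest x * D x\<bar> \<le> (LBINT x. \<bar>rest x\<bar>) * C"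
    by (rule integral_mult_bound(2)[OF integrable_rest _ Dle]) measurable
  also have "... \<le> 2 * mass * C" by (rule mult_right_mono[OF integral_abs_rest_le C0])
  finally have r: "\<bar>LBINT x. rest x * D x\<bar> \<le> 2 * mass * C" .
  \<comment> \<open>With \<open>\<rho> = \<theta> / lam\<close> the height cancels from the L2 term
    and from the halo term, leaving multiples of \<open>\<theta>\<close> and of
    \<open>mass / \<theta>\<close>; both can then be made small.\<close>
  have "0 < \<theta> / lam" using \<theta> lam by simp
  note g = integral_vconv_good_le[OF \<phi> \<delta> this \<kappa> F]
  have e1: "\<theta> / lam * (u * (v * lam * w)) = \<theta> * (u * v * w)" for u v w using lam by simp
  have e2: "(c * (mass / lam) + a) / (2 * (\<theta> / lam)) = (c * mass + lam * a) / (2 * \<theta>)" for c a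
    using lam \<theta> by (simp add: field_simps)
  have e3: "(c + 2 * C) * mass = c * mass + 2 * mass * C" for c by (simp add: algebra_simps)
  show ?thesis unfolding C_def[symmetric] e3 using g[unfolded e1 e2] I r by linarith
qed

end

text \<open>
  The height \<open>(m + 1)\<^sup>2\<close> of the Calderon--Zygmund decomposition tends to infinity with \<open>m\<close>; the
  parameter \<open>\<theta>\<close> balances the \<open>L\<^sup>2\<close> estimate against the measure of the exceptional set.
\<close>

lemma riesz_pairing_bound:
  fixes F :: "'a::euclidean_space \<Rightarrow> 'a"
  assumes f: "integrable lborel f" and \<phi>: "lip_test L (\<phi> :: 'a \<Rightarrow> 'a)" and F: "integrable lborel F"
    and lim: "AE x in lborel. ((\<lambda>\<delta>. vconv (riesz_kern \<delta>) f x) \<longlongrightarrow> F x) (at_right 0)"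
  shows "\<bar>LBINT \<sigma>. pw (- 1 / 2) \<sigma> * heat_pairing f \<phi> \<sigma>\<bar> \<le> (LBINT x. norm (F x))"
proof -
  note [measurable] = lip_test_measurable[OF \<phi>] borel_measurable_integrable[OF f, simplified] borel_measurable_integrable[OF F, simplified]
  define N where "N = (LBINT x. \<bar>f x\<bar>)"
  have N0: "0 \<le> N" by (simp add: N_def)
  define d where "d k = 1 / (real k + 2)" for k :: nat
  have d: "0 < d k" "d k < 1" for k by (simp_all add: d_def)
  have dlim: "filterlim d (at_right 0) sequentially"
    unfolding filterlim_at
  proof (intro conjI)
    show "eventually (\<lambda>k. d k \<in> {0<..} \<and> d k \<noteq> 0) sequentially"
      by (intro always_eventually allI) (use d in \<open>auto simp: less_imp_neq[symmetric]\<close>)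
    show "d \<longlonglongrightarrow> 0"
      using LIMSEQ_ignore_initial_segment[OF LIMSEQ_inverse_real_of_nat, of 1]
      by (simp add: d_def[abs_def] inverse_eq_divide add_ac)
  qed
  define K1 where "K1 = Beta (1 / 2) (1 / 2) * 2 ^ DIM('a) * N"
  define C1 where "C1 = (4 * real DIM('a)) ^ DIM('a)"
  define C2 where "C2 = 12 * real DIM('a) + 2 * (LBINT \<sigma>. pw (- 1 / 2) \<sigma> * min (test_bound L \<phi>) (test_bound L \<phi> / \<sigma>))"
  define \<Phi> where "\<Phi> = (LBINT x. norm (\<phi> x))"
  define X where "X = (LBINT x. norm (F x))"
  define I where "I k = (LBINT \<sigma>. cut (d k) \<sigma> * (pw (- 1 / 2) \<sigma> * heat_pairing f \<phi> \<sigma>))" for k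
  define I' where "I' = (LBINT \<sigma>. pw (- 1 / 2) \<sigma> * heat_pairing f \<phi> \<sigma>)"
  define a where "a \<kappa> k = (LBINT x. (if \<kappa> < norm (vconv (riesz_kern (d k)) f x - F x) then norm (\<phi> x) else 0))" for \<kappa> k
  \<comment> \<open>The bound on \<open>mass\<close> from \<open>mass_le_superlevel\<close> with
    \<open>R = m + 1\<close> at height \<open>R\<^sup>2\<close>: the second term is
    \<open>R * N / R\<^sup>2\<close>.\<close>
  define S where "S m = (LBINT x. (if real (Suc m) < \<bar>f x\<bar> then \<bar>f x\<bar> else 0)) + N / real (Suc m)" for m
  have S: "S \<longlonglongrightarrow> 0"
  proof -
    have "(\<lambda>m. N * inverse (real (Suc m))) \<longlonglongrightarrow> N * 0"
      by (intro tendsto_mult tendsto_const LIMSEQ_inverse_real_of_nat)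
    then show ?thesis
      unfolding S_def using tendsto_add[OF integral_superlevel_tendsto_0[OF f]] by (simp add: divide_inverse)
  qed
  have C2: "0 \<le> C2"
  proof -
    have "0 \<le> pw (- 1 / 2) \<sigma> * min (test_bound L \<phi>) (test_bound L \<phi> / \<sigma>)" for \<sigma>
      using test_bound_nonneg[OF \<phi>] by (cases "0 < \<sigma>") (simp_all add: pw_nonpos)
    then have "0 \<le> (LBINT \<sigma>. pw (- 1 / 2) \<sigma> * min (test_bound L \<phi>) (test_bound L \<phi> / \<sigma>))"
      by (rule Bochner_Integration.integral_nonneg)
    then show ?thesis unfolding C2_def by simp
  qed
  have step: "\<bar>I k\<bar> \<le> \<theta> * K1 + (C1 * S m + (real (Suc m))\<^sup>2 * a \<kappa> k) / (2 * \<theta>) + X + \<kappa> * \<Phi> + C2 * S m"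
    if \<theta>: "0 < \<theta>" and \<kappa>: "0 < \<kappa>" for \<theta> \<kappa> k m
  proof -
    define lam where "lam = (real (Suc m))\<^sup>2"
    have lam: "1 \<le> lam" unfolding lam_def by (rule one_le_power) simp
    \<comment> \<open>The side \<open>N / lam + 1\<close> is at least 1, so its power is no smaller
      than itself, and \<open>lam\<close> times it already exceeds \<open>N\<close>.\<close>
    have "N \<le> lam * (N / lam + 1) ^ DIM('a)"
    proof -
      have "N \<le> lam * (N / lam + 1)" using lam by (simp add: field_simps)
      also have "... \<le> lam * (N / lam + 1) ^ DIM('a)"
        using lam N0 by (intro mult_left_mono self_le_power) auto
      finally show ?thesis .
    qed
    moreover have "0 < N / lam + 1" using lam N0 by (simp add: add_nonneg_pos)
    ultimately interpret calderon_zygmund f lam "N / lam + 1"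
      using f lam by unfold_locales (auto simp: N_def)
    have "mass \<le> S m"
    proof -
      have "real (Suc m) * (N / lam) = N / real (Suc m)" by (simp add: lam_def power2_eq_square)
      then show ?thesis using mass_le_superlevel[of "real (Suc m)"] unfolding N_def[symmetric] S_def by simp
    qed
    then have "C1 * mass / (2 * \<theta>) \<le> C1 * S m / (2 * \<theta>)" "C2 * mass \<le> C2 * S m"
      using C2 \<theta> by (auto intro!: divide_right_mono mult_left_mono simp: C1_def)
    then show ?thesis
      using truncated_pairing_le[OF \<phi> d[of k] \<theta> \<kappa> F]
      unfolding I_def[symmetric] a_def[symmetric] N_def[symmetric] K1_def[symmetric] C1_def[symmetric] C2_def[symmetric]
        X_def[symmetric] \<Phi>_def[symmetric] lam_def[symmetric] add_divide_distrib
      by linarith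
  qed
  have Ilim: "I \<longlonglongrightarrow> I'"
    unfolding I_def I'_def
  proof (rule integral_dominated_convergence)
    let ?T = "N * test_bound L \<phi>"
    have "integrable lborel (\<lambda>\<sigma>. pw (- 1 / 2) \<sigma> * heat_pairing f \<phi> (\<sigma> + 0))"
      using N0 test_bound_nonneg[OF \<phi>]
      by (intro integrable_pw_decay[where D = ?T]) (auto simp: N_def heat_pairing_bounds(1,2)[OF f \<phi>, simplified])
    then show "integrable lborel (\<lambda>\<sigma>. \<bar>pw (- 1 / 2) \<sigma> * heat_pairing f \<phi> \<sigma>\<bar>)" by simp
    show "AE \<sigma> in lborel. norm (cut (d k) \<sigma> * (pw (- 1 / 2) \<sigma> * heat_pairing f \<phi> \<sigma>)) \<le> \<bar>pw (- 1 / 2) \<sigma> * heat_pairing f \<phi> \<sigma>\<bar>" for k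
      using mult_right_mono[OF abs_cut_le[of "d k"] abs_ge_zero]
      by (intro AE_I2) (simp only: real_norm_def abs_mult[of "cut _ _"] mult_1)
    show "AE \<sigma> in lborel. (\<lambda>k. cut (d k) \<sigma> * (pw (- 1 / 2) \<sigma> * heat_pairing f \<phi> \<sigma>)) \<longlonglongrightarrow> pw (- 1 / 2) \<sigma> * heat_pairing f \<phi> \<sigma>"
    proof (rule AE_I2)
      fix \<sigma> :: real
      show "(\<lambda>k. cut (d k) \<sigma> * (pw (- 1 / 2) \<sigma> * heat_pairing f \<phi> \<sigma>)) \<longlonglongrightarrow> pw (- 1 / 2) \<sigma> * heat_pairing f \<phi> \<sigma>"
      proof (cases "0 < \<sigma>")
        case True
        obtain n where n: "1 / \<sigma> + \<sigma> < real n" using reals_Archimedean2 by blast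
        have "cut (d k) \<sigma> = 1" if "n \<le> k" for k
        proof -
          have "1 / \<sigma> < real k + 2" "\<sigma> \<le> real k + 2" using n that True by (simp_all add: add_pos_pos) (smt (verit) divide_pos_pos of_nat_mono)+
          then show ?thesis using True by (simp add: cut_def d_def field_simps)
        qed
        then have "eventually (\<lambda>k. cut (d k) \<sigma> * (pw (- 1 / 2) \<sigma> * heat_pairing f \<phi> \<sigma>) = pw (- 1 / 2) \<sigma> * heat_pairing f \<phi> \<sigma>) sequentially"
          unfolding eventually_sequentially by (intro exI[of _ n]) simp
        then show ?thesis by (rule tendsto_eventually)
      qed (simp add: pw_nonpos)
    qed
  qed measurable
  have alim: "a \<kappa> \<longlonglongrightarrow> 0" if \<kappa>: "0 < \<kappa>" for \<kappa>
  proof -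
    have "a \<kappa> \<longlonglongrightarrow> (LBINT (x::'a). 0)"
      unfolding a_def
    proof (rule integral_dominated_convergence)
      show "integrable lborel (\<lambda>x. norm (\<phi> x))" using lip_test_integrable[OF \<phi>] by simp
      show "AE x in lborel. (\<lambda>k. if \<kappa> < norm (vconv (riesz_kern (d k)) f x - F x) then norm (\<phi> x) else 0) \<longlonglongrightarrow> 0"
        using lim
      proof eventually_elim
        fix x
        assume "((\<lambda>\<delta>. vconv (riesz_kern \<delta>) f x) \<longlongrightarrow> F x) (at_right 0)"
        then have "(\<lambda>k. vconv (riesz_kern (d k)) f x) \<longlonglongrightarrow> F x" by (rule filterlim_compose[OF _ dlim])
        then have "(\<lambda>k. norm (vconv (riesz_kern (d k)) f x - F x)) \<longlonglongrightarrow> 0" by (simp add: tendsto_norm_zero LIM_zero)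
        then have "eventually (\<lambda>k. norm (vconv (riesz_kern (d k)) f x - F x) < \<kappa>) sequentially"
          using \<kappa> by (rule order_tendstoD(2))
        then have "eventually (\<lambda>k. (if \<kappa> < norm (vconv (riesz_kern (d k)) f x - F x) then norm (\<phi> x) else 0) = 0) sequentially"
          by eventually_elim simp
        then show "(\<lambda>k. if \<kappa> < norm (vconv (riesz_kern (d k)) f x - F x) then norm (\<phi> x) else 0) \<longlonglongrightarrow> 0"
          by (rule tendsto_eventually)
      qed
    qed auto
    then show ?thesis by simp
  qed
  \<comment> \<open>The truncation is removed first, at a fixed height: the term
    \<open>a \<kappa> k\<close> carries the height as a factor, so the order of the limits
    matters.\<close>
  have 1: "\<bar>I'\<bar> \<le> \<theta> * K1 + C1 * S m / (2 * \<theta>) + X + \<kappa> * \<Phi> + C2 * S m"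
    if \<theta>: "0 < \<theta>" and \<kappa>: "0 < \<kappa>" for \<theta> \<kappa> m
  proof -
    have "(\<lambda>k. \<theta> * K1 + (C1 * S m + (real (Suc m))\<^sup>2 * a \<kappa> k) / (2 * \<theta>) + X + \<kappa> * \<Phi> + C2 * S m)
      \<longlonglongrightarrow> \<theta> * K1 + (C1 * S m + (real (Suc m))\<^sup>2 * 0) / (2 * \<theta>) + X + \<kappa> * \<Phi> + C2 * S m"
      by (intro tendsto_intros alim[OF \<kappa>]) (use \<theta> in auto)
    from LIMSEQ_le[OF tendsto_rabs[OF Ilim] this] step[OF \<theta> \<kappa>] show ?thesis by simp
  qed
  \<comment> \<open>Now the height tends to infinity, which removes the terms with
    \<open>S m\<close>. \<open>\<kappa>\<close> is set equal to \<open>\<theta>\<close>, as both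
    tend to 0 in the last limit.\<close>
  have 2: "\<bar>I'\<bar> \<le> \<theta> * K1 + X + \<theta> * \<Phi>" if \<theta>: "0 < \<theta>" for \<theta>
  proof -
    have "(\<lambda>m. \<theta> * K1 + C1 * S m / (2 * \<theta>) + X + \<theta> * \<Phi> + C2 * S m)
      \<longlonglongrightarrow> \<theta> * K1 + C1 * 0 / (2 * \<theta>) + X + \<theta> * \<Phi> + C2 * 0"
      by (intro tendsto_intros S) (use \<theta> in auto)
    from LIMSEQ_le_const[OF this, of "\<bar>I'\<bar>"] 1[OF \<theta> \<theta>] show ?thesis by simp
  qed
  have "((\<lambda>\<theta>. \<theta> * K1 + X + \<theta> * \<Phi>) \<longlongrightarrow> 0 * K1 + X + 0 * \<Phi>) (at_right 0)"
    by (intro tendsto_intros)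
  then have "\<bar>I'\<bar> \<le> 0 * K1 + X + 0 * \<Phi>"
    by (rule tendsto_lowerbound) (auto intro: eventually_mono[OF eventually_at_right_less[of 0]] 2)
  then show ?thesis by (simp add: I'_def X_def)
qed

text \<open>The spaces and seminorms are defined with the completed measure, while the estimates
  need Borel functions for the product measures; this passes from one to the other along almost
  everywhere equality.\<close>

lemma
  fixes g h :: "'a::euclidean_space \<Rightarrow> 'b::{banach,second_countable_topology}"
  assumes h: "h \<in> borel_measurable borel" and ae: "AE x in lborel. g x = h x"
  shows lebesgue_measurable_AE: "g \<in> borel_measurable lebesgue"
    and integral_lebesgue_AE: "integral\<^sup>L lebesgue g = integral\<^sup>L lborel h"
    and integrable_lebesgue_AE: "integrable lebesgue g \<longleftrightarrow> integrable lborel h"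
proof -
  have hl: "h \<in> borel_measurable lborel" using h by simp
  have hL: "h \<in> borel_measurable lebesgue" by (rule measurable_completion[OF hl])
  have aeL: "AE x in lebesgue. g x = h x" using ae by (rule AE_completion)
  show gL: "g \<in> borel_measurable lebesgue"
  proof (rule measurableI)
    fix A :: "'b set" assume A: "A \<in> sets borel"
    have "g -` A \<in> sets lebesgue"
    proof (rule completion.in_sets_AE)
      show "AE x in lebesgue. x \<in> h -` A \<longleftrightarrow> x \<in> g -` A" using aeL by eventually_elim simp
      show "h -` A \<in> sets lebesgue" using measurable_sets[OF hL A] by simp
    qed simp
    then show "g -` A \<inter> space lebesgue \<in> sets lebesgue" by simp
  qed simp
  show "integral\<^sup>L lebesgue g = integral\<^sup>L lborel h"
    by (subst integral_cong_AE[OF gL hL aeL]) (rule integral_completion[OF hl])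
  show "integrable lebesgue g \<longleftrightarrow> integrable lborel h"
    by (subst integrable_cong_AE[OF gL hL aeL]) (rule integrable_completion[OF hl])
qed

lemma AE_lborel_shift:
  fixes x :: "'a::euclidean_space"
  assumes "AE y in lborel. P y"
  shows "AE y in lborel. P (x + y)"
proof -
  obtain N where N: "N \<in> null_sets lborel" "{y \<in> space lborel. \<not> P y} \<subseteq> N"
    using assms unfolding eventually_ae_filter by blast
  show ?thesis
  proof (rule AE_I')
    show "{y. y - (- x) \<in> N} \<in> null_sets lborel" by (rule null_sets_translation[OF N(1)])
    show "{y \<in> space lborel. \<not> P (x + y)} \<subseteq> {y. y - (- x) \<in> N}" using N(2) by (auto simp: add.commute)
  qed
qed

text \<open>Translation invariance moves the difference quotient from \<open>\<psi>\<close> to the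
  kernel. Both quotients converge under dominated convergence, one by the Lipschitz bound of
  \<open>\<psi>\<close>, the other by the mean value theorem for the kernel, so neither boundary
  terms nor more than one directional derivative enter.\<close>

lemma integral_heat_by_parts:
  fixes e :: "'a::euclidean_space" and \<psi> \<psi>' :: "'a \<Rightarrow> real"
  assumes s: "0 < s" and \<psi>: "integrable lborel \<psi>" and lip: "\<And>x y. \<bar>\<psi> x - \<psi> y\<bar> \<le> L * norm (x - y)"
    and [measurable]: "\<psi>' \<in> borel_measurable borel"
    and der: "\<And>x. ((\<lambda>t. \<psi> (x + t *\<^sub>R e)) has_real_derivative \<psi>' x) (at 0)"
  shows "(LBINT y. heat s y * \<psi>' (x + y)) = (LBINT y. (kern s y \<bullet> e) * \<psi> (x + y))"
proof -
  note [measurable] = borel_measurable_integrable[OF \<psi>, simplified]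
  define K where "K = s powr (- (real DIM('a) + 1) / 2)"
  have sh: "integrable lborel (\<lambda>y. \<psi> (z + y))" for z using \<psi> by (simp add: integrable_shift)
  have hder: "((\<lambda>t. heat s (y - t *\<^sub>R e)) has_real_derivative (kern s (y - t *\<^sub>R e) \<bullet> e)) (at t)" for y t
  proof -
    have N: "(norm (y - t *\<^sub>R e))\<^sup>2 = (norm y)\<^sup>2 - 2 * t * (y \<bullet> e) + t\<^sup>2 * (norm e)\<^sup>2" for t
      unfolding power2_norm_eq_inner by (simp add: inner_diff_left inner_diff_right inner_commute power2_eq_square algebra_simps)
    have "((\<lambda>t. heat s (y - t *\<^sub>R e)) has_real_derivative
      heat s (y - t *\<^sub>R e) * (- (- 2 * (y \<bullet> e) + 2 * t * (norm e)\<^sup>2) / (4 * s))) (at t)"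
      unfolding heat_def N using s by (auto intro!: derivative_eq_intros simp: field_simps)
    moreover have "heat s (y - t *\<^sub>R e) * (- (- 2 * (y \<bullet> e) + 2 * t * (norm e)\<^sup>2) / (4 * s)) = kern s (y - t *\<^sub>R e) \<bullet> e"
      using s unfolding kern_def power2_norm_eq_inner by (simp add: inner_diff_left field_simps)
    ultimately show ?thesis by simp
  qed
  have hlip: "\<bar>heat s (y - t *\<^sub>R e) - heat s y\<bar> \<le> t * (K * norm e)" if t: "0 < t" for y t
  proof -
    obtain z where z: "heat s (y - t *\<^sub>R e) - heat s (y - 0 *\<^sub>R e) = (t - 0) * (kern s (y - z *\<^sub>R e) \<bullet> e)"
      using MVT2[OF t hder] by blast
    have "\<bar>kern s (y - z *\<^sub>R e) \<bullet> e\<bar> \<le> norm (kern s (y - z *\<^sub>R e)) * norm e" by (rule Cauchy_Schwarz_ineq2)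
    also have "... \<le> K * norm e" unfolding K_def by (intro mult_right_mono norm_kern_le[OF s]) simp
    finally have "\<bar>t * (kern s (y - z *\<^sub>R e) \<bullet> e)\<bar> \<le> t * (K * norm e)" using t by (simp add: abs_mult)
    then show ?thesis using z by simp
  qed
  have quot: "((\<lambda>\<epsilon>. (g \<epsilon> - g 0) / \<epsilon>) \<longlongrightarrow> D) (at_right 0)" if "(g has_real_derivative D) (at 0)" for g :: "real \<Rightarrow> real" and D
    using that unfolding DERIV_def by (auto intro: tendsto_mono[OF at_le])
  have lim1: "((\<lambda>\<epsilon>. LBINT y. heat s y * ((\<psi> (x + y + \<epsilon> *\<^sub>R e) - \<psi> (x + y)) / \<epsilon>)) \<longlongrightarrow> (LBINT y. heat s y * \<psi>' (x + y))) (at_right 0)"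
  proof (rule integral_dominated_convergence_at_right)
    show "integrable lborel (\<lambda>y::'a. heat s y * (L * norm e))" using s by simp
    show "AE y in lborel. ((\<lambda>\<epsilon>. heat s y * ((\<psi> (x + y + \<epsilon> *\<^sub>R e) - \<psi> (x + y)) / \<epsilon>)) \<longlongrightarrow> heat s y * \<psi>' (x + y)) (at_right 0)"
      using tendsto_mult_left[OF quot[OF der]] by simp
    show "AE y in lborel. norm (heat s y * ((\<psi> (x + y + \<epsilon> *\<^sub>R e) - \<psi> (x + y)) / \<epsilon>)) \<le> heat s y * (L * norm e)"
      if \<epsilon>: "0 < \<epsilon>" for \<epsilon>
    proof (rule AE_I2)
      fix y
      have "\<bar>(\<psi> (x + y + \<epsilon> *\<^sub>R e) - \<psi> (x + y)) / \<epsilon>\<bar> \<le> L * norm e"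
        using lip[of "x + y + \<epsilon> *\<^sub>R e" "x + y"] \<epsilon> by (simp add: pos_divide_le_eq mult_ac)
      then show "norm (heat s y * ((\<psi> (x + y + \<epsilon> *\<^sub>R e) - \<psi> (x + y)) / \<epsilon>)) \<le> heat s y * (L * norm e)"
        unfolding real_norm_def abs_mult abs_of_nonneg[OF heat_nonneg] by (rule mult_left_mono) simp
    qed
  qed measurable
  have lim2: "((\<lambda>\<epsilon>. LBINT y. (heat s (y - \<epsilon> *\<^sub>R e) - heat s y) / \<epsilon> * \<psi> (x + y)) \<longlongrightarrow> (LBINT y. (kern s y \<bullet> e) * \<psi> (x + y))) (at_right 0)"
  proof (rule integral_dominated_convergence_at_right)
    show "integrable lborel (\<lambda>y. K * norm e * \<bar>\<psi> (x + y)\<bar>)" using sh by simp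
    show "AE y in lborel. ((\<lambda>\<epsilon>. (heat s (y - \<epsilon> *\<^sub>R e) - heat s y) / \<epsilon> * \<psi> (x + y)) \<longlongrightarrow> (kern s y \<bullet> e) * \<psi> (x + y)) (at_right 0)"
    proof (rule AE_I2)
      fix y
      show "((\<lambda>\<epsilon>. (heat s (y - \<epsilon> *\<^sub>R e) - heat s y) / \<epsilon> * \<psi> (x + y)) \<longlongrightarrow> (kern s y \<bullet> e) * \<psi> (x + y)) (at_right 0)"
        using tendsto_mult_right[OF quot[OF hder[of y 0]]] by simp
    qed
    show "AE y in lborel. norm ((heat s (y - \<epsilon> *\<^sub>R e) - heat s y) / \<epsilon> * \<psi> (x + y)) \<le> K * norm e * \<bar>\<psi> (x + y)\<bar>"
      if \<epsilon>: "0 < \<epsilon>" for \<epsilon>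
    proof (rule AE_I2)
      fix y
      have "\<bar>(heat s (y - \<epsilon> *\<^sub>R e) - heat s y) / \<epsilon>\<bar> \<le> K * norm e"
        using hlip[OF \<epsilon>, of y] \<epsilon> by (simp add: pos_divide_le_eq mult_ac)
      then show "norm ((heat s (y - \<epsilon> *\<^sub>R e) - heat s y) / \<epsilon> * \<psi> (x + y)) \<le> K * norm e * \<bar>\<psi> (x + y)\<bar>"
        unfolding real_norm_def abs_mult by (rule mult_right_mono) simp
    qed
  qed measurable
  have eq: "(LBINT y. heat s y * ((\<psi> (x + y + \<epsilon> *\<^sub>R e) - \<psi> (x + y)) / \<epsilon>)) = (LBINT y. (heat s (y - \<epsilon> *\<^sub>R e) - heat s y) / \<epsilon> * \<psi> (x + y))" for \<epsilon>
  proof -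
    have hK: "\<bar>heat s z\<bar> \<le> (4 * pi * s) powr (- real DIM('a) / 2)" for z :: 'a
      unfolding heat_def using s by (simp add: abs_mult mult_left_le)
    have i: "integrable lborel (\<lambda>y. heat s (y - a) * \<psi> (z + y))" for a z
      by (subst mult.commute, rule integral_mult_bound(1)[OF sh _ hK]) measurable
    have "(LBINT y. heat s y * \<psi> (x + y + \<epsilon> *\<^sub>R e)) = (LBINT y. heat s (\<epsilon> *\<^sub>R e + y - \<epsilon> *\<^sub>R e) * \<psi> (x + (\<epsilon> *\<^sub>R e + y)))"
      by (simp add: algebra_simps)
    also have "... = (LBINT y. heat s (y - \<epsilon> *\<^sub>R e) * \<psi> (x + y))"
      by (rule integral_shift[of "\<lambda>y. heat s (y - \<epsilon> *\<^sub>R e) * \<psi> (x + y)"]) measurable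
    finally have sw: "(LBINT y. heat s y * \<psi> (x + y + \<epsilon> *\<^sub>R e)) = (LBINT y. heat s (y - \<epsilon> *\<^sub>R e) * \<psi> (x + y))" .
    have i0: "integrable lborel (\<lambda>y. heat s y * \<psi> (z + y))" for z using i[of 0 z] by simp
    have "(LBINT y. heat s y * ((\<psi> (x + y + \<epsilon> *\<^sub>R e) - \<psi> (x + y)) / \<epsilon>))
      = (LBINT y. heat s y * \<psi> (x + \<epsilon> *\<^sub>R e + y) - heat s y * \<psi> (x + y)) / \<epsilon>"
      unfolding integral_divide_zero[symmetric] by (intro Bochner_Integration.integral_cong) (auto simp: algebra_simps diff_divide_distrib)
    also have "... = ((LBINT y. heat s y * \<psi> (x + \<epsilon> *\<^sub>R e + y)) - (LBINT y. heat s y * \<psi> (x + y))) / \<epsilon>"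
      by (subst Bochner_Integration.integral_diff[OF i0 i0]) simp
    also have "... = ((LBINT y. heat s (y - \<epsilon> *\<^sub>R e) * \<psi> (x + y)) - (LBINT y. heat s y * \<psi> (x + y))) / \<epsilon>"
      using sw by (simp add: add_ac)
    also have "... = (LBINT y. heat s (y - \<epsilon> *\<^sub>R e) * \<psi> (x + y) - heat s y * \<psi> (x + y)) / \<epsilon>"
      by (subst Bochner_Integration.integral_diff[OF i i0]) simp
    also have "... = (LBINT y. (heat s (y - \<epsilon> *\<^sub>R e) - heat s y) / \<epsilon> * \<psi> (x + y))"
      unfolding integral_divide_zero[symmetric] by (intro Bochner_Integration.integral_cong) (auto simp: algebra_simps diff_divide_distrib)
    finally show ?thesis .
  qed
  show ?thesis
    by (rule tendsto_unique[OF trivial_limit_at_right_real lim1 lim2[folded eq]])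
qed

section \<open>Smooth test fields and the classical divergence\<close>

lemma frechet_derivative_shift:
  assumes "f differentiable (at (x + z))"
  shows "frechet_derivative (\<lambda>w. f (w + z)) (at x) = frechet_derivative f (at (x + z))"
    and "(\<lambda>w. f (w + z)) differentiable (at x)"
proof -
  have "((\<lambda>w. w + z) has_derivative (\<lambda>h. h)) (at x)" by (auto intro!: derivative_eq_intros)
  from has_derivative_compose[OF this, of f] assms
  have "((\<lambda>w. f (w + z)) has_derivative frechet_derivative f (at (x + z))) (at x)"
    by (simp add: frechet_derivative_works)
  then show "frechet_derivative (\<lambda>w. f (w + z)) (at x) = frechet_derivative f (at (x + z))"
    and "(\<lambda>w. f (w + z)) differentiable (at x)"
    by (simp_all add: frechet_derivative_at[symmetric] differentiableI)
qed

lemma C_k_shift: "C_k k f \<Longrightarrow> C_k k (\<lambda>w. f (w + z))"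
proof (induction k arbitrary: f)
  case 0
  then show ?case by (auto intro!: continuous_intros continuous_on_compose2[of UNIV f])
next
  case (Suc k)
  have "C_k k (\<lambda>x. frechet_derivative f (at (x + z)) v)" for v
    using Suc.IH[of "\<lambda>x. frechet_derivative f (at x) v"] Suc.prems by simp
  then show ?case using Suc.prems by (simp add: frechet_derivative_shift)
qed

lemma C_k_uminus: "C_k k f \<Longrightarrow> C_k k (\<lambda>w. - f w)"
proof (induction k arbitrary: f)
  case 0
  then show ?case by (auto intro!: continuous_intros)
next
  case (Suc k)
  have "((\<lambda>w. - f w) has_derivative (\<lambda>v. - frechet_derivative f (at x) v)) (at x)" for x
    using Suc.prems by (intro derivative_intros) (simp add: frechet_derivative_works[symmetric])
  then have "frechet_derivative (\<lambda>w. - f w) (at x) = (\<lambda>v. - frechet_derivative f (at x) v)" "(\<lambda>w. - f w) differentiable (at x)" for x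
    by (simp_all add: frechet_derivative_at[symmetric] differentiable_def) blast
  moreover have "C_k k (\<lambda>x. - frechet_derivative f (at x) v)" for v
    using Suc.IH[of "\<lambda>x. frechet_derivative f (at x) v"] Suc.prems by simp
  ultimately show ?case by simp
qed

lemma C_k_zero: "C_k k (\<lambda>w. 0)"
  by (induction k) (simp_all add: frechet_derivative_const)

text \<open>By continuity the set where the bound holds is closed, and a closed set of full measure
  is everything.\<close>

lemma unit_test_field_le1: "\<phi> \<in> unit_test_fields \<Longrightarrow> norm (\<phi> x) \<le> 1"
proof -
  assume \<phi>: "\<phi> \<in> unit_test_fields"
  then have "C_k 0 \<phi>" by (auto simp: unit_test_fields_def test_fields_def)
  then have "closed {x. norm (\<phi> x) \<le> 1}" by (intro closed_Collect_le) (auto intro!: continuous_intros)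
  from mem_closed_if_AE_lebesgue[OF this, of x] \<phi> show ?thesis by (simp add: unit_test_fields_def)
qed

lemma unit_test_field_shift:
  assumes "\<phi> \<in> unit_test_fields"
  shows "(\<lambda>w. \<phi> (w + z)) \<in> unit_test_fields"
proof -
  have "{x. \<phi> (x + z) \<noteq> 0} = (\<lambda>x. x - z) ` {x. \<phi> x \<noteq> 0}" by (auto simp: image_iff intro!: exI[of _ "_ + z"])
  then have "closure {x. \<phi> (x + z) \<noteq> 0} = (\<lambda>x. x - z) ` closure {x. \<phi> x \<noteq> 0}"
    using closure_translation_subtract[of z "{x. \<phi> x \<noteq> 0}"] by simp
  moreover have "compact ((\<lambda>x. x - z) ` closure {x. \<phi> x \<noteq> 0})"
    using assms by (intro compact_translation_subtract) (simp add: unit_test_fields_def test_fields_def)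
  ultimately have "compact (closure {x. \<phi> (x + z) \<noteq> 0})" by simp
  then show ?thesis
    using assms unit_test_field_le1[OF assms] by (auto simp: unit_test_fields_def test_fields_def intro!: C_k_shift)
qed

lemma unit_test_field_uminus: "\<phi> \<in> unit_test_fields \<Longrightarrow> (\<lambda>w. - \<phi> w) \<in> unit_test_fields"
  by (auto simp: unit_test_fields_def test_fields_def intro!: C_k_uminus)

lemma unit_test_field_zero: "(\<lambda>w. 0) \<in> unit_test_fields"
  using C_k_zero by (auto simp: unit_test_fields_def test_fields_def)

text \<open>Each directional derivative is continuous and vanishes off the compact support, hence is
  bounded; expanding \<open>v\<close> in the basis bounds the derivative as a linear map.\<close>

lemma unit_test_field_derivative:
  assumes \<phi>: "\<phi> \<in> unit_test_fields"
  shows "(\<phi> has_derivative frechet_derivative \<phi> (at x)) (at x)"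
    and "continuous_on UNIV (\<lambda>x. frechet_derivative \<phi> (at x) v)"
    and "\<exists>B. \<forall>x v. norm (frechet_derivative \<phi> (at x) v) \<le> B * norm v"
proof -
  have "C_k (Suc 0) \<phi>" using \<phi> by (auto simp only: unit_test_fields_def test_fields_def)
  then have d: "(\<phi> has_derivative frechet_derivative \<phi> (at x)) (at x)"
    and c: "continuous_on UNIV (\<lambda>x. frechet_derivative \<phi> (at x) v)" for x v
    by (simp_all add: frechet_derivative_works)
  show "(\<phi> has_derivative frechet_derivative \<phi> (at x)) (at x)" "continuous_on UNIV (\<lambda>x. frechet_derivative \<phi> (at x) v)"
    by (rule d c)+
  define K where "K = closure {x. \<phi> x \<noteq> 0}"
  have K: "compact K" using \<phi> by (simp add: unit_test_fields_def test_fields_def K_def)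
  have out: "frechet_derivative \<phi> (at x) v = 0" if "x \<notin> K" for x v
  proof -
    have "((\<lambda>_. 0) has_derivative (\<lambda>_. 0)) (at x)" by simp
    moreover have "open (- K)" unfolding K_def by (intro open_Compl closed_closure)
    moreover have "\<phi> w = 0" if "w \<in> - K" for w
      using that closure_subset[of "{x. \<phi> x \<noteq> 0}"] by (auto simp: K_def)
    ultimately have "(\<phi> has_derivative (\<lambda>_. 0)) (at x)"
      using \<open>x \<notin> K\<close> by (intro has_derivative_transform_within_open[of "\<lambda>_. 0" "\<lambda>_. 0" x UNIV "- K" \<phi>]) auto
    then show ?thesis using frechet_derivative_at[of \<phi> "\<lambda>_. 0" x] by metis
  qed
  have "\<exists>B\<ge>0. \<forall>x. norm (frechet_derivative \<phi> (at x) b) \<le> B" for b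
  proof -
    have "compact ((\<lambda>x. frechet_derivative \<phi> (at x) b) ` K)"
      by (rule compact_continuous_image[OF continuous_on_subset[OF c subset_UNIV] K])
    from compact_imp_bounded[OF this, unfolded bounded_iff]
    obtain B where "\<forall>y\<in>(\<lambda>x. frechet_derivative \<phi> (at x) b) ` K. norm y \<le> B" ..
    then have B: "\<And>x. x \<in> K \<Longrightarrow> norm (frechet_derivative \<phi> (at x) b) \<le> B" by simp
    have "norm (frechet_derivative \<phi> (at x) b) \<le> \<bar>B\<bar>" for x
      using B[of x] out[of x b] by (cases "x \<in> K") auto
    then show ?thesis by (intro exI[of _ "\<bar>B\<bar>"]) auto
  qed
  then obtain B where B0: "\<And>b. 0 \<le> B b" and B: "\<And>b x. norm (frechet_derivative \<phi> (at x) b) \<le> B b" by metis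
  have "norm (frechet_derivative \<phi> (at x) v) \<le> (\<Sum>b\<in>Basis. B b) * norm v" for x v
  proof -
    interpret D: linear "frechet_derivative \<phi> (at x)" using has_derivative_linear[OF d] .
    have "frechet_derivative \<phi> (at x) v = frechet_derivative \<phi> (at x) (\<Sum>b\<in>Basis. (v \<bullet> b) *\<^sub>R b)"
      by (simp add: euclidean_representation)
    also have "... = (\<Sum>b\<in>Basis. (v \<bullet> b) *\<^sub>R frechet_derivative \<phi> (at x) b)" by (simp add: D.sum D.scaleR)
    also have "norm ... \<le> (\<Sum>b\<in>Basis. norm ((v \<bullet> b) *\<^sub>R frechet_derivative \<phi> (at x) b))" by (rule norm_sum)
    also have "... \<le> (\<Sum>b\<in>Basis. norm v * B b)"
      unfolding norm_scaleR by (intro sum_mono mult_mono B) (auto simp: Basis_le_norm)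
    finally show ?thesis by (simp add: sum_distrib_left mult.commute)
  qed
  then show "\<exists>B. \<forall>x v. norm (frechet_derivative \<phi> (at x) v) \<le> B * norm v" by blast
qed

lemma unit_test_field_lip_test:
  assumes \<phi>: "\<phi> \<in> unit_test_fields"
  obtains L where "lip_test L \<phi>"
proof -
  obtain B where B: "\<And>x v. norm (frechet_derivative \<phi> (at x) v) \<le> B * norm v"
    using unit_test_field_derivative(3)[OF \<phi>] by blast
  have lip: "norm (\<phi> x - \<phi> y) \<le> B * norm (x - y)" for x y
    by (rule differentiable_bound[OF convex_UNIV]) (auto intro: unit_test_field_derivative(1)[OF \<phi>] onorm_le B)
  have "C_k 0 \<phi>" using \<phi> by (auto simp only: unit_test_fields_def test_fields_def)
  then have c: "continuous_on UNIV \<phi>" by simp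
  define K where "K = closure {x. \<phi> x \<noteq> 0}"
  have K: "compact K" using \<phi> by (simp add: unit_test_fields_def test_fields_def K_def)
  have "integrable lborel (\<lambda>x. indicator K x *\<^sub>R \<phi> x)"
    by (rule borel_integrable_compact[OF K continuous_on_subset[OF c]]) simp
  moreover have "indicator K x *\<^sub>R \<phi> x = \<phi> x" for x
    using closure_subset[of "{x. \<phi> x \<noteq> 0}"] by (auto simp: K_def indicator_def)
  ultimately have "integrable lborel \<phi>" by simp
  then have "lip_test B \<phi>" using lip unit_test_field_le1[OF \<phi>] by (simp add: lip_test_def)
  then show ?thesis by (rule that)
qed

section \<open>The classical divergence under the heat flow\<close>

lemma Basis_vec_eq_axis: "(Basis :: (real ^ 'n::finite) set) = (\<lambda>i. axis i 1) ` UNIV"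
  by (auto simp: Basis_vec_def)

lemma classical_div_eq:
  fixes \<phi> :: "real ^ 'n \<Rightarrow> real ^ 'n"
  shows "classical_div \<phi> x = (\<Sum>b\<in>Basis. frechet_derivative \<phi> (at x) b \<bullet> b)"
proof -
  have "inj (\<lambda>i::'n. axis i (1::real))" by (auto simp: inj_on_def axis_eq_axis)
  then show ?thesis unfolding Basis_vec_eq_axis classical_div_def by (simp add: sum.reindex inner_axis)
qed

lemma
  fixes \<phi> :: "real ^ 'n \<Rightarrow> real ^ 'n"
  assumes \<phi>: "\<phi> \<in> unit_test_fields"
  shows classical_div_measurable: "classical_div \<phi> \<in> borel_measurable borel"
    and classical_div_bounded: "\<exists>B. \<forall>x. \<bar>classical_div \<phi> x\<bar> \<le> B"
proof -
  have "continuous_on UNIV (\<lambda>x. \<Sum>b\<in>Basis. frechet_derivative \<phi> (at x) b \<bullet> b)"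
    by (intro continuous_intros unit_test_field_derivative(2)[OF \<phi>])
  then show "classical_div \<phi> \<in> borel_measurable borel"
    unfolding classical_div_eq[symmetric] by (rule borel_measurable_continuous_onI)
  obtain B where B: "\<And>x v. norm (frechet_derivative \<phi> (at x) v) \<le> B * norm v"
    using unit_test_field_derivative(3)[OF \<phi>] by blast
  have "\<bar>classical_div \<phi> x\<bar> \<le> (\<Sum>b\<in>(Basis :: (real ^ 'n) set). B)" for x
    unfolding classical_div_eq
  proof (rule order_trans[OF sum_abs], rule sum_mono)
    fix b :: "real ^ 'n" assume b: "b \<in> Basis"
    have "\<bar>frechet_derivative \<phi> (at x) b \<bullet> b\<bar> \<le> norm (frechet_derivative \<phi> (at x) b)"
      by (rule Basis_le_norm[OF b])
    then show "\<bar>frechet_derivative \<phi> (at x) b \<bullet> b\<bar> \<le> B" using B[of x b] b by simp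
  qed
  then show "\<exists>B. \<forall>x. \<bar>classical_div \<phi> x\<bar> \<le> B" by blast
qed

text \<open>Integration by parts in each coordinate, which moves the derivative from the kernel to
  the field.\<close>

lemma heat_div_eq_classical:
  fixes \<phi> :: "real ^ 'n \<Rightarrow> real ^ 'n"
  assumes \<phi>: "\<phi> \<in> unit_test_fields" and s: "0 < s"
  shows "heat_div s \<phi> x = (LBINT y. heat s y * classical_div \<phi> (x + y))"
proof -
  obtain L where L: "lip_test L \<phi>" by (rule unit_test_field_lip_test[OF \<phi>])
  obtain B where B: "\<And>x v. norm (frechet_derivative \<phi> (at x) v) \<le> B * norm v"
    using unit_test_field_derivative(3)[OF \<phi>] by blast
  note [measurable] = lip_test_measurable[OF L]
  have dm[measurable]: "(\<lambda>x. frechet_derivative \<phi> (at x) b \<bullet> b) \<in> borel_measurable borel" for b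
    by (intro borel_measurable_continuous_onI continuous_intros unit_test_field_derivative(2)[OF \<phi>])
  have byparts: "(LBINT y. heat s y * (frechet_derivative \<phi> (at (x + y)) b \<bullet> b)) = (LBINT y. (kern s y \<bullet> b) * (\<phi> (x + y) \<bullet> b))"
    if b: "b \<in> Basis" for b
  proof (rule integral_heat_by_parts[OF s, of "\<lambda>x. \<phi> x \<bullet> b" L "\<lambda>x. frechet_derivative \<phi> (at x) b \<bullet> b"])
    show "integrable lborel (\<lambda>x. \<phi> x \<bullet> b)" using lip_test_integrable[OF L] by simp
    show "\<bar>\<phi> x \<bullet> b - \<phi> y \<bullet> b\<bar> \<le> L * norm (x - y)" for x y
      using order_trans[OF Basis_le_norm[OF b, of "\<phi> x - \<phi> y"] lip_test_lip[OF L]] by (simp add: inner_diff_left)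
    show "((\<lambda>t. \<phi> (x + t *\<^sub>R b) \<bullet> b) has_real_derivative frechet_derivative \<phi> (at x) b \<bullet> b) (at 0)" for x
    proof -
      have "((\<lambda>t. x + t *\<^sub>R b) has_derivative (\<lambda>t. t *\<^sub>R b)) (at (0::real))" by (auto intro!: derivative_eq_intros)
      from has_derivative_compose[OF this, of \<phi> "frechet_derivative \<phi> (at x)"] unit_test_field_derivative(1)[OF \<phi>, of x]
      have "((\<lambda>t. \<phi> (x + t *\<^sub>R b)) has_derivative (\<lambda>t. frechet_derivative \<phi> (at x) (t *\<^sub>R b))) (at 0)" by simp
      then have "((\<lambda>t. \<phi> (x + t *\<^sub>R b) \<bullet> b) has_derivative (\<lambda>t. frechet_derivative \<phi> (at x) (t *\<^sub>R b) \<bullet> b)) (at 0)"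
        by (rule has_derivative_inner_left)
      moreover have "frechet_derivative \<phi> (at x) (t *\<^sub>R b) = t *\<^sub>R frechet_derivative \<phi> (at x) b" for t
        using has_derivative_linear[OF unit_test_field_derivative(1)[OF \<phi>, of x]] by (simp add: linear_scale)
      ultimately show ?thesis by (simp add: has_field_derivative_def mult_commute_abs)
    qed
  qed measurable
  have i1: "integrable lborel (\<lambda>y. heat s y * (frechet_derivative \<phi> (at (x + y)) b \<bullet> b))" if b: "b \<in> Basis" for b
  proof (rule integral_mult_bound(1)[of _ _ _ B])
    show "\<bar>frechet_derivative \<phi> (at (x + y)) b \<bullet> b\<bar> \<le> B" for y
      using order_trans[OF Basis_le_norm[OF b, of "frechet_derivative \<phi> (at (x + y)) b"] B] b by simp
    show "integrable lborel (heat s :: real ^ 'n \<Rightarrow> real)" using s by simp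
    show "(\<lambda>y. frechet_derivative \<phi> (at (x + y)) b \<bullet> b) \<in> borel_measurable lborel"
      by (rule measurable_compose[OF _ dm]) measurable
  qed
  have i2: "integrable lborel (\<lambda>y. (kern s y \<bullet> b) * (\<phi> (x + y) \<bullet> b))" if b: "b \<in> Basis" for b
  proof (rule integral_mult_bound(1)[of _ _ _ 1])
    show "\<bar>\<phi> (x + y) \<bullet> b\<bar> \<le> 1" for y
      using order_trans[OF Basis_le_norm[OF b] lip_test_le1[OF L]] .
    show "integrable lborel (\<lambda>y. kern s y \<bullet> b)" using s by simp
  qed measurable
  have "heat_div s \<phi> x = (LBINT y. (\<Sum>b\<in>Basis. (kern s y \<bullet> b) * (\<phi> (x + y) \<bullet> b)))"
    unfolding heat_div_def by (subst euclidean_inner) simp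
  also have "... = (\<Sum>b\<in>Basis. LBINT y. (kern s y \<bullet> b) * (\<phi> (x + y) \<bullet> b))"
    by (rule Bochner_Integration.integral_sum[OF i2])
  also have "... = (\<Sum>b\<in>Basis. LBINT y. heat s y * (frechet_derivative \<phi> (at (x + y)) b \<bullet> b))"
    by (intro sum.cong refl byparts[symmetric])
  also have "... = (LBINT y. (\<Sum>b\<in>Basis. heat s y * (frechet_derivative \<phi> (at (x + y)) b \<bullet> b)))"
    by (rule Bochner_Integration.integral_sum[OF i1, symmetric])
  finally show ?thesis unfolding classical_div_eq sum_distrib_left .
qed

text \<open>The heat divergence averages the classical divergence over translates with a density of
  mass 1. Every translate and its negative are admissible fields, which turns the one-sided bound
  \<open>V\<close> into one on absolute values.\<close>

lemma heat_pairing_le_total_variation: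
  fixes f :: "real ^ 'n \<Rightarrow> real"
  assumes f: "integrable lborel f" and \<phi>: "\<phi> \<in> unit_test_fields" and s: "0 < s"
    and V: "\<And>\<psi>. \<psi> \<in> unit_test_fields \<Longrightarrow> (LBINT x. f x * classical_div \<psi> x) \<le> V"
  shows "\<bar>heat_pairing f \<phi> s\<bar> \<le> V"
proof -
  note [measurable] = classical_div_measurable[OF \<phi>] borel_measurable_integrable[OF f, simplified]
  obtain B where B: "\<And>x. \<bar>classical_div \<phi> x\<bar> \<le> B" using classical_div_bounded[OF \<phi>] by blast
  have diff: "\<phi> differentiable (at x)" for x using unit_test_field_derivative(1)[OF \<phi>] by (rule differentiableI)
  have shift: "classical_div (\<lambda>w. \<phi> (w + z)) x = classical_div \<phi> (x + z)" for x z
    unfolding classical_div_def by (simp add: frechet_derivative_shift[OF diff])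
  have neg: "classical_div (\<lambda>w. - \<phi> (w + z)) x = - classical_div \<phi> (x + z)" for x z
  proof -
    have "((\<lambda>w. - \<phi> (w + z)) has_derivative (\<lambda>v. - frechet_derivative \<phi> (at (x + z)) v)) (at x)"
      using frechet_derivative_shift[OF diff, where x = x and z = z] by (intro derivative_intros) (simp add: frechet_derivative_works)
    from frechet_derivative_at[OF this, symmetric] show ?thesis
      unfolding classical_div_def by (simp add: sum_negf)
  qed
  have W: "\<bar>LBINT x. f x * classical_div \<phi> (x + z)\<bar> \<le> V" for z
    using V[OF unit_test_field_shift[OF \<phi>, of z]] V[OF unit_test_field_uminus[OF unit_test_field_shift[OF \<phi>, of z]]]
    by (simp add: shift neg)
  let ?F = "\<lambda>x y. f x * (heat s y * classical_div \<phi> (x + y))"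
  have Fm: "(\<lambda>(x, y). ?F x y) \<in> borel_measurable (lborel \<Otimes>\<^sub>M lborel)" by measurable
  have B0: "0 \<le> B" using order_trans[OF abs_ge_zero B] .
  have "(NN x. NN y. ennreal (norm (?F x y))) \<le> (NN x. NN (y :: real ^ 'n). ennreal (norm (B * f x)) * ennreal (heat s y))"
  proof (intro nn_integral_mono)
    fix x y
    have "\<bar>f x\<bar> * heat s y * \<bar>classical_div \<phi> (x + y)\<bar> \<le> \<bar>f x\<bar> * heat s y * B" by (intro mult_left_mono B) simp
    then have "norm (?F x y) \<le> norm (B * f x) * heat s y" using B0 by (simp add: abs_mult mult_ac)
    then show "ennreal (norm (?F x y)) \<le> ennreal (norm (B * f x)) * ennreal (heat s y)"
      unfolding ennreal_mult'[OF norm_ge_zero, symmetric] by (rule ennreal_leI)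
  qed
  also have "... = (NN x. ennreal (norm (B * f x)))" using s by (simp add: nn_integral_cmult nn_integral_heat)
  also have "... < \<infinity>"
  proof -
    have "integrable lborel (\<lambda>x. B * f x)" using f by simp
    then show ?thesis by (simp only: integrable_iff_bounded)
  qed
  finally have fin: "(NN x. NN y. ennreal (norm (?F x y))) < \<infinity>" .
  have "heat_pairing f \<phi> s = (LBINT x. LBINT y. ?F x y)"
    unfolding heat_pairing_def heat_div_eq_classical[OF \<phi> s] by simp
  also have "... = (LBINT y. LBINT x. ?F x y)" by (rule Fubini_lborel(1)[OF Fm fin])
  also have "... = (LBINT y. heat s y * (LBINT x. f x * classical_div \<phi> (x + y)))"
  proof (rule Bochner_Integration.integral_cong[OF refl])
    fix y
    have eq: "?F x y = heat s y * (f x * classical_div \<phi> (x + y))" for x by simp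
    show "(LBINT x. ?F x y) = heat s y * (LBINT x. f x * classical_div \<phi> (x + y))"
      unfolding eq by (rule integral_mult_right_zero)
  qed
  finally have "\<bar>heat_pairing f \<phi> s\<bar> = \<bar>LBINT y. heat s y * (LBINT x. f x * classical_div \<phi> (x + y))\<bar>" by simp
  also have "... \<le> (LBINT y. \<bar>heat s (y :: real ^ 'n)\<bar>) * V"
  proof (rule integral_mult_bound(2)[OF _ _ W])
    show "integrable lborel (heat s :: real ^ 'n \<Rightarrow> real)" using s by simp
  qed measurable
  finally show ?thesis using s by simp
qed

section \<open>The interpolation inequality\<close>

text \<open>The factor between the fractional divergence and the superposition of heat
  divergences.\<close>

definition frac_coeff :: "nat \<Rightarrow> real \<Rightarrow> real" where
  "frac_coeff n \<beta> = frac_mu n \<beta> / heat_const (real n) (- (1 + \<beta>) / 2)"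

lemma frac_mu_pos: "0 \<le> \<beta> \<Longrightarrow> \<beta> < 1 \<Longrightarrow> 0 < frac_mu n \<beta>"
  by (auto simp: frac_mu_def intro!: divide_pos_pos mult_pos_pos)

lemma frac_coeff_pos: "0 \<le> \<beta> \<Longrightarrow> \<beta> < 1 \<Longrightarrow> 0 < frac_coeff CARD('n::finite) \<beta>"
  unfolding frac_coeff_def
  using heat_const_pos[of "- (1 + \<beta>) / 2", where 'a = "real ^ 'n"] by (intro divide_pos_pos frac_mu_pos) auto

text \<open>\<open>Gamma ((1 - \<beta>) / 2)\<close> in the denominator of \<open>frac_mu\<close>
  has a pole at \<beta> = 1. The functional equation extracts the factor \<open>1 - \<beta>\<close>
  and leaves \<open>h\<close>, continuous on the closed interval, while \<open>heat_const\<close> is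
  bounded below uniformly. This zero keeps the final constant bounded near \<beta> = 1 in the case
  \<alpha> = 1.\<close>

lemma frac_coeff_le: "\<exists>C>0. \<forall>\<beta>. 0 \<le> \<beta> \<longrightarrow> \<beta> < 1 \<longrightarrow> frac_coeff CARD('n::finite) \<beta> \<le> C * (1 - \<beta>)"
proof -
  let ?n = "real CARD('n)"
  define h where "h \<beta> = 2 powr \<beta> * Gamma ((?n + \<beta> + 1) / 2) / Gamma ((1 - \<beta>) / 2 + 1)" for \<beta>
  define c0 where "c0 = (8 * pi) powr (- ?n / 2) * exp (- 1 / 4) / 8"
  have c0: "0 < c0" by (simp add: c0_def)
  have G: "continuous_on {0<..} (Gamma :: real \<Rightarrow> real)"
    by (rule continuous_on_Gamma) (auto elim!: nonpos_Ints_cases)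
  have "continuous_on {0..1} h"
    unfolding h_def
    by (intro continuous_intros continuous_on_compose2[OF G]) (auto intro!: Gamma_real_pos less_imp_neq[symmetric] add_nonneg_pos)
  then have "bounded (h ` {0..1})" by (intro compact_imp_bounded compact_continuous_image) auto
  then obtain B where B: "0 < B" "\<And>\<beta>. 0 \<le> \<beta> \<Longrightarrow> \<beta> < 1 \<Longrightarrow> \<bar>h \<beta>\<bar> \<le> B" by (auto simp: bounded_pos)
  have "frac_coeff CARD('n) \<beta> \<le> pi powr (- ?n / 2) * B / (2 * c0) * (1 - \<beta>)" if \<beta>: "0 \<le> \<beta>" "\<beta> < 1" for \<beta>
  proof -
    have G1: "Gamma ((1 - \<beta>) / 2 + 1) = (1 - \<beta>) / 2 * Gamma ((1 - \<beta>) / 2)"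
      by (rule Gamma_plus1) (use \<beta> in \<open>auto elim!: nonpos_Ints_cases\<close>)
    have "inverse g = x * inverse (x * g)" if "0 < x" for x g :: real
      using that by (simp add: field_simps)
    from this[of "(1 - \<beta>) / 2" "Gamma ((1 - \<beta>) / 2)"]
    have "inverse (Gamma ((1 - \<beta>) / 2)) = (1 - \<beta>) / 2 * inverse (Gamma ((1 - \<beta>) / 2 + 1))"
      using \<beta> unfolding G1 by simp
    then have mu: "frac_mu CARD('n) \<beta> = pi powr (- ?n / 2) * h \<beta> * (1 - \<beta>) / 2"
      unfolding frac_mu_def h_def divide_inverse[of _ "Gamma _"] by simp
    have hc: "c0 \<le> heat_const ?n (- (1 + \<beta>) / 2)"
      using heat_const_ge[of "- (1 + \<beta>) / 2", where 'a = "real ^ 'n"] \<beta> by (simp add: c0_def)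
    have "frac_coeff CARD('n) \<beta> \<le> frac_mu CARD('n) \<beta> / c0"
      unfolding frac_coeff_def using hc c0 frac_mu_pos[OF \<beta>, of "CARD('n)"] by (intro divide_left_mono mult_pos_pos) auto
    also have "... \<le> (pi powr (- ?n / 2) * B * (1 - \<beta>) / 2) / c0"
      unfolding mu using B(2)[OF \<beta>] \<beta> c0 by (intro divide_right_mono mult_right_mono mult_left_mono) auto
    finally show ?thesis by (simp add: field_simps)
  qed
  moreover have "0 < pi powr (- ?n / 2) * B / (2 * c0)" using B c0 by simp
  ultimately show ?thesis by blast
qed

text \<open>For a Lipschitz field the principal value converges at every point, so
  \<open>Lim\<close> returns the actual limit.\<close>

lemma frac_div_eq:
  fixes \<phi> :: "real ^ 'n \<Rightarrow> real ^ 'n"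
  assumes \<phi>: "lip_test L \<phi>" and \<beta>: "0 \<le> \<beta>" "\<beta> < 1"
  shows "frac_div \<beta> \<phi> x = frac_coeff CARD('n) \<beta> * (LBINT \<sigma>. pw (- (1 + \<beta>) / 2) \<sigma> * heat_div \<sigma> \<phi> x)"
proof -
  note [measurable] = lip_test_measurable[OF \<phi>]
  have tr: "set_lebesgue_integral lebesgue {y. norm y > \<epsilon>} (\<lambda>y. (y \<bullet> \<phi> (x + y)) / norm y powr (real CARD('n) + \<beta> + 1)) = div_trunc \<beta> \<phi> x \<epsilon>" for \<epsilon>
  proof -
    have m: "(\<lambda>y. indicator {y. \<epsilon> < norm y} y *\<^sub>R ((y \<bullet> \<phi> (x + y)) / norm y powr (real CARD('n) + \<beta> + 1))) \<in> borel_measurable lborel"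
      by measurable
    show ?thesis unfolding set_lebesgue_integral_def div_trunc_def integral_completion[OF m] by simp
  qed
  show ?thesis
    unfolding frac_div_def tr frac_coeff_def
    using tendsto_Lim[OF trivial_limit_at_right_real tendsto_div_trunc[OF \<phi> \<beta>, of x]] by simp
qed

lemma integral_frac_div:
  fixes \<phi> :: "real ^ 'n \<Rightarrow> real ^ 'n"
  assumes f: "integrable lborel f" and \<phi>: "lip_test L \<phi>" and \<beta>: "0 \<le> \<beta>" "\<beta> < 1"
  shows "(LBINT x. f x * frac_div \<beta> \<phi> x) = frac_coeff CARD('n) \<beta> * (LBINT \<sigma>. pw (- 1 / 2 - \<beta> / 2) \<sigma> * heat_pairing f \<phi> \<sigma>)"
proof -
  have q: "- 1 < - 1 / 2 - \<beta> / 2" "- 1 / 2 - \<beta> / 2 < 0" and qe: "- (1 + \<beta>) / 2 = - 1 / 2 - \<beta> / 2" using \<beta> by (auto simp: field_simps)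
  have "(LBINT x. f x * frac_div \<beta> \<phi> x) = (LBINT x. frac_coeff CARD('n) \<beta> * (f x * (LBINT \<sigma>. pw (- 1 / 2 - \<beta> / 2) \<sigma> * heat_div \<sigma> \<phi> x)))"
    unfolding frac_div_eq[OF \<phi> \<beta>] qe by (simp add: mult_ac)
  also have "... = frac_coeff CARD('n) \<beta> * (LBINT x. f x * (LBINT \<sigma>. pw (- 1 / 2 - \<beta> / 2) \<sigma> * heat_div \<sigma> \<phi> x))"
    by (rule integral_mult_right_zero)
  finally show ?thesis
    using integral_heat_div_superposition[OF f \<phi> q, of "\<lambda>_. 1"] by simp
qed

lemma frac_div_measurable:
  fixes \<phi> :: "real ^ 'n \<Rightarrow> real ^ 'n"
  assumes \<phi>: "lip_test L \<phi>" and \<beta>: "0 \<le> \<beta>" "\<beta> < 1"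
  shows "frac_div \<beta> \<phi> \<in> borel_measurable borel"
proof -
  note [measurable] = lip_test_measurable[OF \<phi>]
  have "(\<lambda>x. frac_coeff CARD('n) \<beta> * (LBINT \<sigma>. pw (- (1 + \<beta>) / 2) \<sigma> * heat_div \<sigma> \<phi> x)) \<in> borel_measurable borel"
    by measurable
  then show ?thesis unfolding frac_div_eq[OF \<phi> \<beta>, symmetric] by simp
qed

lemma heat_pairing_uminus: "heat_pairing f (\<lambda>w. - \<phi> w) s = - heat_pairing f \<phi> s"
  by (simp add: heat_pairing_def heat_div_def)

text \<open>\<open>fractional_interpolation\<close> with \<open>a = \<alpha> / 2\<close> and
  \<open>b = \<beta> / 2\<close>. Its factor \<open>a - b\<close> cancels the singular denominator
  of the first term; in the second term \<open>\<alpha> - \<beta>\<close> is enlarged to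
  \<open>\<alpha>\<close>.\<close>

lemma fractional_two_term_bound:
  fixes f :: "real ^ 'n \<Rightarrow> real"
  assumes f: "integrable lborel f" and \<alpha>: "0 < \<alpha>" "\<alpha> < 1" and \<beta>: "0 \<le> \<beta>" "\<beta> < \<alpha>" and T: "0 < T"
    and N: "real CARD('n) * (LBINT x. \<bar>f x\<bar>) \<le> M0"
    and M0: "\<And>\<psi>. \<psi> \<in> unit_test_fields \<Longrightarrow> \<bar>LBINT t. pw (- 1 / 2) t * heat_pairing f \<psi> t\<bar> \<le> M0"
    and V: "\<And>\<psi>. \<psi> \<in> unit_test_fields \<Longrightarrow> (LBINT x. f x * frac_div \<alpha> \<psi> x) \<le> V"
    and \<phi>: "\<phi> \<in> unit_test_fields"
  shows "(LBINT x. f x * frac_div \<beta> \<phi> x) \<le> frac_coeff CARD('n) \<beta> *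
    (V / frac_coeff CARD('n) \<alpha> * T powr (\<alpha> / 2 - \<beta> / 2)
      + \<alpha> * (2 / \<alpha> + 3) * (Beta (\<alpha> / 2) (1 / 2 - \<alpha> / 2) + 1 / (1 / 2 - \<alpha> / 2) + 2 / \<alpha>) * M0 * T powr (- (\<beta> / 2)))"
proof -
  obtain L where L: "lip_test L \<phi>" by (rule unit_test_field_lip_test[OF \<phi>])
  note [measurable] = lip_test_measurable[OF L] borel_measurable_integrable[OF f, simplified]
  let ?c = "frac_coeff CARD('n)"
  let ?K = "Beta (\<alpha> / 2) (1 / 2 - \<alpha> / 2) + 1 / (1 / 2 - \<alpha> / 2) + 2 / \<alpha>"
  have c: "0 < ?c \<alpha>" "0 < ?c \<beta>" using \<alpha> \<beta> by (auto intro!: frac_coeff_pos)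
  have M00: "0 \<le> M0" using order_trans[OF _ N] by simp
  have K0: "0 \<le> ?K" using \<alpha> Beta_real_pos[of "\<alpha> / 2" "1 / 2 - \<alpha> / 2"] by (intro add_nonneg_nonneg) auto
  \<comment> \<open>The supremum in the seminorm is one-sided; applying it to \<open>\<psi>\<close>
    and to its negative bounds the absolute value.\<close>
  have bd: "\<bar>LBINT t. pw (- 1 / 2 - \<alpha> / 2) t * heat_pairing f \<psi> t\<bar> \<le> V / ?c \<alpha>" if \<psi>: "\<psi> \<in> unit_test_fields" for \<psi>
  proof -
    obtain L' where L': "lip_test L' \<psi>" by (rule unit_test_field_lip_test[OF \<psi>])
    obtain L'' where L'': "lip_test L'' (\<lambda>w. - \<psi> w)" by (rule unit_test_field_lip_test[OF unit_test_field_uminus[OF \<psi>]])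
    have \<alpha>0: "0 \<le> \<alpha>" using \<alpha> by simp
    let ?I = "LBINT t. pw (- 1 / 2 - \<alpha> / 2) t * heat_pairing f \<psi> t"
    have "?c \<alpha> * ?I \<le> V" using V[OF \<psi>] unfolding integral_frac_div[OF f L' \<alpha>0 \<alpha>(2)] .
    moreover have "?c \<alpha> * (- ?I) \<le> V"
      using V[OF unit_test_field_uminus[OF \<psi>]] unfolding integral_frac_div[OF f L'' \<alpha>0 \<alpha>(2)] heat_pairing_uminus by simp
    ultimately have "?c \<alpha> * \<bar>?I\<bar> \<le> V" by (simp add: abs_if)
    then show ?thesis using c by (simp add: field_simps)
  qed
  have V0: "0 \<le> V / ?c \<alpha>" using order_trans[OF abs_ge_zero bd[OF \<phi>]] .
  have "\<bar>LBINT \<sigma>. pw (- 1 / 2 - \<beta> / 2) \<sigma> * heat_pairing f \<phi> \<sigma>\<bar>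
    \<le> (\<alpha> / 2 - \<beta> / 2) * (V / ?c \<alpha> * T powr (\<alpha> / 2 - \<beta> / 2) / (\<alpha> / 2 - \<beta> / 2)
      + 2 * (1 / (\<alpha> / 2) + 3) * ((Beta (\<alpha> / 2) (1 / 2 - \<alpha> / 2) + 1 / (1 / 2 - \<alpha> / 2) + 1 / (\<alpha> / 2)) * M0) * T powr (- (\<beta> / 2)))"
  proof (rule fractional_interpolation)
    show "heat_pairing f \<phi> \<in> borel_measurable borel" by measurable
    show "0 < \<alpha> / 2" "\<alpha> / 2 < 1 / 2" "0 \<le> \<beta> / 2" "\<beta> / 2 < \<alpha> / 2" using \<alpha> \<beta> by auto
    show "0 \<le> (LBINT x. \<bar>f x\<bar>) * test_bound L \<phi>" using test_bound_nonneg[OF L] by simp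
    show "\<bar>heat_pairing f \<phi> t\<bar> \<le> (LBINT x. \<bar>f x\<bar>) * test_bound L \<phi>" if "0 < t" for t
      by (rule heat_pairing_bounds(1)[OF f L that])
    show "\<bar>heat_pairing f \<phi> t\<bar> \<le> (LBINT x. \<bar>f x\<bar>) * test_bound L \<phi> / t" if "0 < t" for t
      by (rule heat_pairing_bounds(2)[OF f L that])
    show "\<bar>heat_pairing f \<phi> t\<bar> \<le> M0 * t powr (- 1 / 2)" if "0 < t" for t
    proof -
      have "\<bar>heat_pairing f \<phi> t\<bar> \<le> real CARD('n) * (LBINT x. \<bar>f x\<bar>) * t powr (- 1 / 2)"
        using heat_pairing_bounds(3)[OF f L that] by simp
      also have "... \<le> M0 * t powr (- 1 / 2)" by (intro mult_right_mono N) simp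
      finally show ?thesis .
    qed
    show "\<bar>LBINT t. pw (- 1 / 2) t * heat_pairing f \<phi> (t + s)\<bar> \<le> M0" if "0 < s" for s
      by (rule heat_pairing_weighted_bound[OF f L that _ _ M00 M0[OF unit_test_field_shift[OF \<phi>]]]) auto
    show "\<bar>LBINT t. pw (- 1 / 2 - \<alpha> / 2) t * heat_pairing f \<phi> (t + s)\<bar> \<le> V / ?c \<alpha>" if "0 < s" for s
      by (rule heat_pairing_weighted_bound[OF f L that _ _ V0 bd[OF unit_test_field_shift[OF \<phi>]]]) (use \<alpha> in \<open>auto simp: field_simps\<close>)
  qed (use M00 V0 T in auto)
  also have "... = V / ?c \<alpha> * T powr (\<alpha> / 2 - \<beta> / 2) + (\<alpha> - \<beta>) * ((2 / \<alpha> + 3) * ?K * M0 * T powr (- (\<beta> / 2)))"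
  proof -
    have e: "d * (u / d + 2 * p * (k * m) * t) = u + 2 * d * (p * k * m * t)" if "d \<noteq> 0" for d u p k m t :: real
      using that by (simp add: field_simps)
    have e1: "1 / (\<alpha> / 2) = 2 / \<alpha>" and e2: "\<alpha> - \<beta> = 2 * (\<alpha> / 2 - \<beta> / 2)" by (simp_all add: algebra_simps)
    show ?thesis unfolding e1 e2 by (rule e) (use \<beta> in simp)
  qed
  also have "... \<le> V / ?c \<alpha> * T powr (\<alpha> / 2 - \<beta> / 2) + \<alpha> * ((2 / \<alpha> + 3) * ?K * M0 * T powr (- (\<beta> / 2)))"
    using \<alpha> \<beta> K0 M00 by (intro add_left_mono mult_right_mono mult_nonneg_nonneg) auto
  finally have le: "(LBINT \<sigma>. pw (- 1 / 2 - \<beta> / 2) \<sigma> * heat_pairing f \<phi> \<sigma>)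
    \<le> V / ?c \<alpha> * T powr (\<alpha> / 2 - \<beta> / 2) + \<alpha> * (2 / \<alpha> + 3) * ?K * M0 * T powr (- (\<beta> / 2))" by (simp add: mult_ac)
  have "\<beta> < 1" using \<alpha> \<beta> by simp
  then show ?thesis
    unfolding integral_frac_div[OF f L \<beta>(1) \<open>\<beta> < 1\<close>] using le c by (intro mult_left_mono) auto
qed

text \<open>At \<alpha> = 1 the fractional order 1/2 - \<alpha>/2 is 0: the pairing itself is
  bounded by the total variation, and \<open>weighted_integral_bound\<close> applies directly with
  \<open>a = 1 / 2\<close>, where \<open>2 * (1 / a + 3)\<close> is 10. The denominator
  \<open>1 / 2 - \<beta> / 2\<close> remains and is compensated later by
  \<open>frac_coeff_le\<close>.\<close>

lemma classical_two_term_bound: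
  fixes f :: "real ^ 'n \<Rightarrow> real"
  assumes f: "integrable lborel f" and \<beta>: "0 \<le> \<beta>" "\<beta> < 1" and T: "0 < T"
    and N: "real CARD('n) * (LBINT x. \<bar>f x\<bar>) \<le> M0"
    and M0: "\<And>\<psi>. \<psi> \<in> unit_test_fields \<Longrightarrow> \<bar>LBINT t. pw (- 1 / 2) t * heat_pairing f \<psi> t\<bar> \<le> M0"
    and V: "\<And>\<psi>. \<psi> \<in> unit_test_fields \<Longrightarrow> (LBINT x. f x * classical_div \<psi> x) \<le> V"
    and \<phi>: "\<phi> \<in> unit_test_fields"
  shows "(LBINT x. f x * frac_div \<beta> \<phi> x) \<le> frac_coeff CARD('n) \<beta> *
    (V * T powr (1 / 2 - \<beta> / 2) / (1 / 2 - \<beta> / 2) + 10 * M0 * T powr (- (\<beta> / 2)))"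
proof -
  obtain L where L: "lip_test L \<phi>" by (rule unit_test_field_lip_test[OF \<phi>])
  note [measurable] = lip_test_measurable[OF L] borel_measurable_integrable[OF f, simplified]
  have c: "0 < frac_coeff CARD('n) \<beta>" by (rule frac_coeff_pos[OF \<beta>])
  have M00: "0 \<le> M0" using order_trans[OF _ N] by simp
  have bd: "\<bar>heat_pairing f \<phi> t\<bar> \<le> V" if "0 < t" for t
    by (rule heat_pairing_le_total_variation[OF f \<phi> that V])
  have V0: "0 \<le> V" using order_trans[OF abs_ge_zero bd[of 1]] by simp
  have i: "integrable lborel (\<lambda>t. pw (1 / 2 - 1) t * heat_pairing f \<phi> (t + 0))"
    by (rule integrable_pw_decay[where D = "(LBINT x. \<bar>f x\<bar>) * test_bound L \<phi>"])
      (use test_bound_nonneg[OF L] heat_pairing_bounds(1,2)[OF f L] in auto)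
  have "\<bar>LBINT \<sigma>. pw (1 / 2 - \<beta> / 2 - 1) \<sigma> * heat_pairing f \<phi> \<sigma>\<bar>
    \<le> V * T powr (1 / 2 - \<beta> / 2) / (1 / 2 - \<beta> / 2) + 2 * (1 / (1 / 2) + 3) * M0 * T powr (- (\<beta> / 2))"
  proof (rule weighted_integral_bound)
    show "heat_pairing f \<phi> \<in> borel_measurable borel" by measurable
    show "integrable lborel (\<lambda>t. pw (1 / 2 - 1) t * heat_pairing f \<phi> t)" using i by simp
    show "\<bar>heat_pairing f \<phi> t\<bar> \<le> M0 * t powr (- (1 / 2))" if "0 < t" for t
    proof -
      have "\<bar>heat_pairing f \<phi> t\<bar> \<le> real CARD('n) * (LBINT x. \<bar>f x\<bar>) * t powr (- 1 / 2)"
        using heat_pairing_bounds(3)[OF f L that] by simp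
      also have "... \<le> M0 * t powr (- 1 / 2)" by (intro mult_right_mono N) simp
      finally show ?thesis by simp
    qed
    have "\<bar>LBINT t. pw (- 1 / 2) t * heat_pairing f \<phi> (t + s)\<bar> \<le> M0" if "0 < s" for s
      by (rule heat_pairing_weighted_bound[OF f L that _ _ M00 M0[OF unit_test_field_shift[OF \<phi>]]]) auto
    then show "\<bar>LBINT t. pw (1 / 2 - 1) t * heat_pairing f \<phi> (t + s)\<bar> \<le> M0" if "0 < s" for s
      using that by simp
  qed (use \<beta> T M00 V0 bd in auto)
  moreover have "1 / 2 - \<beta> / 2 - 1 = - 1 / 2 - \<beta> / 2" by simp
  ultimately have "(LBINT \<sigma>. pw (- 1 / 2 - \<beta> / 2) \<sigma> * heat_pairing f \<phi> \<sigma>)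
    \<le> V * T powr (1 / 2 - \<beta> / 2) / (1 / 2 - \<beta> / 2) + 10 * M0 * T powr (- (\<beta> / 2))" by simp
  then show ?thesis
    unfolding integral_frac_div[OF f L \<beta>] using c by (intro mult_left_mono) auto
qed

text \<open>\<open>T = (M / V) powr (1 / a)\<close> makes the two terms equal, whence the factor 2.
  Degenerate cases are limits: \<open>T\<close> to 0 if \<open>b\<close> or \<open>M\<close>
  vanishes, \<open>T\<close> to infinity if \<open>V\<close> vanishes with \<open>b > 0\<close>. For
  \<open>b = 0\<close> the convention of \<open>rpow\<close> gives the value 1 to the second power
  even at \<open>V = 0\<close>.\<close>

lemma two_term_optimize:
  fixes X V M :: real
  assumes a: "0 < a" and b: "0 \<le> b" "b < a" and C: "0 \<le> C" and V: "0 \<le> V" and M: "0 \<le> M"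
    and le: "\<And>T. 0 < T \<Longrightarrow> X \<le> C * (V * T powr (a - b) + M * T powr (- b))"
  shows "X \<le> 2 * C * rpow M ((a - b) / a) * rpow V (b / a)"
proof -
  have small: "((\<lambda>T. C * (V * T powr (a - b) + m)) \<longlongrightarrow> C * (V * 0 + m)) (at_right 0)" for m
  proof -
    have "((\<lambda>T. T powr (a - b)) \<longlongrightarrow> 0) (at_right 0)"
      using b by (intro tendsto_eq_intros tendsto_zero_powrI[where b = "a - b"] tendsto_ident_at tendsto_const)
        (auto simp: eventually_at_right_field intro!: exI[of _ 1])
    then show ?thesis by (intro tendsto_intros)
  qed
  have at0: "X \<le> C * m" if "\<And>T. 0 < T \<Longrightarrow> X \<le> C * (V * T powr (a - b) + m)" for m
  proof -
    have "X \<le> C * (V * 0 + m)"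
    proof (rule tendsto_lowerbound[OF small])
      show "eventually (\<lambda>T. X \<le> C * (V * T powr (a - b) + m)) (at_right 0)"
        using eventually_at_right_less[of 0] by eventually_elim (rule that)
    qed simp
    then show ?thesis by simp
  qed
  consider "b = 0" | "0 < b" "M = 0" | "0 < b" "V = 0" | "0 < b" "0 < V" "0 < M" using b V M by linarith
  then show ?thesis
  proof cases
    case 1
    have "X \<le> C * M" by (rule at0) (use le 1 in simp)
    also have "... \<le> 2 * C * M" using C M by simp
    finally show ?thesis using 1 a M by (simp add: rpow_def)
  next
    case 2
    have "X \<le> C * 0" by (rule at0) (use le 2 in simp)
    then show ?thesis using 2 a b by (simp add: rpow_def)
  next
    case 3
    have "((\<lambda>T. C * (M * T powr (- b))) \<longlongrightarrow> C * (M * 0)) at_top"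
      using 3 by (intro tendsto_intros tendsto_neg_powr filterlim_ident) auto
    then have "X \<le> C * (M * 0)"
      by (rule tendsto_lowerbound) (use le 3 in \<open>auto intro: eventually_mono[OF eventually_gt_at_top[of 0]]\<close>)
    then show ?thesis using 3 a b by (simp add: rpow_def)
  next
    case 4
    have T: "0 < (M / V) powr (1 / a)" using 4 by simp
    have p: "((M / V) powr (1 / a)) powr r = M powr (r / a) * V powr (- (r / a))" for r
      using 4 by (simp add: powr_powr powr_divide powr_minus_divide)
    have e1: "V * (M powr ((a - b) / a) * V powr (- ((a - b) / a))) = M powr ((a - b) / a) * V powr (b / a)"
    proof -
      have "V powr (b / a) = V powr 1 * V powr (- ((a - b) / a))"
        unfolding powr_add[symmetric] using a by (simp add: field_simps)
      then show ?thesis using 4 by simp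
    qed
    have e2: "M * (M powr (- b / a) * V powr (- (- b / a))) = M powr ((a - b) / a) * V powr (b / a)"
    proof -
      have "M powr ((a - b) / a) = M powr 1 * M powr (- b / a)"
        unfolding powr_add[symmetric] using a by (simp add: field_simps)
      then show ?thesis using 4 by simp
    qed
    have "X \<le> C * (M powr ((a - b) / a) * V powr (b / a) + M powr ((a - b) / a) * V powr (b / a))"
      using le[OF T] unfolding p e1 e2 .
    then show ?thesis using 4 a b by (simp add: rpow_def mult_ac)
  qed
qed

text \<open>The summand \<open>n\<close> comes from the pointwise decay of the pairing in terms of
  the L1 norm; the quotient converts \<open>riesz\<close>, normalised by \<open>frac_mu\<close>,
  into the limit of the heat truncations.\<close>

definition hardy_factor :: "nat \<Rightarrow> real" where
  "hardy_factor n = real n + heat_const (real n) (- 1 / 2) / frac_mu n 0"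

lemma hardy_factor_pos: "0 < hardy_factor CARD('n::finite)"
  unfolding hardy_factor_def
  using heat_const_pos[of "- 1 / 2", where 'a = "real ^ 'n"] frac_mu_pos[of 0 "CARD('n)"]
  by (intro add_pos_pos divide_pos_pos) auto

text \<open>Collects the consequences of the Hardy norm for a Borel representative of
  \<open>f\<close>. The truncated Riesz integrals of the two functions coincide at every point,
  since they see only the almost everywhere class.\<close>

lemma hardy_H1_pairing:
  fixes f :: "real ^ 'n \<Rightarrow> real"
  assumes f: "f \<in> hardy_H1"
  obtains g where "integrable lborel g" "AE x in lborel. f x = g x"
    "real CARD('n) * (LBINT x. \<bar>g x\<bar>) \<le> hardy_factor CARD('n) * H1_norm f"
    "\<And>\<psi>. \<psi> \<in> unit_test_fields \<Longrightarrow> \<bar>LBINT t. pw (- 1 / 2) t * heat_pairing g \<psi> t\<bar> \<le> hardy_factor CARD('n) * H1_norm f"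
proof -
  let ?n = "real CARD('n)"
  define hc where "hc = heat_const ?n (- 1 / 2)"
  define mu where "mu = frac_mu CARD('n) 0"
  have hc: "0 < hc" using heat_const_pos[of "- 1 / 2", where 'a = "real ^ 'n"] by (simp add: hc_def)
  have mu: "0 < mu" unfolding mu_def by (rule frac_mu_pos) auto
  have fi: "integrable lebesgue f" and lim: "AE x in lebesgue. \<exists>l. (riesz_trunc f x \<longlongrightarrow> l) (at_right 0)"
    and ri: "integrable lebesgue (riesz f)" using f by (auto simp: hardy_H1_def)
  obtain g where "g \<in> borel_measurable lborel" and ae: "AE x in lborel. f x = g x"
    using completion_ex_borel_measurable_real[of f lborel] fi by auto
  then have g[measurable]: "g \<in> borel_measurable borel" by simp
  have gi: "integrable lborel g" using integrable_lebesgue_AE[OF g ae] fi by simp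
  have tr: "riesz_trunc f x = trunc_riesz g x" for x
  proof
    fix \<epsilon>
    show "riesz_trunc f x \<epsilon> = trunc_riesz g x \<epsilon>"
      unfolding riesz_trunc_def trunc_riesz_def set_lebesgue_integral_def
    proof (rule trans[OF integral_lebesgue_AE])
      show "(\<lambda>y. indicator {y. \<epsilon> < norm y} y *\<^sub>R (g (x + y) / norm y ^ (CARD('n) + 1)) *\<^sub>R y) \<in> borel_measurable borel"
        by measurable
      show "AE y in lborel. indicator {y. \<epsilon> < norm y} y *\<^sub>R (f (x + y) / norm y ^ (CARD('n) + 1)) *\<^sub>R y
          = indicator {y. \<epsilon> < norm y} y *\<^sub>R (g (x + y) / norm y ^ (CARD('n) + 1)) *\<^sub>R y"
        using AE_lborel_shift[OF ae, of x] by eventually_elim simp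
    qed simp
  qed
  \<comment> \<open>\<open>lim\<close> along the radii 1 / (k + 1) gives a function that is Borel
    everywhere, whereas \<open>riesz f\<close> is only known to be measurable for the completed
    measure; up to the factor \<open>hc / mu\<close> they agree almost everywhere.\<close>
  define F where "F x = hc *\<^sub>R lim (\<lambda>k. trunc_riesz g x (inverse (real (Suc k))))" for x
  have Fm[measurable]: "F \<in> borel_measurable borel" unfolding F_def by measurable
  have seq: "filterlim (\<lambda>k. inverse (real (Suc k))) (at_right 0) sequentially"
    using LIMSEQ_inverse_real_of_nat by (auto simp: filterlim_at)
  have lim': "AE x in lborel. \<exists>l. (trunc_riesz g x \<longlongrightarrow> l) (at_right 0)"
    using lim unfolding tr AE_completion_iff .
  then have FL: "AE x in lborel. ((\<lambda>\<delta>. vconv (riesz_kern \<delta>) g x) \<longlongrightarrow> F x) (at_right 0) \<and> (hc / mu) *\<^sub>R riesz f x = F x"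
  proof eventually_elim
    fix x
    assume "\<exists>l. (trunc_riesz g x \<longlongrightarrow> l) (at_right 0)"
    then obtain l where l: "(trunc_riesz g x \<longlongrightarrow> l) (at_right 0)" by blast
    have "F x = hc *\<^sub>R l" unfolding F_def by (simp only: limI[OF filterlim_compose[OF l seq]])
    moreover have "riesz f x = mu *\<^sub>R l"
      unfolding riesz_def tr mu_def tendsto_Lim[OF trivial_limit_at_right_real l] ..
    ultimately show "((\<lambda>\<delta>. vconv (riesz_kern \<delta>) g x) \<longlongrightarrow> F x) (at_right 0) \<and> (hc / mu) *\<^sub>R riesz f x = F x"
      using tendsto_vconv_riesz_kern[OF gi l] mu by (simp add: hc_def)
  qed
  have FR: "AE x in lborel. (hc / mu) *\<^sub>R riesz f x = F x" using FL by eventually_elim simp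
  have Fi: "integrable lborel F" using integrable_lebesgue_AE[OF Fm FR] ri by simp
  have FL': "AE x in lborel. ((\<lambda>\<delta>. vconv (riesz_kern \<delta>) g x) \<longlongrightarrow> F x) (at_right 0)" using FL by eventually_elim simp
  have nF: "(LBINT x. norm (F x)) = hc / mu * integral\<^sup>L lebesgue (\<lambda>x. norm (riesz f x))"
  proof -
    have "integral\<^sup>L lebesgue (\<lambda>x. hc / mu * norm (riesz f x)) = (LBINT x. norm (F x))"
    proof (rule integral_lebesgue_AE)
      show "AE x in lborel. hc / mu * norm (riesz f x) = norm (F x)"
        using FR
      proof eventually_elim
        fix x assume "(hc / mu) *\<^sub>R riesz f x = F x"
        then show "hc / mu * norm (riesz f x) = norm (F x)" using hc mu by (metis abs_of_pos divide_pos_pos norm_scaleR)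
      qed
    qed measurable
    then show ?thesis by simp
  qed
  have nf: "integral\<^sup>L lebesgue (\<lambda>x. \<bar>f x\<bar>) = (LBINT x. \<bar>g x\<bar>)"
    by (rule integral_lebesgue_AE) (use ae in \<open>auto elim: eventually_mono\<close>)
  have N0: "0 \<le> (LBINT x. \<bar>g x\<bar>)" "0 \<le> integral\<^sup>L lebesgue (\<lambda>x. norm (riesz f x))" by simp_all
  have k: "0 \<le> hc / mu" using hc mu by simp
  have H: "hardy_factor CARD('n) * H1_norm f
    = (?n + hc / mu) * ((LBINT x. \<bar>g x\<bar>) + integral\<^sup>L lebesgue (\<lambda>x. norm (riesz f x)))"
    by (simp add: hardy_factor_def H1_norm_def nf hc_def mu_def)
  show ?thesis
  proof (rule that[OF gi ae])
    show "?n * (LBINT x. \<bar>g x\<bar>) \<le> hardy_factor CARD('n) * H1_norm f"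
      unfolding H using N0 k by (intro mult_mono) auto
    show "\<bar>LBINT t. pw (- 1 / 2) t * heat_pairing g \<psi> t\<bar> \<le> hardy_factor CARD('n) * H1_norm f"
      if \<psi>: "\<psi> \<in> unit_test_fields" for \<psi>
    proof -
      obtain L where L: "lip_test L \<psi>" by (rule unit_test_field_lip_test[OF \<psi>])
      have "\<bar>LBINT t. pw (- 1 / 2) t * heat_pairing g \<psi> t\<bar> \<le> hc / mu * integral\<^sup>L lebesgue (\<lambda>x. norm (riesz f x))"
        unfolding nF[symmetric] by (rule riesz_pairing_bound[OF gi L Fi FL'])
      also have "... \<le> hardy_factor CARD('n) * H1_norm f"
        unfolding H using N0 k by (intro mult_mono) auto
      finally show ?thesis .
    qed
  qed
qed

lemma integral_lebesgue_mult_AE: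
  fixes f g :: "real ^ 'n \<Rightarrow> real"
  assumes g: "integrable lborel g" and ae: "AE x in lborel. f x = g x"
    and h: "h \<in> borel_measurable borel"
  shows "integral\<^sup>L lebesgue (\<lambda>x. f x * h x) = (LBINT x. g x * h x)"
proof (rule integral_lebesgue_AE)
  note [measurable] = borel_measurable_integrable[OF g, simplified] h
  show "(\<lambda>x. g x * h x) \<in> borel_measurable borel" by measurable
  show "AE x in lborel. f x * h x = g x * h x" using ae by eventually_elim simp
qed

text \<open>\<open>real_of_ereal\<close> maps infinities to 0, so finiteness comes first: above by
  membership in \<open>BV_space\<close>, below because the supremum dominates a real number.\<close>

lemma BV_seminorm_upper:
  fixes f :: "real ^ 'n \<Rightarrow> real"
  assumes f: "f \<in> BV_space \<alpha>" and \<psi>: "\<psi> \<in> unit_test_fields"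
  shows "integral\<^sup>L lebesgue (\<lambda>x. f x * (if \<alpha> = 1 then classical_div \<psi> x else frac_div \<alpha> \<psi> x)) \<le> real_of_ereal (BV_seminorm \<alpha> f)"
proof -
  have le: "ereal (integral\<^sup>L lebesgue (\<lambda>x. f x * (if \<alpha> = 1 then classical_div \<psi> x else frac_div \<alpha> \<psi> x))) \<le> BV_seminorm \<alpha> f"
    unfolding BV_seminorm_def frac_variation_def total_variation_def
    by (cases "\<alpha> = 1") (auto intro: SUP_upper2[OF \<psi>])
  moreover have "BV_seminorm \<alpha> f \<noteq> \<infinity>" using f by (auto simp: BV_space_def)
  moreover have "BV_seminorm \<alpha> f \<noteq> - \<infinity>" using le by auto
  ultimately show ?thesis by (cases "BV_seminorm \<alpha> f") auto
qed

text \<open>The zero field is admissible and has zero divergence of either kind.\<close>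

lemma BV_seminorm_nonneg:
  fixes f :: "real ^ 'n \<Rightarrow> real"
  assumes f: "f \<in> BV_space \<alpha>"
  shows "0 \<le> real_of_ereal (BV_seminorm \<alpha> f)"
proof -
  have "classical_div (\<lambda>_. 0) x = 0" for x :: "real ^ 'n" by (simp add: classical_div_def frechet_derivative_const)
  moreover have "frac_div \<alpha> (\<lambda>_. 0) x = 0" for x :: "real ^ 'n"
    unfolding frac_div_def using tendsto_Lim[OF trivial_limit_at_right_real tendsto_const[of "0::real" "at_right (0::real)"]] by simp
  ultimately show ?thesis using BV_seminorm_upper[OF f unit_test_field_zero] by (simp cong: if_cong)
qed

text \<open>Here \<beta> leaves the constant. \<open>A\<close> and \<open>B\<close> bound the
  coefficients of the two terms once \<open>frac_coeff\<close> has been estimated: by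
  \<open>C1\<close> alone for \<alpha> < 1, and by \<open>C1 * (1 - \<beta>)\<close> for \<alpha> =
  1.\<close>

lemma two_term_bound:
  fixes \<alpha> :: real
  assumes \<alpha>: "0 < \<alpha>" "\<alpha> \<le> 1"
  obtains C where "0 < C" "\<And>\<beta> (f :: real ^ 'n \<Rightarrow> real) \<phi> T. 0 \<le> \<beta> \<Longrightarrow> \<beta> < \<alpha> \<Longrightarrow> f \<in> hardy_H1 \<inter> BV_space \<alpha> \<Longrightarrow> \<phi> \<in> unit_test_fields \<Longrightarrow> 0 < T \<Longrightarrow>
    integral\<^sup>L lebesgue (\<lambda>x. f x * frac_div \<beta> \<phi> x)
      \<le> C * (real_of_ereal (BV_seminorm \<alpha> f) * T powr (\<alpha> / 2 - \<beta> / 2) + H1_norm f * T powr (- (\<beta> / 2)))"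
proof -
  let ?c = "frac_coeff CARD('n)" and ?h = "hardy_factor CARD('n)"
  obtain C1 where C1: "0 < C1" "\<And>\<beta>. 0 \<le> \<beta> \<Longrightarrow> \<beta> < 1 \<Longrightarrow> ?c \<beta> \<le> C1 * (1 - \<beta>)"
    using frac_coeff_le[where 'n = 'n] by blast
  have h: "0 < ?h" by (rule hardy_factor_pos)
  define K where "K = \<alpha> * (2 / \<alpha> + 3) * (Beta (\<alpha> / 2) (1 / 2 - \<alpha> / 2) + 1 / (1 / 2 - \<alpha> / 2) + 2 / \<alpha>)"
  define A where "A = (if \<alpha> = 1 then 2 else 1 / ?c \<alpha>)"
  define B where "B = (if \<alpha> = 1 then 10 else K)"
  have A: "0 < A" using \<alpha> frac_coeff_pos[of \<alpha>, where 'n = 'n] by (auto simp: A_def)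
  have B: "0 < B"
  proof (cases "\<alpha> = 1")
    case False
    then have "0 < Beta (\<alpha> / 2) (1 / 2 - \<alpha> / 2)" using \<alpha> by (intro Beta_real_pos) auto
    then show ?thesis using False \<alpha> unfolding B_def K_def by (auto intro!: mult_pos_pos add_pos_pos)
  qed (simp add: B_def)
  show ?thesis
  proof (rule that[of "C1 * (A + B * ?h)"])
    show "0 < C1 * (A + B * ?h)" using C1 A B h by (simp add: add_pos_pos)
    fix \<beta> T :: real and f :: "real ^ 'n \<Rightarrow> real" and \<phi>
    assume \<beta>: "0 \<le> \<beta>" "\<beta> < \<alpha>" and f: "f \<in> hardy_H1 \<inter> BV_space \<alpha>" and \<phi>: "(\<phi> :: real ^ 'n \<Rightarrow> real ^ 'n) \<in> unit_test_fields" and T: "0 < T"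
    define V where "V = real_of_ereal (BV_seminorm \<alpha> f)"
    define N where "N = H1_norm f"
    have V0: "0 \<le> V" unfolding V_def using f by (intro BV_seminorm_nonneg) simp
    have \<beta>1: "\<beta> < 1" using \<alpha> \<beta> by simp
    have fH: "f \<in> hardy_H1" using f by simp
    obtain g where g: "integrable lborel g" "AE x in lborel. f x = g x"
      "real CARD('n) * (LBINT x. \<bar>g x\<bar>) \<le> ?h * H1_norm f"
      "\<And>\<psi>. \<psi> \<in> unit_test_fields \<Longrightarrow> \<bar>LBINT t. pw (- 1 / 2) t * heat_pairing g \<psi> t\<bar> \<le> ?h * H1_norm f"
      by (rule hardy_H1_pairing[OF fH]) (rule that)
    note g = g[folded N_def]
    have "0 \<le> ?h * N" using order_trans[OF _ g(3)] by simp
    then have N0: "0 \<le> N" using h by (simp add: zero_le_mult_iff)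
    have V: "(LBINT x. g x * (if \<alpha> = 1 then classical_div \<psi> x else frac_div \<alpha> \<psi> x)) \<le> V" if \<psi>: "\<psi> \<in> unit_test_fields" for \<psi>
    proof -
      obtain L where L: "lip_test L \<psi>" by (rule unit_test_field_lip_test[OF \<psi>])
      have "(\<lambda>x. if \<alpha> = 1 then classical_div \<psi> x else frac_div \<alpha> \<psi> x) \<in> borel_measurable borel"
        using frac_div_measurable[OF L, of \<alpha>] classical_div_measurable[OF \<psi>] \<alpha> by (cases "\<alpha> = 1") auto
      from integral_lebesgue_mult_AE[OF g(1,2) this] BV_seminorm_upper[of f \<alpha> \<psi>] f \<psi> show ?thesis by (simp add: V_def)
    qed
    define P where "P = V * T powr (\<alpha> / 2 - \<beta> / 2)"
    define Q where "Q = N * T powr (- (\<beta> / 2))"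
    have P0: "0 \<le> P" and Q0: "0 \<le> Q" using V0 N0 by (simp_all add: P_def Q_def)
    have main: "(LBINT x. g x * frac_div \<beta> \<phi> x) \<le> C1 * (A * P + B * (?h * Q))"
    proof (cases "\<alpha> = 1")
      case True
      have "(LBINT x. g x * frac_div \<beta> \<phi> x) \<le> ?c \<beta> * (V * T powr (1 / 2 - \<beta> / 2) / (1 / 2 - \<beta> / 2) + 10 * (?h * N) * T powr (- (\<beta> / 2)))"
        using V True by (intro classical_two_term_bound[OF g(1) \<beta>(1) \<beta>1 T g(3,4) _ \<phi>]) auto
      also have "... = ?c \<beta> * (P / (1 / 2 - \<beta> / 2) + 10 * (?h * Q))" using True by (simp add: P_def Q_def mult_ac)
      also have "... \<le> C1 * (1 - \<beta>) * (P / (1 / 2 - \<beta> / 2) + 10 * (?h * Q))"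
        using C1(2)[OF \<beta>(1) \<beta>1] P0 Q0 h \<beta>1 by (intro mult_right_mono add_nonneg_nonneg) auto
      \<comment> \<open>The zero of \<open>frac_coeff\<close> at \<beta> = 1 meets the denominator
        \<open>1 / 2 - \<beta> / 2\<close>; their quotient is 2, the value of \<open>A\<close> in
        this case.\<close>
      also have "... = C1 * (2 * P + (1 - \<beta>) * (10 * (?h * Q)))"
      proof -
        have "(1 - \<beta>) * (P / (1 / 2 - \<beta> / 2)) = 2 * P" using \<beta>1 by (simp add: field_simps)
        then show ?thesis by (simp only: mult.assoc distrib_left)
      qed
      also have "... \<le> C1 * (2 * P + 1 * (10 * (?h * Q)))"
        using C1(1) \<beta> h Q0 by (intro mult_left_mono add_left_mono mult_right_mono) auto
      finally show ?thesis using True by (simp add: A_def B_def)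
    next
      case False
      then have \<alpha>1: "\<alpha> < 1" using \<alpha> by simp
      have "(LBINT x. g x * frac_div \<beta> \<phi> x) \<le> ?c \<beta> * (V / ?c \<alpha> * T powr (\<alpha> / 2 - \<beta> / 2) + K * (?h * N) * T powr (- (\<beta> / 2)))"
        unfolding K_def using V False by (intro fractional_two_term_bound[OF g(1) \<alpha>(1) \<alpha>1 \<beta> T g(3,4) _ \<phi>]) auto
      also have "... = ?c \<beta> * (A * P + B * (?h * Q))" using False by (simp add: A_def B_def P_def Q_def mult_ac)
      also have "... \<le> C1 * (A * P + B * (?h * Q))"
      proof (rule mult_right_mono)
        have "?c \<beta> \<le> C1 * (1 - \<beta>)" by (rule C1(2)[OF \<beta>(1) \<beta>1])
        also have "... \<le> C1 * 1" using C1(1) \<beta> by (intro mult_left_mono) auto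
        finally show "?c \<beta> \<le> C1" by simp
      qed (use A B P0 Q0 h in simp)
      finally show ?thesis .
    qed
    also have "... \<le> C1 * ((A + B * ?h) * (P + Q))"
      using C1(1) A B h P0 Q0 by (intro mult_left_mono) (auto simp: algebra_simps)
    finally have "(LBINT x. g x * frac_div \<beta> \<phi> x) \<le> C1 * (A + B * ?h) * (P + Q)" by (simp add: mult.assoc)
    moreover obtain L where L: "lip_test L \<phi>" by (rule unit_test_field_lip_test[OF \<phi>])
    ultimately show "integral\<^sup>L lebesgue (\<lambda>x. f x * frac_div \<beta> \<phi> x)
      \<le> C1 * (A + B * ?h) * (real_of_ereal (BV_seminorm \<alpha> f) * T powr (\<alpha> / 2 - \<beta> / 2) + H1_norm f * T powr (- (\<beta> / 2)))"
      using integral_lebesgue_mult_AE[OF g(1,2) frac_div_measurable[OF L \<beta>(1) \<beta>1]] by (simp add: P_def Q_def V_def N_def)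
  qed
qed

theorem theorem4p2:
  fixes \<alpha> :: real
  assumes "0 < \<alpha>" and "\<alpha> \<le> 1"
  shows "\<exists>c::real. c > 0 \<and>
    (\<forall>\<beta>::real. 0 \<le> \<beta> \<and> \<beta> < \<alpha> \<longrightarrow>
      (\<forall>f :: real ^ 'n \<Rightarrow> real. f \<in> hardy_H1 \<inter> BV_space \<alpha> \<longrightarrow>
        BV_seminorm \<beta> f \<le>
          ereal (c * rpow (H1_norm f) ((\<alpha> - \<beta>) / \<alpha>) *
                 rpow (real_of_ereal (BV_seminorm \<alpha> f)) (\<beta> / \<alpha>))))"
proof -
  obtain C where C: "0 < C" "\<And>\<beta> (f :: real ^ 'n \<Rightarrow> real) \<phi> T. 0 \<le> \<beta> \<Longrightarrow> \<beta> < \<alpha> \<Longrightarrow> f \<in> hardy_H1 \<inter> BV_space \<alpha> \<Longrightarrow> \<phi> \<in> unit_test_fields \<Longrightarrow> 0 < T \<Longrightarrow>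
    integral\<^sup>L lebesgue (\<lambda>x. f x * frac_div \<beta> \<phi> x)
      \<le> C * (real_of_ereal (BV_seminorm \<alpha> f) * T powr (\<alpha> / 2 - \<beta> / 2) + H1_norm f * T powr (- (\<beta> / 2)))"
    by (rule two_term_bound[OF assms, where 'n = 'n]) blast
  show ?thesis
  proof (intro exI[of _ "2 * C"] conjI allI impI)
    show "0 < 2 * C" using C by simp
    fix \<beta> :: real and f :: "real ^ 'n \<Rightarrow> real"
    assume \<beta>: "0 \<le> \<beta> \<and> \<beta> < \<alpha>" and f: "f \<in> hardy_H1 \<inter> BV_space \<alpha>"
    have V0: "0 \<le> real_of_ereal (BV_seminorm \<alpha> f)" using f by (intro BV_seminorm_nonneg) simp
    have N0: "0 \<le> H1_norm f" by (simp add: H1_norm_def)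
    \<comment> \<open>The halved orders have the same quotients, so the optimisation in
      \<open>T\<close> produces the exponents of the theorem.\<close>
    have e: "(\<alpha> / 2 - \<beta> / 2) / (\<alpha> / 2) = (\<alpha> - \<beta>) / \<alpha>" "\<beta> / 2 / (\<alpha> / 2) = \<beta> / \<alpha>" using assms by (simp_all add: field_simps)
    have bound: "integral\<^sup>L lebesgue (\<lambda>x. f x * frac_div \<beta> \<phi> x)
        \<le> 2 * C * rpow (H1_norm f) ((\<alpha> - \<beta>) / \<alpha>) * rpow (real_of_ereal (BV_seminorm \<alpha> f)) (\<beta> / \<alpha>)"
      if \<phi>: "\<phi> \<in> unit_test_fields" for \<phi>
      using two_term_optimize[of "\<alpha> / 2" "\<beta> / 2" C, OF _ _ _ _ V0 N0 C(2)[OF _ _ f \<phi>]] assms \<beta> C(1) unfolding e by simp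
    have "\<beta> \<noteq> 1" using assms \<beta> by simp
    then show "BV_seminorm \<beta> f \<le> ereal (2 * C * rpow (H1_norm f) ((\<alpha> - \<beta>) / \<alpha>) * rpow (real_of_ereal (BV_seminorm \<alpha> f)) (\<beta> / \<alpha>))"
      unfolding BV_seminorm_def[of \<beta>] frac_variation_def by (auto intro!: SUP_least bound)
  qed
qed

end
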